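(* Assume $n r_n^d\to 0$ as $n\to\infty$ and let $1\le k\le d$. Let $M_n$ denote either $N_{k,n}$ (for all $n$) or $\widehat N_{k,n}$ (for all $n$). Then: (1) If $\lim_{n\to\infty}n^{k+1}r_n^{dk}=0$, then $M_n\to0$ in $L^2$. (2) If $\lim_{n\to\infty}n^{k+1}r_n^{dk}=\alpha\in(0,\infty)$, then $M_n$ converges in distribution to a Poisson random variable with mean $\alpha\mu_k$. (3) If $\lim_{n\to\infty}n^{k+1}r_n^{dk}=\infty$, then \[ \frac{M_n-\mathbb{E}\{M_n\}}{(n^{k+1}r_n^{dk})^{1/2}} \] converges in distribution to a centered normal distribution with variance $\mu_k$. Here \[ \mu_k=\frac{1}{(k+1)!}\int_{\mathbb{R}^d}f^{k+1}(x)\,dx\int_{(\mathbb{R}^d)^k}h_1(0,\mathbf{y})\,d\mathbf{y}. \]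
   Context: Fix $d\ge1$. Let $f$ be a bounded probability density on $\mathbb{R}^d$. For each $n$, $\mathcal{X}_n=\{X_1,\dots,X_n\}$ where $X_1,X_2,\dots$ are i.i.d. with density $f$, and $\mathcal{P}_n$ is a Poisson point process on $\mathbb{R}^d$ with intensity function $nf$. $(r_n)_{n\ge1}$ is a sequence of positive numbers with $r_n\to0$. For a finite set $\mathcal{P}\subset\mathbb{R}^d$ let $d_{\mathcal{P}}(x)=\min_{p\in\mathcal{P}}\|x-p\|$. For a set $\mathcal{Y}$ of $k+1$ affinely independent points of $\mathbb{R}^d$, $C(\mathcal{Y})$ is the center and $R(\mathcal{Y})$ the radius of the unique $(k-1)$-dimensional sphere containing $\mathcal{Y}$, and $\mathrm{conv}^\circ(\mathcal{Y})$ is the interior of the convex hull of $\mathcal{Y}$ (an open $k$-simplex). For $1\le k\le d$, a point $c\in\mathbb{R}^d$ is a critical point of index $k$ of $d_{\mathcal{P}}$ if there is a subset $\mathcal{Y}\subset\mathcal{P}$ of $k+1$ affinely independent points with $\|c-y\|=d_{\mathcal{P}}(c)$ for all $y\in\mathcal{Y}$, $\|c-p\|>d_{\mathcal{P}}(c)$ for all $p\in\mathcal{P}\setminus\mathcal{Y}$, and $c\in\mathrm{conv}^\circ(\mathcal{Y})$. $N_{k,n}$ is the number of critical points $c$ of index $k$ of $d_{\mathcal{X}_n}$ with $d_{\mathcal{X}_n}(c)\le r_n$, and $\widehat N_{k,n}$ is the number of critical points $c$ of index $k$ of $d_{\mathcal{P}_n}$ with $d_{\mathcal{P}_n}(c)\le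 r_n$. For $\mathbf{y}=(y_1,\dots,y_k)\in(\mathbb{R}^d)^k$, $h_1(0,\mathbf{y})=1$ if $\{0,y_1,\dots,y_k\}$ consists of $k+1$ affinely independent points $\mathcal{Y}$ with $C(\mathcal{Y})\in\mathrm{conv}^\circ(\mathcal{Y})$ and $R(\mathcal{Y})\le 1$, and $h_1(0,\mathbf{y})=0$ otherwise. *)

theory Defs
  imports "HOL-Analysis.Analysis" "HOL-Probability.Probability"
begin

definition dist_to :: "'a::euclidean_space set \<Rightarrow> 'a \<Rightarrow> real" where
  "dist_to P x = Min ((\<lambda>p. dist x p) ` P)"

definition crit_point :: "nat \<Rightarrow> 'a::euclidean_space set \<Rightarrow> 'a \<Rightarrow> bool" where
  "crit_point k P c \<longleftrightarrow>
     (\<exists>Y. Y \<subseteq> P \<and> card Y = k + 1 \<and> \<not> affine_dependent Y \<and>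
          (\<forall>y\<in>Y. dist c y = dist_to P c) \<and>
          (\<forall>p\<in>P - Y. dist c p > dist_to P c) \<and>
          c \<in> rel_interior (convex hull Y))"

definition num_crit :: "nat \<Rightarrow> 'a::euclidean_space set \<Rightarrow> real \<Rightarrow> nat" where
  "num_crit k P r = card {c. crit_point k P c \<and> dist_to P c \<le> r}"

definition circumcenter :: "'a::euclidean_space set \<Rightarrow> 'a" where
  "circumcenter Y = (THE c. c \<in> affine hull Y \<and> (\<forall>y\<in>Y. \<forall>z\<in>Y. dist c y = dist c z))"

definition circumradius :: "'a::euclidean_space set \<Rightarrow> real" where
  "circumradius Y = dist (circumcenter Y) (SOME y. y \<in> Y)"

definition h1 :: "nat \<Rightarrow> (nat \<Rightarrow> 'a::euclidean_space) \<Rightarrow> bool" where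
  "h1 k y = (let Y = insert 0 (y ` {..<k}) in
      card Y = k + 1 \<and> \<not> affine_dependent Y \<and>
      circumcenter Y \<in> rel_interior (convex hull Y) \<and> circumradius Y \<le> 1)"

definition mu :: "nat \<Rightarrow> ('a::euclidean_space \<Rightarrow> real) \<Rightarrow> real" where
  "mu k f = 1 / fact (k + 1) * (\<integral>x. f x ^ (k + 1) \<partial>lborel) *
      (\<integral>y. (if h1 k y then 1 else 0) \<partial>(PiM {..<k} (\<lambda>_. (lborel :: 'a measure))))"

definition bounded_density :: "('a::euclidean_space \<Rightarrow> real) \<Rightarrow> bool" where
  "bounded_density f \<longleftrightarrow> f \<in> borel_measurable lborel \<and> (\<forall>x. 0 \<le> f x) \<and>
     (\<integral>\<^sup>+x. ennreal (f x) \<partial>lborel) = 1 \<and> (\<exists>B. \<forall>x. f x \<le> B)"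

definition iid_density :: "'w measure \<Rightarrow> (nat \<Rightarrow> 'w \<Rightarrow> 'a::euclidean_space) \<Rightarrow> ('a \<Rightarrow> real) \<Rightarrow> bool" where
  "iid_density \<Omega> X f \<longleftrightarrow> prob_space \<Omega> \<and> prob_space.indep_vars \<Omega> (\<lambda>_. borel) X UNIV \<and>
     (\<forall>i. distributed \<Omega> lborel (X i) (\<lambda>x. ennreal (f x)))"

definition poisson_process :: "'w measure \<Rightarrow> ('w \<Rightarrow> 'a::euclidean_space set) \<Rightarrow> ('a \<Rightarrow> real) \<Rightarrow> bool" where
  "poisson_process \<Omega> P lam \<longleftrightarrow> prob_space \<Omega> \<and>
     (AE \<omega> in \<Omega>. finite (P \<omega>)) \<and>
     (\<forall>A \<in> sets borel.
        (\<lambda>\<omega>. card (P \<omega> \<inter> A)) \<in> measurable \<Omega> (count_space UNIV) \<and>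
        (\<forall>j. measure \<Omega> {\<omega> \<in> space \<Omega>. card (P \<omega> \<inter> A) = j} =
               (LINT x:A|lborel. lam x) ^ j / fact j * exp (- (LINT x:A|lborel. lam x)))) \<and>
     (\<forall>(I::nat set) A. finite I \<longrightarrow> (\<forall>i\<in>I. A i \<in> sets borel) \<longrightarrow> disjoint_family_on A I \<longrightarrow>
        prob_space.indep_vars \<Omega> (\<lambda>_. count_space UNIV) (\<lambda>i \<omega>. card (P \<omega> \<inter> A i)) I)"

definition crit_limits :: "(nat \<Rightarrow> 'w measure) \<Rightarrow> (nat \<Rightarrow> 'w \<Rightarrow> nat) \<Rightarrow> nat \<Rightarrow> (nat \<Rightarrow> real)
     \<Rightarrow> nat \<Rightarrow> real \<Rightarrow> bool" where
  "crit_limits \<Omega> Z k r d \<mu> \<longleftrightarrow>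
     ((((\<lambda>n. real n ^ (k + 1) * r n ^ (d * k)) \<longlonglongrightarrow> 0) \<longrightarrow>
        ((\<lambda>n. \<integral>\<^sup>+\<omega>. ennreal ((real (Z n \<omega>))\<^sup>2) \<partial>\<Omega> n) \<longlonglongrightarrow> 0)) \<and>
      (\<forall>\<alpha>>0. ((\<lambda>n. real n ^ (k + 1) * r n ^ (d * k)) \<longlonglongrightarrow> \<alpha>) \<longrightarrow>
        weak_conv_m (\<lambda>n. distr (\<Omega> n) borel (\<lambda>\<omega>. real (Z n \<omega>)))
                    (distr (measure_pmf (poisson_pmf (\<alpha> * \<mu>))) borel real)) \<and>
      (filterlim (\<lambda>n. real n ^ (k + 1) * r n ^ (d * k)) at_top sequentially \<longrightarrow>
        weak_conv_m (\<lambda>n. distr (\<Omega> n) borel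
                      (\<lambda>\<omega>. (real (Z n \<omega>) - (\<integral>\<omega>'. real (Z n \<omega>') \<partial>\<Omega> n)) /
                           sqrt (real n ^ (k + 1) * r n ^ (d * k))))
                    (density lborel (normal_density 0 (sqrt \<mu>)))))"

end

(* A critical point of index k below level r is carried by a (k+1)-subset that is a critical
   simplex and whose open circumball contains no further sample point. Ignoring the emptiness
   condition, the count is a sum of dissociated indicators, and the differential equation
   satisfied by its characteristic function in t shows that it is close to Poisson; the means
   are computed by rescaling the simplex to unit size. The correction for non-empty balls is
   small in L^1, and its variance is controlled by negative correlation. The Poisson process is
   handled by noting that its counts determine its law, so it may be replaced by a sample of
   independent Poisson size, which is within a small L^1 distance of the sample of size n. *)
theory Submission
  imports Defs
begin


text \<open>In the third regime the expected number of simplices with a non-empty ball may itself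
  diverge; it is only of smaller order than T = n^(k+1) r^(dk). Its size alone does not survive
  division by sqrt T, so there the correction is centered and its standard deviation is used, of
  order sqrt W with W / T -> 0. The error of the Poisson approximation carries the factors t^2 and
  exp (lam t^2 / 2), which stay under control at t / sqrt T; hence one estimate serves the second
  and the third regime, and the normal law arises as the limit of centered Poisson laws with growing
  mean. The density is only bounded, so the means are found from continuity of translations in L^1
  instead of pointwise limits. The other obstacle is measurability. Circumcenter and radius are
  given by \<open>THE\<close> and \<open>SOME\<close>, and a realisation of the Poisson process is
  an arbitrary set seen only through its counts, possibly infinite on a null set, where
  \<open>card\<close> degenerates. The number of critical points must therefore be recovered from
  countably many counts in Borel sets.\<close>

section \<open>Affine independence, circumcenters and critical simplices\<close>

definition aff_indep_family :: "'i set \<Rightarrow> ('i \<Rightarrow> 'a::euclidean_space) \<Rightarrow> bool" where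
  "aff_indep_family I x \<longleftrightarrow>
     (\<forall>u. sum u I = 0 \<longrightarrow> (\<Sum>i\<in>I. u i *\<^sub>R x i) = 0 \<longrightarrow> (\<forall>i\<in>I. u i = 0))"

text \<open>Indexing makes a repeated point a dependence, whence the injectivity. The coefficient
  form is kept because it is stable under affine maps and can be tested over compact sets of
  coefficients.\<close>

lemma aff_indep_family_iff:
  fixes x :: "'i \<Rightarrow> 'a::euclidean_space"
  assumes "finite I"
  shows "aff_indep_family I x \<longleftrightarrow> inj_on x I \<and> \<not> affine_dependent (x ` I)"
proof
  assume ind: "aff_indep_family I x"
  have inj: "inj_on x I"
  proof (rule inj_onI, rule ccontr)
    fix i j assume ij: "i \<in> I" "j \<in> I" "x i = x j" "i \<noteq> j"
    define u where "u l = (if l = i then 1 else if l = j then -1 else (0::real))" for l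
    have u: "u l = (if l = i then 1 else 0) - (if l = j then 1 else 0)" for l
      using ij(4) by (simp add: u_def)
    have "sum u I = 0" unfolding u using ij assms by (simp add: sum_subtractf)
    moreover have "(\<Sum>l\<in>I. u l *\<^sub>R x l) = (\<Sum>l\<in>I. (if l = i then x l else 0) - (if l = j then x l else 0))"
      using ij(4) by (intro sum.cong refl) (simp add: u_def)
    then have "(\<Sum>l\<in>I. u l *\<^sub>R x l) = 0"
      using ij(1,2) ij(3)[symmetric] assms by (simp add: sum_subtractf)
    ultimately have "u i = 0" using ind ij unfolding aff_indep_family_def by blast
    then show False by (simp add: u_def)
  qed
  moreover have "\<not> affine_dependent (x ` I)"
  proof
    assume "affine_dependent (x ` I)"
    then obtain U where U: "sum U (x ` I) = 0" "\<exists>v\<in>x ` I. U v \<noteq> 0" "(\<Sum>v\<in>x ` I. U v *\<^sub>R v) = 0"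
      using affine_dependent_explicit_finite[of "x ` I"] assms by auto
    have "sum (U \<circ> x) I = 0" "(\<Sum>i\<in>I. (U \<circ> x) i *\<^sub>R x i) = 0"
      using U by (simp_all add: sum.reindex[OF inj])
    then have "\<forall>i\<in>I. (U \<circ> x) i = 0" using ind unfolding aff_indep_family_def by blast
    with U show False by auto
  qed
  ultimately show "inj_on x I \<and> \<not> affine_dependent (x ` I)" ..
next
  assume *: "inj_on x I \<and> \<not> affine_dependent (x ` I)"
  show "aff_indep_family I x"
    unfolding aff_indep_family_def
  proof (intro allI impI)
    fix v :: "'i \<Rightarrow> real"
    assume u: "sum v I = 0" "(\<Sum>i\<in>I. v i *\<^sub>R x i) = 0"
    define U where "U = v \<circ> the_inv_into I x"
    have U: "U (x i) = v i" if "i \<in> I" for i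
      using * that by (simp add: U_def the_inv_into_f_f)
    have "sum U (x ` I) = 0" "(\<Sum>v\<in>x ` I. U v *\<^sub>R v) = 0"
      using u * by (simp_all add: sum.reindex U)
    then have "\<forall>p\<in>x ` I. U p = 0"
      using * affine_dependent_explicit_finite[of "x ` I"] assms by blast
    then show "\<forall>i\<in>I. v i = 0" using U by auto
  qed
qed

text \<open>Seen from a vertex \<open>a\<close>, equidistance of \<open>0\<close> and
  \<open>v\<close> from \<open>p\<close> reads \<open>2 * (p \<bullet> v) = v \<bullet> v\<close>.
  The right side prescribes a linear functional on the independent edge vectors; a vector
  \<open>q\<close> represents it, and projecting \<open>q\<close> to the span of the edges brings
  the center into the affine hull.\<close>

lemma circumcenter_exists:
  fixes Y :: "'a::euclidean_space set"
  assumes "\<not> affine_dependent Y" "Y \<noteq> {}"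
  shows "\<exists>c\<in>affine hull Y. \<forall>y\<in>Y. \<forall>z\<in>Y. dist c y = dist c z"
proof -
  obtain a where a: "a \<in> Y" using assms by auto
  define V where "V = (\<lambda>y. - a + y) ` (Y - {a})"
  have "insert a (Y - {a}) = Y" using a by auto
  then have ind: "independent V"
    using affine_dependent_iff_dependent[of a "Y - {a}"] assms unfolding V_def by auto
  then obtain g :: "'a \<Rightarrow> real" where g: "linear g" "\<And>v. v \<in> V \<Longrightarrow> g v = (v \<bullet> v) / 2"
    using linear_independent_extend[OF ind, of "\<lambda>v. (v \<bullet> v) / 2"] by auto
  define q where "q = (\<Sum>b\<in>Basis. g b *\<^sub>R b)"
  have gq: "g v = v \<bullet> q" for v
  proof -
    have "g v = g (\<Sum>b\<in>Basis. (v \<bullet> b) *\<^sub>R b)" by (simp add: euclidean_representation)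
    also have "\<dots> = (\<Sum>b\<in>Basis. (v \<bullet> b) * g b)"
      using g(1) by (simp add: linear_sum linear_cmul)
    also have "\<dots> = v \<bullet> q" unfolding q_def by (simp add: inner_sum_right mult.commute)
    finally show ?thesis .
  qed
  obtain p z where pz: "p \<in> span V" "\<And>w. w \<in> span V \<Longrightarrow> orthogonal z w" "q = p + z"
    using orthogonal_subspace_decomp_exists[of V q] by metis
  have pv: "2 * (p \<bullet> v) = v \<bullet> v" if "v \<in> V" for v
    using pz(2)[OF span_base[OF that]] g(2)[OF that] gq[of v] pz(3)
    by (simp add: orthogonal_def inner_add_right inner_commute)
  have d: "dist (a + p) y = norm p" if "y \<in> Y" for y
  proof (cases "y = a")
    case False
    then have "y - a \<in> V" using that by (auto simp: V_def)
    from pv[OF this] have "(norm (p - (y - a)))\<^sup>2 = (norm p)\<^sup>2"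
      by (simp only: power2_norm_eq_inner) (simp add: inner_diff_left inner_diff_right inner_commute)
    then have "norm (p - (y - a)) = norm p" by simp
    then show ?thesis by (simp add: dist_norm algebra_simps)
  qed (simp add: dist_norm)
  have "a + p \<in> affine hull Y"
    using affine_hull_span2[OF a] pz(1) unfolding V_def by auto
  then show ?thesis using d by (metis (no_types, lifting))
qed

text \<open>Two centers satisfy the same linear equations against all edge vectors, so their
  difference is orthogonal to the span that contains it.\<close>

lemma circumcenter_unique:
  fixes Y :: "'a::euclidean_space set"
  assumes "Y \<noteq> {}" and c: "c \<in> affine hull Y" "\<forall>y\<in>Y. \<forall>z\<in>Y. dist c y = dist c z"
    and c': "c' \<in> affine hull Y" "\<forall>y\<in>Y. \<forall>z\<in>Y. dist c' y = dist c' z"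
  shows "c = c'"
proof -
  obtain a where a: "a \<in> Y" using assms by auto
  define V where "V = (\<lambda>y. - a + y) ` (Y - {a})"
  obtain p p' where p: "p \<in> span V" "c = a + p" "p' \<in> span V" "c' = a + p'"
    using c(1) c'(1) unfolding affine_hull_span2[OF a] V_def by auto
  have *: "2 * (q \<bullet> v) = v \<bullet> v"
    if "\<forall>y\<in>Y. \<forall>z\<in>Y. dist (a + q) y = dist (a + q) z" "v \<in> V" for q v
  proof -
    obtain y where y: "y \<in> Y" "v = y - a" using \<open>v \<in> V\<close> by (auto simp: V_def)
    have "dist (a + q) y = dist (a + q) a" using that a y by blast
    then have "(norm (q - v))\<^sup>2 = (norm q)\<^sup>2" by (simp add: dist_norm y algebra_simps)
    then show ?thesis
      by (simp only: power2_norm_eq_inner) (simp add: inner_diff_left inner_diff_right inner_commute)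
  qed
  have "(p - p') \<bullet> v = 0" if "v \<in> V" for v
    using *[OF c(2)[unfolded p(2)] that] *[OF c'(2)[unfolded p(4)] that] by (simp add: inner_diff_left)
  then have "orthogonal (p - p') x" if "x \<in> span V" for x
    using orthogonal_to_span[OF that, of "p - p'"] by (simp add: orthogonal_def inner_commute)
  moreover have "p - p' \<in> span V" using p by (simp add: span_diff)
  ultimately have "orthogonal (p - p') (p - p')" by blast
  then show ?thesis using p by (simp add: orthogonal_self)
qed

lemma circumcenter_eqI:
  assumes "Y \<noteq> {}" "c \<in> affine hull Y" "\<And>y z. y \<in> Y \<Longrightarrow> z \<in> Y \<Longrightarrow> dist c y = dist c z"
  shows "circumcenter Y = c"
  unfolding circumcenter_def
  by (rule the_equality) (use assms circumcenter_unique[of Y] in blast)+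

lemma circumcenter:
  assumes "\<not> affine_dependent Y" "Y \<noteq> {}"
  shows circumcenter_in: "circumcenter Y \<in> affine hull Y"
    and dist_circumcenter: "y \<in> Y \<Longrightarrow> dist (circumcenter Y) y = circumradius Y"
proof -
  obtain c where c: "c \<in> affine hull Y" "\<forall>y\<in>Y. \<forall>z\<in>Y. dist c y = dist c z"
    using circumcenter_exists[OF assms] by blast
  have cc: "circumcenter Y = c" using circumcenter_eqI[of Y c] assms c by blast
  show "circumcenter Y \<in> affine hull Y" using c cc by simp
  have "(SOME y. y \<in> Y) \<in> Y" using assms by (simp add: some_in_eq)
  then show "dist (circumcenter Y) y = circumradius Y" if "y \<in> Y"
    unfolding circumradius_def using that c unfolding cc by blast
qed

text \<open>The part of criticality that depends on the simplex alone: \<open>h1\<close> is the case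
  \<open>r = 1\<close> with one vertex at the origin, and the emptiness of the ball is added in
  \<open>crit_subset\<close>.\<close>

definition crit_simplex :: "nat \<Rightarrow> real \<Rightarrow> 'a::euclidean_space set \<Rightarrow> bool" where
  "crit_simplex k r Y \<longleftrightarrow> card Y = k + 1 \<and> \<not> affine_dependent Y \<and>
      circumcenter Y \<in> rel_interior (convex hull Y) \<and> circumradius Y \<le> r"

lemma h1_iff: "h1 k y \<longleftrightarrow> crit_simplex k 1 (insert 0 (y ` {..<k}))"
  by (simp add: h1_def crit_simplex_def Let_def)

lemma crit_simplexD:
  assumes "crit_simplex k r Y"
  shows "finite Y" "Y \<noteq> {}" "card Y = k + 1" "\<not> affine_dependent Y"
    "circumcenter Y \<in> rel_interior (convex hull Y)" "circumradius Y \<le> r"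
    "\<And>y. y \<in> Y \<Longrightarrow> dist (circumcenter Y) y = circumradius Y"
proof -
  show c: "card Y = k + 1" and a: "\<not> affine_dependent Y"
    "circumcenter Y \<in> rel_interior (convex hull Y)" "circumradius Y \<le> r"
    using assms by (auto simp: crit_simplex_def)
  show f: "finite Y" "Y \<noteq> {}" using c by (auto intro: card_ge_0_finite)
  show "\<And>y. y \<in> Y \<Longrightarrow> dist (circumcenter Y) y = circumradius Y"
    using dist_circumcenter[OF a(1) f(2)] .
qed

lemma sum_image_weights:
  fixes x :: "'i \<Rightarrow> 'a::euclidean_space"
  assumes "finite I" "inj_on x I"
  shows "(\<exists>u. (\<forall>p\<in>x ` I. 0 < u p) \<and> sum u (x ` I) = 1 \<and> (\<Sum>p\<in>x ` I. u p *\<^sub>R p) = c) \<longleftrightarrow>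
    (\<exists>w. (\<forall>i\<in>I. 0 < w i) \<and> sum w I = 1 \<and> (\<Sum>i\<in>I. w i *\<^sub>R x i) = c)"
proof safe
  fix u :: "'a \<Rightarrow> real" assume "\<forall>p\<in>x ` I. 0 < u p" "sum u (x ` I) = 1"
  then show "\<exists>w. (\<forall>i\<in>I. 0 < w i) \<and> sum w I = 1 \<and> (\<Sum>i\<in>I. w i *\<^sub>R x i) = (\<Sum>p\<in>x ` I. u p *\<^sub>R p)"
    by (intro exI[of _ "u \<circ> x"]) (auto simp: sum.reindex[OF assms(2)])
next
  fix w :: "'i \<Rightarrow> real" assume w: "\<forall>i\<in>I. 0 < w i" "sum w I = 1"
  have *: "the_inv_into I x (x i) = i" if "i \<in> I" for i
    using assms that by (simp add: the_inv_into_f_f)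
  show "\<exists>u. (\<forall>p\<in>x ` I. 0 < u p) \<and> sum u (x ` I) = 1 \<and> (\<Sum>p\<in>x ` I. u p *\<^sub>R p) = (\<Sum>i\<in>I. w i *\<^sub>R x i)"
    using w by (intro exI[of _ "w \<circ> the_inv_into I x"]) (auto simp: sum.reindex[OF assms(2)] *)
qed

definition bary :: "'i set \<Rightarrow> ('i \<Rightarrow> real) \<Rightarrow> ('i \<Rightarrow> 'a::euclidean_space) \<Rightarrow> 'a" where
  "bary I w x = (\<Sum>i\<in>I. w i *\<^sub>R x i)"

text \<open>Trades the description of the circumcenter by \<open>THE\<close> for an existential over
  positive barycentric weights. In this form the condition can be carried along affine maps and
  tested for measurability.\<close>

lemma crit_simplex_family:
  fixes x :: "'i \<Rightarrow> 'a::euclidean_space"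
  assumes "finite I" "card I = k + 1"
  shows "crit_simplex k r (x ` I) \<and> circumcenter (x ` I) = c \<longleftrightarrow> aff_indep_family I x \<and>
     (\<exists>w. (\<forall>i\<in>I. 0 < w i) \<and> sum w I = 1 \<and> bary I w x = c \<and>
        (\<forall>i\<in>I. \<forall>j\<in>I. dist c (x i) = dist c (x j)) \<and> (\<forall>i\<in>I. dist c (x i) \<le> r))"
    (is "?L \<longleftrightarrow> ?R")
proof
  have ne: "x ` I \<noteq> {}" using assms by auto
  show ?R if L: ?L
  proof -
    have "inj_on x I" using L assms by (auto simp: crit_simplex_def intro: eq_card_imp_inj_on)
    moreover note D = crit_simplexD[OF conjunct1[OF L]]
    ultimately have ind: "aff_indep_family I x" using aff_indep_family_iff[OF assms(1)] by blast
    have "c \<in> rel_interior (convex hull (x ` I))" using D(5) L by simp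
    then have "\<exists>w. (\<forall>i\<in>I. 0 < w i) \<and> sum w I = 1 \<and> bary I w x = c"
      unfolding rel_interior_convex_hull_explicit[OF D(4)] bary_def
        sum_image_weights[OF assms(1) \<open>inj_on x I\<close>, symmetric] by simp
    moreover have "dist c (x i) = circumradius (x ` I)" if "i \<in> I" for i
      using D(7) L that by blast
    ultimately show ?R using ind D(6) by auto
  qed
  show ?L if R: ?R
  proof -
    have *: "inj_on x I" "\<not> affine_dependent (x ` I)"
      using R aff_indep_family_iff[OF assms(1)] by auto
    have "\<exists>w. (\<forall>i\<in>I. 0 < w i) \<and> sum w I = 1 \<and> (\<Sum>i\<in>I. w i *\<^sub>R x i) = c"
      using R unfolding bary_def by blast
    then have c: "c \<in> rel_interior (convex hull (x ` I))"
      unfolding rel_interior_convex_hull_explicit[OF *(2)] sum_image_weights[OF assms(1) *(1), symmetric]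
      by simp
    then have "c \<in> affine hull (x ` I)"
      using rel_interior_subset convex_hull_subset_affine_hull by blast
    then have cc: "circumcenter (x ` I) = c" using circumcenter_eqI[OF ne, of c] R by blast
    obtain i where i: "i \<in> I" using ne by auto
    have "circumradius (x ` I) = dist c (x i)"
      using dist_circumcenter[OF *(2) ne, of "x i"] i cc by auto
    then show ?L using R cc c * assms i by (auto simp: crit_simplex_def card_image)
  qed
qed

lemma crit_simplex_affinity:
  fixes Y :: "'a::euclidean_space set"
  assumes "0 < s"
  shows "crit_simplex k (s * r) ((\<lambda>z. a + s *\<^sub>R z) ` Y) \<longleftrightarrow> crit_simplex k r Y"
proof -
  have dir: "crit_simplex k (s * r) ((\<lambda>z. a + s *\<^sub>R z) ` Y)"
    if "0 < s" "crit_simplex k r Y" for a :: 'a and s r and Y :: "'a set"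
  proof -
    note D = crit_simplexD[OF that(2)]
    let ?c = "circumcenter Y" and ?x = "\<lambda>z. a + s *\<^sub>R z"
    have "crit_simplex k r (id ` Y) \<and> circumcenter (id ` Y) = ?c" using that by simp
    then have fam: "aff_indep_family Y id \<and> (\<exists>w. (\<forall>i\<in>Y. 0 < w i) \<and> sum w Y = 1 \<and> bary Y w id = ?c \<and>
        (\<forall>i\<in>Y. \<forall>j\<in>Y. dist ?c (id i) = dist ?c (id j)) \<and> (\<forall>i\<in>Y. dist ?c (id i) \<le> r))"
      using crit_simplex_family[OF D(1,3), of r id ?c] by blast
    then obtain w where w: "(\<forall>i\<in>Y. 0 < w i)" "sum w Y = 1" "bary Y w id = ?c"
      "\<forall>i\<in>Y. \<forall>j\<in>Y. dist ?c i = dist ?c j" "\<forall>i\<in>Y. dist ?c i \<le> r" unfolding id_apply by (elim conjE exE) metis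
    have b: "bary Y u ?x = sum u Y *\<^sub>R a + s *\<^sub>R bary Y u id" for u
      by (simp add: bary_def scaleR_add_right sum.distrib scaleR_sum_left[symmetric] scaleR_sum_right mult.commute)
    have "aff_indep_family Y ?x"
      using conjunct1[OF fam] b that(1) unfolding aff_indep_family_def bary_def[symmetric] by (simp add: id_def)
    moreover have "bary Y w ?x = a + s *\<^sub>R ?c" using w(2,3) b by simp
    moreover have ds: "dist (a + s *\<^sub>R p) (a + s *\<^sub>R q) = s * dist p q" for p q
      using that(1) by (simp add: dist_norm scaleR_diff_right[symmetric])
    have "dist (a + s *\<^sub>R ?c) (?x i) = dist (a + s *\<^sub>R ?c) (?x j)" if "i \<in> Y" "j \<in> Y" for i j
      unfolding ds using w(4) that by metis
    moreover have "dist (a + s *\<^sub>R ?c) (?x i) \<le> s * r" if "i \<in> Y" for i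
      unfolding ds using w(5) that \<open>0 < s\<close> by simp
    ultimately have "crit_simplex k (s * r) (?x ` Y) \<and> circumcenter (?x ` Y) = a + s *\<^sub>R ?c"
      unfolding crit_simplex_family[OF D(1,3)] using w(1,2) by blast
    then show ?thesis ..
  qed
  \<comment> \<open>The converse is the implication just proved, applied to the inverse
    homothety.\<close>
  have "Y = (\<lambda>z. (- (1/s) *\<^sub>R a) + (1/s) *\<^sub>R z) ` (\<lambda>z. a + s *\<^sub>R z) ` Y"
    using assms by (simp add: image_image scaleR_add_right)
  then show ?thesis
    using dir[where s = "1/s" and r = "s * r" and Y = "(\<lambda>z. a + s *\<^sub>R z) ` Y" and a = "- (1/s) *\<^sub>R a"]
      dir[where s = s and r = r and Y = Y and a = a] assms by auto
qed

text \<open>Finiteness of the set of distances is what makes the \<open>Min\<close> in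
  \<open>dist_to\<close> a true minimum when \<open>P\<close> is infinite.\<close>

definition crit_subset :: "nat \<Rightarrow> real \<Rightarrow> 'a::euclidean_space set \<Rightarrow> 'a set \<Rightarrow> bool" where
  "crit_subset k r P Y \<longleftrightarrow> Y \<subseteq> P \<and> crit_simplex k r Y \<and>
     (\<forall>p\<in>P - Y. circumradius Y < dist (circumcenter Y) p) \<and> finite (dist (circumcenter Y) ` P)"

text \<open>\<open>Min\<close> of an infinite set is a fixed unspecified number; below that
  threshold an infinite set of distances never produces a critical point.\<close>

lemma crit_subset_bij:
  fixes P :: "'a::euclidean_space set"
  assumes k: "1 \<le> k" and r: "finite P \<or> \<not> 0 < Min (UNIV::real set) \<or> r < Min (UNIV::real set)"
  shows "bij_betw circumcenter {Y. crit_subset k r P Y} {c. crit_point k P c \<and> dist_to P c \<le> r}"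
proof (rule bij_betw_imageI)
  show "inj_on circumcenter {Y. crit_subset k r P Y}"
  proof (rule inj_onI)
    \<comment> \<open>With a common center, the vertices on the smaller sphere lie in the larger
      closed ball, whose only points of \<open>P\<close> are its own vertices.\<close>
    have sub: "Y \<subseteq> Y'" if "crit_subset k r P Y" "crit_subset k r P Y'" "circumcenter Y = circumcenter Y'"
      "circumradius Y \<le> circumradius Y'" for Y Y' :: "'a set"
    proof
      fix y assume y: "y \<in> Y"
      have "crit_simplex k r Y" using that(1) by (simp add: crit_subset_def)
      from crit_simplexD(7)[OF this y] y that(1) have "dist (circumcenter Y') y = circumradius Y" "y \<in> P"
        unfolding that(3)[symmetric] by (auto simp: crit_subset_def)
      then show "y \<in> Y'" using that(2,4) by (force simp: crit_subset_def)
    qed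
    fix Y Y' :: "'a set" assume Y: "Y \<in> {Y. crit_subset k r P Y}" "Y' \<in> {Y. crit_subset k r P Y}"
      and eq: "circumcenter Y = circumcenter Y'"
    have "crit_simplex k r Y" "crit_simplex k r Y'" using Y by (auto simp: crit_subset_def)
    note crit_simplexD(1,3)[OF this(1)] crit_simplexD(1,3)[OF this(2)]
    then have card: "finite Y" "finite Y'" "card Y = card Y'" by simp_all
    show "Y = Y'"
    proof (cases "circumradius Y \<le> circumradius Y'")
      case True then show ?thesis using sub[of Y Y'] Y eq card by (simp add: card_subset_eq)
    next
      case False then show ?thesis using sub[of Y' Y] Y eq card by (metis card_subset_eq linear mem_Collect_eq)
    qed
  qed
  show "circumcenter ` {Y. crit_subset k r P Y} = {c. crit_point k P c \<and> dist_to P c \<le> r}"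
  proof (intro equalityI subsetI)
    fix c assume "c \<in> circumcenter ` {Y. crit_subset k r P Y}"
    then obtain Y where Y: "crit_subset k r P Y" "c = circumcenter Y" by auto
    note D = crit_simplexD[of k r Y]
    have fin: "finite (dist c ` P)" and cs: "crit_simplex k r Y" and sub: "Y \<subseteq> P"
      and far: "\<And>p. p \<in> P - Y \<Longrightarrow> circumradius Y < dist c p" using Y by (auto simp: crit_subset_def)
    obtain y where y: "y \<in> Y" using D(2)[OF cs] by auto
    have dt: "dist_to P c = circumradius Y"
      unfolding dist_to_def
    proof (rule Min_eqI[OF fin])
      show "circumradius Y \<in> dist c ` P" using D(7)[OF cs y] sub y unfolding Y(2) by (metis imageI subsetD)
      show "circumradius Y \<le> z" if "z \<in> dist c ` P" for z
        using that far D(7)[OF cs] Y(2) by (force simp: less_imp_le)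
    qed
    have "crit_point k P c"
      unfolding crit_point_def dt using D[OF cs] sub far Y(2) by (intro exI[of _ Y]) auto
    then show "c \<in> {c. crit_point k P c \<and> dist_to P c \<le> r}" using dt D(6)[OF cs] by simp
  next
    fix c assume "c \<in> {c. crit_point k P c \<and> dist_to P c \<le> r}"
    then obtain Y where Y: "Y \<subseteq> P" "card Y = k + 1" "\<not> affine_dependent Y"
      "\<forall>y\<in>Y. dist c y = dist_to P c" "\<forall>p\<in>P - Y. dist c p > dist_to P c"
      "c \<in> rel_interior (convex hull Y)" "dist_to P c \<le> r" unfolding crit_point_def by blast
    have fY: "finite Y" "Y \<noteq> {}" using Y(2) by (auto intro: card_ge_0_finite)
    have "c \<in> affine hull Y"
      using Y(6) rel_interior_subset convex_hull_subset_affine_hull by blast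
    then have cc: "circumcenter Y = c" using circumcenter_eqI[OF fY(2), of c] Y(4) by force
    have cr: "circumradius Y = dist_to P c"
      using dist_circumcenter[OF Y(3) fY(2)] cc Y(4) fY(2) by force
    \<comment> \<open>Otherwise \<open>dist_to P c\<close> would be the unspecified
      \<open>Min UNIV\<close>. As it is at most \<open>r\<close>, the hypothesis leaves only a
      nonpositive value, which would collapse \<open>Y\<close> to a single point against
      \<open>1 \<le> k\<close>.\<close>
    have "finite (dist c ` P)"
    proof (rule ccontr)
      assume inf: "infinite (dist c ` P)"
      then have "dist_to P c = Min (UNIV::real set)"
        unfolding dist_to_def by (simp add: Min.infinite infinite_UNIV_char_0)
      moreover have "infinite P" using inf by auto
      ultimately have "\<not> 0 < dist_to P c" using r Y(7) by linarith
      then have "Y \<subseteq> {c}" using Y(4) by (metis dist_eq_0_iff insertCI subsetI zero_less_dist_iff)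
      then have "card Y \<le> 1" by (metis card.empty card.insert card_mono empty_iff finite.emptyI finite.insertI One_nat_def)
      then show False using k Y(2) by simp
    qed
    then have "crit_subset k r P Y"
      using Y cc cr by (auto simp: crit_subset_def crit_simplex_def)
    then show "c \<in> circumcenter ` {Y. crit_subset k r P Y}" using cc by auto
  qed
qed

lemma num_crit_eq:
  fixes P :: "'a::euclidean_space set"
  assumes "1 \<le> k" "finite P \<or> \<not> 0 < Min (UNIV::real set) \<or> r < Min (UNIV::real set)"
  shows "num_crit k P r = card {Y. crit_subset k r P Y}"
  unfolding num_crit_def using bij_betw_same_card[OF crit_subset_bij[OF assms]] by simp


section \<open>Measurability of the critical simplex condition and of its center\<close>

text \<open>Density is relative to \<open>C\<close>: a countable dense set of the whole space may
  miss a thin set \<open>C\<close> entirely.\<close>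

lemma countable_dense_subset:
  fixes C :: "'t::second_countable_topology set"
  obtains D where "countable D" "D \<subseteq> C" "\<And>U. open U \<Longrightarrow> U \<inter> C \<noteq> {} \<Longrightarrow> U \<inter> D \<noteq> {}"
proof -
  obtain B :: "'t set set" where B: "countable B" "topological_basis B" using ex_countable_basis by auto
  define D where "D = (\<lambda>b. SOME x. x \<in> b \<inter> C) ` {b\<in>B. b \<inter> C \<noteq> {}}"
  have some: "(SOME x. x \<in> b \<inter> C) \<in> b \<inter> C" if "b \<inter> C \<noteq> {}" for b
    by (rule someI_ex) (use that in blast)
  show thesis
  proof (rule that)
    show "countable D" using B(1) by (auto simp: D_def)
    show "D \<subseteq> C" using some by (auto simp: D_def)
    show "U \<inter> D \<noteq> {}" if U: "open U" "U \<inter> C \<noteq> {}" for U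
    proof -
      obtain x where x: "x \<in> U" "x \<in> C" using U by auto
      obtain b where b: "b \<in> B" "x \<in> b" "b \<subseteq> U" using topological_basisE[OF B(2) U(1) x(1)] by metis
      then have "(SOME x. x \<in> b \<inter> C) \<in> U \<inter> D" using some[of b] x unfolding D_def by blast
      then show ?thesis by auto
    qed
  qed
qed

text \<open>A nonnegative continuous function has a zero on a compact set iff its values come
  arbitrarily close to 0 there, and by continuity this can be tested on a countable dense subset. An
  uncountable existential thus becomes a countable combination of measurable conditions.\<close>

lemma measurable_ex_compact:
  fixes F :: "'t::{second_countable_topology,t2_space} \<Rightarrow> 'x \<Rightarrow> real"
  assumes C: "compact C" and cont: "\<And>x. x \<in> space M \<Longrightarrow> continuous_on C (\<lambda>t. F t x)"
    and meas: "\<And>t. t \<in> C \<Longrightarrow> F t \<in> borel_measurable M"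
    and nn: "\<And>t x. 0 \<le> F t x"
  shows "{x \<in> space M. \<exists>t\<in>C. F t x = 0} \<in> sets M"
proof -
  obtain D where D: "countable D" "D \<subseteq> C" "\<And>U. open U \<Longrightarrow> U \<inter> C \<noteq> {} \<Longrightarrow> U \<inter> D \<noteq> {}"
    using countable_dense_subset[of C] by metis
  have "(\<exists>t\<in>C. F t x = 0) \<longleftrightarrow> (\<forall>n::nat. \<exists>t\<in>D. F t x < 1 / Suc n)" if x: "x \<in> space M" for x
  proof
    assume "\<exists>t\<in>C. F t x = 0"
    then obtain t where t: "t \<in> C" "F t x = 0" by auto
    show "\<forall>n::nat. \<exists>t\<in>D. F t x < 1 / Suc n"
    proof
      fix n :: nat
      obtain U where U: "open U" "U \<inter> C = (\<lambda>t. F t x) -` {..<1 / Suc n} \<inter> C"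
        using continuous_on_open_invariant[THEN iffD1, OF cont[OF x]] open_lessThan by metis
      then have "t \<in> U \<inter> C" using t by simp
      then have "U \<inter> D \<noteq> {}" using D(3)[OF U(1)] by blast
      then show "\<exists>t\<in>D. F t x < 1 / Suc n" using U(2) D(2) by blast
    qed
  next
    assume *: "\<forall>n::nat. \<exists>t\<in>D. F t x < 1 / Suc n"
    then have "C \<noteq> {}" using D(2) by blast
    then obtain t where t: "t \<in> C" "\<And>s. s \<in> C \<Longrightarrow> F t x \<le> F s x"
      using continuous_attains_inf[OF C _ cont[OF x]] by metis
    have "F t x \<le> 0"
    proof (rule ccontr)
      assume "\<not> F t x \<le> 0"
      then obtain n :: nat where n: "1 / Suc n < F t x"
        using reals_Archimedean[of "F t x"] by (auto simp: inverse_eq_divide)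
      obtain s where "s \<in> D" "F s x < 1 / Suc n" using * by blast
      then show False using t(2)[of s] D(2) n by auto
    qed
    then show "\<exists>t\<in>C. F t x = 0" using t nn[of t x] by force
  qed
  then have "{x \<in> space M. \<exists>t\<in>C. F t x = 0} = {x \<in> space M. \<forall>n::nat. \<exists>t\<in>D. F t x < 1 / Suc n}"
    by blast
  also have "\<dots> \<in> sets M"
  proof -
    have "{x \<in> space M. F t x < 1 / Suc n} \<in> sets M" if "t \<in> D" for t and n :: nat
      using meas[of t] that D(2) by (intro borel_measurable_less) auto
    then show ?thesis
      by (intro sets.sets_Collect_countable_All sets.sets_Collect_countable_Ex' D(1))
  qed
  finally show ?thesis .
qed

text \<open>Weights are functions on all of \<open>nat\<close> with the product topology, so this is
  Tychonoff's theorem; coordinates outside the index set are boxed as well.\<close>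

lemma compact_box_family:
  fixes l u :: "nat \<Rightarrow> real"
  shows "compact {w. \<forall>i. l i \<le> w i \<and> w i \<le> u i}"
proof -
  have "compactin (product_topology (\<lambda>_. euclidean) UNIV) (PiE UNIV (\<lambda>i. {l i..u i}))"
    by (simp add: compactin_PiE)
  moreover have "PiE UNIV (\<lambda>i. {l i..u i}) = {w. \<forall>i. l i \<le> w i \<and> w i \<le> u i}" by (auto simp: PiE_def)
  ultimately show ?thesis by (simp add: euclidean_product_topology)
qed

lemma continuous_on_apply [continuous_intros]: "continuous_on S (\<lambda>w::nat \<Rightarrow> real. w i)"
  by (rule continuous_on_subset[OF continuous_on_product_coordinates subset_UNIV])

lemma measurable_aff_indep_family:
  fixes I J :: "nat set"
  assumes "finite I" "I \<subseteq> J"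
  shows "{x \<in> space (PiM J (\<lambda>_. borel :: 'a::euclidean_space measure)). aff_indep_family I x}
    \<in> sets (PiM J (\<lambda>_. borel))" (is "?A \<in> sets ?M")
proof -
  have coord: "(\<lambda>x. x i) \<in> borel_measurable ?M" if "i \<in> I" for i
    using that assms by (intro measurable_component_singleton) auto
  \<comment> \<open>Dividing a nontrivial relation by its coefficient of largest modulus gives one
    with coefficient 1 at some \<open>i\<close> and all others in [-1, 1], so dependence is an
    existential over finitely many compact sets.\<close>
  define C where "C i = {w::nat \<Rightarrow> real. \<forall>j. (if j = i then 1 else -1) \<le> w j \<and> w j \<le> 1}" for i
  define F where "F w x = \<bar>sum w I\<bar> + norm (bary I w x)" for w and x :: "nat \<Rightarrow> 'a"
  have meas: "{x \<in> space ?M. \<exists>w\<in>C i. F w x = 0} \<in> sets ?M" for i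
  proof (rule measurable_ex_compact)
    show "compact (C i)" unfolding C_def by (rule compact_box_family)
    show "continuous_on (C i) (\<lambda>w. F w x)" for x
      unfolding F_def bary_def by (intro continuous_intros)
    show "F w \<in> borel_measurable ?M" for w
      unfolding F_def bary_def
      by (intro borel_measurable_add borel_measurable_abs measurable_compose[OF _ borel_measurable_norm] borel_measurable_sum
          borel_measurable_scaleR borel_measurable_const coord)
  qed (simp add: F_def)
  have "aff_indep_family I x \<longleftrightarrow> \<not> (\<exists>i\<in>I. \<exists>w\<in>C i. F w x = 0)" for x
  proof
    assume ind: "aff_indep_family I x"
    show "\<not> (\<exists>i\<in>I. \<exists>w\<in>C i. F w x = 0)"
    proof
      assume "\<exists>i\<in>I. \<exists>w\<in>C i. F w x = 0"
      then obtain i w where w: "i \<in> I" "w \<in> C i" "F w x = 0" by auto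
      then have "\<bar>sum w I\<bar> + norm (bary I w x) = 0" by (simp add: F_def)
      then have "\<bar>sum w I\<bar> = 0" "norm (bary I w x) = 0"
        using norm_ge_zero[of "bary I w x"] abs_ge_zero[of "sum w I"] by linarith+
      then have "sum w I = 0" "bary I w x = 0" by simp_all
      then have "w i = 0" using ind w(1) unfolding aff_indep_family_def bary_def by blast
      moreover have "1 \<le> w i" using spec[OF w(2)[unfolded C_def mem_Collect_eq], of i] by simp
      ultimately show False by simp
    qed
  next
    assume nex: "\<not> (\<exists>i\<in>I. \<exists>w\<in>C i. F w x = 0)"
    show "aff_indep_family I x"
      unfolding aff_indep_family_def
    proof (intro allI impI ballI, rule ccontr)
      fix u j assume u: "sum u I = 0" "(\<Sum>i\<in>I. u i *\<^sub>R x i) = 0" and j: "j \<in> I" "u j \<noteq> 0"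
      define m where "m = Max ((\<lambda>i. \<bar>u i\<bar>) ` I)"
      have "m \<in> (\<lambda>i. \<bar>u i\<bar>) ` I" unfolding m_def using j assms by (intro Max_in) auto
      then obtain i where i: "i \<in> I" "m = \<bar>u i\<bar>" by auto
      have le: "\<bar>u l\<bar> \<le> \<bar>u i\<bar>" if "l \<in> I" for l
        using that assms unfolding i(2)[symmetric] m_def by simp
      have ui: "u i \<noteq> 0" using le[OF j(1)] j(2) by auto
      define w where "w l = (if l \<in> I then u l / u i else 0)" for l
      have "sum w I = sum u I / u i" "bary I w x = (1 / u i) *\<^sub>R (\<Sum>i\<in>I. u i *\<^sub>R x i)"
        by (simp_all add: w_def bary_def sum_divide_distrib scaleR_sum_right)
      then have "F w x = 0" using u by (simp add: F_def)
      moreover have wl: "\<bar>w l\<bar> \<le> 1" for l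
        using le[of l] ui by (auto simp: w_def)
      have "w i = 1" using i(1) ui by (simp add: w_def)
      then have "w \<in> C i" using wl unfolding C_def abs_le_iff by (auto simp: minus_le_iff)
      ultimately show False using nex i by blast
    qed
  qed
  then have "?A = {x \<in> space ?M. \<not> (\<exists>i\<in>I. \<exists>w\<in>C i. F w x = 0)}" by blast
  also have "\<dots> \<in> sets ?M" using assms(1) by (intro sets.sets_Collect_neg sets.sets_Collect_finite_Ex meas)
  finally show ?thesis .
qed

text \<open>The half-space condition is carried along because it yields the measurability of the
  center itself. \<open>F\<close> gathers all closed conditions into one nonnegative continuous
  function of the weights; positivity of the weights is an open condition and is exhausted by the
  compact sets \<open>C m\<close>, on which they are at least \<open>1 / Suc m\<close>.\<close>

lemma measurable_crit_simplex_aux: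
  fixes I J :: "nat set"
  assumes "finite I" "card I = k + 1" "I \<subseteq> J"
  shows "{x \<in> space (PiM J (\<lambda>_. borel :: 'a::euclidean_space measure)).
     crit_simplex k r (x ` I) \<and> circumcenter (x ` I) \<bullet> b \<le> a} \<in> sets (PiM J (\<lambda>_. borel))"
    (is "?A \<in> sets ?M")
proof -
  have coord: "(\<lambda>x. x i) \<in> borel_measurable ?M" if "i \<in> I" for i
    using that assms by (intro measurable_component_singleton) auto
  define C where "C m = {w::nat \<Rightarrow> real. \<forall>j. (if j \<in> I then 1 / Suc m else 0) \<le> w j \<and> w j \<le> (if j \<in> I then 1 else 0)}" for m :: nat
  define F where "F w x = \<bar>sum w I - 1\<bar> +
    (\<Sum>i\<in>I. \<Sum>j\<in>I. \<bar>dist (bary I w x) (x i) - dist (bary I w x) (x j)\<bar>) +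
    (\<Sum>i\<in>I. max 0 (dist (bary I w x) (x i) - r)) + max 0 (bary I w x \<bullet> b - a)" for w and x :: "nat \<Rightarrow> 'a"
  have [measurable]: "{x \<in> space ?M. \<exists>w\<in>C m. F w x = 0} \<in> sets ?M" for m
  proof (rule measurable_ex_compact)
    show "compact (C m)" unfolding C_def by (rule compact_box_family)
    show "continuous_on (C m) (\<lambda>w. F w x)" for x
      unfolding F_def bary_def by (intro continuous_intros)
    show "F w \<in> borel_measurable ?M" for w
      unfolding F_def bary_def
      by (intro borel_measurable_add borel_measurable_abs borel_measurable_dist borel_measurable_sum
          borel_measurable_diff borel_measurable_max borel_measurable_inner
          borel_measurable_scaleR borel_measurable_const coord)
  qed (auto simp: F_def intro!: add_nonneg_nonneg sum_nonneg)
  have F0: "F w x = 0 \<longleftrightarrow> sum w I = 1 \<and>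
    (\<forall>i\<in>I. \<forall>j\<in>I. dist (bary I w x) (x i) = dist (bary I w x) (x j)) \<and>
    (\<forall>i\<in>I. dist (bary I w x) (x i) \<le> r) \<and> bary I w x \<bullet> b \<le> a" for w x
  proof -
    have "0 \<le> (\<Sum>i\<in>I. \<Sum>j\<in>I. \<bar>dist (bary I w x) (x i) - dist (bary I w x) (x j)\<bar>)"
      "0 \<le> (\<Sum>i\<in>I. max 0 (dist (bary I w x) (x i) - r))" by (auto intro!: sum_nonneg)
    then have "F w x = 0 \<longleftrightarrow> \<bar>sum w I - 1\<bar> = 0 \<and>
      (\<Sum>i\<in>I. \<Sum>j\<in>I. \<bar>dist (bary I w x) (x i) - dist (bary I w x) (x j)\<bar>) = 0 \<and>
      (\<Sum>i\<in>I. max 0 (dist (bary I w x) (x i) - r)) = 0 \<and> max 0 (bary I w x \<bullet> b - a) = 0"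
      unfolding F_def by linarith
    also have "\<dots> \<longleftrightarrow> sum w I = 1 \<and>
    (\<forall>i\<in>I. \<forall>j\<in>I. dist (bary I w x) (x i) = dist (bary I w x) (x j)) \<and>
    (\<forall>i\<in>I. dist (bary I w x) (x i) \<le> r) \<and> bary I w x \<bullet> b \<le> a"
    proof -
      have m: "max 0 (t - u) = 0 \<longleftrightarrow> t \<le> u" for t u :: real by auto
      show ?thesis using assms(1) by (simp add: sum_nonneg_eq_0_iff sum_nonneg m)
    qed
    finally show ?thesis .
  qed
  have "(\<exists>m. \<exists>w\<in>C m. F w x = 0) \<longleftrightarrow> (\<exists>w. (\<forall>i\<in>I. 0 < w i) \<and> F w x = 0)" for x
  proof safe
    fix m w assume w: "w \<in> C m" "F w x = 0"
    have "0 < w i" if "i \<in> I" for i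
    proof -
      have "1 / Suc m \<le> w i" using spec[OF w(1)[unfolded C_def mem_Collect_eq], of i] that by simp
      then show ?thesis by (rule less_le_trans[rotated]) simp
    qed
    then show "\<exists>w. (\<forall>i\<in>I. 0 < w i) \<and> F w x = 0" using w by blast
  next
    fix w assume w: "\<forall>i\<in>I. 0 < w i" "F w x = 0"
    then have s: "sum w I = 1" using F0 by simp
    \<comment> \<open>Coordinates outside \<open>I\<close> are set to 0, as the box
      \<open>C m\<close> demands; the sums over \<open>I\<close> do not see them.\<close>
    define v where "v i = (if i \<in> I then w i else 0)" for i
    have e: "sum v I = sum w I" "bary I v x = bary I w x" by (simp_all add: v_def bary_def)
    then have "F v x = 0" using w(2) unfolding F_def by simp
    have ne: "I \<noteq> {}" using assms by auto
    have "0 < Min (w ` I)" using w(1) ne assms(1) by simp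
    then obtain m :: nat where m: "1 / Suc m < Min (w ` I)"
      using reals_Archimedean[of "Min (w ` I)"] by (metis inverse_eq_divide)
    have "1 / Suc m \<le> w i" if "i \<in> I" for i
      using m that assms(1) Min_le[of "w ` I" "w i"] by (meson finite_imageI imageI less_imp_le order_trans)
    moreover have "w i \<le> 1" if "i \<in> I" for i
      using member_le_sum[of i I w] that assms(1) w(1) s by (simp add: less_imp_le)
    ultimately have "v \<in> C m" unfolding C_def v_def by simp
    then show "\<exists>m. \<exists>w\<in>C m. F w x = 0" using \<open>F v x = 0\<close> by blast
  qed
  moreover have "crit_simplex k r (x ` I) \<and> circumcenter (x ` I) \<bullet> b \<le> a \<longleftrightarrow>
     aff_indep_family I x \<and> (\<exists>w. (\<forall>i\<in>I. 0 < w i) \<and> F w x = 0)" (is "?L x \<longleftrightarrow> ?R x") for x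
  proof
    assume "?L x"
    then obtain w where "aff_indep_family I x \<and> (\<forall>i\<in>I. 0 < w i) \<and> sum w I = 1 \<and> bary I w x = circumcenter (x ` I) \<and>
        (\<forall>i\<in>I. \<forall>j\<in>I. dist (circumcenter (x ` I)) (x i) = dist (circumcenter (x ` I)) (x j)) \<and>
        (\<forall>i\<in>I. dist (circumcenter (x ` I)) (x i) \<le> r)"
      using crit_simplex_family[OF assms(1,2), of r x "circumcenter (x ` I)"] by blast
    then show "?R x" unfolding F0 using \<open>?L x\<close> by metis
  next
    assume "?R x"
    then obtain w where w: "aff_indep_family I x" "\<forall>i\<in>I. 0 < w i" "F w x = 0" by blast
    then have "crit_simplex k r (x ` I) \<and> circumcenter (x ` I) = bary I w x"
      unfolding F0 crit_simplex_family[OF assms(1,2)] by blast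
    then show "?L x" using conjunct2[OF conjunct2[OF conjunct2[OF F0[THEN iffD1, OF w(3)]]]] by simp
  qed
  ultimately have "?A = {x \<in> space ?M. aff_indep_family I x \<and> (\<exists>m. \<exists>w\<in>C m. F w x = 0)}"
    by blast
  also have "\<dots> \<in> sets ?M"
    using measurable_aff_indep_family[OF assms(1,3)]
    by (intro sets.sets_Collect_conj sets.sets_Collect_countable_Ex) auto
  finally show ?thesis .
qed

lemma measurable_crit_simplex:
  fixes I J :: "nat set"
  assumes "finite I" "card I = k + 1" "I \<subseteq> J"
  shows "{x \<in> space (PiM J (\<lambda>_. borel :: 'a::euclidean_space measure)). crit_simplex k r (x ` I)}
    \<in> sets (PiM J (\<lambda>_. borel))"
  using measurable_crit_simplex_aux[OF assms, of r 0 0] by simp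

text \<open>Outside of \<open>crit_simplex\<close> the circumcenter is replaced by \<open>0\<close>, since
  there \<open>THE\<close> need not be measurable.\<close>

definition crit_center :: "nat \<Rightarrow> real \<Rightarrow> 'a::euclidean_space set \<Rightarrow> 'a" where
  "crit_center k r Y = (if crit_simplex k r Y then circumcenter Y else 0)"

lemma measurable_crit_center:
  fixes I J :: "nat set"
  assumes "finite I" "card I = k + 1" "I \<subseteq> J"
  shows "(\<lambda>x. crit_center k r (x ` I)) \<in> borel_measurable (PiM J (\<lambda>_. borel :: 'a::euclidean_space measure))"
    (is "_ \<in> borel_measurable ?M")
proof (subst borel_measurable_iff_halfspace_le, intro ballI allI)
  fix b :: 'a and a :: real
  have "{x \<in> space ?M. crit_center k r (x ` I) \<bullet> b \<le> a} =
    {x \<in> space ?M. (crit_simplex k r (x ` I) \<and> circumcenter (x ` I) \<bullet> b \<le> a) \<or>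
        (\<not> crit_simplex k r (x ` I) \<and> 0 \<le> a)}"
    by (auto simp: crit_center_def)
  also have "\<dots> \<in> sets ?M"
  proof -
    have [measurable]: "Measurable.pred ?M (\<lambda>x. crit_simplex k r (x ` I) \<and> circumcenter (x ` I) \<bullet> b \<le> a)"
      "Measurable.pred ?M (\<lambda>x. crit_simplex k r (x ` I))"
      using measurable_crit_simplex_aux[OF assms, of r b a] measurable_crit_simplex[OF assms, of r]
      by (simp_all add: pred_def)
    show ?thesis by measurable
  qed
  finally show "{x \<in> space ?M. crit_center k r (x ` I) \<bullet> b \<le> a} \<in> sets ?M" .
qed


section \<open>Poisson approximation for sums of dissociated indicators\<close>

lemma cmod_cis_diff_le: "cmod (cis x - cis y) \<le> \<bar>x - y\<bar>"
proof -
  have "cis x - cis y = cis y * (cis (x - y) - 1)"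
    by (simp add: algebra_simps cis_mult)
  moreover have "cmod (cis z - 1) \<le> \<bar>z\<bar>" for z
    using iexp_approx1[of z 0] by (simp add: cis_conv_exp)
  ultimately show ?thesis by (simp add: norm_mult)
qed

lemma one_minus_cos_le: "1 - cos t \<le> t\<^sup>2 / (2::real)"
proof -
  have "1 - cos t = 2 * (sin (t / 2))\<^sup>2" using cos_double_sin[of "t / 2"] by simp
  also have "(sin (t / 2))\<^sup>2 \<le> (t / 2)\<^sup>2"
    using abs_sin_x_le_abs_x[of "t / 2"] abs_le_square_iff by blast
  finally show ?thesis by (simp add: power_divide)
qed

context prob_space begin

lemma integrable_bounded:
  fixes g :: "'a \<Rightarrow> 'b::{banach,second_countable_topology}"
  assumes "g \<in> borel_measurable M" "\<And>\<omega>. \<omega> \<in> space M \<Longrightarrow> norm (g \<omega>) \<le> C"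
  shows "integrable M g"
  using assms by (intro integrable_const_bound[of _ C]) auto

lemma expectation_cis_close:
  assumes [measurable]: "F \<in> borel_measurable M" "G \<in> borel_measurable M"
    and int: "integrable M (\<lambda>\<omega>. F \<omega> - G \<omega>)"
  shows "cmod ((CLINT \<omega>|M. cis (F \<omega>)) - (CLINT \<omega>|M. cis (G \<omega>))) \<le> expectation (\<lambda>\<omega>. \<bar>F \<omega> - G \<omega>\<bar>)"
proof -
  have [measurable]: "cis \<in> borel_measurable borel"
    by (intro borel_measurable_continuous_onI continuous_intros)
  have i: "integrable M (\<lambda>\<omega>. cis (F \<omega>))" "integrable M (\<lambda>\<omega>. cis (G \<omega>))"
    by (rule integrable_bounded[where C = 1]; simp)+
  have "cmod ((CLINT \<omega>|M. cis (F \<omega>)) - (CLINT \<omega>|M. cis (G \<omega>))) = cmod (CLINT \<omega>|M. cis (F \<omega>) - cis (G \<omega>))"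
    using i by simp
  also have "\<dots> \<le> expectation (\<lambda>\<omega>. cmod (cis (F \<omega>) - cis (G \<omega>)))" by (rule integral_norm_bound)
  also have "\<dots> \<le> expectation (\<lambda>\<omega>. \<bar>F \<omega> - G \<omega>\<bar>)"
    using i int by (intro integral_mono integrable_norm integrable_diff integrable_abs) (auto simp: cmod_cis_diff_le)
  finally show ?thesis .
qed

text \<open>The characteristic function \<open>\<phi>\<close> of the sum almost satisfies the Poisson equation
  \<open>\<phi>' = \<i> \<lambda> cis t \<phi>\<close>: given \<open>I a = 1\<close>, the remaining sum is, up to the neighbours of \<open>a\<close>,
  an independent copy of the whole sum.\<close>

lemma dissociated_char_bound:
  fixes I :: "'i \<Rightarrow> 'a \<Rightarrow> real" and nb :: "'i \<Rightarrow> 'i set" and A :: "'i set"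
  defines "S \<equiv> \<lambda>\<omega>. \<Sum>a\<in>A. I a \<omega>"
    and "lam \<equiv> \<Sum>a\<in>A. expectation (I a)"
    and "b \<equiv> (\<Sum>a\<in>A. \<Sum>c\<in>nb a. expectation (I a) * expectation (I c)) +
       (\<Sum>a\<in>A. \<Sum>c\<in>nb a - {a}. expectation (\<lambda>\<omega>. I a \<omega> * I c \<omega>))"
  assumes fin: "finite A" and meas: "\<And>a. a \<in> A \<Longrightarrow> I a \<in> borel_measurable M"
    and range: "\<And>a \<omega>. I a \<omega> = 0 \<or> I a \<omega> = 1"
    and nb: "\<And>a. a \<in> A \<Longrightarrow> a \<in> nb a" "\<And>a. a \<in> A \<Longrightarrow> nb a \<subseteq> A"
    and ind: "\<And>a. a \<in> A \<Longrightarrow> indep_var borel (I a) borel (\<lambda>\<omega>. \<Sum>c\<in>A - nb a. I c \<omega>)"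
  shows "cmod ((CLINT \<omega>|M. cis (t * S \<omega>)) - exp (of_real lam * (cis t - 1))) \<le> t\<^sup>2 * b * exp (lam * t\<^sup>2 / 2)"
proof -
  have cism[measurable]: "cis \<in> borel_measurable borel"
    by (intro borel_measurable_continuous_onI continuous_intros)
  have Im: "I a \<in> borel_measurable M" if "a \<in> A" for a using meas that .
  have sm: "(\<lambda>\<omega>. \<Sum>a\<in>A'. I a \<omega>) \<in> borel_measurable M" if "A' \<subseteq> A" for A'
    using that meas by (intro borel_measurable_sum) auto
  have Sm[measurable]: "S \<in> borel_measurable M" unfolding S_def by (rule sm) simp
  have I01: "0 \<le> I a \<omega>" "I a \<omega> \<le> 1" for a \<omega> using range[of a \<omega>] by auto
  have Ii: "integrable M (I a)" if "a \<in> A" for a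
    by (rule integrable_bounded[where C = 1]) (use I01 Im[OF that] in auto)
  have IIi: "integrable M (\<lambda>\<omega>. I a \<omega> * I c \<omega>)" if "a \<in> A" "c \<in> A" for a c
    using Im[OF that(1)] Im[OF that(2)]
    by (intro integrable_bounded[where C = 1]) (auto simp: abs_mult intro!: mult_le_one I01 simp: abs_of_nonneg[OF I01(1)])
  have p0: "0 \<le> expectation (I a)" for a by (rule Bochner_Integration.integral_nonneg) (use I01 in auto)
  have pp0: "0 \<le> expectation (\<lambda>\<omega>. I a \<omega> * I c \<omega>)" for a c
    by (rule Bochner_Integration.integral_nonneg) (use I01 in auto)
  have lam0: "0 \<le> lam" unfolding lam_def by (intro sum_nonneg p0)
  have b0: "0 \<le> b" unfolding b_def by (intro add_nonneg_nonneg sum_nonneg mult_nonneg_nonneg p0 pp0)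
  define \<phi> where "\<phi> t = (CLINT \<omega>|M. cis (t * S \<omega>))" for t
  define \<phi>' where "\<phi>' t = (CLINT \<omega>|M. \<i> * of_real (S \<omega>) * cis (t * S \<omega>))" for t
  define ev where "ev s = expectation (\<lambda>\<omega>. indicator {of_nat s} (S \<omega>) :: real)" for s :: nat
  have Sval: "\<exists>s\<le>card A. S \<omega> = real s" for \<omega>
  proof -
    have "S \<omega> = (\<Sum>a\<in>A. if I a \<omega> = 1 then 1 else 0)" unfolding S_def using range by (intro sum.cong) auto
    also have "\<dots> = real (card {a\<in>A. I a \<omega> = 1})" using fin by (simp add: sum.If_cases Int_def)
    finally show ?thesis using fin by (intro exI[of _ "card {a\<in>A. I a \<omega> = 1}"]) (auto intro: card_mono)
  qed
  \<comment> \<open>Since \<open>S\<close> takes finitely many values, \<phi> is a finite sum of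
    exponentials and can be differentiated term by term.\<close>
  have rep: "g (S \<omega>) = (\<Sum>s\<le>card A. of_real (indicator {real s} (S \<omega>)) * g (real s))" for g :: "real \<Rightarrow> complex" and \<omega>
  proof -
    obtain s where s: "s \<le> card A" "S \<omega> = real s" using Sval by blast
    have "(\<Sum>s'\<le>card A. of_real (indicator {real s'} (S \<omega>)) * g (real s')) = (\<Sum>s'\<le>card A. if s' = s then g (real s) else 0)"
      using s(2) by (intro sum.cong refl) (auto simp: indicator_def)
    then show ?thesis using s by simp
  qed
  have Erep: "(CLINT \<omega>|M. g (S \<omega>)) = (\<Sum>s\<le>card A. of_real (ev s) * g (real s))" for g :: "real \<Rightarrow> complex"
  proof -
    have int: "integrable M (\<lambda>\<omega>. of_real (indicator {real s} (S \<omega>)) * g (real s))" for s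
      by (intro integrable_mult_left integrable_of_real integrable_bounded[where C = 1]) (auto simp: indicator_def)
    have "(CLINT \<omega>|M. g (S \<omega>)) = (CLINT \<omega>|M. (\<Sum>s\<le>card A. of_real (indicator {real s} (S \<omega>)) * g (real s)))"
      by (subst rep) simp
    also have "\<dots> = (\<Sum>s\<le>card A. (CLINT \<omega>|M. of_real (indicator {real s} (S \<omega>)) * g (real s)))"
      by (rule Bochner_Integration.integral_sum) (rule int)
    also have "\<dots> = (\<Sum>s\<le>card A. of_real (ev s) * g (real s))" by (simp add: ev_def)
    finally show ?thesis .
  qed
  have der: "(\<phi> has_vector_derivative \<phi>' t) (at t within T)" for t T
  proof -
    have eq: "\<phi> = (\<lambda>t. \<Sum>s\<le>card A. of_real (ev s) * cis (t * real s))"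
      unfolding \<phi>_def using Erep[of "\<lambda>x. cis (_ * x)"] by auto
    have eq': "\<phi>' t = (\<Sum>s\<le>card A. of_real (ev s) * (\<i> * of_real (real s) * cis (t * real s)))"
      unfolding \<phi>'_def using Erep[of "\<lambda>x. \<i> * of_real x * cis (t * x)"] by simp
    show ?thesis unfolding eq eq' cis_conv_exp
      by (intro has_vector_derivative_sum has_vector_derivative_mult_right)
         (auto intro!: derivative_eq_intros has_vector_derivative_real_field simp: mult_ac)
  qed
  have key: "cmod (\<phi>' t - \<i> * of_real lam * cis t * \<phi> t) \<le> \<bar>t\<bar> * b" for t
  proof -
    have ci: "integrable M (\<lambda>\<omega>. of_real (I a \<omega>) * cis (t * T \<omega>))" if "a \<in> A" "T \<in> borel_measurable M" for a T
      using Im[OF that(1)] that(2) I01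
      by (intro integrable_bounded[where C = 1]) (auto simp: norm_mult)
    \<comment> \<open>Three replacements: where \<open>I a = 1\<close>, the neighbours of
      \<open>a\<close> are dropped from \<open>S\<close> at the cost of the joint expectations; the
      remainder \<open>T\<close> is then independent of \<open>I a\<close>; finally the neighbours
      are put back at the cost of the products of expectations.\<close>
    have Ea: "cmod ((CLINT \<omega>|M. of_real (I a \<omega>) * cis (t * S \<omega>)) - of_real (expectation (I a)) * cis t * \<phi> t)
        \<le> \<bar>t\<bar> * ((\<Sum>c\<in>nb a - {a}. expectation (\<lambda>\<omega>. I a \<omega> * I c \<omega>)) +
              (\<Sum>c\<in>nb a. expectation (I a) * expectation (I c)))" if a: "a \<in> A" for a
    proof -
      define T where "T \<omega> = (\<Sum>c\<in>A - nb a. I c \<omega>)" for \<omega>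
      have Tm[measurable]: "T \<in> borel_measurable M" unfolding T_def by (rule sm) auto
      have ST: "S \<omega> - T \<omega> = (\<Sum>c\<in>nb a. I c \<omega>)" for \<omega>
        unfolding S_def T_def using sum.subset_diff[OF nb(2)[OF a] fin, of "\<lambda>c. I c \<omega>"] by simp
      have finb: "finite (nb a)" using fin nb(2)[OF a] finite_subset by blast
      have ST': "S \<omega> = T \<omega> + I a \<omega> + (\<Sum>c\<in>nb a - {a}. I c \<omega>)" for \<omega>
        using ST[of \<omega>] sum.remove[OF finb nb(1)[OF a], of "\<lambda>c. I c \<omega>"] by simp
      have iT: "integrable M (\<lambda>\<omega>. S \<omega> - T \<omega>)"
        unfolding ST using Ii nb(2)[OF a] by (intro Bochner_Integration.integrable_sum) auto
      have 1: "cmod ((CLINT \<omega>|M. of_real (I a \<omega>) * cis (t * S \<omega>)) - (CLINT \<omega>|M. of_real (I a \<omega>) * cis (t * (1 + T \<omega>))))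
        \<le> \<bar>t\<bar> * (\<Sum>c\<in>nb a - {a}. expectation (\<lambda>\<omega>. I a \<omega> * I c \<omega>))"
      proof -
        have "cmod ((CLINT \<omega>|M. of_real (I a \<omega>) * cis (t * S \<omega>)) - (CLINT \<omega>|M. of_real (I a \<omega>) * cis (t * (1 + T \<omega>))))
          = cmod (CLINT \<omega>|M. of_real (I a \<omega>) * cis (t * S \<omega>) - of_real (I a \<omega>) * cis (t * (1 + T \<omega>)))"
          using ci[OF a] by simp
        also have "\<dots> \<le> expectation (\<lambda>\<omega>. cmod (of_real (I a \<omega>) * cis (t * S \<omega>) - of_real (I a \<omega>) * cis (t * (1 + T \<omega>))))"
          by (rule integral_norm_bound)
        also have "\<dots> \<le> expectation (\<lambda>\<omega>. \<bar>t\<bar> * (\<Sum>c\<in>nb a - {a}. I a \<omega> * I c \<omega>))"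
        proof (intro integral_mono integrable_norm Bochner_Integration.integrable_diff ci a
            integrable_mult_right Bochner_Integration.integrable_sum IIi)
          fix \<omega>
          show "cmod (of_real (I a \<omega>) * cis (t * S \<omega>) - of_real (I a \<omega>) * cis (t * (1 + T \<omega>)))
            \<le> \<bar>t\<bar> * (\<Sum>c\<in>nb a - {a}. I a \<omega> * I c \<omega>)"
          proof (cases "I a \<omega> = 0")
            case False
            then have 1: "I a \<omega> = 1" using range by auto
            have "t * S \<omega> - t * (1 + T \<omega>) = t * (\<Sum>c\<in>nb a - {a}. I c \<omega>)"
              unfolding ST'[of \<omega>] 1 by (simp add: algebra_simps)
            moreover have "0 \<le> (\<Sum>c\<in>nb a - {a}. I c \<omega>)" by (intro sum_nonneg I01)
            ultimately show ?thesis using cmod_cis_diff_le[of "t * S \<omega>" "t * (1 + T \<omega>)"] 1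
              by (simp add: abs_mult)
          qed simp
        qed (use nb(2)[OF a] a Sm Tm in auto)
        also have "\<dots> = \<bar>t\<bar> * (\<Sum>c\<in>nb a - {a}. expectation (\<lambda>\<omega>. I a \<omega> * I c \<omega>))"
          using IIi a nb(2)[OF a] by (subst integral_mult_right_zero, subst Bochner_Integration.integral_sum) auto
        finally show ?thesis .
      qed
      have 2: "(CLINT \<omega>|M. of_real (I a \<omega>) * cis (t * (1 + T \<omega>))) = of_real (expectation (I a)) * cis t * (CLINT \<omega>|M. cis (t * T \<omega>))"
      proof -
        have iv: "indep_var borel ((\<lambda>x. complex_of_real x) \<circ> I a) borel ((\<lambda>x. cis (t * (1 + x))) \<circ> T)"
          using ind[OF a] unfolding T_def[symmetric]
          by (rule indep_var_compose) measurable
        have "(CLINT \<omega>|M. of_real (I a \<omega>) * cis (t * (1 + T \<omega>))) = (CLINT \<omega>|M. of_real (I a \<omega>)) * (CLINT \<omega>|M. cis (t * (1 + T \<omega>)))"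
          using Ii[OF a] abs_of_nonneg[OF I01(1)] I01(2)
          by (intro indep_var_lebesgue_integral[OF iv[unfolded comp_def]] integrable_of_real integrable_bounded[where C = 1]) auto
        also have "(CLINT \<omega>|M. cis (t * (1 + T \<omega>))) = cis t * (CLINT \<omega>|M. cis (t * T \<omega>))"
          by (simp add: distrib_left cis_mult[symmetric])
        finally show ?thesis by (simp add: mult.assoc)
      qed
      have 3: "cmod ((CLINT \<omega>|M. cis (t * T \<omega>)) - \<phi> t) \<le> \<bar>t\<bar> * (\<Sum>c\<in>nb a. expectation (I c))"
      proof -
        have "integrable M (\<lambda>\<omega>. t * T \<omega> - t * S \<omega>)"
          using integrable_mult_right[OF iT, of "-t"] by (simp add: algebra_simps)
        then have "cmod ((CLINT \<omega>|M. cis (t * T \<omega>)) - \<phi> t) \<le> expectation (\<lambda>\<omega>. \<bar>t * T \<omega> - t * S \<omega>\<bar>)"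
          unfolding \<phi>_def by (intro expectation_cis_close) auto
        also have "(\<lambda>\<omega>. \<bar>t * T \<omega> - t * S \<omega>\<bar>) = (\<lambda>\<omega>. \<bar>t\<bar> * (\<Sum>c\<in>nb a. I c \<omega>))"
        proof
          fix \<omega>
          have "0 \<le> (\<Sum>c\<in>nb a. I c \<omega>)" by (intro sum_nonneg I01)
          moreover have "t * T \<omega> - t * S \<omega> = - (t * (\<Sum>c\<in>nb a. I c \<omega>))"
            unfolding ST[symmetric] by (simp add: algebra_simps)
          ultimately show "\<bar>t * T \<omega> - t * S \<omega>\<bar> = \<bar>t\<bar> * (\<Sum>c\<in>nb a. I c \<omega>)" by (simp add: abs_mult)
        qed
        also have "expectation \<dots> = \<bar>t\<bar> * (\<Sum>c\<in>nb a. expectation (I c))"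
          using Ii nb(2)[OF a] by (subst integral_mult_right_zero, subst Bochner_Integration.integral_sum) auto
        finally show ?thesis .
      qed
      have "cmod (of_real (expectation (I a)) * cis t * (CLINT \<omega>|M. cis (t * T \<omega>)) - of_real (expectation (I a)) * cis t * \<phi> t)
        = expectation (I a) * cmod ((CLINT \<omega>|M. cis (t * T \<omega>)) - \<phi> t)"
        using p0[of a] by (simp add: right_diff_distrib[symmetric] norm_mult)
      also have "\<dots> \<le> expectation (I a) * (\<bar>t\<bar> * (\<Sum>c\<in>nb a. expectation (I c)))"
        by (intro mult_left_mono 3 p0)
      also have "\<dots> = \<bar>t\<bar> * (\<Sum>c\<in>nb a. expectation (I a) * expectation (I c))"
        by (simp add: sum_distrib_left mult_ac)
      finally have 4: "cmod (of_real (expectation (I a)) * cis t * (CLINT \<omega>|M. cis (t * T \<omega>)) - of_real (expectation (I a)) * cis t * \<phi> t)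
         \<le> \<bar>t\<bar> * (\<Sum>c\<in>nb a. expectation (I a) * expectation (I c))" .
      show ?thesis
        using norm_triangle_le[OF add_mono[OF 1[unfolded 2] 4]] by (simp add: distrib_left)
    qed
    have "\<phi>' t = \<i> * (\<Sum>a\<in>A. (CLINT \<omega>|M. of_real (I a \<omega>) * cis (t * S \<omega>)))"
    proof -
      have "\<phi>' t = (CLINT \<omega>|M. \<i> * (\<Sum>a\<in>A. of_real (I a \<omega>) * cis (t * S \<omega>)))"
        unfolding \<phi>'_def by (simp add: S_def sum_distrib_right mult.assoc)
      then show ?thesis using ci by (simp add: Bochner_Integration.integral_sum)
    qed
    moreover have "\<i> * of_real lam * cis t * \<phi> t = \<i> * (\<Sum>a\<in>A. of_real (expectation (I a)) * cis t * \<phi> t)"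
      by (simp add: lam_def sum_distrib_right mult.assoc)
    ultimately have "cmod (\<phi>' t - \<i> * of_real lam * cis t * \<phi> t) =
       cmod (\<Sum>a\<in>A. (CLINT \<omega>|M. of_real (I a \<omega>) * cis (t * S \<omega>)) - of_real (expectation (I a)) * cis t * \<phi> t)"
      by (simp only: right_diff_distrib[symmetric] norm_mult sum_subtractf) simp
    also have "\<dots> \<le> (\<Sum>a\<in>A. \<bar>t\<bar> * ((\<Sum>c\<in>nb a - {a}. expectation (\<lambda>\<omega>. I a \<omega> * I c \<omega>)) +
              (\<Sum>c\<in>nb a. expectation (I a) * expectation (I c))))"
      by (intro sum_norm_le Ea)
    also have "\<dots> = \<bar>t\<bar> * b" unfolding b_def by (simp add: sum_distrib_left sum.distrib distrib_left)
    finally show ?thesis .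
  qed
  \<comment> \<open>The integrating factor of the exact equation: without the error term the product
    \<psi> would be constant. The function \<open>g\<close> runs along the segment from 0 to
    \<open>t\<close>, which treats both signs of \<open>t\<close> at once.\<close>
  define E where "E s = exp (- of_real lam * (cis s - 1))" for s
  define \<psi> where "\<psi> s = \<phi> s * E s" for s
  define g where "g u = \<psi> (u * t)" for u
  have dE: "(E has_vector_derivative (- of_real lam * (\<i> * cis s) * E s)) (at s within T)" for s T
    unfolding E_def cis_conv_exp
    by (rule has_vector_derivative_real_field) (auto intro!: derivative_eq_intros)
  have d\<psi>: "(\<psi> has_vector_derivative ((\<phi>' s - \<i> * of_real lam * cis s * \<phi> s) * E s)) (at s within T)" for s T
    unfolding \<psi>_def by (rule has_vector_derivative_eq_rhs[OF has_vector_derivative_mult[OF der dE]])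
      (simp add: algebra_simps)
  have dg: "(g has_vector_derivative (t *\<^sub>R ((\<phi>' (u * t) - \<i> * of_real lam * cis (u * t) * \<phi> (u * t)) * E (u * t)))) (at u)" for u
  proof -
    have "((\<lambda>u. u * t) has_vector_derivative t) (at u)" by (auto intro!: derivative_eq_intros)
    from vector_diff_chain_at[OF this d\<psi>] show ?thesis unfolding g_def comp_def .
  qed
  \<comment> \<open>A bound quadratic in \<open>s\<close> is essential: in the normal regime
    \<open>s\<close> is of order \<open>lam\<close> to the power -1/2, and then
    \<open>lam * s\<^sup>2\<close> stays bounded.\<close>
  have nE: "cmod (E s) \<le> exp (lam * s\<^sup>2 / 2)" for s
  proof -
    have "cmod (E s) = exp (lam * (1 - cos s))" unfolding E_def by (simp add: algebra_simps)
    also have "\<dots> \<le> exp (lam * (s\<^sup>2 / 2))" using mult_left_mono[OF one_minus_cos_le lam0] by simp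
    finally show ?thesis by simp
  qed
  obtain u where u: "u \<in> {0<..<1}" "norm (g 1 - g 0) \<le> norm ((1 - 0) *\<^sub>R (t *\<^sub>R ((\<phi>' (u * t) - \<i> * of_real lam * cis (u * t) * \<phi> (u * t)) * E (u * t))))"
    using mvt_general[of 0 1 g "\<lambda>u x. x *\<^sub>R (t *\<^sub>R ((\<phi>' (u * t) - \<i> * of_real lam * cis (u * t) * \<phi> (u * t)) * E (u * t)))"] dg
    by (force simp: has_vector_derivative_def intro!: continuous_at_imp_continuous_on has_vector_derivative_continuous[OF dg])
  have "\<phi> 0 = 1" by (simp add: \<phi>_def prob_space)
  then have "g 0 = 1" by (simp add: g_def \<psi>_def E_def)
  moreover have "g 1 = \<phi> t * E t" by (simp add: g_def \<psi>_def)
  ultimately have "cmod (\<phi> t * E t - 1) \<le> \<bar>t\<bar> * (cmod (\<phi>' (u * t) - \<i> * of_real lam * cis (u * t) * \<phi> (u * t)) * cmod (E (u * t)))"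
    using u(2) by (simp add: norm_mult)
  also have "\<dots> \<le> \<bar>t\<bar> * ((\<bar>t\<bar> * b) * exp (lam * t\<^sup>2 / 2))"
  proof (intro mult_left_mono mult_mono)
    have u1: "\<bar>u * t\<bar> \<le> \<bar>t\<bar>" using u(1) by (simp add: abs_mult mult_left_le_one_le)
    show "cmod (\<phi>' (u * t) - \<i> * of_real lam * cis (u * t) * \<phi> (u * t)) \<le> \<bar>t\<bar> * b"
      using key[of "u * t"] mult_right_mono[OF u1 b0] by linarith
    have "(u * t)\<^sup>2 \<le> t\<^sup>2" using u1 by (simp add: abs_le_square_iff)
    then have "exp (lam * (u * t)\<^sup>2 / 2) \<le> exp (lam * t\<^sup>2 / 2)" using lam0 by (simp add: mult_left_mono)
    then show "cmod (E (u * t)) \<le> exp (lam * t\<^sup>2 / 2)" using nE[of "u * t"] by linarith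
  qed (use b0 in auto)
  finally have fin: "cmod (\<phi> t * E t - 1) \<le> t\<^sup>2 * b * exp (lam * t\<^sup>2 / 2)"
    by (simp add: power2_eq_square mult_ac)
  \<comment> \<open>Undoing the integrating factor costs nothing, since exp (lam * (cis t - 1)) has
    modulus at most 1.\<close>
  have "E t * exp (of_real lam * (cis t - 1)) = 1"
    unfolding E_def by (simp add: exp_add[symmetric])
  then have "\<phi> t - exp (of_real lam * (cis t - 1)) = (\<phi> t * E t - 1) * exp (of_real lam * (cis t - 1))"
    by (simp add: left_diff_distrib mult.assoc)
  then have "cmod (\<phi> t - exp (of_real lam * (cis t - 1))) = cmod (\<phi> t * E t - 1) * exp (lam * (cos t - 1))"
    by (simp add: norm_mult)
  also have "\<dots> \<le> cmod (\<phi> t * E t - 1) * 1"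
    using lam0 by (intro mult_left_mono) (auto intro!: mult_nonneg_nonpos)
  finally show ?thesis using fin unfolding \<phi>_def by simp
qed

end


section \<open>Moments of the Poisson distribution\<close>

text \<open>The size-bias identity: m times the weight of m equals the rate times the weight of m -
  1. All moments below are generated by it.\<close>

lemma nn_integral_poisson_Suc:
  fixes g :: "nat \<Rightarrow> ennreal"
  assumes r: "0 < rate"
  shows "(\<integral>\<^sup>+m. of_nat m * g m \<partial>measure_pmf (poisson_pmf rate)) =
    ennreal rate * (\<integral>\<^sup>+m. g (Suc m) \<partial>measure_pmf (poisson_pmf rate))"
proof -
  have "(\<integral>\<^sup>+m. of_nat m * g m \<partial>measure_pmf (poisson_pmf rate)) =
    (\<Sum>m. ennreal (pmf (poisson_pmf rate) m) * (of_nat m * g m))"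
    by (simp add: nn_integral_measure_pmf nn_integral_count_space_nat)
  also have "\<dots> = (\<Sum>m. ennreal (pmf (poisson_pmf rate) (Suc m)) * (of_nat (Suc m) * g (Suc m)))"
    by (subst suminf_offset[of _ 1]) (simp_all add: summableI)
  also have "\<dots> = (\<Sum>m. ennreal rate * (ennreal (pmf (poisson_pmf rate) m) * g (Suc m)))"
  proof (intro suminf_cong)
    fix m
    have "pmf (poisson_pmf rate) (Suc m) * real (Suc m) = rate * pmf (poisson_pmf rate) m"
      using r by (simp add: divide_simps)
    then have "ennreal (pmf (poisson_pmf rate) (Suc m)) * of_nat (Suc m) = ennreal rate * ennreal (pmf (poisson_pmf rate) m)"
      using r by (simp only: ennreal_of_nat_eq_real_of_nat ennreal_mult[symmetric] of_nat_0_le_iff pmf_nonneg less_imp_le)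
    then show "ennreal (pmf (poisson_pmf rate) (Suc m)) * (of_nat (Suc m) * g (Suc m)) =
      ennreal rate * (ennreal (pmf (poisson_pmf rate) m) * g (Suc m))"
      by (simp only: mult.assoc[symmetric])
  qed
  also have "\<dots> = ennreal rate * (\<integral>\<^sup>+m. g (Suc m) \<partial>measure_pmf (poisson_pmf rate))"
    by (simp add: nn_integral_measure_pmf nn_integral_count_space_nat ennreal_suminf_cmult)
  finally show ?thesis .
qed

lemma poisson_moment_step:
  assumes "0 < rate"
  shows "(\<integral>\<^sup>+m. ennreal (real m ^ Suc l) \<partial>measure_pmf (poisson_pmf rate)) =
    ennreal rate * (\<integral>\<^sup>+m. ennreal (real (Suc m) ^ l) \<partial>measure_pmf (poisson_pmf rate))"
  using nn_integral_poisson_Suc[OF assms, of "\<lambda>m. ennreal (real m ^ l)"]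
  by (simp add: ennreal_of_nat_eq_real_of_nat ennreal_mult[symmetric])

lemma add_power_le:
  fixes a b :: real
  assumes "0 \<le> a" "0 \<le> b"
  shows "(a + b) ^ l \<le> 2 ^ l * (a ^ l + b ^ l)"
proof -
  have "(a + b) ^ l \<le> (2 * max a b) ^ l" using assms by (intro power_mono) auto
  also have "\<dots> = 2 ^ l * max a b ^ l" by (simp add: power_mult_distrib)
  also have "max a b ^ l \<le> a ^ l + b ^ l" using assms by (auto simp: max_def)
  finally show ?thesis by simp
qed

text \<open>The size-bias identity lowers the degree by one. For rates of at least 1 the lower
  powers that appear are absorbed by the top power.\<close>

lemma poisson_moment_bound:
  "\<exists>C\<ge>0. \<forall>rate\<ge>1. (\<integral>\<^sup>+m. ennreal (real m ^ l) \<partial>measure_pmf (poisson_pmf rate)) \<le> ennreal (C * rate ^ l)"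
proof (induction l)
  case 0
  then show ?case by (intro exI[of _ 1]) (simp add: measure_pmf.emeasure_space_1[simplified])
next
  case (Suc l)
  then obtain C where C: "0 \<le> C" "\<And>rate. 1 \<le> rate \<Longrightarrow>
    (\<integral>\<^sup>+m. ennreal (real m ^ l) \<partial>measure_pmf (poisson_pmf rate)) \<le> ennreal (C * rate ^ l)" by blast
  show ?case
  proof (intro exI[of _ "2 ^ l * (C + 1)"] conjI allI impI)
    fix rate :: real assume r: "1 \<le> rate"
    have "(\<integral>\<^sup>+m. ennreal (real (Suc m) ^ l) \<partial>measure_pmf (poisson_pmf rate)) \<le>
      (\<integral>\<^sup>+m. ennreal (2 ^ l) * (ennreal (real m ^ l) + 1) \<partial>measure_pmf (poisson_pmf rate))"
    proof (intro nn_integral_mono)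
      fix m
      have "ennreal (real (Suc m) ^ l) \<le> ennreal (2 ^ l * (real m ^ l + 1))"
        using add_power_le[of "real m" 1 l] by (intro ennreal_leI) (simp add: add.commute)
      also have "\<dots> = ennreal (2 ^ l) * (ennreal (real m ^ l) + 1)"
        by (simp add: ennreal_mult ennreal_plus flip: ennreal_1)
      finally show "ennreal (real (Suc m) ^ l) \<le> ennreal (2 ^ l) * (ennreal (real m ^ l) + 1)" .
    qed
    also have "\<dots> = ennreal (2 ^ l) * ((\<integral>\<^sup>+m. ennreal (real m ^ l) \<partial>measure_pmf (poisson_pmf rate)) + 1)"
      by (simp add: nn_integral_cmult nn_integral_add measure_pmf.emeasure_space_1[simplified])
    also have "\<dots> \<le> ennreal (2 ^ l) * (ennreal (C * rate ^ l) + ennreal (rate ^ l))"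
    proof (intro mult_left_mono add_mono C(2) r)
      show "1 \<le> ennreal (rate ^ l)" using r by (simp add: one_le_power)
    qed simp
    also have "\<dots> = ennreal (2 ^ l * (C + 1) * rate ^ l)"
      using r C(1) by (simp add: ennreal_mult[symmetric] ennreal_plus[symmetric] algebra_simps del: ennreal_plus)
    finally have "ennreal rate * (\<integral>\<^sup>+m. ennreal (real (Suc m) ^ l) \<partial>measure_pmf (poisson_pmf rate)) \<le>
      ennreal rate * ennreal (2 ^ l * (C + 1) * rate ^ l)" by (rule mult_left_mono) simp
    also have "\<dots> = ennreal (2 ^ l * (C + 1) * rate ^ Suc l)"
      using r C(1) by (subst ennreal_mult[symmetric]) (auto simp: mult_ac)
    finally show "(\<integral>\<^sup>+m. ennreal (real m ^ Suc l) \<partial>measure_pmf (poisson_pmf rate)) \<le> ennreal (2 ^ l * (C + 1) * rate ^ Suc l)"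
      using poisson_moment_step[of rate l] r by simp
  qed (use C(1) in simp)
qed

lemma poisson_variance:
  assumes "0 < rate"
  shows "(\<integral>\<^sup>+m. ennreal ((real m - rate)\<^sup>2) \<partial>measure_pmf (poisson_pmf rate)) = ennreal rate"
proof -
  let ?P = "measure_pmf (poisson_pmf rate)"
  have m1: "(\<integral>\<^sup>+m. ennreal (real m) \<partial>?P) = ennreal rate"
    using poisson_moment_step[OF assms, of 0] by (simp add: measure_pmf.emeasure_space_1[simplified])
  have m2: "(\<integral>\<^sup>+m. ennreal (real m ^ 2) \<partial>?P) = ennreal (rate * (rate + 1))"
  proof -
    have "(\<integral>\<^sup>+m. ennreal (real (Suc m)) \<partial>?P) = (\<integral>\<^sup>+m. ennreal (real m) + 1 \<partial>?P)"
      by (intro nn_integral_cong) (simp add: ennreal_plus flip: ennreal_1)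
    also have "\<dots> = ennreal (rate + 1)"
      using m1 assms by (simp add: nn_integral_add measure_pmf.emeasure_space_1[simplified])
    finally have "(\<integral>\<^sup>+m. ennreal (real m ^ Suc 1) \<partial>?P) = ennreal rate * ennreal (rate + 1)"
      using poisson_moment_step[OF assms, of 1] by (simp only: power_one_right)
    also have "\<dots> = ennreal (rate * (rate + 1))"
      using assms by (intro ennreal_mult[symmetric]) auto
    finally show ?thesis by (simp only: Suc_1)
  qed
  \<comment> \<open>The cross term is added on both sides and cancelled at the end, because
    subtraction in \<open>ennreal\<close> is truncated.\<close>
  have "(\<integral>\<^sup>+m. ennreal ((real m - rate)\<^sup>2) \<partial>?P) + ennreal (2 * rate) * ennreal rate =
    (\<integral>\<^sup>+m. ennreal ((real m - rate)\<^sup>2) + ennreal (2 * rate) * ennreal (real m) \<partial>?P)"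
    by (simp add: nn_integral_add nn_integral_cmult m1)
  also have "\<dots> = (\<integral>\<^sup>+m. ennreal (real m ^ 2) + ennreal (rate\<^sup>2) \<partial>?P)"
  proof (intro nn_integral_cong)
    fix m
    have "ennreal ((real m - rate)\<^sup>2) + ennreal (2 * rate) * ennreal (real m) = ennreal ((real m - rate)\<^sup>2 + 2 * rate * real m)"
      using assms by (simp add: ennreal_mult[symmetric] ennreal_plus[symmetric] del: ennreal_plus)
    also have "(real m - rate)\<^sup>2 + 2 * rate * real m = real m ^ 2 + rate\<^sup>2" by (simp add: power2_eq_square algebra_simps)
    finally show "ennreal ((real m - rate)\<^sup>2) + ennreal (2 * rate) * ennreal (real m) = ennreal (real m ^ 2) + ennreal (rate\<^sup>2)"
      by (simp add: ennreal_plus)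
  qed
  also have "\<dots> = ennreal (rate * (rate + 1) + rate\<^sup>2)"
    using assms by (subst nn_integral_add) (simp_all add: m2 measure_pmf.emeasure_space_1[simplified])
  also have "\<dots> = ennreal rate + ennreal (2 * rate) * ennreal rate"
  proof -
    have "rate * (rate + 1) + rate\<^sup>2 = rate + 2 * rate * rate" by (simp add: power2_eq_square algebra_simps)
    then show ?thesis using assms by (simp add: ennreal_mult[symmetric])
  qed
  finally show ?thesis
    using ennreal_add_left_cancel[of "ennreal (2 * rate) * ennreal rate"]
    by (simp add: add.commute ennreal_mult_eq_top_iff)
qed


section \<open>Independent samples: decoupling, clusters of points, negative correlation\<close>

locale iid_sample = prob_space M for M :: "'w measure" +
  fixes X :: "nat \<Rightarrow> 'w \<Rightarrow> 'a::euclidean_space" and f :: "'a \<Rightarrow> real" and B :: real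
  assumes indep: "indep_vars (\<lambda>_. borel) X UNIV"
    and distX: "\<And>i. distributed M lborel (X i) (\<lambda>x. ennreal (f x))"
    and f_meas: "f \<in> borel_measurable borel" and f_nonneg: "\<And>x. 0 \<le> f x" and f_le: "\<And>x. f x \<le> B"
begin

abbreviation "Xs \<equiv> (\<lambda>\<omega> i. X i \<omega>)"

lemma X_meas [measurable]: "X i \<in> borel_measurable M"
  using indep by (auto simp: indep_vars_def)

lemma Xs_meas [measurable]: "Xs \<in> M \<rightarrow>\<^sub>M PiM UNIV (\<lambda>_. borel)"
  by (intro measurable_PiM_single') (auto simp: PiE_def)

lemma restrict_Xs_meas: "(\<lambda>\<omega>. restrict (Xs \<omega>) J) \<in> M \<rightarrow>\<^sub>M PiM J (\<lambda>_. borel)"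
  by (intro measurable_restrict) simp

text \<open>Functions of disjoint blocks of coordinates may be integrated as if the
  second block came from an independent copy of the sample.\<close>

lemma decouple:
  fixes G :: "(nat \<Rightarrow> 'a) \<Rightarrow> (nat \<Rightarrow> 'a) \<Rightarrow> ennreal"
  assumes JK: "J \<inter> K = {}"
    and Gm: "(\<lambda>(x, y). G x y) \<in> borel_measurable (PiM UNIV (\<lambda>_. borel) \<Otimes>\<^sub>M PiM UNIV (\<lambda>_. borel))"
    and dep: "\<And>x y. G x y = G (\<lambda>i. if i \<in> J then x i else 0) (\<lambda>i. if i \<in> K then y i else 0)"
  shows "(\<integral>\<^sup>+\<omega>. G (Xs \<omega>) (Xs \<omega>) \<partial>M) = (\<integral>\<^sup>+\<omega>. \<integral>\<^sup>+\<omega>'. G (Xs \<omega>) (Xs \<omega>') \<partial>M \<partial>M)"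
proof -
  define ext where "ext L x i = (if i \<in> L then x i else (0::'a))" for L :: "nat set" and x i
  have ext[measurable]: "ext L \<in> PiM L (\<lambda>_. borel) \<rightarrow>\<^sub>M PiM UNIV (\<lambda>_. borel)" for L
  proof (intro measurable_PiM_single')
    fix i :: nat assume "i \<in> UNIV"
    show "(\<lambda>x. ext L x i) \<in> PiM L (\<lambda>_. borel) \<rightarrow>\<^sub>M borel"
      unfolding ext_def by (cases "i \<in> L") auto
  qed (auto simp: PiE_def)
  have er: "ext L (restrict x L) = (\<lambda>i. if i \<in> L then x i else 0)" for L x
    by (auto simp: ext_def fun_eq_iff)
  let ?G = "\<lambda>(x, y). G (ext J x) (ext K y)"
  let ?J = "\<lambda>\<omega>. restrict (Xs \<omega>) J" and ?K = "\<lambda>\<omega>. restrict (Xs \<omega>) K"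
  have Gm'[measurable]: "?G \<in> borel_measurable (PiM J (\<lambda>_. borel) \<Otimes>\<^sub>M PiM K (\<lambda>_. borel))"
  proof -
    have "(\<lambda>z. (ext J (fst z), ext K (snd z))) \<in> PiM J (\<lambda>_. borel) \<Otimes>\<^sub>M PiM K (\<lambda>_. borel) \<rightarrow>\<^sub>M
      PiM UNIV (\<lambda>_. borel) \<Otimes>\<^sub>M PiM UNIV (\<lambda>_. borel)" by measurable
    from measurable_compose[OF this Gm] show ?thesis by (simp add: case_prod_beta')
  qed
  have Jm: "?J \<in> M \<rightarrow>\<^sub>M PiM J (\<lambda>_. borel)" and Km: "?K \<in> M \<rightarrow>\<^sub>M PiM K (\<lambda>_. borel)"
    by (rule restrict_Xs_meas)+
  note [measurable] = Jm Km
  have "indep_var (PiM J (\<lambda>_. borel)) ?J (PiM K (\<lambda>_. borel)) ?K"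
    using indep_var_restrict[OF indep JK] by simp
  then have eq: "distr M (PiM J (\<lambda>_. borel) \<Otimes>\<^sub>M PiM K (\<lambda>_. borel)) (\<lambda>\<omega>. (?J \<omega>, ?K \<omega>)) =
    distr M (PiM J (\<lambda>_. borel)) ?J \<Otimes>\<^sub>M distr M (PiM K (\<lambda>_. borel)) ?K"
    by (simp add: indep_var_distribution_eq)
  interpret PJ: prob_space "distr M (PiM J (\<lambda>_. borel)) ?J" by (rule prob_space_distr) (rule Jm)
  interpret PK: prob_space "distr M (PiM K (\<lambda>_. borel)) ?K" by (rule prob_space_distr) (rule Km)
  have "(\<integral>\<^sup>+\<omega>. G (Xs \<omega>) (Xs \<omega>) \<partial>M) = (\<integral>\<^sup>+\<omega>. ?G (?J \<omega>, ?K \<omega>) \<partial>M)"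
    using dep by (simp add: er)
  also have "\<dots> = (\<integral>\<^sup>+z. ?G z \<partial>distr M (PiM J (\<lambda>_. borel) \<Otimes>\<^sub>M PiM K (\<lambda>_. borel)) (\<lambda>\<omega>. (?J \<omega>, ?K \<omega>)))"
    by (subst nn_integral_distr) measurable
  also have "\<dots> = (\<integral>\<^sup>+x. \<integral>\<^sup>+y. ?G (x, y) \<partial>distr M (PiM K (\<lambda>_. borel)) ?K \<partial>distr M (PiM J (\<lambda>_. borel)) ?J)"
    unfolding eq by (subst PK.nn_integral_fst[symmetric]) (simp_all add: Gm' cong: measurable_cong_sets)
  also have "\<dots> = (\<integral>\<^sup>+x. \<integral>\<^sup>+\<omega>'. ?G (x, ?K \<omega>') \<partial>M \<partial>distr M (PiM J (\<lambda>_. borel)) ?J)"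
    by (intro nn_integral_cong nn_integral_distr) (auto intro!: Km measurable_compose[OF _ Gm'] measurable_Pair1')
  also have "\<dots> = (\<integral>\<^sup>+\<omega>. \<integral>\<^sup>+\<omega>'. ?G (?J \<omega>, ?K \<omega>') \<partial>M \<partial>M)"
    by (rule nn_integral_distr) measurable
  also have "\<dots> = (\<integral>\<^sup>+\<omega>. \<integral>\<^sup>+\<omega>'. G (Xs \<omega>) (Xs \<omega>') \<partial>M \<partial>M)"
    using dep by (simp add: er)
  finally show ?thesis .
qed

text \<open>Density bound times volume of the unit ball, so that \<open>q * s ^ DIM('a)\<close>
  bounds the probability of every ball of radius \<open>s\<close>.\<close>

definition q where "q = B * unit_ball_vol (real DIM('a))"

lemma B_nonneg: "0 \<le> B" using f_nonneg[of 0] f_le[of 0] by linarith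

lemma q_nonneg: "0 \<le> q" unfolding q_def using B_nonneg by simp

lemma emeasure_X_in: "A \<in> sets borel \<Longrightarrow> emeasure M {\<omega>\<in>space M. X i \<omega> \<in> A} = (\<integral>\<^sup>+x. ennreal (f x) * indicator A x \<partial>lborel)"
  using distributed_emeasure[OF distX, of A i] by (simp add: vimage_def Int_def conj_commute)

lemma prob_X_in: "A \<in> sets borel \<Longrightarrow> prob {\<omega>\<in>space M. X i \<omega> \<in> A} = prob {\<omega>\<in>space M. X j \<omega> \<in> A}"
  by (simp add: measure_def emeasure_X_in)

lemma emeasure_X_cball:
  assumes "0 \<le> s"
  shows "emeasure M {\<omega>\<in>space M. dist (X i \<omega>) a \<le> s} \<le> ennreal (q * s ^ DIM('a))"
proof -
  have "{\<omega>\<in>space M. dist (X i \<omega>) a \<le> s} = {\<omega>\<in>space M. X i \<omega> \<in> cball a s}" by (auto simp: dist_commute)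
  then have "emeasure M {\<omega>\<in>space M. dist (X i \<omega>) a \<le> s} = (\<integral>\<^sup>+x. ennreal (f x) * indicator (cball a s) x \<partial>lborel)"
    by (simp only: emeasure_X_in[OF borel_closed[OF closed_cball]])
  also have "\<dots> \<le> (\<integral>\<^sup>+x. ennreal B * indicator (cball a s) x \<partial>lborel)"
    by (intro nn_integral_mono mult_right_mono ennreal_leI f_le) simp
  also have "\<dots> = ennreal B * emeasure lborel (cball a s)" by (rule nn_integral_cmult_indicator) simp
  also have "\<dots> = ennreal (q * s ^ DIM('a))"
    using assms B_nonneg by (simp add: emeasure_cball q_def ennreal_mult[symmetric] mult.assoc)
  finally show ?thesis .
qed

text \<open>Induction on \<open>J\<close>: given the reference point \<open>X i0\<close> and the
  earlier points, a further point is independent of them and lies in the ball around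
  \<open>X i0\<close> with probability at most \<open>q * s ^ DIM('a)\<close>.\<close>

lemma emeasure_cluster:
  assumes "finite J" "i0 \<notin> J" "0 \<le> s"
  shows "emeasure M {\<omega>\<in>space M. \<forall>j\<in>J. dist (X j \<omega>) (X i0 \<omega>) \<le> s} \<le> ennreal ((q * s ^ DIM('a)) ^ card J)"
  using assms(1,2)
proof (induction J)
  case empty then show ?case by (simp add: emeasure_space_1)
next
  case (insert j J)
  define G where "G x y = (indicator {x. \<forall>j\<in>J. dist (x j) (x i0) \<le> s} x * indicator {z. dist z (x i0) \<le> s} (y j) :: ennreal)"
    for x y :: "nat \<Rightarrow> 'a"
  have [measurable]: "Measurable.pred (PiM UNIV (\<lambda>_. borel :: 'a measure)) (\<lambda>x. \<forall>j\<in>J. dist (x j) (x i0) \<le> s)"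
    using insert(1) by measurable
  have q0: "0 \<le> q * s ^ DIM('a)" using q_nonneg assms(3) by simp
  have "emeasure M {\<omega>\<in>space M. \<forall>j\<in>insert j J. dist (X j \<omega>) (X i0 \<omega>) \<le> s} =
    (\<integral>\<^sup>+\<omega>. indicator {\<omega>\<in>space M. \<forall>j\<in>insert j J. dist (X j \<omega>) (X i0 \<omega>) \<le> s} \<omega> \<partial>M)"
    using insert(1) by (intro nn_integral_indicator[symmetric]) measurable
  also have "\<dots> = (\<integral>\<^sup>+\<omega>. G (Xs \<omega>) (Xs \<omega>) \<partial>M)"
    by (intro nn_integral_cong) (auto simp: G_def indicator_def)
  also have "\<dots> = (\<integral>\<^sup>+\<omega>. \<integral>\<^sup>+\<omega>'. G (Xs \<omega>) (Xs \<omega>') \<partial>M \<partial>M)"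
  proof (rule decouple[of "insert i0 J" "{j}"])
    show "insert i0 J \<inter> {j} = {}" using insert by auto
    show "(\<lambda>(x, y). G x y) \<in> borel_measurable (PiM UNIV (\<lambda>_. borel) \<Otimes>\<^sub>M PiM UNIV (\<lambda>_. borel))"
      unfolding G_def using insert(1) by measurable
    show "G x y = G (\<lambda>i. if i \<in> insert i0 J then x i else 0) (\<lambda>i. if i \<in> {j} then y i else 0)" for x y
      by (simp add: G_def indicator_def)
  qed
  also have "\<dots> \<le> (\<integral>\<^sup>+\<omega>. ennreal (q * s ^ DIM('a)) * indicator {\<omega>\<in>space M. \<forall>j\<in>J. dist (X j \<omega>) (X i0 \<omega>) \<le> s} \<omega> \<partial>M)"
  proof (intro nn_integral_mono)
    fix \<omega> assume w: "\<omega> \<in> space M"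
    have "(\<integral>\<^sup>+\<omega>'. G (Xs \<omega>) (Xs \<omega>') \<partial>M) =
       indicator {\<omega>\<in>space M. \<forall>j\<in>J. dist (X j \<omega>) (X i0 \<omega>) \<le> s} \<omega> *
       (\<integral>\<^sup>+\<omega>'. indicator {\<omega>'\<in>space M. dist (X j \<omega>') (X i0 \<omega>) \<le> s} \<omega>' \<partial>M)"
      unfolding G_def using w
      by (subst nn_integral_cmult[symmetric]) (auto intro!: nn_integral_cong simp: indicator_def)
    also have "\<dots> \<le> indicator {\<omega>\<in>space M. \<forall>j\<in>J. dist (X j \<omega>) (X i0 \<omega>) \<le> s} \<omega> * ennreal (q * s ^ DIM('a))"
      using emeasure_X_cball[OF assms(3), of j "X i0 \<omega>"] by (intro mult_left_mono) simp_all
    finally show "(\<integral>\<^sup>+\<omega>'. G (Xs \<omega>) (Xs \<omega>') \<partial>M) \<le>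
       ennreal (q * s ^ DIM('a)) * indicator {\<omega>\<in>space M. \<forall>j\<in>J. dist (X j \<omega>) (X i0 \<omega>) \<le> s} \<omega>"
      by (simp only: mult.commute)
  qed
  also have "\<dots> = ennreal (q * s ^ DIM('a)) * emeasure M {\<omega>\<in>space M. \<forall>j\<in>J. dist (X j \<omega>) (X i0 \<omega>) \<le> s}"
    using insert(1) by (subst nn_integral_cmult_indicator) measurable
  also have "\<dots> \<le> ennreal (q * s ^ DIM('a)) * ennreal ((q * s ^ DIM('a)) ^ card J)"
    using insert by (intro mult_left_mono) auto
  also have "\<dots> = ennreal ((q * s ^ DIM('a)) ^ card (insert j J))"
    using insert q0 by (simp add: ennreal_mult[symmetric])
  finally show ?case .
qed

text \<open>One point serves as reference and contributes no factor, whence the exponent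
  \<open>card J - 1\<close>. The bounds below for simplices, overlaps, hits and coincidences are all
  instances.\<close>

lemma prob_cluster:
  assumes "finite J" "i0 \<in> J" "0 \<le> s"
    and sub: "\<And>\<omega>. \<omega> \<in> space M \<Longrightarrow> P \<omega> \<Longrightarrow> \<forall>i\<in>J. \<forall>j\<in>J. dist (X i \<omega>) (X j \<omega>) \<le> s"
  shows "prob {\<omega>\<in>space M. P \<omega>} \<le> (q * s ^ DIM('a)) ^ (card J - 1)"
proof -
  have q0: "0 \<le> q * s ^ DIM('a)" using q_nonneg assms(3) by simp
  have "prob {\<omega>\<in>space M. P \<omega>} \<le> prob {\<omega>\<in>space M. \<forall>j\<in>J - {i0}. dist (X j \<omega>) (X i0 \<omega>) \<le> s}"
    using assms(1,2) sub by (intro finite_measure_mono) auto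
  also have "\<dots> \<le> (q * s ^ DIM('a)) ^ (card J - 1)"
    using emeasure_cluster[of "J - {i0}" i0 s] assms q0
    by (simp add: emeasure_eq_measure)
  finally show ?thesis .
qed

lemma prob_none_in:
  assumes "finite J" "A \<in> sets borel"
  shows "prob {\<omega>\<in>space M. \<forall>j\<in>J. X j \<omega> \<notin> A} = (1 - prob {\<omega>\<in>space M. X 0 \<omega> \<in> A}) ^ card J"
proof (cases "J = {}")
  case False
  have "{\<omega>\<in>space M. \<forall>j\<in>J. X j \<omega> \<notin> A} = (\<Inter>j\<in>J. X j -` (- A) \<inter> space M)" using False by auto
  also have "prob \<dots> = (\<Prod>j\<in>J. prob (X j -` (- A) \<inter> space M))"
    using assms False by (intro indep_varsD[OF indep]) auto
  also have "\<dots> = (\<Prod>j\<in>J. 1 - prob {\<omega>\<in>space M. X 0 \<omega> \<in> A})"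
  proof (intro prod.cong refl)
    fix j
    have "X j -` (- A) \<inter> space M = space M - {\<omega>\<in>space M. X j \<omega> \<in> A}" by auto
    moreover have "{\<omega>\<in>space M. X j \<omega> \<in> A} \<in> events" using assms(2) by measurable
    ultimately show "prob (X j -` (- A) \<inter> space M) = 1 - prob {\<omega>\<in>space M. X 0 \<omega> \<in> A}"
      using prob_X_in[OF assms(2), of j 0] by (simp add: prob_compl)
  qed
  finally show ?thesis by simp
qed (simp add: prob_space)

text \<open>The points compete for the two disjoint sets: if these have probabilities p and p', all
  m points avoid both with probability (1 - p - p')^m, which is at most ((1 - p)(1 - p'))^m.
  Inclusion-exclusion turns this into negative correlation of the two hitting events.\<close>

lemma prob_hit_both_le:
  assumes J: "finite J" and A: "A \<in> sets borel" "A' \<in> sets borel" "A \<inter> A' = {}"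
  shows "prob {\<omega>\<in>space M. (\<exists>j\<in>J. X j \<omega> \<in> A) \<and> (\<exists>j\<in>J. X j \<omega> \<in> A')} \<le>
    prob {\<omega>\<in>space M. \<exists>j\<in>J. X j \<omega> \<in> A} * prob {\<omega>\<in>space M. \<exists>j\<in>J. X j \<omega> \<in> A'}"
proof -
  define p where "p C = prob {\<omega>\<in>space M. X 0 \<omega> \<in> C}" for C
  define m where "m C = prob {\<omega>\<in>space M. \<forall>j\<in>J. X j \<omega> \<notin> C}" for C
  have ev[measurable]: "{\<omega>\<in>space M. \<forall>j\<in>J. X j \<omega> \<notin> C} \<in> events" if "C \<in> sets borel" for C
    using J that by measurable
  have hit: "prob {\<omega>\<in>space M. \<exists>j\<in>J. X j \<omega> \<in> C} = 1 - m C" if "C \<in> sets borel" for C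
  proof -
    have "{\<omega>\<in>space M. \<exists>j\<in>J. X j \<omega> \<in> C} = space M - {\<omega>\<in>space M. \<forall>j\<in>J. X j \<omega> \<notin> C}" by auto
    then show ?thesis using prob_compl[OF ev[OF that]] by (simp add: m_def)
  qed
  have pU: "p (A \<union> A') = p A + p A'"
  proof -
    have e: "{\<omega>\<in>space M. X 0 \<omega> \<in> A} \<in> events" "{\<omega>\<in>space M. X 0 \<omega> \<in> A'} \<in> events" using A by measurable
    have "{\<omega>\<in>space M. X 0 \<omega> \<in> A \<union> A'} = {\<omega>\<in>space M. X 0 \<omega> \<in> A} \<union> {\<omega>\<in>space M. X 0 \<omega> \<in> A'}" by auto
    then show ?thesis unfolding p_def using e A(3) by (subst finite_measure_Union[symmetric]) auto
  qed
  have mp: "m C = (1 - p C) ^ card J" if "C \<in> sets borel" for C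
    unfolding m_def p_def by (rule prob_none_in[OF J that])
  have mU: "m (A \<union> A') \<le> m A * m A'"
  proof -
    have "p (A \<union> A') \<le> 1" unfolding p_def by (rule prob_le_1)
    then have "p A + p A' \<le> 1" unfolding pU .
    moreover have "1 - (p A + p A') \<le> (1 - p A) * (1 - p A')"
      by (simp add: algebra_simps p_def)
    ultimately have "(1 - (p A + p A')) ^ card J \<le> ((1 - p A) * (1 - p A')) ^ card J"
      by (intro power_mono) auto
    then show ?thesis using A by (simp add: mp pU power_mult_distrib)
  qed
  have "{\<omega>\<in>space M. (\<exists>j\<in>J. X j \<omega> \<in> A) \<and> (\<exists>j\<in>J. X j \<omega> \<in> A')} =
    space M - ({\<omega>\<in>space M. \<forall>j\<in>J. X j \<omega> \<notin> A} \<union> {\<omega>\<in>space M. \<forall>j\<in>J. X j \<omega> \<notin> A'})" by auto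
  then have "prob {\<omega>\<in>space M. (\<exists>j\<in>J. X j \<omega> \<in> A) \<and> (\<exists>j\<in>J. X j \<omega> \<in> A')} =
    1 - prob ({\<omega>\<in>space M. \<forall>j\<in>J. X j \<omega> \<notin> A} \<union> {\<omega>\<in>space M. \<forall>j\<in>J. X j \<omega> \<notin> A'})"
    using prob_compl ev A by simp
  also have "prob ({\<omega>\<in>space M. \<forall>j\<in>J. X j \<omega> \<notin> A} \<union> {\<omega>\<in>space M. \<forall>j\<in>J. X j \<omega> \<notin> A'}) =
     m A + m A' - prob ({\<omega>\<in>space M. \<forall>j\<in>J. X j \<omega> \<notin> A} \<inter> {\<omega>\<in>space M. \<forall>j\<in>J. X j \<omega> \<notin> A'})"
    unfolding m_def using ev A by (intro measure_Un3) (auto simp: fmeasurable_eq_sets)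
  also have "{\<omega>\<in>space M. \<forall>j\<in>J. X j \<omega> \<notin> A} \<inter> {\<omega>\<in>space M. \<forall>j\<in>J. X j \<omega> \<notin> A'} = {\<omega>\<in>space M. \<forall>j\<in>J. X j \<omega> \<notin> A \<union> A'}"
    by auto
  finally have "prob {\<omega>\<in>space M. (\<exists>j\<in>J. X j \<omega> \<in> A) \<and> (\<exists>j\<in>J. X j \<omega> \<in> A')} = 1 - m A - m A' + m (A \<union> A')"
    by (simp add: m_def)
  then show ?thesis using mU unfolding hit[OF A(1)] hit[OF A(2)] by (simp add: algebra_simps)
qed

end


section \<open>Simplices, hits and close pairs in a sample\<close>

text \<open>The ball is closed, since \<open>crit_subset\<close> asks for a strict inequality. Its
  radius is written as the distance from \<open>crit_center\<close> to a vertex, which avoids the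
  \<open>SOME\<close> in \<open>circumradius\<close>.\<close>

definition ball_hit :: "nat \<Rightarrow> real \<Rightarrow> (nat \<Rightarrow> 'a::euclidean_space) \<Rightarrow> nat set \<Rightarrow> 'a \<Rightarrow> bool" where
  "ball_hit k r x a p \<longleftrightarrow> crit_simplex k r (x ` a) \<and>
     (\<exists>i\<in>a. dist (crit_center k r (x ` a)) p \<le> dist (crit_center k r (x ` a)) (x i))"

lemma crit_simplex_pred [measurable (raw)]:
  fixes a :: "nat set"
  assumes "x \<in> L \<rightarrow>\<^sub>M PiM UNIV (\<lambda>_. borel :: 'a::euclidean_space measure)" "finite a" "card a = k + 1"
  shows "Measurable.pred L (\<lambda>w. crit_simplex k r (x w ` a))"
proof -
  have "Measurable.pred (PiM UNIV (\<lambda>_. borel :: 'a measure)) (\<lambda>x. crit_simplex k r (x ` a))"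
    using measurable_crit_simplex[OF assms(2,3), of UNIV r] by (simp add: pred_def)
  from measurable_compose[OF assms(1) this] show ?thesis .
qed

lemma crit_center_meas [measurable (raw)]:
  fixes a :: "nat set"
  assumes "x \<in> L \<rightarrow>\<^sub>M PiM UNIV (\<lambda>_. borel :: 'a::euclidean_space measure)" "finite a" "card a = k + 1"
  shows "(\<lambda>w. crit_center k r (x w ` a)) \<in> borel_measurable L"
  using measurable_compose[OF assms(1) measurable_crit_center[OF assms(2,3), of UNIV r]] by simp

lemma ball_hit_pred [measurable (raw)]:
  assumes [measurable]: "x \<in> L \<rightarrow>\<^sub>M PiM UNIV (\<lambda>_. borel :: 'a::euclidean_space measure)"
    and a: "finite a" "card a = k + 1" and [measurable]: "p \<in> borel_measurable L"
  shows "Measurable.pred L (\<lambda>w. ball_hit k r (x w) a (p w))"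
  unfolding ball_hit_def using a by measurable

lemma crit_simplex_dist:
  assumes "crit_simplex k r Y" "y \<in> Y" "z \<in> Y"
  shows "dist y z \<le> 2 * r"
proof -
  have "dist y z \<le> dist (circumcenter Y) y + dist (circumcenter Y) z"
    by (metis dist_commute dist_triangle)
  then show ?thesis using crit_simplexD(6,7)[OF assms(1)] assms(2,3) by fastforce
qed

lemma ball_hit_iff:
  assumes "a \<noteq> {}"
  shows "ball_hit k r x a p \<longleftrightarrow> crit_simplex k r (x ` a) \<and>
     dist (circumcenter (x ` a)) p \<le> circumradius (x ` a)"
  using crit_simplexD(7)[of k r "x ` a"] assms by (auto simp: ball_hit_def crit_center_def)

lemma ball_hit_dist:
  assumes "ball_hit k r x a p" "i \<in> a"
  shows "dist (x i) p \<le> 2 * r"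
proof -
  have h: "crit_simplex k r (x ` a)" "dist (circumcenter (x ` a)) p \<le> circumradius (x ` a)"
    using assms ball_hit_iff[of a k r x p] by auto
  have "dist (x i) p \<le> dist (circumcenter (x ` a)) (x i) + dist (circumcenter (x ` a)) p"
    by (metis dist_commute dist_triangle)
  then show ?thesis using crit_simplexD(6,7)[OF h(1)] h(2) assms(2) by fastforce
qed

definition ksubsets :: "nat \<Rightarrow> nat set \<Rightarrow> nat set set" where
  "ksubsets k N = {a. a \<subseteq> N \<and> card a = k + 1}"

lemma ksubsetsD:
  assumes "a \<in> ksubsets k N"
  shows "finite a" "card a = k + 1" "a \<subseteq> N" "a \<noteq> {}"
  using assms by (auto simp: ksubsets_def intro: card_ge_0_finite)

lemma finite_ksubsets: "finite N \<Longrightarrow> finite (ksubsets k N)"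
  by (rule finite_subset[of _ "Pow N"]) (auto simp: ksubsets_def)

lemma card_ksubsets: "finite N \<Longrightarrow> card (ksubsets k N) = card N choose (k + 1)"
  unfolding ksubsets_def by (rule n_subsets)

lemma choose_le_power: "real (n choose l) \<le> real n ^ l"
proof (cases "l \<le> n")
  case True then show ?thesis using binomial_le_pow[OF True] by (metis of_nat_le_iff of_nat_power)
qed (simp add: binomial_eq_0)

text \<open>Pairs are grouped by their union: a set of \<open>l\<close> elements is the union of at
  most \<open>4 ^ l\<close> pairs of its subsets, and at most \<open>real (card N) ^ l\<close> sets
  have that size. The function \<open>F\<close> stands for a probability bound that depends only on
  the number of points involved.\<close>

lemma pair_sum_bound:
  fixes F :: "nat \<Rightarrow> real"
  assumes N: "finite N" and L: "finite L" and F: "\<And>l. 0 \<le> F l"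
    and R: "\<And>a c. a \<in> ksubsets k N \<Longrightarrow> c \<in> ksubsets k N \<Longrightarrow> R a c \<Longrightarrow> card (a \<union> c) \<in> L"
  shows "(\<Sum>a\<in>ksubsets k N. \<Sum>c\<in>{c\<in>ksubsets k N. R a c}. F (card (a \<union> c))) \<le> (\<Sum>l\<in>L. 4 ^ l * real (card N) ^ l * F l)"
proof -
  let ?PR = "SIGMA a:ksubsets k N. {c\<in>ksubsets k N. R a c}" and ?U = "{U. U \<subseteq> N \<and> card U \<in> L}"
  have fin: "finite ?PR" using finite_ksubsets[OF N] by auto
  have finU: "finite ?U" using N by auto
  have "(\<Sum>a\<in>ksubsets k N. \<Sum>c\<in>{c\<in>ksubsets k N. R a c}. F (card (a \<union> c))) = (\<Sum>(a, c)\<in>?PR. F (card (a \<union> c)))"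
    using finite_ksubsets[OF N] by (subst sum.Sigma) auto
  also have "\<dots> = (\<Sum>U\<in>?U. \<Sum>z\<in>{z\<in>?PR. (case z of (a, c) \<Rightarrow> a \<union> c) = U}. case z of (a, c) \<Rightarrow> F (card (a \<union> c)))"
    using fin finU by (intro sum.group[symmetric]) (auto dest: ksubsetsD(3) intro: R)
  also have "\<dots> \<le> (\<Sum>U\<in>?U. 4 ^ card U * F (card U))"
  proof (rule sum_mono)
    fix U assume U: "U \<in> ?U"
    then have fU: "finite U" using N finite_subset by auto
    let ?Z = "{z\<in>?PR. (case z of (a, c) \<Rightarrow> a \<union> c) = U}"
    have "(\<Sum>z\<in>?Z. case z of (a, c) \<Rightarrow> F (card (a \<union> c))) = (\<Sum>z\<in>?Z. F (card U))"
      by (intro sum.cong) auto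
    also have "\<dots> = real (card ?Z) * F (card U)" by simp
    also have "\<dots> \<le> real (card (Pow U \<times> Pow U)) * F (card U)"
      using fU F by (intro mult_right_mono of_nat_mono card_mono) auto
    also have "card (Pow U \<times> Pow U) = 4 ^ card U"
      using fU by (simp add: card_cartesian_product card_Pow power_mult_distrib[symmetric])
    finally show "(\<Sum>z\<in>?Z. case z of (a, c) \<Rightarrow> F (card (a \<union> c))) \<le> 4 ^ card U * F (card U)" by simp
  qed
  also have "\<dots> = (\<Sum>l\<in>L. \<Sum>U\<in>{U\<in>?U. card U = l}. 4 ^ card U * F (card U))"
    using finU L by (intro sum.group[symmetric]) auto
  also have "\<dots> \<le> (\<Sum>l\<in>L. 4 ^ l * real (card N) ^ l * F l)"
  proof (rule sum_mono)
    fix l assume l: "l \<in> L"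
    have "(\<Sum>U\<in>{U\<in>?U. card U = l}. 4 ^ card U * F (card U)) = (\<Sum>U\<in>{U. U \<subseteq> N \<and> card U = l}. 4 ^ l * F l)"
      using l by (intro sum.cong) auto
    also have "\<dots> = real (card N choose l) * (4 ^ l * F l)" by (simp add: n_subsets[OF N])
    also have "\<dots> \<le> real (card N) ^ l * (4 ^ l * F l)"
      using F by (intro mult_right_mono choose_le_power) simp
    finally show "(\<Sum>U\<in>{U\<in>?U. card U = l}. 4 ^ card U * F (card U)) \<le> 4 ^ l * real (card N) ^ l * F l"
      by (simp add: mult_ac)
  qed
  finally show ?thesis .
qed

locale crit_sample = iid_sample +
  fixes k :: nat and r :: real
  assumes r_pos: "0 < r" and k_pos: "1 \<le> k"
begin

definition ev :: "nat set \<Rightarrow> 'a \<Rightarrow> bool" where "ev a \<omega> \<longleftrightarrow> crit_simplex k r (Xs \<omega> ` a)"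

definition hit :: "nat set \<Rightarrow> nat set \<Rightarrow> 'a \<Rightarrow> bool" where
  "hit a J \<omega> \<longleftrightarrow> (\<exists>j\<in>J. ball_hit k r (Xs \<omega>) a (X j \<omega>))"

text \<open>The closed circumballs of the two simplices meet, with the radii again written as
  distances to vertices. Hits of such pairs need not be negatively correlated; they are estimated by
  clustering instead.\<close>

definition near :: "nat set \<Rightarrow> nat set \<Rightarrow> 'a \<Rightarrow> bool" where
  "near a c \<omega> \<longleftrightarrow> ev a \<omega> \<and> ev c \<omega> \<and> (\<exists>i\<in>a. \<exists>j\<in>c.
     dist (crit_center k r (Xs \<omega> ` a)) (crit_center k r (Xs \<omega> ` c)) \<le>
     dist (crit_center k r (Xs \<omega> ` a)) (X i \<omega>) + dist (crit_center k r (Xs \<omega> ` c)) (X j \<omega>))"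

text \<open>The factor 8 is a common and generous choice: two overlapping simplices, two simplices
  with meeting balls, and a simplex with a point in its ball all have diameter at most
  \<open>6 * r\<close>.\<close>

definition theta where "theta = q * (8 * r) ^ DIM('b)"

lemma theta_nonneg: "0 \<le> theta" unfolding theta_def using q_nonneg r_pos by simp

lemma ev_pred: "a \<in> ksubsets k N \<Longrightarrow> Measurable.pred M (ev a)"
  unfolding ev_def using ksubsetsD[of a k N] by (intro crit_simplex_pred[OF Xs_meas]) auto

lemma ball_hit_pred': "a \<in> ksubsets k N \<Longrightarrow> Measurable.pred M (\<lambda>\<omega>. ball_hit k r (Xs \<omega>) a (X j \<omega>))"
  using ksubsetsD[of a k N] by (intro ball_hit_pred[OF Xs_meas _ _ X_meas]) auto

lemma hit_pred: "a \<in> ksubsets k N \<Longrightarrow> finite J \<Longrightarrow> Measurable.pred M (hit a J)"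
  unfolding hit_def using ball_hit_pred' by measurable

lemma prob_near_cluster:
  assumes "finite J" "J \<noteq> {}"
    "\<And>\<omega>. P \<omega> \<Longrightarrow> \<forall>i\<in>J. \<forall>j\<in>J. dist (X i \<omega>) (X j \<omega>) \<le> 8 * r"
  shows "prob {\<omega>\<in>space M. P \<omega>} \<le> theta ^ (card J - 1)"
proof -
  obtain i where "i \<in> J" using assms by auto
  then show ?thesis unfolding theta_def using assms r_pos by (intro prob_cluster[of J i]) auto
qed

lemma ev_dist: "ev a \<omega> \<Longrightarrow> i \<in> a \<Longrightarrow> j \<in> a \<Longrightarrow> dist (X i \<omega>) (X j \<omega>) \<le> 2 * r"
  unfolding ev_def using crit_simplex_dist[of k r "Xs \<omega> ` a" "X i \<omega>" "X j \<omega>"] by auto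

lemma prob_ev_le:
  assumes "a \<in> ksubsets k N" shows "prob {\<omega>\<in>space M. ev a \<omega>} \<le> theta ^ k"
  using prob_near_cluster[of a "ev a"] ksubsetsD[OF assms] ev_dist r_pos by force

lemma prob_ev_overlap_le:
  assumes "a \<in> ksubsets k N" "c \<in> ksubsets k N" "a \<inter> c \<noteq> {}"
  shows "prob {\<omega>\<in>space M. ev a \<omega> \<and> ev c \<omega>} \<le> theta ^ (card (a \<union> c) - 1)"
proof (rule prob_near_cluster)
  obtain l where l: "l \<in> a" "l \<in> c" using assms by auto
  fix \<omega> assume e: "ev a \<omega> \<and> ev c \<omega>"
  have *: "dist (X i \<omega>) (X l \<omega>) \<le> 2 * r" if "i \<in> a \<union> c" for i using that e l ev_dist by blast
  have "dist (X i \<omega>) (X j \<omega>) \<le> 8 * r" if "i \<in> a \<union> c" "j \<in> a \<union> c" for i j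
    using *[OF that(1)] *[OF that(2)] dist_triangle2[of "X i \<omega>" "X j \<omega>" "X l \<omega>"] r_pos by linarith
  then show "\<forall>i\<in>a \<union> c. \<forall>j\<in>a \<union> c. dist (X i \<omega>) (X j \<omega>) \<le> 8 * r" by blast
qed (use ksubsetsD assms in auto)

lemma ev_center:
  assumes "ev a \<omega>" "i \<in> a"
  shows "dist (crit_center k r (Xs \<omega> ` a)) (X i \<omega>) = circumradius (Xs \<omega> ` a)"
    "circumradius (Xs \<omega> ` a) \<le> r"
  using assms crit_simplexD(6,7)[of k r "Xs \<omega> ` a"] by (auto simp: ev_def crit_center_def)

lemma prob_near_le:
  assumes "a \<in> ksubsets k N" "c \<in> ksubsets k N" "a \<inter> c = {}"
  shows "prob {\<omega>\<in>space M. near a c \<omega>} \<le> theta ^ (2 * k + 1)"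
proof -
  have "prob {\<omega>\<in>space M. near a c \<omega>} \<le> theta ^ (card (a \<union> c) - 1)"
  proof (rule prob_near_cluster)
    fix \<omega> assume n: "near a c \<omega>"
    let ?A = "crit_center k r (Xs \<omega> ` a)" and ?C = "crit_center k r (Xs \<omega> ` c)"
    have e: "ev a \<omega>" "ev c \<omega>" using n by (auto simp: near_def)
    have AC: "dist ?A ?C \<le> 2 * r"
      using n ev_center[OF e(1)] ev_center[OF e(2)] unfolding near_def by fastforce
    \<comment> \<open>A vertex is within \<open>r\<close> of the center of its own simplex, and the
      two centers are at most \<open>2 * r\<close> apart.\<close>
    have *: "dist (X i \<omega>) ?A \<le> 3 * r" if "i \<in> a \<union> c" for i
    proof (cases "i \<in> a")
      case True
      then show ?thesis using ev_center[OF e(1) True] r_pos by (simp add: dist_commute)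
    next
      case False
      then have "i \<in> c" using that by simp
      then show ?thesis
        using ev_center[OF e(2)] AC dist_triangle[of "X i \<omega>" ?A ?C] by (fastforce simp: dist_commute)
    qed
    have "dist (X i \<omega>) (X j \<omega>) \<le> 8 * r" if "i \<in> a \<union> c" "j \<in> a \<union> c" for i j
      using *[OF that(1)] *[OF that(2)] dist_triangle2[of "X i \<omega>" "X j \<omega>" ?A] r_pos by linarith
    then show "\<forall>i\<in>a \<union> c. \<forall>j\<in>a \<union> c. dist (X i \<omega>) (X j \<omega>) \<le> 8 * r" by blast
  qed (use ksubsetsD assms in auto)
  moreover have "card (a \<union> c) = 2 * k + 2"
    using assms ksubsetsD[OF assms(1)] ksubsetsD[OF assms(2)] by (simp add: card_Un_disjoint)
  ultimately show ?thesis by simp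
qed

text \<open>A union bound over \<open>J\<close>; the simplex and the hitting point form a cluster of
  \<open>k + 2\<close> points.\<close>

lemma prob_hit_le:
  assumes a: "a \<in> ksubsets k N" and J: "finite J" "a \<inter> J = {}"
  shows "prob {\<omega>\<in>space M. hit a J \<omega>} \<le> real (card J) * theta ^ (k + 1)"
proof -
  have ev[measurable]: "{\<omega>\<in>space M. ball_hit k r (Xs \<omega>) a (X j \<omega>)} \<in> events" for j
    using ball_hit_pred'[OF a] by (simp add: pred_def)
  have "{\<omega>\<in>space M. hit a J \<omega>} = (\<Union>j\<in>J. {\<omega>\<in>space M. ball_hit k r (Xs \<omega>) a (X j \<omega>)})"
    by (auto simp: hit_def)
  then have "prob {\<omega>\<in>space M. hit a J \<omega>} \<le> (\<Sum>j\<in>J. prob {\<omega>\<in>space M. ball_hit k r (Xs \<omega>) a (X j \<omega>)})"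
    using finite_measure_subadditive_finite[OF J(1), of "\<lambda>j. {\<omega>\<in>space M. ball_hit k r (Xs \<omega>) a (X j \<omega>)}"] ev
    by (simp only:) blast
  also have "\<dots> \<le> (\<Sum>j\<in>J. theta ^ (k + 1))"
  proof (rule sum_mono)
    fix j assume j: "j \<in> J"
    have pl: "prob {\<omega>\<in>space M. ball_hit k r (Xs \<omega>) a (X j \<omega>)} \<le> theta ^ (card (insert j a) - 1)"
    proof (rule prob_near_cluster)
      fix \<omega> assume h: "ball_hit k r (Xs \<omega>) a (X j \<omega>)"
      then have "ev a \<omega>" by (simp add: ball_hit_def ev_def)
      then have "dist (X i \<omega>) (X l \<omega>) \<le> 2 * r" if "i \<in> insert j a" "l \<in> insert j a" for i l
        using that ev_dist[of a \<omega> i l] ball_hit_dist[OF h, of i] ball_hit_dist[OF h, of l] r_pos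
        by (auto simp: dist_commute)
      then show "\<forall>i\<in>insert j a. \<forall>l\<in>insert j a. dist (X i \<omega>) (X l \<omega>) \<le> 8 * r" using r_pos by fastforce
    qed (use ksubsetsD(1)[OF a] in auto)
    show "prob {\<omega>\<in>space M. ball_hit k r (Xs \<omega>) a (X j \<omega>)} \<le> theta ^ (k + 1)"
    proof -
      have "j \<notin> a" using j J(2) by auto
      then have "card (insert j a) - 1 = k + 1" using ksubsetsD(1,2)[OF a] by simp
      then show ?thesis using pl by metis
    qed
  qed
  finally show ?thesis by simp
qed

text \<open>Hits of two disjoint balls by the same points are negatively correlated.\<close>

lemma prob_hit_far_le:
  assumes a: "a \<in> ksubsets k N" and c: "c \<in> ksubsets k N" and ac: "a \<inter> c = {}"
    and J: "finite J" "a \<inter> J = {}" "c \<inter> J = {}"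
  shows "prob {\<omega>\<in>space M. hit a J \<omega> \<and> hit c J \<omega> \<and> \<not> near a c \<omega>} \<le>
    prob {\<omega>\<in>space M. hit a J \<omega>} * prob {\<omega>\<in>space M. hit c J \<omega>}"
proof -
  let ?P = "PiM UNIV (\<lambda>_. borel) :: (nat \<Rightarrow> 'b) measure"
  \<comment> \<open>The geometric part of \<open>near\<close> as a function of the coordinates; the
    events \<open>ev\<close> are implied by the hits.\<close>
  define nr where "nr x \<longleftrightarrow> (\<exists>i\<in>a. \<exists>j\<in>c. dist (crit_center k r (x ` a)) (crit_center k r (x ` c)) \<le>
     dist (crit_center k r (x ` a)) (x i) + dist (crit_center k r (x ` c)) (x j))" for x :: "nat \<Rightarrow> 'b"
  define h where "h b x y \<longleftrightarrow> (\<exists>j\<in>J. ball_hit k r x b (y j))" for b and x y :: "nat \<Rightarrow> 'b"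
  \<comment> \<open>The probability of a hit when the vertices \<open>x\<close> are frozen and the
    remaining points form an independent copy.\<close>
  define u where "u b x = (\<integral>\<^sup>+\<omega>'. of_bool (h b x (Xs \<omega>')) \<partial>M)" for b x
  note da = ksubsetsD[OF a] and dc = ksubsetsD[OF c]
  have hm[measurable]: "Measurable.pred (?P \<Otimes>\<^sub>M ?P) (\<lambda>z. h b (fst z) (snd z))" if "b = a \<or> b = c" for b
  proof -
    have "finite b" "card b = k + 1" using that da dc by auto
    then show ?thesis unfolding h_def using J(1) by measurable
  qed
  have nrm[measurable]: "Measurable.pred (?P \<Otimes>\<^sub>M ?P) (\<lambda>z. nr (fst z))"
    unfolding nr_def using da dc by measurable
  have img: "(\<lambda>i. if i \<in> L then x i else (0::'b)) ` b = x ` b" if "b \<subseteq> L" for L b and x :: "nat \<Rightarrow> 'b"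
    using that by (auto intro!: image_cong)
  have bh: "ball_hit k r (\<lambda>i. if i \<in> L then x i else 0) b p = ball_hit k r x b p" if "b \<subseteq> L" for L b x p
    unfolding ball_hit_def img[OF that] using that by (auto simp: subset_iff)
  have hdep: "h b x y = h b (\<lambda>i. if i \<in> L then x i else 0) (\<lambda>i. if i \<in> J then y i else 0)" if "b \<subseteq> L" for L b x y
    unfolding h_def bh[OF that] by auto
  have prob_u: "ennreal (prob {\<omega>\<in>space M. hit b J \<omega>}) = (\<integral>\<^sup>+\<omega>. u b (Xs \<omega>) \<partial>M)" if b: "b = a \<or> b = c" for b
  proof -
    have "b \<in> ksubsets k N" "b \<inter> J = {}" using b a c J by auto
    then have "{\<omega>\<in>space M. hit b J \<omega>} \<in> events" using hit_pred[OF _ J(1), of b N] by (simp add: pred_def)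
    then have "ennreal (prob {\<omega>\<in>space M. hit b J \<omega>}) = (\<integral>\<^sup>+\<omega>. indicator {\<omega>\<in>space M. hit b J \<omega>} \<omega> \<partial>M)"
      by (simp add: emeasure_eq_measure)
    also have "\<dots> = (\<integral>\<^sup>+\<omega>. of_bool (h b (Xs \<omega>) (Xs \<omega>)) \<partial>M)"
      by (intro nn_integral_cong) (auto simp: h_def hit_def indicator_def)
    also have "\<dots> = (\<integral>\<^sup>+\<omega>. u b (Xs \<omega>) \<partial>M)"
      unfolding u_def
    proof (rule decouple[of b J])
      show "(\<lambda>(x, y). of_bool (h b x y) :: ennreal) \<in> borel_measurable (?P \<Otimes>\<^sub>M ?P)"
        using hm[OF b] by (simp add: case_prod_beta')
      show "(of_bool (h b x y) :: ennreal) = of_bool (h b (\<lambda>i. if i \<in> b then x i else 0) (\<lambda>i. if i \<in> J then y i else 0))" for x y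
        using hdep[of b b x y] by simp
    qed fact
    finally show ?thesis .
  qed
  have um: "u b \<in> borel_measurable ?P" if "b = a \<or> b = c" for b
  proof -
    have "(\<lambda>z. (fst z, Xs (snd z))) \<in> ?P \<Otimes>\<^sub>M M \<rightarrow>\<^sub>M ?P \<Otimes>\<^sub>M ?P" by measurable
    from measurable_compose[OF this hm[OF that]]
    have "Measurable.pred (?P \<Otimes>\<^sub>M M) (\<lambda>z. h b (fst z) (Xs (snd z)))" by simp
    then have "(\<lambda>(x, w). of_bool (h b x (Xs w)) :: ennreal) \<in> borel_measurable (?P \<Otimes>\<^sub>M M)"
      by (simp add: case_prod_beta')
    from borel_measurable_nn_integral[OF this] show ?thesis unfolding u_def .
  qed
  have "{\<omega>\<in>space M. hit a J \<omega> \<and> hit c J \<omega> \<and> \<not> near a c \<omega>} \<in> events"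
  proof -
    have [measurable]: "Measurable.pred M (hit a J)" "Measurable.pred M (hit c J)"
      "Measurable.pred M (ev a)" "Measurable.pred M (ev c)"
      using hit_pred[OF a J(1)] hit_pred[OF c J(1)] ev_pred[OF a] ev_pred[OF c] by auto
    show ?thesis unfolding near_def using da dc by measurable
  qed
  then have "ennreal (prob {\<omega>\<in>space M. hit a J \<omega> \<and> hit c J \<omega> \<and> \<not> near a c \<omega>}) =
    (\<integral>\<^sup>+\<omega>. indicator {\<omega>\<in>space M. hit a J \<omega> \<and> hit c J \<omega> \<and> \<not> near a c \<omega>} \<omega> \<partial>M)"
    by (simp add: emeasure_eq_measure)
  also have "\<dots> \<le> (\<integral>\<^sup>+\<omega>. of_bool (\<not> nr (Xs \<omega>) \<and> h a (Xs \<omega>) (Xs \<omega>) \<and> h c (Xs \<omega>) (Xs \<omega>)) \<partial>M)"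
    by (intro nn_integral_mono) (auto simp: h_def hit_def near_def nr_def ev_def ball_hit_def indicator_def)
  \<comment> \<open>First decoupling: the vertices of both simplices are frozen and only the points
    of \<open>J\<close> stay random.\<close>
  also have "\<dots> = (\<integral>\<^sup>+\<omega>. \<integral>\<^sup>+\<omega>'. of_bool (\<not> nr (Xs \<omega>) \<and> h a (Xs \<omega>) (Xs \<omega>') \<and> h c (Xs \<omega>) (Xs \<omega>')) \<partial>M \<partial>M)"
  proof (rule decouple[of "a \<union> c" J])
    show "(\<lambda>(x, y). of_bool (\<not> nr x \<and> h a x y \<and> h c x y) :: ennreal) \<in> borel_measurable (?P \<Otimes>\<^sub>M ?P)"
      using hm[of a] hm[of c] nrm by (simp add: case_prod_beta')
    have "nr x = nr (\<lambda>i. if i \<in> a \<union> c then x i else 0)" for x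
      unfolding nr_def by (simp add: img)
    then show "(of_bool (\<not> nr x \<and> h a x y \<and> h c x y) :: ennreal) =
      of_bool (\<not> nr (\<lambda>i. if i \<in> a \<union> c then x i else 0) \<and>
        h a (\<lambda>i. if i \<in> a \<union> c then x i else 0) (\<lambda>i. if i \<in> J then y i else 0) \<and>
        h c (\<lambda>i. if i \<in> a \<union> c then x i else 0) (\<lambda>i. if i \<in> J then y i else 0))" for x y
      using hdep[of a "a \<union> c" x y] hdep[of c "a \<union> c" x y] by simp
  qed (use J in auto)
  also have "\<dots> \<le> (\<integral>\<^sup>+\<omega>. u a (Xs \<omega>) * u c (Xs \<omega>) \<partial>M)"
  proof (rule nn_integral_mono)
    fix \<omega> assume w: "\<omega> \<in> space M"
    show "(\<integral>\<^sup>+\<omega>'. of_bool (\<not> nr (Xs \<omega>) \<and> h a (Xs \<omega>) (Xs \<omega>') \<and> h c (Xs \<omega>) (Xs \<omega>')) \<partial>M) \<le> u a (Xs \<omega>) * u c (Xs \<omega>)"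
    proof (cases "\<not> nr (Xs \<omega>) \<and> ev a \<omega> \<and> ev c \<omega>")
      case False
      then have z: "of_bool (\<not> nr (Xs \<omega>) \<and> h a (Xs \<omega>) (Xs \<omega>') \<and> h c (Xs \<omega>) (Xs \<omega>')) = (0::ennreal)" for \<omega>'
        by (auto simp: h_def ball_hit_def ev_def)
      show ?thesis unfolding z by simp
    next
      case True
      let ?B = "\<lambda>b. cball (circumcenter (Xs \<omega> ` b)) (circumradius (Xs \<omega> ` b))"
      have Bs: "?B b \<in> sets borel" for b by simp
      have hB: "h b (Xs \<omega>) y \<longleftrightarrow> (\<exists>j\<in>J. y j \<in> ?B b)" if "b = a \<or> b = c" for b y
      proof -
        have "b \<noteq> {}" "crit_simplex k r (Xs \<omega> ` b)" using that True da(4) dc(4) by (auto simp: ev_def)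
        then show ?thesis by (simp add: h_def ball_hit_iff)
      qed
      have uB: "u b (Xs \<omega>) = ennreal (prob {\<omega>'\<in>space M. \<exists>j\<in>J. X j \<omega>' \<in> ?B b})" if b: "b = a \<or> b = c" for b
      proof -
        have "u b (Xs \<omega>) = (\<integral>\<^sup>+\<omega>'. indicator {\<omega>'\<in>space M. \<exists>j\<in>J. X j \<omega>' \<in> ?B b} \<omega>' \<partial>M)"
          unfolding u_def hB[OF b] by (intro nn_integral_cong) (auto simp: indicator_def)
        also have "\<dots> = ennreal (prob {\<omega>'\<in>space M. \<exists>j\<in>J. X j \<omega>' \<in> ?B b})"
        proof -
          have "{\<omega>'\<in>space M. \<exists>j\<in>J. X j \<omega>' \<in> ?B b} \<in> events"
            using J(1) Bs[of b] by measurable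
          then show ?thesis by (simp only: nn_integral_indicator emeasure_eq_measure)
        qed
        finally show ?thesis .
      qed
      \<comment> \<open>This is the purpose of excluding close pairs: for frozen vertices the two
        balls are fixed disjoint sets, so \<open>prob_hit_both_le\<close> applies.\<close>
      have disj: "?B a \<inter> ?B c = {}"
      proof (rule ccontr)
        assume "?B a \<inter> ?B c \<noteq> {}"
        then obtain p where p: "dist (circumcenter (Xs \<omega> ` a)) p \<le> circumradius (Xs \<omega> ` a)"
          "dist (circumcenter (Xs \<omega> ` c)) p \<le> circumradius (Xs \<omega> ` c)" by auto
        obtain i j where ij: "i \<in> a" "j \<in> c" using da(4) dc(4) by auto
        have e: "ev a \<omega>" "ev c \<omega>" using True by auto
        have cc: "crit_center k r (Xs \<omega> ` a) = circumcenter (Xs \<omega> ` a)" "crit_center k r (Xs \<omega> ` c) = circumcenter (Xs \<omega> ` c)"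
          using e by (simp_all add: crit_center_def ev_def)
        have "dist (circumcenter (Xs \<omega> ` a)) (circumcenter (Xs \<omega> ` c)) \<le> circumradius (Xs \<omega> ` a) + circumradius (Xs \<omega> ` c)"
          using p dist_triangle2[of "circumcenter (Xs \<omega> ` a)" "circumcenter (Xs \<omega> ` c)" p] by linarith
        then have "nr (Xs \<omega>)"
          unfolding nr_def using ev_center(1)[OF e(1) ij(1)] ev_center(1)[OF e(2) ij(2)] cc
          by (intro bexI[OF _ ij(1)] bexI[OF _ ij(2)]) simp
        then show False using True by simp
      qed
      have "(\<integral>\<^sup>+\<omega>'. of_bool (\<not> nr (Xs \<omega>) \<and> h a (Xs \<omega>) (Xs \<omega>') \<and> h c (Xs \<omega>) (Xs \<omega>')) \<partial>M) =
        (\<integral>\<^sup>+\<omega>'. indicator {\<omega>'\<in>space M. (\<exists>j\<in>J. X j \<omega>' \<in> ?B a) \<and> (\<exists>j\<in>J. X j \<omega>' \<in> ?B c)} \<omega>' \<partial>M)"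
        using True hB by (intro nn_integral_cong) (auto simp: indicator_def)
      also have "\<dots> = ennreal (prob {\<omega>'\<in>space M. (\<exists>j\<in>J. X j \<omega>' \<in> ?B a) \<and> (\<exists>j\<in>J. X j \<omega>' \<in> ?B c)})"
      proof -
        have "{\<omega>'\<in>space M. (\<exists>j\<in>J. X j \<omega>' \<in> ?B a) \<and> (\<exists>j\<in>J. X j \<omega>' \<in> ?B c)} \<in> events"
          using J(1) Bs[of a] Bs[of c] by measurable
        then show ?thesis by (simp only: nn_integral_indicator emeasure_eq_measure)
      qed
      also have "\<dots> \<le> ennreal (prob {\<omega>'\<in>space M. \<exists>j\<in>J. X j \<omega>' \<in> ?B a} * prob {\<omega>'\<in>space M. \<exists>j\<in>J. X j \<omega>' \<in> ?B c})"
        by (intro ennreal_leI prob_hit_both_le J disj) auto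
      also have "\<dots> = u a (Xs \<omega>) * u c (Xs \<omega>)" by (simp add: uB ennreal_mult)
      finally show ?thesis .
    qed
  qed
  \<comment> \<open>Second decoupling: \<open>u a\<close> depends only on the coordinates in
    \<open>a\<close> and \<open>u c\<close> only on those in \<open>c\<close>.\<close>
  also have "\<dots> = (\<integral>\<^sup>+\<omega>. \<integral>\<^sup>+\<omega>'. u a (Xs \<omega>) * u c (Xs \<omega>') \<partial>M \<partial>M)"
  proof (rule decouple[of a c])
    show "(\<lambda>(x, y). u a x * u c y) \<in> borel_measurable (?P \<Otimes>\<^sub>M ?P)"
      using um[of a] um[of c] by measurable
    have "u b x = u b (\<lambda>i. if i \<in> b then x i else 0)" for b x
      unfolding u_def h_def by (subst bh[of b b]) auto
    then show "u a x * u c y = u a (\<lambda>i. if i \<in> a then x i else 0) * u c (\<lambda>i. if i \<in> c then y i else 0)" for x y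
      by metis
  qed fact
  also have "\<dots> = (\<integral>\<^sup>+\<omega>. u a (Xs \<omega>) \<partial>M) * (\<integral>\<^sup>+\<omega>. u c (Xs \<omega>) \<partial>M)"
    using measurable_compose[OF Xs_meas um[of a]] measurable_compose[OF Xs_meas um[of c]]
    by (simp add: nn_integral_cmult nn_integral_multc)
  also have "\<dots> = ennreal (prob {\<omega>\<in>space M. hit a J \<omega>} * prob {\<omega>\<in>space M. hit c J \<omega>})"
    by (simp add: prob_u[symmetric] ennreal_mult)
  finally show ?thesis by (simp add: measure_nonneg mult_nonneg_nonneg)
qed

end


section \<open>Moments and characteristic functions of the sums over index sets\<close>

context prob_space begin

lemma expectation_of_bool:
  assumes "Measurable.pred M P"
  shows "expectation (\<lambda>\<omega>. of_bool (P \<omega>) :: real) = prob {\<omega>\<in>space M. P \<omega>}"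
proof -
  have "expectation (\<lambda>\<omega>. of_bool (P \<omega>) :: real) = expectation (indicator {\<omega>\<in>space M. P \<omega>})"
    by (intro Bochner_Integration.integral_cong) (auto simp: indicator_def)
  then show ?thesis using assms by (simp add: pred_def)
qed

lemma integrable_of_bool:
  assumes "Measurable.pred M P"
  shows "integrable M (\<lambda>\<omega>. of_bool (P \<omega>) :: real)"
  using assms by (intro integrable_bounded[where C = 1]) auto

lemma expectation_abs_le_sqrt:
  assumes "integrable M Y" "integrable M (\<lambda>\<omega>. (Y \<omega>)\<^sup>2)"
  shows "expectation (\<lambda>\<omega>. \<bar>Y \<omega>\<bar>) \<le> sqrt (expectation (\<lambda>\<omega>. (Y \<omega>)\<^sup>2))"
proof -
  define m where "m = expectation (\<lambda>\<omega>. \<bar>Y \<omega>\<bar>)"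
  have i: "integrable M (\<lambda>\<omega>. 2 * m * \<bar>Y \<omega>\<bar> - m\<^sup>2)" using assms by auto
  have "m\<^sup>2 = expectation (\<lambda>\<omega>. 2 * m * \<bar>Y \<omega>\<bar> - m\<^sup>2)"
    using assms(1) by (simp add: m_def[symmetric] prob_space power2_eq_square)
  also have "\<dots> \<le> expectation (\<lambda>\<omega>. (Y \<omega>)\<^sup>2)"
  proof (intro integral_mono i assms)
    fix \<omega>
    have "0 \<le> (\<bar>Y \<omega>\<bar> - m)\<^sup>2" by simp
    then show "2 * m * \<bar>Y \<omega>\<bar> - m\<^sup>2 \<le> (Y \<omega>)\<^sup>2" by (simp add: power2_diff algebra_simps)
  qed
  finally show ?thesis unfolding m_def by (rule real_le_rsqrt)
qed

end

lemma indep_var_cong_fun: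
  assumes "prob_space.indep_var M A X B Y" "prob_space M" "X = X'" "Y = Y'"
  shows "prob_space.indep_var M A X' B Y'"
  using assms by simp

context crit_sample begin

definition Ssum :: "nat set \<Rightarrow> 'a \<Rightarrow> real" where
  "Ssum N \<omega> = (\<Sum>a\<in>ksubsets k N. of_bool (ev a \<omega>))"

definition Dsum :: "nat set \<Rightarrow> 'a \<Rightarrow> real" where
  "Dsum N \<omega> = (\<Sum>a\<in>ksubsets k N. of_bool (hit a (N - a) \<omega>))"

definition lam :: "nat set \<Rightarrow> real" where
  "lam N = (\<Sum>a\<in>ksubsets k N. prob {\<omega>\<in>space M. ev a \<omega>})"

text \<open>The sum runs over the possible sizes \<open>l\<close> of the union of two different
  index sets, each term being a number of pairs times a cluster probability. The top size
  \<open>2 * k + 2\<close> accounts for disjoint pairs with meeting balls; the term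
  \<open>l = k + 2\<close> also dominates the expected number of hits.\<close>

definition W :: "nat \<Rightarrow> real" where
  "W n = (\<Sum>l\<in>{k + 2..2 * k + 2}. 4 ^ l * real n ^ l * theta ^ (l - 1))"

text \<open>The same count for products of two single probabilities, each at most
  \<open>theta ^ k\<close>, over index sets with a common element. Equal sets are included, so the
  sizes start at \<open>k + 1\<close>.\<close>

definition W' :: "nat \<Rightarrow> real" where
  "W' n = (\<Sum>l\<in>{k + 1..2 * k + 1}. 4 ^ l * real n ^ l * theta ^ (2 * k))"

lemma Ssum_meas [measurable]: "Ssum N \<in> borel_measurable M"
  unfolding Ssum_def using ev_pred by (intro borel_measurable_sum) measurable

lemma Dsum_meas: "finite N \<Longrightarrow> Dsum N \<in> borel_measurable M"
  unfolding Dsum_def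
proof (intro borel_measurable_sum)
  fix a assume "finite N" "a \<in> ksubsets k N"
  then have "Measurable.pred M (hit a (N - a))" by (intro hit_pred) auto
  then show "(\<lambda>\<omega>. of_bool (hit a (N - a) \<omega>) :: real) \<in> borel_measurable M" by measurable
qed

lemma Ssum_bounds: "0 \<le> Ssum N \<omega>" "finite N \<Longrightarrow> Ssum N \<omega> \<le> real (card (ksubsets k N))"
  unfolding Ssum_def by (auto intro!: sum_nonneg sum_bounded_above[where K = 1, simplified])

lemma hit_imp_ev: "hit a J \<omega> \<Longrightarrow> ev a \<omega>" by (auto simp: hit_def ball_hit_def ev_def)

lemma Dsum_bounds: "0 \<le> Dsum N \<omega>" "Dsum N \<omega> \<le> Ssum N \<omega>"
  unfolding Dsum_def Ssum_def using hit_imp_ev by (auto intro!: sum_nonneg sum_mono)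

lemma expectation_Ssum: "expectation (Ssum N) = lam N"
  unfolding Ssum_def lam_def using ev_pred
  by (subst Bochner_Integration.integral_sum) (auto intro!: integrable_of_bool sum.cong expectation_of_bool)

lemma lam_nonneg: "0 \<le> lam N" unfolding lam_def by (intro sum_nonneg) simp

lemma lam_le: "finite N \<Longrightarrow> lam N \<le> real (card N) ^ (k + 1) * theta ^ k"
proof -
  assume N: "finite N"
  have "lam N \<le> (\<Sum>a\<in>ksubsets k N. theta ^ k)" unfolding lam_def by (intro sum_mono prob_ev_le)
  also have "\<dots> = real (card N choose (k + 1)) * theta ^ k" using N by (simp add: card_ksubsets)
  also have "\<dots> \<le> real (card N) ^ (k + 1) * theta ^ k"
    by (intro mult_right_mono choose_le_power zero_le_power theta_nonneg)
  finally show ?thesis .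
qed

lemma W_ge: "real n ^ (k + 2) * theta ^ (k + 1) \<le> W n"
proof -
  have "real n ^ (k + 2) * theta ^ (k + 1) \<le> 4 ^ (k + 2) * real n ^ (k + 2) * theta ^ (k + 2 - 1)"
  proof -
    have "1 * (real n ^ (k + 2) * theta ^ (k + 1)) \<le> 4 ^ (k + 2) * (real n ^ (k + 2) * theta ^ (k + 1))"
      by (rule mult_right_mono) (use theta_nonneg one_le_power[of "4::real" "k + 2"] in auto)
    then show ?thesis by (simp only: mult_1 mult.assoc diff_add_inverse2 one_add_one[symmetric] add.assoc[symmetric] add_diff_cancel_right')
  qed
  also have "\<dots> \<le> W n" unfolding W_def
    by (rule member_le_sum) (auto intro!: mult_nonneg_nonneg zero_le_power theta_nonneg)
  finally show ?thesis .
qed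

lemma W_nonneg: "0 \<le> W n" "0 \<le> W' n"
  unfolding W_def W'_def by (intro sum_nonneg mult_nonneg_nonneg zero_le_power theta_nonneg; simp)+

lemma expectation_Dsum:
  assumes N: "finite N"
  shows "expectation (Dsum N) = (\<Sum>a\<in>ksubsets k N. prob {\<omega>\<in>space M. hit a (N - a) \<omega>})"
  unfolding Dsum_def using hit_pred N
  by (subst Bochner_Integration.integral_sum) (auto intro!: integrable_of_bool sum.cong expectation_of_bool)

lemma sum_prob_hit_le:
  assumes N: "finite N"
  shows "(\<Sum>a\<in>ksubsets k N. prob {\<omega>\<in>space M. hit a (N - a) \<omega>}) \<le> W (card N)"
proof -
  have "(\<Sum>a\<in>ksubsets k N. prob {\<omega>\<in>space M. hit a (N - a) \<omega>}) \<le> (\<Sum>a\<in>ksubsets k N. real (card N) * theta ^ (k + 1))"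
  proof (rule sum_mono)
    fix a assume a: "a \<in> ksubsets k N"
    have "prob {\<omega>\<in>space M. hit a (N - a) \<omega>} \<le> real (card (N - a)) * theta ^ (k + 1)"
      using N by (intro prob_hit_le[OF a]) auto
    also have "\<dots> \<le> real (card N) * theta ^ (k + 1)"
      using N theta_nonneg by (intro mult_right_mono of_nat_mono card_mono zero_le_power) auto
    finally show "prob {\<omega>\<in>space M. hit a (N - a) \<omega>} \<le> real (card N) * theta ^ (k + 1)" .
  qed
  also have "\<dots> = real (card N choose (k + 1)) * (real (card N) * theta ^ (k + 1))" using N by (simp add: card_ksubsets)
  also have "\<dots> \<le> real (card N) ^ (k + 1) * (real (card N) * theta ^ (k + 1))"
    using theta_nonneg by (intro mult_right_mono choose_le_power) auto
  also have "\<dots> \<le> W (card N)" using W_ge[of "card N"] by (simp add: mult_ac)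
  finally show ?thesis .
qed

lemma card_union_ksubsets:
  assumes "a \<in> ksubsets k N" "c \<in> ksubsets k N"
  shows "card (a \<union> c) \<le> 2 * k + 2" "a \<noteq> c \<Longrightarrow> k + 2 \<le> card (a \<union> c)"
    "a \<inter> c = {} \<Longrightarrow> card (a \<union> c) = 2 * k + 2" "a \<inter> c \<noteq> {} \<Longrightarrow> card (a \<union> c) \<le> 2 * k + 1" "k + 1 \<le> card (a \<union> c)"
proof -
  note A = ksubsetsD(1,2)[OF assms(1)] and C = ksubsetsD(1,2)[OF assms(2)]
  have s: "card (a \<union> c) + card (a \<inter> c) = 2 * k + 2" using card_Un_Int[OF A(1) C(1)] A C by simp
  then show "card (a \<union> c) \<le> 2 * k + 2" by simp
  show "a \<inter> c = {} \<Longrightarrow> card (a \<union> c) = 2 * k + 2" using s by simp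
  show "card (a \<union> c) \<le> 2 * k + 1" if "a \<inter> c \<noteq> {}"
  proof -
    have "0 < card (a \<inter> c)" using that A(1) by (simp add: card_gt_0_iff)
    then show ?thesis using s by linarith
  qed
  show "k + 1 \<le> card (a \<union> c)" using card_mono[of "a \<union> c" a] A C by simp
  show "k + 2 \<le> card (a \<union> c)" if "a \<noteq> c"
  proof -
    have "a \<inter> c \<subset> a" using that A C by (metis card_subset_eq inf.cobounded1 inf.orderE inf_commute psubsetI)
    then have "card (a \<inter> c) < k + 1" using psubset_card_mono[OF A(1)] A(2) by metis
    then show ?thesis using s by simp
  qed
qed

lemma sum_pairs_le:
  assumes N: "finite N" and P: "\<And>a c. a \<in> ksubsets k N \<Longrightarrow> c \<in> ksubsets k N \<Longrightarrow> a \<noteq> c \<Longrightarrow> g a c \<le> theta ^ (card (a \<union> c) - 1)"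
  shows "(\<Sum>a\<in>ksubsets k N. \<Sum>c\<in>{c\<in>ksubsets k N. a \<noteq> c}. g a c) \<le> W (card N)"
proof -
  have "(\<Sum>a\<in>ksubsets k N. \<Sum>c\<in>{c\<in>ksubsets k N. a \<noteq> c}. g a c) \<le>
    (\<Sum>a\<in>ksubsets k N. \<Sum>c\<in>{c\<in>ksubsets k N. a \<noteq> c}. theta ^ (card (a \<union> c) - 1))"
    by (intro sum_mono P) auto
  also have "\<dots> \<le> W (card N)" unfolding W_def
    by (rule pair_sum_bound[OF N, where F = "\<lambda>l. theta ^ (l - 1)"])
       (use card_union_ksubsets theta_nonneg in auto)
  finally show ?thesis .
qed

lemma sum_square_pairs:
  fixes x :: "'c \<Rightarrow> real"
  assumes "finite A"
  shows "(\<Sum>a\<in>A. x a)\<^sup>2 = (\<Sum>a\<in>A. (x a)\<^sup>2) + (\<Sum>a\<in>A. \<Sum>c\<in>{c\<in>A. a \<noteq> c}. x a * x c)"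
proof -
  have "(\<Sum>a\<in>A. x a)\<^sup>2 = (\<Sum>a\<in>A. \<Sum>c\<in>A. x a * x c)" by (simp add: power2_eq_square sum_product)
  also have "\<dots> = (\<Sum>a\<in>A. (x a)\<^sup>2 + (\<Sum>c\<in>{c\<in>A. a \<noteq> c}. x a * x c))"
  proof (intro sum.cong refl)
    fix a assume "a \<in> A"
    moreover have "{c\<in>A. a \<noteq> c} = A - {a}" by auto
    ultimately show "(\<Sum>c\<in>A. x a * x c) = (x a)\<^sup>2 + (\<Sum>c\<in>{c\<in>A. a \<noteq> c}. x a * x c)"
      using assms by (simp add: sum.remove[of A a] power2_eq_square)
  qed
  finally show ?thesis by (simp add: sum.distrib)
qed

lemma expectation_square_sum_of_bool:
  assumes A: "finite A" and P: "\<And>a. a \<in> A \<Longrightarrow> Measurable.pred M (P a)"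
  shows "expectation (\<lambda>\<omega>. (\<Sum>a\<in>A. of_bool (P a \<omega>) :: real)\<^sup>2) = (\<Sum>a\<in>A. prob {\<omega>\<in>space M. P a \<omega>}) +
     (\<Sum>a\<in>A. \<Sum>c\<in>{c\<in>A. a \<noteq> c}. prob {\<omega>\<in>space M. P a \<omega> \<and> P c \<omega>})"
proof -
  have P2: "Measurable.pred M (\<lambda>\<omega>. P a \<omega> \<and> P c \<omega>)" if "a \<in> A" "c \<in> A" for a c
    using P[OF that(1)] P[OF that(2)] by measurable
  have eq: "(\<lambda>\<omega>. (\<Sum>a\<in>A. of_bool (P a \<omega>) :: real)\<^sup>2) = (\<lambda>\<omega>. (\<Sum>a\<in>A. of_bool (P a \<omega>)) +
     (\<Sum>a\<in>A. \<Sum>c\<in>{c\<in>A. a \<noteq> c}. of_bool (P a \<omega> \<and> P c \<omega>)))"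
    by (rule ext, subst sum_square_pairs[OF A]) (auto simp: of_bool_conj power2_eq_square intro!: arg_cong2[where f = "(+)"] sum.cong)
  show ?thesis
  proof -
    have i: "integrable M (\<lambda>\<omega>. of_bool (P a \<omega> \<and> P c \<omega>) :: real)" if "a \<in> A" "c \<in> {c\<in>A. a \<noteq> c}" for a c
      using P2 that by (intro integrable_of_bool) auto
    have "expectation (\<lambda>\<omega>. \<Sum>a\<in>A. of_bool (P a \<omega>) :: real) = (\<Sum>a\<in>A. prob {\<omega>\<in>space M. P a \<omega>})"
      using P by (subst Bochner_Integration.integral_sum) (auto intro!: integrable_of_bool sum.cong expectation_of_bool)
    moreover have "expectation (\<lambda>\<omega>. \<Sum>a\<in>A. \<Sum>c\<in>{c\<in>A. a \<noteq> c}. of_bool (P a \<omega> \<and> P c \<omega>) :: real) =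
       (\<Sum>a\<in>A. expectation (\<lambda>\<omega>. \<Sum>c\<in>{c\<in>A. a \<noteq> c}. of_bool (P a \<omega> \<and> P c \<omega>)))"
      by (intro Bochner_Integration.integral_sum Bochner_Integration.integrable_sum i)
    moreover have "expectation (\<lambda>\<omega>. \<Sum>c\<in>{c\<in>A. a \<noteq> c}. of_bool (P a \<omega> \<and> P c \<omega>)) =
       (\<Sum>c\<in>{c\<in>A. a \<noteq> c}. prob {\<omega>\<in>space M. P a \<omega> \<and> P c \<omega>})" if "a \<in> A" for a
      using i[OF that] P2[OF that]
      by (subst Bochner_Integration.integral_sum) (auto intro!: sum.cong expectation_of_bool)
    ultimately show ?thesis
      unfolding eq using P by (subst Bochner_Integration.integral_add)
        (auto intro!: Bochner_Integration.integrable_sum integrable_of_bool i)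
  qed
qed

lemma indep_ev:
  assumes "a \<inter> c = {}" "a \<in> ksubsets k N" "c \<in> ksubsets k N"
  shows "prob {\<omega>\<in>space M. ev a \<omega> \<and> ev c \<omega>} = prob {\<omega>\<in>space M. ev a \<omega>} * prob {\<omega>\<in>space M. ev c \<omega>}"
proof -
  have "indep_var (PiM a (\<lambda>_. borel)) (\<lambda>\<omega>. restrict (Xs \<omega>) a) (PiM c (\<lambda>_. borel)) (\<lambda>\<omega>. restrict (Xs \<omega>) c)"
    using indep_var_restrict[OF indep assms(1)] by simp
  then have "prob ((\<lambda>\<omega>. (restrict (Xs \<omega>) a, restrict (Xs \<omega>) c)) -` ({x\<in>space (PiM a (\<lambda>_. borel)). crit_simplex k r (x ` a)} \<times> {x\<in>space (PiM c (\<lambda>_. borel)). crit_simplex k r (x ` c)}) \<inter> space M) =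
    prob ((\<lambda>\<omega>. restrict (Xs \<omega>) a) -` {x\<in>space (PiM a (\<lambda>_. borel)). crit_simplex k r (x ` a)} \<inter> space M) *
    prob ((\<lambda>\<omega>. restrict (Xs \<omega>) c) -` {x\<in>space (PiM c (\<lambda>_. borel)). crit_simplex k r (x ` c)} \<inter> space M)"
    using measurable_crit_simplex[OF ksubsetsD(1,2)[OF assms(2)] order_refl]
      measurable_crit_simplex[OF ksubsetsD(1,2)[OF assms(3)] order_refl] by (intro indep_varD) auto
  moreover have "(\<lambda>\<omega>. restrict (Xs \<omega>) b) -` {x\<in>space (PiM b (\<lambda>_. borel)). crit_simplex k r (x ` b)} \<inter> space M = {\<omega>\<in>space M. ev b \<omega>}" for b
    by (auto simp: ev_def space_PiM)
  moreover have "(\<lambda>\<omega>. (restrict (Xs \<omega>) a, restrict (Xs \<omega>) c)) -` ({x\<in>space (PiM a (\<lambda>_. borel)). crit_simplex k r (x ` a)} \<times> {x\<in>space (PiM c (\<lambda>_. borel)). crit_simplex k r (x ` c)}) \<inter> space M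
     = {\<omega>\<in>space M. ev a \<omega> \<and> ev c \<omega>}"
    by (auto simp: ev_def space_PiM)
  ultimately show ?thesis by simp
qed

text \<open>Disjoint index sets give independent events, so beyond the diagonal only overlapping
  pairs contribute to the variance, and these are clusters.\<close>

lemma second_moment_Ssum:
  assumes N: "finite N"
  shows "expectation (\<lambda>\<omega>. (Ssum N \<omega>)\<^sup>2) \<le> lam N + W (card N) + (lam N)\<^sup>2"
proof -
  let ?A = "ksubsets k N" and ?p = "\<lambda>a. prob {\<omega>\<in>space M. ev a \<omega>}"
  let ?g = "\<lambda>a c. prob {\<omega>\<in>space M. ev a \<omega> \<and> ev c \<omega>}"
  have "expectation (\<lambda>\<omega>. (Ssum N \<omega>)\<^sup>2) = lam N + (\<Sum>a\<in>?A. \<Sum>c\<in>{c\<in>?A. a \<noteq> c}. ?g a c)"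
    unfolding Ssum_def lam_def using N ev_pred finite_ksubsets by (intro expectation_square_sum_of_bool) auto
  also have "(\<Sum>a\<in>?A. \<Sum>c\<in>{c\<in>?A. a \<noteq> c}. ?g a c) = (\<Sum>a\<in>?A. \<Sum>c\<in>{c\<in>?A. a \<noteq> c}. ?g a c - ?p a * ?p c) +
      (\<Sum>a\<in>?A. \<Sum>c\<in>{c\<in>?A. a \<noteq> c}. ?p a * ?p c)"
    by (simp add: sum_subtractf)
  also have "(\<Sum>a\<in>?A. \<Sum>c\<in>{c\<in>?A. a \<noteq> c}. ?g a c - ?p a * ?p c) \<le> W (card N)"
  proof (rule sum_pairs_le[OF N])
    fix a c assume ac: "a \<in> ?A" "c \<in> ?A"
    show "?g a c - ?p a * ?p c \<le> theta ^ (card (a \<union> c) - 1)"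
    proof (cases "a \<inter> c = {}")
      case True then show ?thesis using indep_ev[OF True ac] theta_nonneg by simp
    next
      case False
      have "0 \<le> ?p a * ?p c" by simp
      then show ?thesis using prob_ev_overlap_le[OF ac False] by linarith
    qed
  qed
  also have "(\<Sum>a\<in>?A. \<Sum>c\<in>{c\<in>?A. a \<noteq> c}. ?p a * ?p c) \<le> (lam N)\<^sup>2"
    unfolding lam_def sum_square_pairs[OF finite_ksubsets[OF N]] by (simp add: sum_nonneg)
  finally show ?thesis by simp
qed

text \<open>One \<open>W\<close> bounds the diagonal, that is the expected number of hits, the other
  one the covariances. Overlapping pairs and pairs with meeting balls are clusters; outside of them
  \<open>prob_hit_far_le\<close> leaves no positive covariance.\<close>

lemma variance_Dsum:
  assumes N: "finite N"
  shows "expectation (\<lambda>\<omega>. (Dsum N \<omega> - expectation (Dsum N))\<^sup>2) \<le> 2 * W (card N)"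
proof -
  let ?A = "ksubsets k N" and ?h = "\<lambda>a. hit a (N - a)"
  let ?p = "\<lambda>a. prob {\<omega>\<in>space M. ?h a \<omega>}"
  let ?g = "\<lambda>a c. prob {\<omega>\<in>space M. ?h a \<omega> \<and> ?h c \<omega>}"
  have hp: "Measurable.pred M (?h a)" if "a \<in> ?A" for a using hit_pred[OF that] N by simp
  note [measurable] = Dsum_meas[OF N]
  have bd: "\<bar>Dsum N \<omega>\<bar> \<le> real (card ?A)" for \<omega>
    using Dsum_bounds[of N \<omega>] Ssum_bounds[of N \<omega>] N by linarith
  have iD: "integrable M (Dsum N)" by (rule integrable_bounded[where C = "real (card ?A)"]) (use bd in auto)
  have iD2: "integrable M (\<lambda>\<omega>. (Dsum N \<omega>)\<^sup>2)"
    by (rule integrable_bounded[where C = "(real (card ?A))\<^sup>2"])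
       (use power_mono[OF bd abs_ge_zero, of _ 2] in auto)
  have "expectation (\<lambda>\<omega>. (Dsum N \<omega> - expectation (Dsum N))\<^sup>2) = expectation (\<lambda>\<omega>. (Dsum N \<omega>)\<^sup>2) - (expectation (Dsum N))\<^sup>2"
    using variance_eq[OF iD iD2] .
  also have "expectation (\<lambda>\<omega>. (Dsum N \<omega>)\<^sup>2) = (\<Sum>a\<in>?A. ?p a) + (\<Sum>a\<in>?A. \<Sum>c\<in>{c\<in>?A. a \<noteq> c}. ?g a c)"
    unfolding Dsum_def using N hp finite_ksubsets by (intro expectation_square_sum_of_bool) auto
  also have "(expectation (Dsum N))\<^sup>2 = (\<Sum>a\<in>?A. (?p a)\<^sup>2) + (\<Sum>a\<in>?A. \<Sum>c\<in>{c\<in>?A. a \<noteq> c}. ?p a * ?p c)"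
    unfolding expectation_Dsum[OF N] by (rule sum_square_pairs[OF finite_ksubsets[OF N]])
  also have "(\<Sum>a\<in>?A. ?p a) + (\<Sum>a\<in>?A. \<Sum>c\<in>{c\<in>?A. a \<noteq> c}. ?g a c) - \<dots> \<le>
      (\<Sum>a\<in>?A. ?p a) + (\<Sum>a\<in>?A. \<Sum>c\<in>{c\<in>?A. a \<noteq> c}. ?g a c - ?p a * ?p c)"
    by (simp add: sum_subtractf sum_nonneg)
  also have "(\<Sum>a\<in>?A. \<Sum>c\<in>{c\<in>?A. a \<noteq> c}. ?g a c - ?p a * ?p c) \<le> W (card N)"
  proof (rule sum_pairs_le[OF N])
    fix a c assume ac: "a \<in> ?A" "c \<in> ?A"
    note [measurable] = hp[OF ac(1)] hp[OF ac(2)] ev_pred[OF ac(1)] ev_pred[OF ac(2)]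
    show "?g a c - ?p a * ?p c \<le> theta ^ (card (a \<union> c) - 1)"
    proof (cases "a \<inter> c = {}")
      case False
      have "?g a c \<le> prob {\<omega>\<in>space M. ev a \<omega> \<and> ev c \<omega>}"
        by (intro finite_measure_mono) (auto dest: hit_imp_ev)
      moreover have "0 \<le> ?p a * ?p c" by simp
      ultimately show ?thesis using prob_ev_overlap_le[OF ac False] by linarith
    next
      case True
      \<comment> \<open>The negative correlation concerns points that belong to neither simplex.
        Away from close pairs nothing is lost by this restriction, since a vertex of one simplex in
        the ball of the other makes the two balls meet.\<close>
      define J where "J = N - a - c"
      have J: "finite J" "a \<inter> J = {}" "c \<inter> J = {}" using N by (auto simp: J_def)
      note [measurable] = hit_pred[OF ac(1) J(1)] hit_pred[OF ac(2) J(1)]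
      have nm[measurable]: "{\<omega>\<in>space M. near a c \<omega>} \<in> events"
        unfolding near_def using ksubsetsD[OF ac(1)] ksubsetsD[OF ac(2)] by measurable
      have sub: "hit b J \<omega>" if "hit b (N - b) \<omega>" "\<not> near a c \<omega>" "ev a \<omega>" "ev c \<omega>"
        "b = a \<and> b' = c \<or> b = c \<and> b' = a" for b b' \<omega>
      proof -
        obtain j where j: "j \<in> N - b" "ball_hit k r (Xs \<omega>) b (X j \<omega>)"
          using \<open>hit b (N - b) \<omega>\<close> by (auto simp: hit_def)
        have "j \<notin> b'"
        proof
          assume jb: "j \<in> b'"
          obtain i where i: "i \<in> b" "dist (crit_center k r (Xs \<omega> ` b)) (X j \<omega>) \<le> dist (crit_center k r (Xs \<omega> ` b)) (X i \<omega>)"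
            using j(2) by (auto simp: ball_hit_def)
          have "dist (crit_center k r (Xs \<omega> ` b)) (crit_center k r (Xs \<omega> ` b')) \<le>
             dist (crit_center k r (Xs \<omega> ` b)) (X i \<omega>) + dist (crit_center k r (Xs \<omega> ` b')) (X j \<omega>)"
            using i(2) dist_triangle2[of "crit_center k r (Xs \<omega> ` b)" "crit_center k r (Xs \<omega> ` b')" "X j \<omega>"] by linarith
          then have "near a c \<omega>"
            using that(3-5) i(1) jb unfolding near_def by (metis add.commute dist_commute)
          then show False using that by simp
        qed
        then show ?thesis using j that(5) unfolding hit_def J_def by blast
      qed
      have "?g a c \<le> prob ({\<omega>\<in>space M. hit a J \<omega> \<and> hit c J \<omega> \<and> \<not> near a c \<omega>} \<union> {\<omega>\<in>space M. near a c \<omega>})"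
      proof (rule finite_measure_mono)
        show "{\<omega>\<in>space M. ?h a \<omega> \<and> ?h c \<omega>} \<subseteq>
          {\<omega>\<in>space M. hit a J \<omega> \<and> hit c J \<omega> \<and> \<not> near a c \<omega>} \<union> {\<omega>\<in>space M. near a c \<omega>}"
          using sub[of a _ c] sub[of c _ a] hit_imp_ev by auto
        have "{\<omega>\<in>space M. hit a J \<omega> \<and> hit c J \<omega> \<and> \<not> near a c \<omega>} =
          {\<omega>\<in>space M. hit a J \<omega> \<and> hit c J \<omega>} - {\<omega>\<in>space M. near a c \<omega>}" by auto
        then have "{\<omega>\<in>space M. hit a J \<omega> \<and> hit c J \<omega> \<and> \<not> near a c \<omega>} \<in> events" using nm by simp
        then show "{\<omega>\<in>space M. hit a J \<omega> \<and> hit c J \<omega> \<and> \<not> near a c \<omega>} \<union> {\<omega>\<in>space M. near a c \<omega>} \<in> events"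
          using nm by simp
      qed
      also have "\<dots> \<le> prob {\<omega>\<in>space M. hit a J \<omega> \<and> hit c J \<omega> \<and> \<not> near a c \<omega>} + prob {\<omega>\<in>space M. near a c \<omega>}"
      proof (rule measure_Un_le)
        have "{\<omega>\<in>space M. hit a J \<omega> \<and> hit c J \<omega> \<and> \<not> near a c \<omega>} =
          {\<omega>\<in>space M. hit a J \<omega> \<and> hit c J \<omega>} - {\<omega>\<in>space M. near a c \<omega>}" by auto
        then show "{\<omega>\<in>space M. hit a J \<omega> \<and> hit c J \<omega> \<and> \<not> near a c \<omega>} \<in> events" using nm by simp
      qed (rule nm)
      also have "\<dots> \<le> prob {\<omega>\<in>space M. hit a J \<omega>} * prob {\<omega>\<in>space M. hit c J \<omega>} + theta ^ (2 * k + 1)"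
        by (intro add_mono prob_hit_far_le[OF ac True J] prob_near_le[OF ac True])
      \<comment> \<open>Restoring the points that were left out of \<open>J\<close> can only
        increase the hitting probabilities.\<close>
      also have "\<dots> \<le> ?p a * ?p c + theta ^ (2 * k + 1)"
      proof -
        have "prob {\<omega>\<in>space M. hit b J \<omega>} \<le> ?p b" if "b \<in> ?A" "b = a \<or> b = c" for b
        proof (rule finite_measure_mono)
          show "{\<omega>\<in>space M. ?h b \<omega>} \<in> events" using hp[OF that(1)] by (simp add: pred_def)
          show "{\<omega>\<in>space M. hit b J \<omega>} \<subseteq> {\<omega>\<in>space M. ?h b \<omega>}" using that(2) by (auto simp: hit_def J_def)
        qed
        then show ?thesis using ac by (intro add_right_mono mult_mono) auto
      qed
      finally show ?thesis using card_union_ksubsets(3)[OF ac True] by simp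
    qed
  qed
  also have "(\<Sum>a\<in>?A. ?p a) \<le> W (card N)" by (rule sum_prob_hit_le[OF N])
  finally show ?thesis by simp
qed

lemma Dsum_deviation:
  assumes N: "finite N"
  shows "expectation (\<lambda>\<omega>. \<bar>Dsum N \<omega> - expectation (Dsum N)\<bar>) \<le> sqrt (2 * W (card N))"
proof -
  note [measurable] = Dsum_meas[OF N]
  have bd: "\<bar>Dsum N \<omega>\<bar> \<le> real (card (ksubsets k N))" for \<omega>
    using Dsum_bounds[of N \<omega>] Ssum_bounds[of N \<omega>] N by linarith
  let ?C = "real (card (ksubsets k N)) + \<bar>expectation (Dsum N)\<bar>"
  have bd': "\<bar>Dsum N \<omega> - expectation (Dsum N)\<bar> \<le> ?C" for \<omega> using bd[of \<omega>] by linarith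
  have "integrable M (\<lambda>\<omega>. Dsum N \<omega> - expectation (Dsum N))"
    by (rule integrable_bounded[where C = ?C]) (use bd' in auto)
  moreover have "integrable M (\<lambda>\<omega>. (Dsum N \<omega> - expectation (Dsum N))\<^sup>2)"
    by (rule integrable_bounded[where C = "?C\<^sup>2"])
      (use power_mono[OF bd' abs_ge_zero, of _ 2] in auto)
  ultimately show ?thesis
    using expectation_abs_le_sqrt variance_Dsum[OF N] by (meson order_trans real_sqrt_le_mono)
qed

text \<open>The neighbours of \<open>a\<close> are the index sets that meet it; all others use
  disjoint coordinates. The two sums of \<open>dissociated_char_bound\<close> are bounded by
  \<open>W'\<close> and \<open>W\<close>.\<close>

lemma Ssum_char:
  assumes N: "finite N"
  shows "cmod ((CLINT \<omega>|M. cis (t * Ssum N \<omega>)) - exp (of_real (lam N) * (cis t - 1))) \<le>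
     t\<^sup>2 * (W' (card N) + W (card N)) * exp (lam N * t\<^sup>2 / 2)"
proof -
  let ?A = "ksubsets k N" and ?p = "\<lambda>a. prob {\<omega>\<in>space M. ev a \<omega>}"
  let ?nb = "\<lambda>a. {c\<in>?A. a \<inter> c \<noteq> {}}"
  let ?I = "\<lambda>a \<omega>. of_bool (ev a \<omega>) :: real"
  have pe: "expectation (?I a) = ?p a" if "a \<in> ?A" for a using expectation_of_bool ev_pred[OF that] by blast
  have le: "lam N = (\<Sum>a\<in>?A. expectation (?I a))" unfolding lam_def using pe by simp
  define b where "b = (\<Sum>a\<in>?A. \<Sum>c\<in>?nb a. expectation (?I a) * expectation (?I c)) +
       (\<Sum>a\<in>?A. \<Sum>c\<in>?nb a - {a}. expectation (\<lambda>\<omega>. ?I a \<omega> * ?I c \<omega>))"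
  have "cmod ((CLINT \<omega>|M. cis (t * Ssum N \<omega>)) - exp (of_real (lam N) * (cis t - 1))) \<le> t\<^sup>2 * b * exp (lam N * t\<^sup>2 / 2)"
    unfolding b_def le Ssum_def
  proof (rule dissociated_char_bound)
    show "finite ?A" using finite_ksubsets[OF N] .
    fix a assume a: "a \<in> ?A"
    note da = ksubsetsD[OF a]
    show "?I a \<in> borel_measurable M" using ev_pred[OF a] by measurable
    show "a \<in> ?nb a" "?nb a \<subseteq> ?A" using a da by auto
    show "indep_var borel (?I a) borel (\<lambda>\<omega>. \<Sum>c\<in>?A - ?nb a. ?I c \<omega>)"
    proof (rule indep_var_cong_fun)
      have sub: "c \<subseteq> - a" "finite c" "card c = k + 1" if "c \<in> ?A - ?nb a" for c
        using that ksubsetsD(1,2)[of c k N] by auto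
      have pr: "(\<lambda>x. of_bool (crit_simplex k r (x ` c)) :: real) \<in> borel_measurable (PiM J (\<lambda>_. borel :: 'b measure))"
        if "c \<subseteq> J" "finite c" "card c = k + 1" for c J :: "nat set"
      proof -
        have "Measurable.pred (PiM J (\<lambda>_. borel :: 'b measure)) (\<lambda>x. crit_simplex k r (x ` c))"
          using measurable_crit_simplex[OF that(2,3,1), of r] by (simp add: pred_def)
        then show ?thesis by measurable
      qed
      have "indep_var (PiM a (\<lambda>_. borel)) (\<lambda>\<omega>. restrict (Xs \<omega>) a) (PiM (- a) (\<lambda>_. borel)) (\<lambda>\<omega>. restrict (Xs \<omega>) (- a))"
        using indep_var_restrict[OF indep, of a "- a"] by simp
      then show "indep_var borel ((\<lambda>x. of_bool (crit_simplex k r (x ` a)) :: real) \<circ> (\<lambda>\<omega>. restrict (Xs \<omega>) a))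
        borel ((\<lambda>x. \<Sum>c\<in>?A - ?nb a. of_bool (crit_simplex k r (x ` c)) :: real) \<circ> (\<lambda>\<omega>. restrict (Xs \<omega>) (- a)))"
        by (rule indep_var_compose) (use da sub in \<open>auto intro!: borel_measurable_sum pr\<close>)
      show "(\<lambda>x. of_bool (crit_simplex k r (x ` a)) :: real) \<circ> (\<lambda>\<omega>. restrict (Xs \<omega>) a) = ?I a"
        by (auto simp: ev_def fun_eq_iff)
      show "(\<lambda>x. \<Sum>c\<in>?A - ?nb a. of_bool (crit_simplex k r (x ` c)) :: real) \<circ> (\<lambda>\<omega>. restrict (Xs \<omega>) (- a)) =
        (\<lambda>\<omega>. \<Sum>c\<in>?A - ?nb a. ?I c \<omega>)"
      proof
        fix \<omega>
        have "restrict (Xs \<omega>) (- a) ` c = Xs \<omega> ` c" if "c \<in> ?A - ?nb a" for c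
          using sub(1)[OF that] by (intro image_cong) auto
        then show "((\<lambda>x. \<Sum>c\<in>?A - ?nb a. of_bool (crit_simplex k r (x ` c)) :: real) \<circ> (\<lambda>\<omega>. restrict (Xs \<omega>) (- a))) \<omega> =
          (\<Sum>c\<in>?A - ?nb a. ?I c \<omega>)" unfolding comp_def ev_def by (intro sum.cong) simp_all
      qed
    qed (rule prob_space_axioms)
  qed auto
  also have "\<dots> \<le> t\<^sup>2 * (W' (card N) + W (card N)) * exp (lam N * t\<^sup>2 / 2)"
  proof (intro mult_right_mono mult_left_mono)
    have "(\<Sum>a\<in>?A. \<Sum>c\<in>?nb a. expectation (?I a) * expectation (?I c)) \<le> (\<Sum>a\<in>?A. \<Sum>c\<in>?nb a. theta ^ (2 * k))"
    proof (intro sum_mono)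
      fix a c assume ac: "a \<in> ?A" "c \<in> ?nb a"
      then have "c \<in> ?A" by simp
      have "?p a * ?p c \<le> theta ^ k * theta ^ k"
        using theta_nonneg by (intro mult_mono prob_ev_le[OF ac(1)] prob_ev_le[OF \<open>c \<in> ?A\<close>]) auto
      then show "expectation (?I a) * expectation (?I c) \<le> theta ^ (2 * k)"
        using pe[OF ac(1)] pe[OF \<open>c \<in> ?A\<close>] by (simp add: power_add[symmetric] mult_2)
    qed
    also have "\<dots> \<le> W' (card N)" unfolding W'_def
      by (rule pair_sum_bound[OF N, where F = "\<lambda>_. theta ^ (2 * k)"])
        (use card_union_ksubsets theta_nonneg in auto)
    finally have 1: "(\<Sum>a\<in>?A. \<Sum>c\<in>?nb a. expectation (?I a) * expectation (?I c)) \<le> W' (card N)" .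
    \<comment> \<open>The inner sum is extended by zeros to all index sets different from
      \<open>a\<close>, the form treated by \<open>sum_pairs_le\<close>.\<close>
    have "(\<Sum>a\<in>?A. \<Sum>c\<in>?nb a - {a}. expectation (\<lambda>\<omega>. ?I a \<omega> * ?I c \<omega>)) \<le>
      (\<Sum>a\<in>?A. \<Sum>c\<in>{c\<in>?A. a \<noteq> c}. if a \<inter> c = {} then 0 else prob {\<omega>\<in>space M. ev a \<omega> \<and> ev c \<omega>})"
    proof (intro sum_mono order.trans[OF sum_mono sum_mono2])
      fix a c assume ac: "a \<in> ?A" "c \<in> ?nb a - {a}"
      then have "Measurable.pred M (\<lambda>\<omega>. ev a \<omega> \<and> ev c \<omega>)" using ev_pred[of a N] ev_pred[of c N] by auto
      then show "expectation (\<lambda>\<omega>. ?I a \<omega> * ?I c \<omega>) \<le> (if a \<inter> c = {} then 0 else prob {\<omega>\<in>space M. ev a \<omega> \<and> ev c \<omega>})"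
        using ac expectation_of_bool[of "\<lambda>\<omega>. ev a \<omega> \<and> ev c \<omega>"] by (simp add: of_bool_conj)
    qed (use finite_ksubsets[OF N] in auto)
    also have "\<dots> \<le> W (card N)"
      using prob_ev_overlap_le theta_nonneg by (intro sum_pairs_le[OF N]) auto
    finally show "b \<le> W' (card N) + W (card N)" unfolding b_def using 1 by linarith
  qed auto
  finally show ?thesis .
qed

end


section \<open>Continuity of translations in L^1\<close>

lemma lborel_shift:
  fixes f :: "'a::euclidean_space \<Rightarrow> real"
  assumes "integrable lborel f"
  shows lborel_integrable_shift: "integrable lborel (\<lambda>x. f (x + h))"
    and lborel_integral_shift: "(\<integral>x. f (x + h) \<partial>lborel) = (\<integral>x. f x \<partial>lborel)"
proof -
  have d: "distr lborel borel (\<lambda>x. x + h) = (lborel :: 'a measure)"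
  proof -
    have "(\<lambda>x. x + h) = (+) h" by (auto simp: add.commute)
    then show ?thesis using lborel_distr_plus[of h] by simp
  qed
  have fm: "f \<in> borel_measurable borel" using borel_measurable_integrable[OF assms] by simp
  have "integrable (distr lborel borel (\<lambda>x. x + h)) f" using assms by (simp only: d)
  then show "integrable lborel (\<lambda>x. f (x + h))" by (rule integrable_distr[rotated]) measurable
  have "(\<integral>x. f x \<partial>distr lborel borel (\<lambda>x. x + h)) = (\<integral>x. f (x + h) \<partial>lborel)"
    by (rule integral_distr) (use fm in measurable)
  then show "(\<integral>x. f (x + h) \<partial>lborel) = (\<integral>x. f x \<partial>lborel)" by (simp only: d)
qed

text \<open>Translation is an isometry of L^1, so the functions with this continuity form a closed
  set.\<close>

lemma L1_translation_approx:
  fixes f :: "'a::euclidean_space \<Rightarrow> real" and h :: "nat \<Rightarrow> 'a"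
  assumes f: "integrable lborel f"
    and g: "\<And>e. 0 < e \<Longrightarrow> \<exists>g. integrable lborel g \<and> (\<integral>x. \<bar>f x - g x\<bar> \<partial>lborel) < e \<and>
       (\<lambda>n. \<integral>x. \<bar>g (x + h n) - g x\<bar> \<partial>lborel) \<longlonglongrightarrow> 0"
  shows "(\<lambda>n. \<integral>x. \<bar>f (x + h n) - f x\<bar> \<partial>lborel) \<longlonglongrightarrow> 0"
proof (rule LIMSEQ_I)
  fix e :: real assume e: "0 < e"
  obtain g where g: "integrable lborel g" "(\<integral>x. \<bar>f x - g x\<bar> \<partial>lborel) < e / 4"
    "(\<lambda>n. \<integral>x. \<bar>g (x + h n) - g x\<bar> \<partial>lborel) \<longlonglongrightarrow> 0" using g[of "e / 4"] e by auto
  obtain n0 where n0: "\<And>n. n0 \<le> n \<Longrightarrow> norm ((\<integral>x. \<bar>g (x + h n) - g x\<bar> \<partial>lborel) - 0) < e / 2"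
    using LIMSEQ_D[OF g(3), of "e / 2"] e by auto
  have d: "integrable lborel (\<lambda>x. \<bar>f x - g x\<bar>)" using f g by auto
  show "\<exists>n0. \<forall>n\<ge>n0. norm ((\<integral>x. \<bar>f (x + h n) - f x\<bar> \<partial>lborel) - 0) < e"
  proof (intro exI[of _ n0] allI impI)
    fix n assume n: "n0 \<le> n"
    note fh = lborel_integrable_shift[OF f, of "h n"] and gh = lborel_integrable_shift[OF g(1), of "h n"]
      and dh = lborel_integrable_shift[OF d, of "h n"]
    have "(\<integral>x. \<bar>f (x + h n) - f x\<bar> \<partial>lborel) \<le>
      (\<integral>x. (\<bar>f (x + h n) - g (x + h n)\<bar> + \<bar>g (x + h n) - g x\<bar>) + \<bar>f x - g x\<bar> \<partial>lborel)"
      using f g fh gh dh d by (intro integral_mono) auto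
    also have "\<dots> = (\<integral>x. \<bar>f (x + h n) - g (x + h n)\<bar> \<partial>lborel) + (\<integral>x. \<bar>g (x + h n) - g x\<bar> \<partial>lborel) + (\<integral>x. \<bar>f x - g x\<bar> \<partial>lborel)"
      using f g fh gh dh d by simp
    also have "(\<integral>x. \<bar>f (x + h n) - g (x + h n)\<bar> \<partial>lborel) = (\<integral>x. \<bar>f x - g x\<bar> \<partial>lborel)"
      using lborel_integral_shift[OF d, of "h n"] .
    finally have "(\<integral>x. \<bar>f (x + h n) - f x\<bar> \<partial>lborel) < e" using g(2) n0[OF n] by auto
    then show "norm ((\<integral>x. \<bar>f (x + h n) - f x\<bar> \<partial>lborel) - 0) < e" by simp
  qed
qed

text \<open>For indicators the distance is twice the measure of \<open>U\<close> minus twice that of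
  the overlap. On the open set \<open>U\<close> the shifted indicator is eventually 1 at each point,
  and off \<open>U\<close> the product vanishes.\<close>

lemma L1_translation_open:
  fixes U :: "'a::euclidean_space set"
  assumes U: "open U" "emeasure lborel U < \<infinity>" and h: "h \<longlonglongrightarrow> 0"
  shows "(\<lambda>n. \<integral>x. \<bar>indicator U (x + h n) - indicator U x :: real\<bar> \<partial>lborel) \<longlonglongrightarrow> 0"
proof -
  have i: "integrable lborel (indicator U :: 'a \<Rightarrow> real)" using U by (intro integrable_real_indicator) auto
  have ih: "integrable lborel (\<lambda>x. indicator U (x + h n) :: real)" for n by (rule lborel_integrable_shift[OF i])
  have im: "integrable lborel (\<lambda>x. indicator U (x + h n) * indicator U x :: real)" for n
    using integrable_mult_indicator[of U lborel "\<lambda>x. indicator U (x + h n) :: real"] ih U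
    by (simp add: mult.commute)
  have "(\<lambda>n. \<integral>x. indicator U (x + h n) * indicator U x \<partial>lborel) \<longlonglongrightarrow> (\<integral>x. (indicator U x :: real) \<partial>lborel)"
  proof (rule integral_dominated_convergence)
    show "AE x in lborel. (\<lambda>n. indicator U (x + h n) * indicator U x :: real) \<longlonglongrightarrow> indicator U x"
    proof (rule AE_I2, cases)
      fix x assume x: "x \<in> U"
      have "(\<lambda>n. x + h n) \<longlonglongrightarrow> x" using tendsto_add[OF tendsto_const h, of x] by simp
      then have "eventually (\<lambda>n. x + h n \<in> U) sequentially" using U(1) x by (rule topological_tendstoD)
      then have "eventually (\<lambda>n. indicator U (x + h n) * indicator U x = (indicator U x :: real)) sequentially"
        by eventually_elim (simp add: indicator_def)
      then show "(\<lambda>n. indicator U (x + h n) * indicator U x :: real) \<longlonglongrightarrow> indicator U x"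
        by (rule tendsto_eventually)
    qed simp
    show "AE x in lborel. norm (indicator U (x + h n) * indicator U x :: real) \<le> indicator U x" for n
      by (auto simp: indicator_def)
    show "(\<lambda>x. indicator U (x + h n) * indicator U x :: real) \<in> borel_measurable lborel" for n
      using im by auto
  qed (use i in auto)
  then have "(\<lambda>n. 2 * (\<integral>x. (indicator U x :: real) \<partial>lborel) - 2 * (\<integral>x. indicator U (x + h n) * indicator U x \<partial>lborel)) \<longlonglongrightarrow>
     2 * (\<integral>x. (indicator U x :: real) \<partial>lborel) - 2 * (\<integral>x. (indicator U x :: real) \<partial>lborel)"
    by (intro tendsto_intros)
  moreover have "(\<integral>x. \<bar>indicator U (x + h n) - indicator U x :: real\<bar> \<partial>lborel) =
     2 * (\<integral>x. (indicator U x :: real) \<partial>lborel) - 2 * (\<integral>x. indicator U (x + h n) * indicator U x \<partial>lborel)" for n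
  proof -
    have "(\<integral>x. \<bar>indicator U (x + h n) - indicator U x :: real\<bar> \<partial>lborel) =
      (\<integral>x. (indicator U (x + h n) + indicator U x) - 2 * (indicator U (x + h n) * indicator U x) \<partial>lborel)"
      by (intro Bochner_Integration.integral_cong) (auto simp: indicator_def)
    also have "\<dots> = (\<integral>x. indicator U (x + h n) \<partial>lborel) + (\<integral>x. indicator U x \<partial>lborel)
        - 2 * (\<integral>x. indicator U (x + h n) * indicator U x \<partial>lborel)"
      using i ih im
      by (subst Bochner_Integration.integral_diff; (subst Bochner_Integration.integral_add)?) auto
    finally show ?thesis using lborel_integral_shift[OF i, of "h n"] by simp
  qed
  ultimately show ?thesis by simp
qed

text \<open>Outer regularity leads from open sets to Borel sets of finite measure, linearity and
  approximation from there to all integrable functions. In the limit of the means this plays the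
  part that continuity of the density would play.\<close>

lemma L1_translation:
  fixes f :: "'a::euclidean_space \<Rightarrow> real"
  assumes f: "integrable lborel f" and h: "h \<longlonglongrightarrow> 0"
  shows "(\<lambda>n. \<integral>x. \<bar>f (x + h n) - f x\<bar> \<partial>lborel) \<longlonglongrightarrow> 0"
  using f
proof (induction f rule: integrable_induct)
  case (base A c)
  have A: "A \<in> sets borel" "emeasure lborel A < \<infinity>" using base by auto
  have iA: "integrable lborel (indicator A :: 'a \<Rightarrow> real)" using A by (intro integrable_real_indicator) auto
  have "(\<lambda>n. \<integral>x. \<bar>indicator A (x + h n) - indicator A x :: real\<bar> \<partial>lborel) \<longlonglongrightarrow> 0"
  proof (rule L1_translation_approx[OF iA])
    fix e :: real assume e: "0 < e"
    obtain U where U: "open U" "A \<subseteq> U" "emeasure lborel (U - A) < e"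
      using outer_regular_lborel[OF A(1) e] .
    have Ufin: "emeasure lborel U < \<infinity>"
    proof -
      have "emeasure lborel U \<le> emeasure lborel A + emeasure lborel (U - A)"
        using emeasure_subadditive[of A lborel "U - A"] A(1) U by (simp add: Un_absorb1)
      also have "\<dots> < \<infinity>" using A(2) U(3) by (auto simp: less_top[symmetric] ennreal_add_eq_top)
      finally show ?thesis .
    qed
    have UA: "emeasure lborel (U - A) < \<infinity>" by (rule less_trans[OF U(3)]) simp
    have "(\<integral>x. \<bar>indicator A x - indicator U x :: real\<bar> \<partial>lborel) = (\<integral>x. indicator (U - A) x \<partial>lborel)"
      using U(2) by (intro Bochner_Integration.integral_cong) (auto simp: indicator_def)
    also have "\<dots> = measure lborel (U - A)" using A(1) U(1) UA by simp
    also have "\<dots> < e" using U(3) e UA by (simp add: measure_def enn2real_less_iff)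
    finally have "(\<integral>x. \<bar>indicator A x - indicator U x :: real\<bar> \<partial>lborel) < e" .
    moreover have "integrable lborel (indicator U :: 'a \<Rightarrow> real)"
      using U(1) Ufin by (intro integrable_real_indicator) auto
    ultimately show "\<exists>g. integrable lborel g \<and> (\<integral>x. \<bar>indicator A x - g x\<bar> \<partial>lborel) < e \<and>
       (\<lambda>n. \<integral>x. \<bar>g (x + h n) - g x\<bar> \<partial>lborel) \<longlonglongrightarrow> 0"
      using L1_translation_open[OF U(1) Ufin h] by blast
  qed
  then have "(\<lambda>n. \<bar>c\<bar> * (\<integral>x. \<bar>indicator A (x + h n) - indicator A x :: real\<bar> \<partial>lborel)) \<longlonglongrightarrow> \<bar>c\<bar> * 0"
    by (intro tendsto_intros)
  moreover have "\<bar>c\<bar> * (\<integral>x. \<bar>indicator A (x + h n) - indicator A x :: real\<bar> \<partial>lborel) =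
     (\<integral>x. \<bar>indicator A (x + h n) *\<^sub>R c - indicator A x *\<^sub>R c\<bar> \<partial>lborel)" for n
    unfolding integral_mult_right_zero[symmetric]
    by (intro Bochner_Integration.integral_cong) (auto simp: abs_mult[symmetric] algebra_simps)
  ultimately show ?case by simp
next
  case (add f g)
  have lim: "(\<lambda>n. (\<integral>x. \<bar>f (x + h n) - f x\<bar> \<partial>lborel) + (\<integral>x. \<bar>g (x + h n) - g x\<bar> \<partial>lborel)) \<longlonglongrightarrow> 0"
    using tendsto_add[OF add.IH] by simp
  have ub: "(\<integral>x. \<bar>(f (x + h n) + g (x + h n)) - (f x + g x)\<bar> \<partial>lborel) \<le>
    (\<integral>x. \<bar>f (x + h n) - f x\<bar> \<partial>lborel) + (\<integral>x. \<bar>g (x + h n) - g x\<bar> \<partial>lborel)" for n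
  proof -
    note fh = lborel_integrable_shift[OF add.hyps(1), of "h n"] and gh = lborel_integrable_shift[OF add.hyps(2), of "h n"]
    have "(\<integral>x. \<bar>(f (x + h n) + g (x + h n)) - (f x + g x)\<bar> \<partial>lborel) \<le>
      (\<integral>x. \<bar>f (x + h n) - f x\<bar> + \<bar>g (x + h n) - g x\<bar> \<partial>lborel)"
      using add.hyps fh gh by (intro integral_mono) auto
    then show ?thesis using add.hyps fh gh by simp
  qed
  show ?case
    by (rule tendsto_sandwich[OF always_eventually always_eventually tendsto_const lim])
      (use ub in \<open>simp_all add: Bochner_Integration.integral_nonneg\<close>)
next
  case (lim f s)
  show ?case
  proof (rule L1_translation_approx[OF lim.hyps(4)])
    fix e :: real assume e: "0 < e"
    have "(\<lambda>i. \<integral>x. \<bar>f x - s i x\<bar> \<partial>lborel) \<longlonglongrightarrow> (\<integral>x. 0 \<partial>(lborel :: 'a measure))"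
    \<comment> \<open>The approximants are bounded by twice the modulus of \<open>f\<close>, whence
      the factor 3.\<close>
    proof (rule integral_dominated_convergence[where w = "\<lambda>x. 3 * \<bar>f x\<bar>"])
      show "AE x in lborel. (\<lambda>i. \<bar>f x - s i x\<bar>) \<longlonglongrightarrow> 0"
      proof (rule AE_I2)
        fix x :: 'a
        have "(\<lambda>i. \<bar>f x - s i x\<bar>) \<longlonglongrightarrow> \<bar>f x - f x\<bar>" using lim.hyps(2)[of x] by (intro tendsto_intros) auto
        then show "(\<lambda>i. \<bar>f x - s i x\<bar>) \<longlonglongrightarrow> 0" by simp
      qed
      have "\<bar>f x - s i x\<bar> \<le> 3 * \<bar>f x\<bar>" for i x using lim.hyps(3)[of x i] by (simp add: abs_if split: if_splits)
      then show "AE x in lborel. norm \<bar>f x - s i x\<bar> \<le> 3 * \<bar>f x\<bar>" for i by auto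
    qed (use lim.hyps(1,4) in auto)
    then obtain i where "norm ((\<integral>x. \<bar>f x - s i x\<bar> \<partial>lborel) - 0) < e"
      using LIMSEQ_D[of _ _ e] e by fastforce
    then show "\<exists>g. integrable lborel g \<and> (\<integral>x. \<bar>f x - g x\<bar> \<partial>lborel) < e \<and>
       (\<lambda>n. \<integral>x. \<bar>g (x + h n) - g x\<bar> \<partial>lborel) \<longlonglongrightarrow> 0"
      using lim.hyps(1) lim.IH by (intro exI[of _ "s i"]) auto
  qed
qed

section \<open>Densities and affine substitution on finite products\<close>

text \<open>Checked on boxes, where both sides split into integrals over the single factors.\<close>

lemma PiM_density:
  fixes f :: "'a::euclidean_space \<Rightarrow> real"
  assumes I: "finite I" and f: "f \<in> borel_measurable borel" "\<And>x. 0 \<le> f x"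
    and prob: "(\<integral>\<^sup>+x. ennreal (f x) \<partial>lborel) = 1"
  shows "PiM I (\<lambda>_. density lborel (\<lambda>x. ennreal (f x))) = density (PiM I (\<lambda>_. lborel)) (\<lambda>x. ennreal (\<Prod>i\<in>I. f (x i)))"
proof -
  let ?D = "density lborel (\<lambda>x. ennreal (f x)) :: 'a measure"
  interpret D: prob_space ?D
    using f prob by (intro prob_spaceI) (simp add: emeasure_density)
  interpret PD: product_sigma_finite "\<lambda>_. ?D" by standard
  interpret PL: product_sigma_finite "\<lambda>_. lborel :: 'a measure" by standard
  note [measurable] = f(1)
  show ?thesis
  proof (rule PD.PiM_eqI[symmetric, OF I])
    show "sets (density (PiM I (\<lambda>_. lborel)) (\<lambda>x. ennreal (\<Prod>i\<in>I. f (x i)))) = sets (PiM I (\<lambda>_. ?D))"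
      by (auto intro!: sets_PiM_cong)
    fix A :: "_ \<Rightarrow> 'a set" assume A: "\<And>i. i \<in> I \<Longrightarrow> A i \<in> sets ?D"
    have [measurable]: "(\<lambda>x. ennreal (\<Prod>i\<in>I. f (x i))) \<in> borel_measurable (PiM I (\<lambda>_. lborel))"
      by measurable
    have AS: "PiE I A \<in> sets (PiM I (\<lambda>_. lborel))" using A by (intro sets_PiM_I_finite I) auto
    have "emeasure (density (PiM I (\<lambda>_. lborel)) (\<lambda>x. ennreal (\<Prod>i\<in>I. f (x i)))) (PiE I A) =
      (\<integral>\<^sup>+x. ennreal (\<Prod>i\<in>I. f (x i)) * indicator (PiE I A) x \<partial>PiM I (\<lambda>_. lborel))"
      using AS by (simp add: emeasure_density)
    also have "\<dots> = (\<integral>\<^sup>+x. (\<Prod>i\<in>I. ennreal (f (x i)) * indicator (A i) (x i)) \<partial>PiM I (\<lambda>_. lborel))"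
    proof (rule nn_integral_cong)
      fix x assume "x \<in> space (PiM I (\<lambda>_. lborel :: 'a measure))"
      then have "indicator (PiE I A) x = (\<Prod>i\<in>I. indicator (A i) (x i) :: ennreal)"
        using I by (auto simp: indicator_def PiE_iff space_PiM prod_zero_iff)
      then show "ennreal (\<Prod>i\<in>I. f (x i)) * indicator (PiE I A) x = (\<Prod>i\<in>I. ennreal (f (x i)) * indicator (A i) (x i))"
        using f(2) by (simp add: prod.distrib prod_ennreal)
    qed
    also have "\<dots> = (\<Prod>i\<in>I. \<integral>\<^sup>+x. ennreal (f x) * indicator (A i) x \<partial>lborel)"
      using A by (intro PL.product_nn_integral_prod I) auto
    also have "\<dots> = (\<Prod>i\<in>I. emeasure ?D (A i))"
      using A by (intro prod.cong) (auto simp: emeasure_density)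
    finally show "emeasure (density (PiM I (\<lambda>_. lborel)) (\<lambda>x. ennreal (\<Prod>i\<in>I. f (x i)))) (PiE I A) = (\<Prod>i\<in>I. emeasure ?D (A i))" .
  qed
qed

text \<open>Each of the \<open>card I\<close> coordinates contributes the Jacobian
  \<open>r ^ DIM('a)\<close>; again boxes suffice.\<close>

lemma nn_integral_PiM_affine:
  fixes g :: "('i \<Rightarrow> 'a::euclidean_space) \<Rightarrow> ennreal"
  assumes I: "finite I" and r: "0 < r" and g: "g \<in> borel_measurable (PiM I (\<lambda>_. lborel))"
  shows "(\<integral>\<^sup>+x. g x \<partial>PiM I (\<lambda>_. lborel)) =
    ennreal (r ^ (DIM('a) * card I)) * (\<integral>\<^sup>+u. g (\<lambda>i\<in>I. z + r *\<^sub>R u i) \<partial>PiM I (\<lambda>_. lborel))"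
proof -
  let ?L = "PiM I (\<lambda>_. lborel :: 'a measure)"
  let ?T = "\<lambda>u. \<lambda>i\<in>I. z + r *\<^sub>R u i"
  interpret PL: product_sigma_finite "\<lambda>_. lborel :: 'a measure" by standard
  have T[measurable]: "?T \<in> ?L \<rightarrow>\<^sub>M ?L" by (intro measurable_restrict) measurable
  have eq: "density (distr ?L ?L ?T) (\<lambda>_. ennreal (r ^ (DIM('a) * card I))) = ?L"
  proof (rule PL.PiM_eqI[OF I])
    fix A :: "_ \<Rightarrow> 'a set" assume A: "\<And>i. i \<in> I \<Longrightarrow> A i \<in> sets lborel"
    have AS: "PiE I A \<in> sets ?L" using A by (intro sets_PiM_I_finite I) auto
    have one: "ennreal (r ^ DIM('a)) * emeasure lborel ((\<lambda>u. z + r *\<^sub>R u) -` C) = emeasure lborel C" if "C \<in> sets lborel" for C :: "'a set"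
    proof -
      have "emeasure lborel C = emeasure (density (distr lborel borel (\<lambda>x. z + r *\<^sub>R x)) (\<lambda>_. ennreal (\<bar>r\<bar> ^ DIM('a)))) C"
        using lborel_affine[of r z] r by simp
      also have "\<dots> = ennreal (r ^ DIM('a)) * emeasure lborel ((\<lambda>u. z + r *\<^sub>R u) -` C)"
        using that r by (simp add: emeasure_density nn_integral_cmult_indicator emeasure_distr)
      finally show ?thesis ..
    qed
    have "emeasure (density (distr ?L ?L ?T) (\<lambda>_. ennreal (r ^ (DIM('a) * card I)))) (PiE I A) =
       ennreal (r ^ (DIM('a) * card I)) * emeasure ?L (?T -` PiE I A \<inter> space ?L)"
      using AS by (simp add: emeasure_density nn_integral_cmult_indicator emeasure_distr)
    also have "?T -` PiE I A \<inter> space ?L = PiE I (\<lambda>i. (\<lambda>u. z + r *\<^sub>R u) -` A i)"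
      by (auto simp: space_PiM PiE_iff extensional_def)
    also have "emeasure ?L \<dots> = (\<Prod>i\<in>I. emeasure lborel ((\<lambda>u. z + r *\<^sub>R u) -` A i))"
    proof (rule PL.emeasure_PiM[OF I])
      fix i assume "i \<in> I"
      have "(\<lambda>u. z + r *\<^sub>R u) \<in> borel \<rightarrow>\<^sub>M borel" by measurable
      from measurable_sets[OF this, of "A i"] A[OF \<open>i \<in> I\<close>] show "(\<lambda>u. z + r *\<^sub>R u) -` A i \<in> sets lborel" by simp
    qed
    also have "ennreal (r ^ (DIM('a) * card I)) * \<dots> = (\<Prod>i\<in>I. ennreal (r ^ DIM('a)) * emeasure lborel ((\<lambda>u. z + r *\<^sub>R u) -` A i))"
      using r by (simp add: prod.distrib power_mult ennreal_power)
    also have "\<dots> = (\<Prod>i\<in>I. emeasure lborel (A i))" using one A by (intro prod.cong) auto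
    finally show "emeasure (density (distr ?L ?L ?T) (\<lambda>_. ennreal (r ^ (DIM('a) * card I)))) (PiE I A) = (\<Prod>i\<in>I. emeasure lborel (A i))" .
  qed simp
  have "(\<integral>\<^sup>+x. g x \<partial>?L) = (\<integral>\<^sup>+x. g x \<partial>density (distr ?L ?L ?T) (\<lambda>_. ennreal (r ^ (DIM('a) * card I))))"
    by (simp only: eq)
  also have "\<dots> = ennreal (r ^ (DIM('a) * card I)) * (\<integral>\<^sup>+u. g (?T u) \<partial>?L)"
    using g by (simp add: nn_integral_density nn_integral_cmult nn_integral_distr)
  finally show ?thesis .
qed


section \<open>The critical configurations at unit scale have positive finite volume\<close>

text \<open>This is the Gram matrix of the edges at a vertex of a regular simplex of side 1. Vectors
  of the form a * b_i + c * (sum of all b_j) over an orthonormal system have Gram matrix a^2 I + (2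
  a c + k c^2) J with J the all-ones matrix, so both coefficients have to be 1/2.\<close>

lemma regular_simplex_vectors:
  assumes k: "1 \<le> k" "k \<le> DIM('a::euclidean_space)"
  obtains y :: "nat \<Rightarrow> 'a::euclidean_space" where "\<And>i j. i < k \<Longrightarrow> j < k \<Longrightarrow> y i \<bullet> y j = (if i = j then 1 else 1 / 2)"
proof -
  obtain C :: "'a set" where C: "C \<subseteq> Basis" "card C = k" using k(2) obtain_subset_with_card_n[of k "Basis :: 'a set"] by metis
  have "finite C" using C(1) finite_Basis finite_subset by blast
  then obtain b where b: "bij_betw b {..<k} C"
    using ex_bij_betw_nat_finite[of C] C(2) by (auto simp: lessThan_atLeast0)
  have bb: "b i \<bullet> b j = (if i = j then 1 else 0)" if "i < k" "j < k" for i j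
  proof -
    have "b i \<in> Basis" "b j \<in> Basis" "b i = b j \<longleftrightarrow> i = j"
      using b that C(1) by (auto simp: bij_betw_def inj_on_def)
    then show ?thesis by (simp add: inner_Basis)
  qed
  define a :: real where "a = sqrt (1 / 2)"
  \<comment> \<open>The positive root of 2 a c + k c^2 = 1/2, found by completing the square: (k c +
    a)^2 = 1/2 + k/2.\<close>
  define c :: real where "c = (sqrt (1 / 2 + real k / 2) - a) / real k"
  define y where "y i = a *\<^sub>R b i + c *\<^sub>R (\<Sum>j<k. b j)" for i
  have a2: "a * a = 1 / 2" unfolding a_def by simp
  have c2: "2 * a * c + real k * c * c = 1 / 2"
  proof -
    have kc: "real k * c = sqrt (1 / 2 + real k / 2) - a" using k by (simp add: c_def)
    have "(real k * c + a) * (real k * c + a) = 1 / 2 + real k / 2" unfolding kc by simp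
    then have "real k * (2 * a * c + real k * c * c) = real k * (1 / 2)"
      using a2 by (simp add: algebra_simps)
    then show ?thesis using k by (simp only: mult_cancel_left) simp
  qed
  show thesis
  proof (rule that)
    fix i j assume ij: "i < k" "j < k"
    have s: "b i \<bullet> (\<Sum>l<k. b l) = 1" if "i < k" for i
      using that by (simp add: inner_sum_right bb)
    have ss: "(\<Sum>l<k. b l) \<bullet> (\<Sum>l<k. b l) = real k"
      unfolding inner_sum_left using s by simp
    have "y i \<bullet> y j = a * a * (b i \<bullet> b j) + (2 * a * c + real k * c * c)"
    proof -
      define D where "D = (\<Sum>l<k. b l)"
      have "b i \<bullet> D = 1" "D \<bullet> b j = 1" "D \<bullet> D = real k"
        using s[OF ij(1)] s[OF ij(2)] ss by (simp_all add: D_def inner_commute)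
      then show ?thesis unfolding y_def D_def[symmetric]
        by (simp add: inner_add_left inner_add_right algebra_simps)
    qed
    then show "y i \<bullet> y j = (if i = j then 1 else 1 / 2)"
      unfolding a2 c2 bb[OF ij] by simp
  qed
qed

lemma sum_square_le:
  fixes v :: "'i \<Rightarrow> real"
  shows "(\<Sum>i\<in>I. \<bar>v i\<bar>)\<^sup>2 \<le> real (card I) * (\<Sum>i\<in>I. (v i)\<^sup>2)"
proof -
  have "(\<Sum>i\<in>I. \<bar>v i\<bar> * 1)\<^sup>2 \<le> (\<Sum>i\<in>I. \<bar>v i\<bar>\<^sup>2) * (\<Sum>i\<in>I. 1\<^sup>2)" by (rule Cauchy_Schwarz_ineq_sum)
  then show ?thesis by (simp add: mult.commute)
qed

text \<open>Perturbation of the regular simplex, whose circumcenter has all barycentric weights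
  equal to 1 / (k + 1). The weights solve a linear system given by the Gram matrix; the matrix stays
  uniformly positive definite, so they move little and remain positive. The bound on
  \<open>eta\<close> is what keeps the total weight error at most half of 1 / (k + 1).\<close>

lemma crit_simplex_near_regular:
  fixes u :: "nat \<Rightarrow> 'a::euclidean_space"
  assumes k: "1 \<le> k" and eta: "0 \<le> eta" "16 * real k ^ 2 * real (k + 1) * eta \<le> 1"
    and G: "\<And>i j. i < k \<Longrightarrow> j < k \<Longrightarrow> \<bar>u i \<bullet> u j - (if i = j then 1 else 1 / 2)\<bar> \<le> eta"
  shows "h1 k u"
proof -
  define G where "G i j = u i \<bullet> u j" for i j
  \<comment> \<open>The origin is adjoined as vertex number \<open>k\<close>.\<close>
  define x where "x i = (if i < k then u i else 0)" for i
  have k1: "1 \<le> real k" using k by simp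
  have k3: "real k \<le> real k ^ 2 * real (k + 1)" 
    using k1 mult_mono[of 1 "real k" 1 "real (k+1)"] mult_left_mono[of 1 "real k * real (k + 1)" "real k"] by (simp add: power2_eq_square mult_ac)
  have ke: "real k * eta \<le> 1 / 16" using mult_right_mono[OF k3 eta(1)] eta(2) by simp
  have e1: "eta \<le> 1 / 16" using ke mult_right_mono[OF k1 eta(1)] by simp
  have sqn: "(norm (\<Sum>i<k. v i *\<^sub>R u i))\<^sup>2 = (\<Sum>i<k. \<Sum>j<k. v i * v j * G i j)" for v
    by (simp add: power2_norm_eq_inner inner_sum_left inner_sum_right G_def mult_ac sum_distrib_left inner_commute)
  \<comment> \<open>For the regular matrix the form is (|v|^2 + (sum v)^2) / 2, hence at least |v|^2
    / 2; the perturbation is at most k * eta * |v|^2, that is at most a sixteenth of |v|^2.\<close>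
  have pd: "(\<Sum>i<k. (v i)\<^sup>2) / 4 \<le> (\<Sum>i<k. \<Sum>j<k. v i * v j * G i j)" for v :: "nat \<Rightarrow> real"
  proof -
    have "(\<Sum>i<k. \<Sum>j<k. v i * v j * (if i = j then 1 else 1 / 2)) =
      (\<Sum>i<k. \<Sum>j<k. v i * v j / 2 + (if i = j then v i * v i / 2 else 0))"
      by (intro sum.cong refl) auto
    also have "\<dots> = (\<Sum>i<k. v i)\<^sup>2 / 2 + (\<Sum>i<k. (v i)\<^sup>2) / 2"
      by (simp add: sum.distrib power2_eq_square sum_product sum_divide_distrib)
    finally have m: "(\<Sum>i<k. (v i)\<^sup>2) / 2 \<le> (\<Sum>i<k. \<Sum>j<k. v i * v j * (if i = j then 1 else 1 / 2))" by simp
    have "\<bar>(\<Sum>i<k. \<Sum>j<k. v i * v j * G i j) - (\<Sum>i<k. \<Sum>j<k. v i * v j * (if i = j then 1 else 1 / 2))\<bar>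
      = \<bar>\<Sum>i<k. \<Sum>j<k. v i * v j * (G i j - (if i = j then 1 else 1 / 2))\<bar>"
      by (simp add: sum_subtractf right_diff_distrib)
    also have "\<dots> \<le> (\<Sum>i<k. \<Sum>j<k. \<bar>v i\<bar> * \<bar>v j\<bar> * eta)"
    proof (intro order.trans[OF sum_abs] sum_mono)
      fix i j assume "i \<in> {..<k}" "j \<in> {..<k}"
      then have "\<bar>G i j - (if i = j then 1 else 1 / 2)\<bar> \<le> eta" using G[of i j] by (simp only: G_def lessThan_iff)
      then show "\<bar>v i * v j * (G i j - (if i = j then 1 else 1 / 2))\<bar> \<le> \<bar>v i\<bar> * \<bar>v j\<bar> * eta"
        unfolding abs_mult by (intro mult_left_mono) auto
    qed
    also have "\<dots> = (\<Sum>i<k. \<bar>v i\<bar>)\<^sup>2 * eta"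
      unfolding power2_eq_square sum_product by (simp add: sum_distrib_right)
    also have "\<dots> \<le> (real k * (\<Sum>i<k. (v i)\<^sup>2)) * eta"
      using sum_square_le[of v "{..<k}"] eta(1) by (intro mult_right_mono) auto
    also have "\<dots> = (real k * eta) * (\<Sum>i<k. (v i)\<^sup>2)" by simp
    also have "\<dots> \<le> (1 / 16) * (\<Sum>i<k. (v i)\<^sup>2)" by (intro mult_right_mono ke sum_nonneg) auto
    finally have "(\<Sum>i<k. \<Sum>j<k. v i * v j * (if i = j then 1 else 1 / 2)) - (\<Sum>i<k. \<Sum>j<k. v i * v j * G i j) \<le> 1 / 16 * (\<Sum>i<k. (v i)\<^sup>2)"
      unfolding abs_le_iff by linarith
    moreover have "0 \<le> (\<Sum>i<k. (v i)\<^sup>2)" by (simp add: sum_nonneg)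
    ultimately show ?thesis using m by linarith
  qed
  have bx: "bary {..k} v x = (\<Sum>i<k. v i *\<^sub>R u i)" for v
    unfolding bary_def x_def by (simp add: lessThan_Suc_atMost[symmetric])
  have sk: "sum v {..k} = sum v {..<k} + v k" for v :: "nat \<Rightarrow> real"
    by (simp add: lessThan_Suc_atMost[symmetric])
  have ind: "aff_indep_family {..k} x"
    unfolding aff_indep_family_def bx[unfolded bary_def]
  proof (intro allI impI ballI)
    fix v i assume v: "sum v {..k} = 0" "(\<Sum>i<k. v i *\<^sub>R u i) = 0" and i: "i \<in> {..k}"
    have "(\<Sum>i<k. (v i)\<^sup>2) \<le> 0" using pd[of v] sqn[of v] v(2) by simp
    then have z: "v j = 0" if "j < k" for j
      using that sum_nonneg_eq_0_iff[of "{..<k}" "\<lambda>i. (v i)\<^sup>2"] sum_nonneg[of "{..<k}" "\<lambda>i. (v i)\<^sup>2"] by auto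
    then have "v k = 0" using v(1) sk[of v] by simp
    then show "v i = 0" using z i by (cases "i = k") auto
  qed
  have inj: "inj_on x {..k}" and naf: "\<not> affine_dependent (x ` {..k})"
    using ind aff_indep_family_iff[of "{..k}" x] by auto
  have img: "x ` {..k} = insert 0 (u ` {..<k})"
    unfolding lessThan_Suc_atMost[symmetric] lessThan_Suc by (auto simp: x_def)
  define c where "c = circumcenter (x ` {..k})"
  have "c \<in> affine hull (x ` {..k})" unfolding c_def using circumcenter_in[OF naf] by auto
  then obtain U where U: "sum U (x ` {..k}) = 1" "(\<Sum>p\<in>x ` {..k}. U p *\<^sub>R p) = c"
    using affine_hull_finite[of "x ` {..k}"] by auto
  define w where "w = U \<circ> x"
  have w: "sum w {..k} = 1" "bary {..k} w x = c"
    using U inj unfolding bary_def w_def by (simp_all add: sum.reindex)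
  have cw: "c = (\<Sum>i<k. w i *\<^sub>R u i)" using w(2) bx by simp
  have dc: "dist c (x i) = circumradius (x ` {..k})" if "i \<le> k" for i
    unfolding c_def using dist_circumcenter[OF naf, of "x i"] that by auto
  have cu: "2 * (c \<bullet> u j) = G j j" if "j < k" for j
  proof -
    have "dist c (u j) = dist c 0" using dc[of j] dc[of k] that by (simp add: x_def)
    then have "(norm (c - u j))\<^sup>2 = (norm c)\<^sup>2" by (simp add: dist_norm)
    then show ?thesis
      by (simp only: power2_norm_eq_inner) (simp add: G_def inner_diff_left inner_diff_right inner_commute)
  qed
  have sys: "(\<Sum>i<k. w i * G i j) = G j j / 2" if "j < k" for j
    using cu[OF that] unfolding cw inner_sum_left by (simp add: G_def)
  define e where "e i = w i - 1 / (real k + 1)" for i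
  \<comment> \<open>The deviation \<open>e\<close> from the regular weights solves the Gram system
    with this residual. For the regular matrix each column sums to (k + 1) / 2, so the residual
    would be 0.\<close>
  have rho: "\<bar>\<Sum>i<k. e i * G i j\<bar> \<le> 2 * eta" if j: "j < k" for j
  proof -
    have "(\<Sum>i<k. e i * G i j) = G j j / 2 - (\<Sum>i<k. G i j) / (real k + 1)"
      using sys[OF j] by (simp add: e_def left_diff_distrib sum_subtractf sum_divide_distrib)
    moreover have "\<bar>(\<Sum>i<k. G i j) - (real k + 1) / 2\<bar> \<le> real k * eta"
    proof -
      have "(\<Sum>i<k. if i = j then 1 else 1 / 2 :: real) = (\<Sum>i<k. 1 / 2 + (if i = j then 1 / 2 else 0))"
        by (intro sum.cong) auto
      also have "\<dots> = (real k + 1) / 2" using j by (simp add: sum.distrib add_divide_distrib)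
      finally have fs: "(\<Sum>i<k. if i = j then 1 else 1 / 2 :: real) = (real k + 1) / 2" .
      have "\<bar>(\<Sum>i<k. G i j) - (real k + 1) / 2\<bar> = \<bar>\<Sum>i<k. G i j - (if i = j then 1 else 1 / 2)\<bar>"
        unfolding sum_subtractf fs ..
      also have "\<dots> \<le> (\<Sum>i<k. eta)"
      proof (intro order.trans[OF sum_abs] sum_mono)
        fix i assume "i \<in> {..<k}"
        then show "\<bar>G i j - (if i = j then 1 else 1 / 2)\<bar> \<le> eta" using G[of i j] j by (simp only: G_def lessThan_iff)
      qed
      finally show ?thesis by simp
    qed
    then have "\<bar>(\<Sum>i<k. G i j) / (real k + 1) - 1 / 2\<bar> \<le> real k * eta / (real k + 1)"
    proof -
      have "(\<Sum>i<k. G i j) / (real k + 1) - 1 / 2 = ((\<Sum>i<k. G i j) - (real k + 1) / 2) / (real k + 1)"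
        using k1 by (simp add: field_simps)
      then show ?thesis using \<open>\<bar>(\<Sum>i<k. G i j) - (real k + 1) / 2\<bar> \<le> real k * eta\<close> k1
        by (simp add: divide_right_mono)
    qed
    moreover have "real k * eta / (real k + 1) \<le> eta" using eta(1) k1 by (simp add: field_simps)
    moreover have "\<bar>G j j - 1\<bar> \<le> eta" using G[OF j j] by (simp add: G_def)
    then have "\<bar>G j j / 2 - 1 / 2\<bar> \<le> eta / 2" unfolding abs_le_iff by linarith
    ultimately show ?thesis using eta(1) by linarith
  qed
  define m where "m = Max ((\<lambda>i. \<bar>e i\<bar>) ` {..<k})"
  have fne: "finite ((\<lambda>i. \<bar>e i\<bar>) ` {..<k})" "(\<lambda>i. \<bar>e i\<bar>) ` {..<k} \<noteq> {}" using k by (auto simp: lessThan_empty_iff)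
  have em: "\<bar>e i\<bar> \<le> m" if "i < k" for i unfolding m_def using that by (intro Max_ge fne) auto
  obtain i0 where i0: "i0 < k" "m = \<bar>e i0\<bar>" using Max_in[OF fne] by (auto simp: m_def)
  have m0: "0 \<le> m" using i0 by simp
  \<comment> \<open>Positive definiteness bounds |e|^2 by 4 times the pairing of \<open>e\<close>
    with the residual, and this pairing is at most linear in \<open>m\<close>; dividing by
    \<open>m\<close> yields \<open>m \<le> 8 * real k * eta\<close>.\<close>
  have "m\<^sup>2 \<le> (\<Sum>i<k. (e i)\<^sup>2)"
    unfolding i0(2) power2_abs using i0(1) by (intro member_le_sum) auto
  also have "\<dots> \<le> 4 * (\<Sum>i<k. \<Sum>j<k. e i * e j * G i j)" using pd[of e] by simp
  also have "(\<Sum>i<k. \<Sum>j<k. e i * e j * G i j) = (\<Sum>j<k. e j * (\<Sum>i<k. e i * G i j))"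
    by (subst sum.swap) (simp add: sum_distrib_left mult_ac)
  also have "\<dots> \<le> (\<Sum>j<k. m * (2 * eta))"
  proof (rule sum_mono)
    fix j assume j: "j \<in> {..<k}"
    have "e j * (\<Sum>i<k. e i * G i j) \<le> \<bar>e j\<bar> * \<bar>\<Sum>i<k. e i * G i j\<bar>" by (simp add: abs_mult[symmetric])
    also have "\<dots> \<le> m * (2 * eta)" using em rho j m0 by (intro mult_mono) auto
    finally show "e j * (\<Sum>i<k. e i * G i j) \<le> m * (2 * eta)" .
  qed
  finally have "m * m \<le> m * (8 * real k * eta)" by (simp add: power2_eq_square mult_ac)
  then have m8: "m \<le> 8 * real k * eta"
    using m0 eta(1) by (cases "m = 0") (auto simp: mult_le_cancel_left)
  have km: "real k * m \<le> 1 / (2 * (real k + 1))"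
  proof -
    have "real k * m * (2 * (real k + 1)) \<le> real k * (8 * real k * eta) * (2 * (real k + 1))"
      using m8 by (intro mult_right_mono mult_left_mono) auto
    also have "\<dots> \<le> 1" using eta(2) by (simp add: power2_eq_square mult_ac add.commute)
    finally show ?thesis using k1 by (simp add: pos_le_divide_eq)
  qed
  have hk: "1 / (2 * (real k + 1)) < 1 / (real k + 1)" using k1 by (simp add: field_simps)
  have m1: "m < 1 / (real k + 1)" using km hk mult_right_mono[OF k1 m0] by linarith
  have wpos: "0 < w i" if "i \<le> k" for i
  proof (cases "i < k")
    case True
    then show ?thesis using em[of i] m1 by (simp add: e_def)
  next
    case False
    then have ik: "i = k" using that by simp
    have "(\<Sum>i<k. w i) = real k / (real k + 1) + (\<Sum>i<k. e i)" by (simp add: e_def sum_subtractf)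
    moreover have "(\<Sum>i<k. e i) \<le> (\<Sum>i<k. m)" using em by (intro sum_mono) (auto simp: abs_le_iff)
    moreover have "1 - real k / (real k + 1) = 1 / (real k + 1)" using k1 by (simp add: field_simps)
    ultimately have "1 / (real k + 1) - real k * m \<le> w k" using w(1) sk[of w] by simp
    then show ?thesis unfolding ik using km hk by linarith
  qed
  \<comment> \<open>The origin is a vertex, so the radius is the norm of \<open>c\<close>. Its
    square is half a weighted sum of squared edge lengths, with total weight at most 1 and lengths
    squared at most 2.\<close>
  have "norm c \<le> 1"
  proof -
    have "2 * (norm c)\<^sup>2 = (\<Sum>j<k. w j * (2 * (c \<bullet> u j)))"
      unfolding power2_norm_eq_inner by (subst (2) cw) (simp add: inner_sum_right sum_distrib_left mult_ac)
    also have "\<dots> = (\<Sum>j<k. w j * G j j)" using cu by (intro sum.cong) auto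
    also have "\<dots> \<le> (\<Sum>j<k. w j * 2)"
    proof (intro sum_mono mult_left_mono)
      fix j assume j: "j \<in> {..<k}"
      then show "G j j \<le> 2" using G[of j j] e1 by (simp add: G_def abs_le_iff)
      show "0 \<le> w j" using wpos[of j] j by simp
    qed
    also have "\<dots> \<le> 2" using w(1) sk[of w] wpos[of k] by (simp add: sum_distrib_right[symmetric])
    finally have "(norm c)\<^sup>2 \<le> 1\<^sup>2" by simp
    then show ?thesis by (rule power2_le_imp_le) simp
  qed
  then have "circumradius (x ` {..k}) \<le> 1" using dc[of k] by (simp add: x_def)
  then have "crit_simplex k 1 (x ` {..k}) \<and> circumcenter (x ` {..k}) = c"
    unfolding crit_simplex_family[of "{..k}" k, simplified]
  proof (intro conjI exI[of _ w] ballI ind w)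
    show "dist c (x i) = dist c (x j)" if "i \<in> {..k}" "j \<in> {..k}" for i j
      using that dc[of i] dc[of j] by (simp only: atMost_iff)
    show "dist c (x i) \<le> 1" if "i \<in> {..k}" for i
      using that dc[of i] \<open>circumradius (x ` {..k}) \<le> 1\<close> by (simp only: atMost_iff)
  qed (use wpos in auto)
  then show ?thesis unfolding h1_iff img by simp
qed

lemma h1_measurable [measurable]: "Measurable.pred (PiM {..<k} (\<lambda>_. lborel :: 'a::euclidean_space measure)) (h1 k)"
proof -
  \<comment> \<open>Extension by zero supplies the origin as point number \<open>k\<close>.\<close>
  define T where "T y i = (if i < k then y i else (0::'a))" for y :: "nat \<Rightarrow> 'a" and i :: nat
  have "T \<in> PiM {..<k} (\<lambda>_. lborel) \<rightarrow>\<^sub>M PiM UNIV (\<lambda>_. borel)"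
  proof (rule measurable_PiM_single')
    fix i :: nat assume "i \<in> UNIV"
    show "(\<lambda>y. T y i) \<in> PiM {..<k} (\<lambda>_. lborel) \<rightarrow>\<^sub>M borel" unfolding T_def by (cases "i < k") auto
  qed (auto simp: PiE_def)
  from crit_simplex_pred[OF this, of "{..k}" k 1]
  have "Measurable.pred (PiM {..<k} (\<lambda>_. lborel)) (\<lambda>y. crit_simplex k 1 (T y ` {..k}))" by simp
  moreover have "T y ` {..k} = insert 0 (y ` {..<k})" for y
    unfolding lessThan_Suc_atMost[symmetric] lessThan_Suc by (auto simp: T_def)
  ultimately show ?thesis by (simp add: h1_iff[abs_def])
qed

lemma h1_norm_le: "h1 k y \<Longrightarrow> i < k \<Longrightarrow> norm (y i) \<le> 2"
  using crit_simplex_dist[of k 1 "insert 0 (y ` {..<k})" "y i" 0] by (simp add: h1_iff)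

text \<open>An upper bound comes from every vertex lying within 2 of the origin, a lower bound from
  a product of small balls around a regular simplex, all of whose members are critical
  configurations.\<close>

lemma emeasure_h1:
  fixes k :: nat
  defines "H \<equiv> emeasure (PiM {..<k} (\<lambda>_. lborel :: 'a::euclidean_space measure)) {y\<in>space (PiM {..<k} (\<lambda>_. lborel)). h1 k y}"
  shows emeasure_h1_finite: "H < \<infinity>"
    and emeasure_h1_pos: "1 \<le> k \<Longrightarrow> k \<le> DIM('a) \<Longrightarrow> 0 < H"
proof -
  let ?L = "PiM {..<k} (\<lambda>_. lborel :: 'a measure)"
  interpret PL: product_sigma_finite "\<lambda>_. lborel :: 'a measure" by standard
  have "H \<le> emeasure ?L (PiE {..<k} (\<lambda>_. cball 0 2))"
    unfolding H_def using h1_norm_le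
    by (intro emeasure_mono sets_PiM_I_finite) (auto simp: space_PiM)
  also have "\<dots> = (\<Prod>i<k. emeasure lborel (cball (0::'a) 2))" by (intro PL.emeasure_PiM) auto
  also have "\<dots> < \<infinity>" by (simp add: emeasure_cball ennreal_power)
  finally show "H < \<infinity>" .
  show "0 < H" if k: "1 \<le> k" "k \<le> DIM('a)"
  proof -
    obtain y :: "nat \<Rightarrow> 'a" where y: "\<And>i j. i < k \<Longrightarrow> j < k \<Longrightarrow> y i \<bullet> y j = (if i = j then 1 else 1 / 2)"
      using regular_simplex_vectors[OF k] by metis
    define eta :: real where "eta = 1 / (16 * real k ^ 2 * real (k + 1))"
    \<comment> \<open>Moving two unit vectors by at most \<open>del \<le> 1\<close> changes their
      inner product by at most del^2 + 2 * del, hence by at most \<open>3 * del\<close>.\<close>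
    define del where "del = min 1 (eta / 3)"
    have eta: "0 < eta" "16 * real k ^ 2 * real (k + 1) * eta \<le> 1" using k by (auto simp: eta_def)
    have del: "0 < del" "del \<le> 1" "3 * del \<le> eta" using eta by (auto simp: del_def)
    have "PiE {..<k} (\<lambda>i. ball (y i) del) \<subseteq> {y\<in>space ?L. h1 k y}"
    proof
      fix u assume u: "u \<in> PiE {..<k} (\<lambda>i. ball (y i) del)"
      have n: "norm (u i - y i) \<le> del" "norm (y i) = 1" if "i < k" for i
      proof -
        have "u i \<in> ball (y i) del" using PiE_mem[OF u, of i] that by simp
        then show "norm (u i - y i) \<le> del" by (simp add: dist_norm norm_minus_commute)
        show "norm (y i) = 1" using y[OF that that] by (simp add: norm_eq_sqrt_inner)
      qed
      have "h1 k u"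
      proof (rule crit_simplex_near_regular[OF k(1) less_imp_le[OF eta(1)] eta(2)])
        fix i j assume ij: "i < k" "j < k"
        have "u i \<bullet> u j - y i \<bullet> y j = (u i - y i) \<bullet> (u j - y j) + (u i - y i) \<bullet> y j + y i \<bullet> (u j - y j)"
          by (simp add: inner_diff_left inner_diff_right)
        then have "\<bar>u i \<bullet> u j - y i \<bullet> y j\<bar> \<le> norm (u i - y i) * norm (u j - y j) + norm (u i - y i) * norm (y j) + norm (y i) * norm (u j - y j)"
          using Cauchy_Schwarz_ineq2[of "u i - y i" "u j - y j"] Cauchy_Schwarz_ineq2[of "u i - y i" "y j"]
            Cauchy_Schwarz_ineq2[of "y i" "u j - y j"] by linarith
        also have "\<dots> \<le> del * 1 + del * 1 + 1 * del"
          using n[OF ij(1)] n[OF ij(2)] del by (intro add_mono mult_mono) auto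
        finally show "\<bar>u i \<bullet> u j - (if i = j then 1 else 1 / 2)\<bar> \<le> eta" using y[OF ij] del by simp
      qed
      then show "u \<in> {y\<in>space ?L. h1 k y}" using u by (auto simp: space_PiM PiE_iff)
    qed
    then have "emeasure ?L (PiE {..<k} (\<lambda>i. ball (y i) del)) \<le> H"
      unfolding H_def by (intro emeasure_mono) measurable
    moreover have "emeasure ?L (PiE {..<k} (\<lambda>i. ball (y i) del)) = (\<Prod>i<k. emeasure lborel (ball (y i) del))"
      by (intro PL.emeasure_PiM) auto
    moreover have "0 < (\<Prod>i<k. emeasure lborel (ball (y i) del))"
      using del by (simp add: emeasure_ball ennreal_power zero_less_power)
    ultimately show ?thesis by (metis less_le_trans)
  qed
qed


section \<open>Asymptotics of the probability of a critical simplex\<close>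

lemma bounded_density_shift_prod:
  fixes f :: "'a::euclidean_space \<Rightarrow> real" and c :: "nat \<Rightarrow> 'a" and j :: nat
  assumes f: "f \<in> borel_measurable borel" "\<And>x. 0 \<le> f x" "\<And>x. f x \<le> B" "integrable lborel f"
  shows "integrable lborel (\<lambda>z. f z * (\<Prod>i<j. f (z + c i)))"
proof (rule Bochner_Integration.integrable_bound[of _ "\<lambda>z. B ^ j * f z"])
  show "AE z in lborel. norm (f z * (\<Prod>i<j. f (z + c i))) \<le> norm (B ^ j * f z)"
  proof (rule AE_I2)
    fix z
    have "0 \<le> B" using f(2,3)[of z] by linarith
    have "(\<Prod>i<j. f (z + c i)) \<le> (\<Prod>i<j. B)" using f by (intro prod_mono) auto
    then have "f z * (\<Prod>i<j. f (z + c i)) \<le> f z * B ^ j" using f(2) by (simp add: mult_left_mono)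
    moreover have "0 \<le> (\<Prod>i<j. f (z + c i))" using f(2) by (simp add: prod_nonneg)
    ultimately show "norm (f z * (\<Prod>i<j. f (z + c i))) \<le> norm (B ^ j * f z)"
      using f(2)[of z] \<open>0 \<le> B\<close> by (simp add: abs_mult mult.commute)
  qed
  show "(\<lambda>z. f z * (\<Prod>i<j. f (z + c i))) \<in> borel_measurable lborel" using f(1) by measurable
qed (use f in auto)

text \<open>Telescoping over the factors: one shifted factor is replaced at a time while all others
  are bounded by \<open>B\<close>, so each step reduces to \<open>L1_translation\<close>.\<close>

lemma shift_prod_tendsto:
  fixes f :: "'a::euclidean_space \<Rightarrow> real"
  assumes f: "f \<in> borel_measurable borel" "\<And>x. 0 \<le> f x" "\<And>x. f x \<le> B" "integrable lborel f"
    and c: "\<And>i. (\<lambda>n. c n i) \<longlonglongrightarrow> 0"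
  shows "(\<lambda>n. \<integral>z. \<bar>f z * (\<Prod>i<j. f (z + c n i)) - f z ^ (j + 1)\<bar> \<partial>lborel) \<longlonglongrightarrow> 0"
proof (induction j)
  case (Suc j)
  let ?G = "\<lambda>n z. f z * (\<Prod>i<j. f (z + c n i))"
  have B: "0 \<le> B" using f(2,3)[of 0] by linarith
  note iG = bounded_density_shift_prod[OF f]
  have ipow: "integrable lborel (\<lambda>z. f z ^ (j + 1))" for j using iG[where j = j and c = "\<lambda>_. 0"] by (simp add: mult.commute)
  have lim: "(\<lambda>n. B * (\<integral>z. \<bar>?G n z - f z ^ (j + 1)\<bar> \<partial>lborel) + B ^ (j + 1) * (\<integral>z. \<bar>f (z + c n j) - f z\<bar> \<partial>lborel)) \<longlonglongrightarrow> 0"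
    using tendsto_add[OF tendsto_mult[OF tendsto_const[of B] Suc]
       tendsto_mult[OF tendsto_const[of "B ^ (j + 1)"] L1_translation[OF f(4) c[of j]]]] by simp
  have ub: "(\<integral>z. \<bar>f z * (\<Prod>i<Suc j. f (z + c n i)) - f z ^ (Suc j + 1)\<bar> \<partial>lborel) \<le>
     B * (\<integral>z. \<bar>?G n z - f z ^ (j + 1)\<bar> \<partial>lborel) + B ^ (j + 1) * (\<integral>z. \<bar>f (z + c n j) - f z\<bar> \<partial>lborel)" for n
  proof -
    have i1: "integrable lborel (\<lambda>z. \<bar>?G n z - f z ^ (j + 1)\<bar>)" using iG ipow by auto
    have i2: "integrable lborel (\<lambda>z. \<bar>f (z + c n j) - f z\<bar>)" using lborel_integrable_shift[OF f(4)] f(4) by auto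
    have "(\<integral>z. \<bar>f z * (\<Prod>i<Suc j. f (z + c n i)) - f z ^ (Suc j + 1)\<bar> \<partial>lborel) \<le>
      (\<integral>z. B * \<bar>?G n z - f z ^ (j + 1)\<bar> + B ^ (j + 1) * \<bar>f (z + c n j) - f z\<bar> \<partial>lborel)"
    proof (intro integral_mono)
      show "integrable lborel (\<lambda>z. \<bar>f z * (\<Prod>i<Suc j. f (z + c n i)) - f z ^ (Suc j + 1)\<bar>)"
        using iG[where j = "Suc j" and c = "c n"] ipow[of "Suc j"] by (intro integrable_abs Bochner_Integration.integrable_diff)
      show "integrable lborel (\<lambda>z. B * \<bar>?G n z - f z ^ (j + 1)\<bar> + B ^ (j + 1) * \<bar>f (z + c n j) - f z\<bar>)"
        using i1 i2 by auto
      fix z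
      have "f z * (\<Prod>i<Suc j. f (z + c n i)) - f z ^ (Suc j + 1) =
        f (z + c n j) * (?G n z - f z ^ (j + 1)) + f z ^ (j + 1) * (f (z + c n j) - f z)"
        by (simp add: algebra_simps)
      also have "\<bar>\<dots>\<bar> \<le> f (z + c n j) * \<bar>?G n z - f z ^ (j + 1)\<bar> + f z ^ (j + 1) * \<bar>f (z + c n j) - f z\<bar>"
        using f(2) by (intro order.trans[OF abs_triangle_ineq]) (simp add: abs_mult)
      also have "\<dots> \<le> B * \<bar>?G n z - f z ^ (j + 1)\<bar> + B ^ (j + 1) * \<bar>f (z + c n j) - f z\<bar>"
        using f(2,3) by (intro add_mono mult_right_mono power_mono) auto
      finally show "\<bar>f z * (\<Prod>i<Suc j. f (z + c n i)) - f z ^ (Suc j + 1)\<bar> \<le>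
        B * \<bar>?G n z - f z ^ (j + 1)\<bar> + B ^ (j + 1) * \<bar>f (z + c n j) - f z\<bar>" .
    qed
    also have "\<dots> = B * (\<integral>z. \<bar>?G n z - f z ^ (j + 1)\<bar> \<partial>lborel) + B ^ (j + 1) * (\<integral>z. \<bar>f (z + c n j) - f z\<bar> \<partial>lborel)"
      using i1 i2 by simp
    finally show ?thesis .
  qed
  show ?case
    by (rule tendsto_sandwich[OF always_eventually always_eventually tendsto_const lim])
      (use ub in \<open>simp_all only: Bochner_Integration.integral_nonneg abs_ge_zero simp_thms\<close>)
qed simp

context
  fixes f :: "'a::euclidean_space \<Rightarrow> real"
  assumes bd: "bounded_density f"
begin

lemma density_facts:
  shows density_meas: "f \<in> borel_measurable borel" and density_nonneg: "0 \<le> f x"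
    and density_nn_integral: "(\<integral>\<^sup>+x. ennreal (f x) \<partial>lborel) = 1"
    and density_integrable: "integrable lborel f"
proof -
  show m: "f \<in> borel_measurable borel" and n: "\<And>x. 0 \<le> f x" and i: "(\<integral>\<^sup>+x. ennreal (f x) \<partial>lborel) = 1"
    using bd by (auto simp: bounded_density_def)
  show "integrable lborel f" using m n i by (intro integrableI_nonneg) auto
qed

lemma density_bound: obtains B where "\<And>x. f x \<le> B" "0 \<le> B"
proof -
  obtain B where "\<And>x. f x \<le> B" using bd by (auto simp: bounded_density_def)
  then show thesis using that[of B] density_nonneg[of 0] by (meson order_trans)
qed

definition simplex_prob :: "nat \<Rightarrow> real \<Rightarrow> real" where
  "simplex_prob k r = measure (PiM {..k} (\<lambda>_. density lborel (\<lambda>x. ennreal (f x))))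
      {x\<in>space (PiM {..k} (\<lambda>_. borel)). crit_simplex k r (x ` {..k})}"

text \<open>Vertex number \<open>k\<close> becomes the base point \<open>z\<close>, the others are
  \<open>z + r *\<^sub>R u i\<close>. Being critical is invariant under this homothety and turns
  into a condition on \<open>u\<close> alone, so Fubini leaves an inner integral of densities over
  \<open>z\<close>.\<close>

lemma emeasure_simplex:
  assumes r: "0 < r"
  shows "emeasure (PiM {..k} (\<lambda>_. density lborel (\<lambda>x. ennreal (f x)))) {x\<in>space (PiM {..k} (\<lambda>_. borel)). crit_simplex k r (x ` {..k})}
    = ennreal (r ^ (DIM('a) * k)) * (\<integral>\<^sup>+u. of_bool (h1 k u) * ennreal (\<integral>z. f z * (\<Prod>i<k. f (z + r *\<^sub>R u i)) \<partial>lborel) \<partial>PiM {..<k} (\<lambda>_. lborel))"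
    (is "emeasure ?D ?A = _")
proof -
  obtain B where B: "\<And>x. f x \<le> B" "0 \<le> B" using density_bound by blast
  let ?L = "PiM {..<k} (\<lambda>_. lborel :: 'a measure)" and ?L1 = "PiM {..k} (\<lambda>_. lborel :: 'a measure)"
  interpret PL: product_sigma_finite "\<lambda>_. lborel :: 'a measure" by standard
  interpret L: finite_product_sigma_finite "\<lambda>_. lborel :: 'a measure" "{..<k}" by standard simp
  interpret LL: pair_sigma_finite "lborel :: 'a measure" ?L
    by (rule pair_sigma_finite.intro[OF sigma_finite_lborel L.sigma_finite_measure_axioms])
  note [measurable] = density_meas
  have sL1: "sets ?L1 = sets (PiM {..k} (\<lambda>_. borel))" by (intro sets_PiM_cong) auto
  have A: "?A \<in> sets ?L1" unfolding sL1 by (rule measurable_crit_simplex) auto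
  have spL: "space ?L1 = space (PiM {..k} (\<lambda>_. borel :: 'a measure))" by (simp add: space_PiM)
  let ?g = "\<lambda>x. ennreal (\<Prod>i\<le>k. f (x i)) * indicator ?A x"
  have atm: "{..k} = insert k {..<k}" by auto
  have gm: "?g \<in> borel_measurable ?L1"
    by (rule borel_measurable_times_ennreal[OF _ borel_measurable_indicator[OF A]]) measurable
  have cr: "insert z ((\<lambda>i\<in>{..<k}. z + r *\<^sub>R u i) ` {..<k}) = (\<lambda>v. z + r *\<^sub>R v) ` insert 0 (u ` {..<k})" for z :: 'a and u
    by (auto simp: image_iff)
  have g: "?g ((\<lambda>i\<in>{..<k}. z + r *\<^sub>R u i)(k := z)) = ennreal (f z * (\<Prod>i<k. f (z + r *\<^sub>R u i))) * of_bool (h1 k u)" for z u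
  proof -
    let ?x = "(\<lambda>i\<in>{..<k}. z + r *\<^sub>R u i)(k := z)"
    have "?x ` {..k} = insert z ((\<lambda>i\<in>{..<k}. z + r *\<^sub>R u i) ` {..<k})" unfolding atm by auto
    then have "?x ` {..k} = (\<lambda>v. z + r *\<^sub>R v) ` insert 0 (u ` {..<k})" unfolding cr .
    then have "crit_simplex k r (?x ` {..k}) \<longleftrightarrow> h1 k u"
      using crit_simplex_affinity[OF r, of k 1 z "insert 0 (u ` {..<k})"] by (simp only: mult_1_right h1_iff)
    moreover have "?x \<in> space (PiM {..k} (\<lambda>_. borel))" by (auto simp: space_PiM PiE_iff extensional_def)
    ultimately have "indicator ?A ?x = (of_bool (h1 k u) :: ennreal)" by (simp add: indicator_def)
    moreover have "(\<Prod>i\<le>k. f (?x i)) = f z * (\<Prod>i<k. f (z + r *\<^sub>R u i))"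
      unfolding atm by simp
    ultimately show ?thesis by simp
  qed
  have "emeasure ?D ?A = emeasure (density ?L1 (\<lambda>x. ennreal (\<Prod>i\<le>k. f (x i)))) ?A"
    by (subst PiM_density[OF finite_atMost density_meas density_nonneg density_nn_integral]) simp
  also have "\<dots> = (\<integral>\<^sup>+x. ?g x \<partial>?L1)" by (rule emeasure_density[OF _ A]) measurable
  also have "\<dots> = (\<integral>\<^sup>+z. \<integral>\<^sup>+x. ?g (x(k := z)) \<partial>?L \<partial>lborel)"
    using gm unfolding atm by (intro PL.product_nn_integral_insert_rev) auto
  also have "\<dots> = (\<integral>\<^sup>+z. ennreal (r ^ (DIM('a) * k)) * (\<integral>\<^sup>+u. ?g ((\<lambda>i\<in>{..<k}. z + r *\<^sub>R u i)(k := z)) \<partial>?L) \<partial>lborel)"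
  proof (intro nn_integral_cong)
    fix z :: 'a
    have "(\<lambda>x. x(k := z)) \<in> ?L \<rightarrow>\<^sub>M PiM (insert k {..<k}) (\<lambda>_. lborel)"
      by (intro measurable_fun_upd[where J = "{..<k}"]) auto
    then have "(\<lambda>x. ?g (x(k := z))) \<in> borel_measurable ?L"
      unfolding atm[symmetric] by (rule measurable_compose[OF _ gm])
    from nn_integral_PiM_affine[OF finite_lessThan r this, of z]
    show "(\<integral>\<^sup>+x. ?g (x(k := z)) \<partial>?L) = ennreal (r ^ (DIM('a) * k)) * (\<integral>\<^sup>+u. ?g ((\<lambda>i\<in>{..<k}. z + r *\<^sub>R u i)(k := z)) \<partial>?L)"
      by simp
  qed
  also have "\<dots> = (\<integral>\<^sup>+z. ennreal (r ^ (DIM('a) * k)) * (\<integral>\<^sup>+u. ennreal (f z * (\<Prod>i<k. f (z + r *\<^sub>R u i))) * of_bool (h1 k u) \<partial>?L) \<partial>lborel)"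
    by (simp only: g)
  also have "\<dots> = ennreal (r ^ (DIM('a) * k)) * (\<integral>\<^sup>+z. \<integral>\<^sup>+u. ennreal (f z * (\<Prod>i<k. f (z + r *\<^sub>R u i))) * of_bool (h1 k u) \<partial>?L \<partial>lborel)"
    by (rule nn_integral_cmult) measurable
  also have "(\<integral>\<^sup>+z. \<integral>\<^sup>+u. ennreal (f z * (\<Prod>i<k. f (z + r *\<^sub>R u i))) * of_bool (h1 k u) \<partial>?L \<partial>lborel) =
     (\<integral>\<^sup>+u. \<integral>\<^sup>+z. ennreal (f z * (\<Prod>i<k. f (z + r *\<^sub>R u i))) * of_bool (h1 k u) \<partial>lborel \<partial>?L)"
    by (rule LL.Fubini'[symmetric]) measurable
  also have "\<dots> = (\<integral>\<^sup>+u. of_bool (h1 k u) * ennreal (\<integral>z. f z * (\<Prod>i<k. f (z + r *\<^sub>R u i)) \<partial>lborel) \<partial>?L)"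
  proof (rule nn_integral_cong)
    fix u :: "nat \<Rightarrow> 'a"
    have "(\<integral>\<^sup>+z. ennreal (f z * (\<Prod>i<k. f (z + r *\<^sub>R u i))) * of_bool (h1 k u) \<partial>lborel) =
      (\<integral>\<^sup>+z. ennreal (f z * (\<Prod>i<k. f (z + r *\<^sub>R u i))) \<partial>lborel) * of_bool (h1 k u)"
      by (rule nn_integral_multc) measurable
    also have "(\<integral>\<^sup>+z. ennreal (f z * (\<Prod>i<k. f (z + r *\<^sub>R u i))) \<partial>lborel) = ennreal (\<integral>z. f z * (\<Prod>i<k. f (z + r *\<^sub>R u i)) \<partial>lborel)"
      using density_nonneg
      by (intro nn_integral_eq_integral bounded_density_shift_prod[OF density_meas density_nonneg B(1) density_integrable])
        (auto intro!: mult_nonneg_nonneg prod_nonneg)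
    finally show "(\<integral>\<^sup>+z. ennreal (f z * (\<Prod>i<k. f (z + r *\<^sub>R u i))) * of_bool (h1 k u) \<partial>lborel) =
      of_bool (h1 k u) * ennreal (\<integral>z. f z * (\<Prod>i<k. f (z + r *\<^sub>R u i)) \<partial>lborel)" by (simp add: mult.commute)
  qed
  finally show ?thesis .
qed

text \<open>For fixed \<open>u\<close> the inner integral tends to that of
  \<open>f ^ (k + 1)\<close>. It is at most \<open>B ^ k\<close> and the admissible \<open>u\<close>
  have finite volume, so dominated convergence applies. The factorial cancels the one in
  \<open>mu\<close>, which belongs to the number of index sets.\<close>

lemma simplex_prob_limit:
  assumes r: "\<And>n. 0 < r n" "r \<longlonglongrightarrow> 0"
  shows "(\<lambda>n. simplex_prob k (r n) / r n ^ (DIM('a) * k)) \<longlonglongrightarrow> fact (k + 1) * mu k f"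
proof -
  obtain B where B: "\<And>x. f x \<le> B" "0 \<le> B" using density_bound by blast
  note f = density_meas density_nonneg B(1) density_integrable
  note [measurable] = density_meas
  let ?L = "PiM {..<k} (\<lambda>_. lborel :: 'a measure)"
  interpret PL: product_sigma_finite "\<lambda>_. lborel :: 'a measure" by standard
  interpret L: finite_product_sigma_finite "\<lambda>_. lborel :: 'a measure" "{..<k}" by standard simp
  define F where "F n u = (\<integral>z. f z * (\<Prod>i<k. f (z + r n *\<^sub>R u i)) \<partial>lborel)" for n and u :: "nat \<Rightarrow> 'a"
  define F0 where "F0 = (\<integral>z. f z ^ (k + 1) \<partial>lborel)"
  have i0: "integrable lborel (\<lambda>z. f z ^ (k + 1))"
    using bounded_density_shift_prod[OF f, where j = k and c = "\<lambda>_. 0"] by (simp add: mult.commute)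
  have F: "(\<lambda>n. F n u) \<longlonglongrightarrow> F0" for u
  proof -
    have c: "(\<lambda>n. r n *\<^sub>R u i) \<longlonglongrightarrow> 0" for i using tendsto_scaleR[OF r(2) tendsto_const[of "u i"]] by simp
    have "(\<lambda>n. F n u - F0) \<longlonglongrightarrow> 0"
    proof (rule Lim_null_comparison[OF always_eventually shift_prod_tendsto[OF f c, where j = k]], rule allI)
      fix n
      have "F n u - F0 = (\<integral>z. f z * (\<Prod>i<k. f (z + r n *\<^sub>R u i)) - f z ^ (k + 1) \<partial>lborel)"
        unfolding F_def F0_def using bounded_density_shift_prod[OF f] i0 by simp
      then show "norm (F n u - F0) \<le> (\<integral>z. \<bar>f z * (\<Prod>i<k. f (z + r n *\<^sub>R u i)) - f z ^ (k + 1)\<bar> \<partial>lborel)"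
        using integral_norm_bound[of lborel "\<lambda>z. f z * (\<Prod>i<k. f (z + r n *\<^sub>R u i)) - f z ^ (k + 1)"] by simp
    qed
    then show ?thesis by (simp add: LIM_zero_iff)
  qed
  have F_nn: "0 \<le> F n u" for n u unfolding F_def
    using density_nonneg by (intro Bochner_Integration.integral_nonneg mult_nonneg_nonneg prod_nonneg) auto
  have F_le: "F n u \<le> B ^ k" for n u
  proof -
    have "F n u \<le> (\<integral>z. B ^ k * f z \<partial>lborel)"
      unfolding F_def
    proof (intro integral_mono bounded_density_shift_prod[OF f] integrable_mult_right density_integrable)
      fix z
      have "(\<Prod>i<k. f (z + r n *\<^sub>R u i)) \<le> (\<Prod>i<k. B)" using f by (intro prod_mono) auto
      then show "f z * (\<Prod>i<k. f (z + r n *\<^sub>R u i)) \<le> B ^ k * f z"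
        using density_nonneg[of z] by (simp add: mult_left_mono mult.commute)
    qed
    also have "\<dots> = B ^ k"
      using nn_integral_eq_integral[OF density_integrable] density_nonneg density_nn_integral by simp
    finally show ?thesis .
  qed
  have hi: "integrable ?L (\<lambda>u. of_bool (h1 k u) :: real)"
  proof (rule integrableI_bounded)
    have "(\<integral>\<^sup>+u. ennreal (norm (of_bool (h1 k u) :: real)) \<partial>?L) = (\<integral>\<^sup>+u. indicator {u\<in>space ?L. h1 k u} u \<partial>?L)"
      by (intro nn_integral_cong) (auto simp: indicator_def)
    also have "\<dots> = emeasure ?L {u\<in>space ?L. h1 k u}" by simp
    also have "\<dots> < \<infinity>" by (rule emeasure_h1_finite)
    finally show "(\<integral>\<^sup>+u. ennreal (norm (of_bool (h1 k u) :: real)) \<partial>?L) < \<infinity>" .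
  qed measurable
  have Fm[measurable]: "F n \<in> borel_measurable ?L" for n
    unfolding F_def by (rule sigma_finite_measure.borel_measurable_lebesgue_integral[OF sigma_finite_lborel]) measurable
  have iF: "integrable ?L (\<lambda>u. of_bool (h1 k u) * F n u)" for n
    by (rule Bochner_Integration.integrable_bound[OF integrable_mult_left[OF hi, of "B ^ k"]])
      (use F_nn F_le B(2) in \<open>auto simp: abs_mult\<close>)
  have eq: "simplex_prob k (r n) / r n ^ (DIM('a) * k) = (\<integral>u. of_bool (h1 k u) * F n u \<partial>?L)" for n
  proof -
    have "(\<integral>\<^sup>+u. of_bool (h1 k u) * ennreal (F n u) \<partial>?L) = (\<integral>\<^sup>+u. ennreal (of_bool (h1 k u) * F n u) \<partial>?L)"
      by (intro nn_integral_cong) (auto split: split_of_bool)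
    also have "\<dots> = ennreal (\<integral>u. of_bool (h1 k u) * F n u \<partial>?L)"
      using iF F_nn by (intro nn_integral_eq_integral) auto
    finally have "simplex_prob k (r n) = enn2real (ennreal (r n ^ (DIM('a) * k)) * ennreal (\<integral>u. of_bool (h1 k u) * F n u \<partial>?L))"
      unfolding simplex_prob_def measure_def emeasure_simplex[OF r(1)] F_def by simp
    also have "\<dots> = r n ^ (DIM('a) * k) * (\<integral>u. of_bool (h1 k u) * F n u \<partial>?L)"
      using r(1)[of n] F_nn by (simp add: ennreal_mult[symmetric] Bochner_Integration.integral_nonneg)
    finally show ?thesis using r(1)[of n] by simp
  qed
  have "(\<lambda>n. \<integral>u. of_bool (h1 k u) * F n u \<partial>?L) \<longlonglongrightarrow> (\<integral>u. of_bool (h1 k u) * F0 \<partial>?L)"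
  proof (rule integral_dominated_convergence[where w = "\<lambda>u. of_bool (h1 k u) * B ^ k"])
    show "AE u in ?L. (\<lambda>n. of_bool (h1 k u) * F n u) \<longlonglongrightarrow> of_bool (h1 k u) * F0"
      by (intro AE_I2 tendsto_intros F)
    show "AE u in ?L. norm (of_bool (h1 k u) * F n u) \<le> of_bool (h1 k u) * B ^ k" for n
      using F_nn F_le by (intro AE_I2) (simp add: abs_mult)
  qed (use hi in auto)
  moreover have "(\<integral>u. of_bool (h1 k u) * F0 \<partial>?L) = fact (k + 1) * mu k f"
    by (simp add: mu_def F0_def of_bool_def mult.commute del: fact_Suc)
  ultimately show ?thesis by (simp add: eq)
qed

text \<open>The limit laws are used with positive Poisson mean and positive variance. The integral
  of the power could vanish only together with the density, and the other factor is positive by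
  \<open>emeasure_h1_pos\<close>.\<close>

lemma mu_pos:
  assumes k: "1 \<le> k" "k \<le> DIM('a)"
  shows "0 < mu k f"
proof -
  obtain B where B: "\<And>x. f x \<le> B" "0 \<le> B" using density_bound by blast
  note f = density_meas density_nonneg B(1) density_integrable
  let ?L = "PiM {..<k} (\<lambda>_. lborel :: 'a measure)"
  have i0: "integrable lborel (\<lambda>z. f z ^ (k + 1))"
    using bounded_density_shift_prod[OF f, where j = k and c = "\<lambda>_. 0"] by (simp add: mult.commute)
  have "0 < (\<integral>z. f z ^ (k + 1) \<partial>lborel)"
  proof (rule ccontr)
    assume "\<not> 0 < (\<integral>z. f z ^ (k + 1) \<partial>lborel)"
    moreover have "0 \<le> (\<integral>z. f z ^ (k + 1) \<partial>lborel)"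
      using density_nonneg by (intro Bochner_Integration.integral_nonneg) simp
    ultimately have "(\<integral>z. f z ^ (k + 1) \<partial>lborel) = 0" by simp
    then have "AE z in lborel. f z ^ (k + 1) = 0"
      using integral_nonneg_eq_0_iff_AE[OF i0] density_nonneg by simp
    then have "AE z in lborel. ennreal (f z) = 0" by eventually_elim auto
    then have "(\<integral>\<^sup>+x. ennreal (f x) \<partial>lborel) = 0" using density_meas by (subst nn_integral_0_iff_AE) auto
    then show False using density_nn_integral by simp
  qed
  moreover have "(\<integral>y. (if h1 k y then 1 else 0) \<partial>?L) = measure ?L {u\<in>space ?L. h1 k u}"
  proof -
    have "(\<integral>y. (if h1 k y then 1 else 0) \<partial>?L) = (\<integral>y. indicator {u\<in>space ?L. h1 k u} y \<partial>?L)"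
      by (intro Bochner_Integration.integral_cong) (auto simp: indicator_def)
    also have "\<dots> = measure ?L ({u\<in>space ?L. h1 k u} \<inter> space ?L)" by (rule Bochner_Integration.integral_indicator)
    also have "{u\<in>space ?L. h1 k u} \<inter> space ?L = {u\<in>space ?L. h1 k u}" by auto
    finally show ?thesis .
  qed
  moreover have "0 < measure ?L {u\<in>space ?L. h1 k u}"
    using emeasure_h1_finite[where 'a = 'a, of k] emeasure_h1_pos[where 'a = 'a, of k] k
    by (simp add: measure_def enn2real_positive_iff)
  ultimately show ?thesis unfolding mu_def by simp
qed

end

text \<open>The sample law is a product of equal factors, so the index set \<open>a\<close> can be
  renamed to \<open>{..k}\<close>.\<close>

lemma (in crit_sample) prob_ev_eq:
  assumes bd: "bounded_density f" and a: "a \<in> ksubsets k N"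
  shows "prob {\<omega>\<in>space M. ev a \<omega>} = simplex_prob f k r"
proof -
  let ?D = "density lborel (\<lambda>x. ennreal (f x)) :: 'b measure"
  note da = ksubsetsD[OF a]
  have D: "prob_space ?D"
    using density_meas[OF bd] density_nn_integral[OF bd] by (intro prob_spaceI) (simp add: emeasure_density)
  have Xd: "distr M borel (X i) = ?D" for i
  proof -
    have "distr M borel (X i) = distr M lborel (X i)" by (rule distr_cong) auto
    then show ?thesis using distributed_distr_eq_density[OF distX] by simp
  qed
  have sD: "sets (PiM J (\<lambda>_. ?D)) = sets (PiM J (\<lambda>_. borel))" for J :: "nat set" by (intro sets_PiM_cong) auto
  have law: "distr M (PiM UNIV (\<lambda>_. borel)) Xs = PiM UNIV (\<lambda>_. ?D)"
    using indep_vars_iff_distr_eq_PiM'[where I = UNIV and M' = "\<lambda>_. borel" and X = X] indep by (simp add: Xd restrict_UNIV)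
  obtain e where e: "bij_betw e {..k} a"
    using finite_same_card_bij[of "{..k}" a] da by auto
  let ?A = "\<lambda>I b. {x\<in>space (PiM I (\<lambda>_. borel :: 'b measure)). crit_simplex k r (x ` b)}"
  let ?t = "\<lambda>x. \<lambda>n\<in>{..k}. x (e n)"
  have re: "distr (PiM UNIV (\<lambda>_. ?D)) (PiM {..k} (\<lambda>_. ?D)) ?t = PiM {..k} (\<lambda>_. ?D)"
    using e D by (intro distr_PiM_reindex[where K = UNIV and M = "\<lambda>_. ?D"]) (auto simp: bij_betw_def)
  have tm: "?t \<in> PiM UNIV (\<lambda>_. ?D) \<rightarrow>\<^sub>M PiM {..k} (\<lambda>_. ?D)" by (intro measurable_restrict) measurable
  have "prob {\<omega>\<in>space M. ev a \<omega>} = prob (Xs -` ?A UNIV a \<inter> space M)"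
    by (rule arg_cong[where f = prob]) (auto simp: ev_def space_PiM)
  also have "\<dots> = measure (PiM UNIV (\<lambda>_. ?D)) (?A UNIV a)"
    unfolding law[symmetric]
    by (rule measure_distr[OF Xs_meas measurable_crit_simplex[OF da(1,2)], symmetric]) simp
  also have "?A UNIV a = ?t -` ?A {..k} {..k} \<inter> space (PiM UNIV (\<lambda>_. ?D))"
  proof -
    have "?t x ` {..k} = x ` a" for x :: "nat \<Rightarrow> 'b"
      using e by (auto simp: bij_betw_def image_image[symmetric])
    then show ?thesis by (auto simp: space_PiM)
  qed
  also have "measure (PiM UNIV (\<lambda>_. ?D)) \<dots> = measure (PiM {..k} (\<lambda>_. ?D)) (?A {..k} {..k})"
    using measurable_crit_simplex[of "{..k}" k "{..k}" r] tm
    by (subst re[symmetric], subst measure_distr) (auto simp: sD)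
  finally show ?thesis unfolding simplex_prob_def[OF bd] .
qed


section \<open>From index sets to critical points, and the effect of extra sample points\<close>

context crit_sample begin

definition Nsum :: "nat set \<Rightarrow> 'a \<Rightarrow> real" where
  "Nsum N \<omega> = (\<Sum>a\<in>ksubsets k N. of_bool (ev a \<omega> \<and> \<not> hit a (N - a) \<omega>))"

lemma Nsum_eq: "Nsum N \<omega> = Ssum N \<omega> - Dsum N \<omega>"
  unfolding Nsum_def Ssum_def Dsum_def sum_subtractf[symmetric]
  using hit_imp_ev by (intro sum.cong) auto

lemma Nsum_meas [measurable]: "finite N \<Longrightarrow> Nsum N \<in> borel_measurable M"
  unfolding Nsum_eq[abs_def] using Dsum_meas by measurable

lemma Nsum_bounds: "0 \<le> Nsum N \<omega>" "Nsum N \<omega> \<le> Ssum N \<omega>"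
  using Dsum_bounds[of N \<omega>] by (simp_all add: Nsum_eq)

text \<open>The cluster bound at radius 0: two given points coincide with probability at most
  \<open>q * 0 ^ DIM('b)\<close>, which is 0.\<close>

lemma AE_inj:
  assumes "finite N"
  shows "AE \<omega> in M. inj_on (Xs \<omega>) N"
proof -
  have "AE \<omega> in M. X i \<omega> \<noteq> X j \<omega>" if "i \<noteq> j" for i j
  proof -
    have "prob {\<omega>\<in>space M. X i \<omega> = X j \<omega>} \<le> (q * 0 ^ DIM('b)) ^ (card {i, j} - 1)"
      by (rule prob_cluster) auto
    also have "\<dots> = 0" using that by simp
    finally have "prob {\<omega>\<in>space M. X i \<omega> = X j \<omega>} = 0" using measure_nonneg[of M] by (simp add: antisym)
    then have "emeasure M {\<omega>\<in>space M. X i \<omega> = X j \<omega>} = 0" by (simp add: emeasure_eq_measure)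
    then show ?thesis by (subst AE_iff_measurable[OF _ refl]) auto
  qed
  then have "AE \<omega> in M. \<forall>i\<in>N. \<forall>j\<in>N - {i}. X i \<omega> \<noteq> X j \<omega>"
    using assms by (intro AE_finite_allI) auto
  then show ?thesis by eventually_elim (auto simp: inj_on_def)
qed

text \<open>On an injective sample, sets of points correspond to sets of indices, and a sample point
  other than a vertex in the closed circumball is a hit by an index outside
  \<open>a\<close>.\<close>

lemma num_crit_eq_Nsum:
  assumes N: "finite N" and inj: "inj_on (Xs \<omega>) N"
  shows "real (num_crit k (Xs \<omega> ` N) r) = Nsum N \<omega>"
proof -
  let ?x = "Xs \<omega>" and ?P = "\<lambda>a. ev a \<omega> \<and> \<not> hit a (N - a) \<omega>"
  have inj': "inj_on ((`) ?x) (ksubsets k N)"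
    using inj by (intro inj_onI) (meson inj_on_image_eq_iff ksubsetsD(3))
  have iff: "crit_subset k r (?x ` N) (?x ` a) \<longleftrightarrow> ?P a" if a: "a \<in> ksubsets k N" for a
  proof (cases "ev a \<omega>")
    case True
    have "?x ` N - ?x ` a = ?x ` (N - a)" using inj ksubsetsD(3)[OF a] by (simp add: inj_on_image_set_diff)
    moreover have "hit a (N - a) \<omega> \<longleftrightarrow> (\<exists>j\<in>N - a. dist (circumcenter (?x ` a)) (X j \<omega>) \<le> circumradius (?x ` a))"
      using True ksubsetsD(4)[OF a] by (simp add: hit_def ball_hit_iff ev_def)
    moreover have "?x ` a \<subseteq> ?x ` N" using ksubsetsD(3)[OF a] by auto
    ultimately show ?thesis
      using True N unfolding crit_subset_def ev_def by (auto simp: not_le)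
  qed (simp add: crit_subset_def ev_def)
  have "{Y. crit_subset k r (?x ` N) Y} = (`) ?x ` {a\<in>ksubsets k N. ?P a}"
  proof (intro equalityI subsetI)
    fix Y assume "Y \<in> {Y. crit_subset k r (?x ` N) Y}"
    then have Y: "crit_subset k r (?x ` N) Y" by simp
    then have "Y \<subseteq> ?x ` N" "card Y = k + 1" using crit_simplexD(3) by (auto simp: crit_subset_def)
    then obtain a where a: "a \<subseteq> N" "Y = ?x ` a" by (auto simp: subset_image_iff)
    then have "card a = k + 1" using \<open>card Y = k + 1\<close> inj by (metis card_image inj_on_subset)
    then have "a \<in> ksubsets k N" using a by (simp add: ksubsets_def)
    then show "Y \<in> (`) ?x ` {a\<in>ksubsets k N. ?P a}" using a(2) Y iff by blast
  qed (use iff in auto)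
  then have "card {Y. crit_subset k r (?x ` N) Y} = card {a\<in>ksubsets k N. ?P a}"
    using card_image[OF inj_on_subset[OF inj', of "{a\<in>ksubsets k N. ?P a}"]] by auto
  then have "real (num_crit k (?x ` N) r) = real (card {a\<in>ksubsets k N. ?P a})"
    using num_crit_eq[OF k_pos, of "?x ` N" r] N by simp
  also have "\<dots> = Nsum N \<omega>"
    unfolding Nsum_def using finite_ksubsets[OF N] by (simp add: of_bool_def sum.If_cases Int_def)
  finally show ?thesis .
qed

text \<open>A new index set contains a new index; counting pairs of such an index and a set of
  \<open>k\<close> further indices can only overcount.\<close>

lemma card_ksubsets_diff_le:
  assumes N: "N \<subseteq> N'" "finite N'"
  shows "real (card (ksubsets k N' - ksubsets k N)) \<le> real (card (N' - N)) * real (card N') ^ k"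
proof -
  let ?S = "SIGMA j:N' - N. {b. b \<subseteq> N' \<and> card b = k}"
  have fS: "finite ?S" using N(2) by auto
  have "ksubsets k N' - ksubsets k N \<subseteq> (\<lambda>(j, b). insert j b) ` ?S"
  proof
    fix a assume a: "a \<in> ksubsets k N' - ksubsets k N"
    then obtain j where j: "j \<in> a" "j \<in> N' - N" by (auto simp: ksubsets_def)
    have "(j, a - {j}) \<in> ?S" using a j ksubsetsD(1-3)[of a k N'] by auto
    moreover have "a = insert j (a - {j})" using j by auto
    ultimately show "a \<in> (\<lambda>(j, b). insert j b) ` ?S" by (metis (no_types, lifting) image_eqI case_prod_conv)
  qed
  then have "card (ksubsets k N' - ksubsets k N) \<le> card ?S" by (rule surj_card_le[OF fS])
  also have "\<dots> = card (N' - N) * (card N' choose k)"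
    using N(2) by (subst card_SigmaI) (auto simp: n_subsets)
  finally have "real (card (ksubsets k N' - ksubsets k N)) \<le> real (card (N' - N)) * real (card N' choose k)"
    by (metis of_nat_le_iff of_nat_mult)
  also have "\<dots> \<le> real (card (N' - N)) * real (card N') ^ k"
    by (intro mult_left_mono choose_le_power) simp
  finally show ?thesis .
qed

text \<open>The count changes in two ways: simplices that use a new point may appear, and old ones
  are lost when a new point falls into their ball. The bounds on both effects are linear in the
  number of new points.\<close>

lemma Nsum_coupling:
  assumes N: "N \<subseteq> N'" "finite N'"
  shows "expectation (\<lambda>\<omega>. \<bar>Nsum N' \<omega> - Nsum N \<omega>\<bar>) \<le>
     real (card (N' - N)) * real (card N') ^ k * theta ^ k * (1 + real (card N') * theta)"
proof -
  let ?K = "ksubsets k N" and ?K' = "ksubsets k N'"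
  have fN: "finite N" using N finite_subset by blast
  have KK: "?K \<subseteq> ?K'" using N(1) by (auto simp: ksubsets_def)
  have fK': "finite ?K'" using finite_ksubsets[OF N(2)] .
  have fJ: "finite (N' - N)" using N by auto
  let ?U = "\<lambda>\<omega>. (\<Sum>a\<in>?K' - ?K. of_bool (ev a \<omega>)) + (\<Sum>a\<in>?K. of_bool (hit a (N' - N) \<omega>)) :: real"
  have le: "\<bar>Nsum N' \<omega> - Nsum N \<omega>\<bar> \<le> ?U \<omega>" for \<omega>
  proof -
    let ?c = "\<lambda>N a. of_bool (ev a \<omega> \<and> \<not> hit a (N - a) \<omega>) :: real"
    have e: "Nsum N' \<omega> - Nsum N \<omega> = (\<Sum>a\<in>?K' - ?K. ?c N' a) + (\<Sum>a\<in>?K. ?c N' a - ?c N a)"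
      unfolding Nsum_def sum.subset_diff[OF KK fK'] by (simp only: sum_subtractf)
    have "\<bar>Nsum N' \<omega> - Nsum N \<omega>\<bar> \<le> \<bar>\<Sum>a\<in>?K' - ?K. ?c N' a\<bar> + \<bar>\<Sum>a\<in>?K. ?c N' a - ?c N a\<bar>"
      unfolding e by (rule abs_triangle_ineq)
    also have "\<dots> \<le> (\<Sum>a\<in>?K' - ?K. \<bar>?c N' a\<bar>) + (\<Sum>a\<in>?K. \<bar>?c N' a - ?c N a\<bar>)"
      by (intro add_mono sum_abs)
    also have "\<dots> \<le> ?U \<omega>"
    proof (intro add_mono sum_mono)
      fix a assume a: "a \<in> ?K"
      have "hit a (N' - a) \<omega> \<longleftrightarrow> hit a (N - a) \<omega> \<or> hit a (N' - N) \<omega>"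
        using N(1) ksubsetsD(3)[OF a] unfolding hit_def by blast
      then show "\<bar>?c N' a - ?c N a\<bar> \<le> of_bool (hit a (N' - N) \<omega>)" by auto
    qed auto
    finally show ?thesis .
  qed
  have hp: "Measurable.pred M (hit a (N' - N))" if "a \<in> ?K" for a using hit_pred[OF that fJ] .
  have ep: "Measurable.pred M (ev a)" if "a \<in> ?K' - ?K" for a using ev_pred[of a N'] that by auto
  have i1: "integrable M (\<lambda>\<omega>. of_bool (ev a \<omega>) :: real)" if "a \<in> ?K' - ?K" for a
    using ep[OF that] by (rule integrable_of_bool)
  have i2: "integrable M (\<lambda>\<omega>. of_bool (hit a (N' - N) \<omega>) :: real)" if "a \<in> ?K" for a
    using hp[OF that] by (rule integrable_of_bool)
  have iU: "integrable M ?U" using i1 i2 by (intro Bochner_Integration.integrable_add Bochner_Integration.integrable_sum) auto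
  have iD: "integrable M (\<lambda>\<omega>. \<bar>Nsum N' \<omega> - Nsum N \<omega>\<bar>)"
    by (rule Bochner_Integration.integrable_bound[OF iU])
      (use le N(2) fN in \<open>auto intro: order_trans[OF le abs_ge_self]\<close>)
  have "expectation (\<lambda>\<omega>. \<bar>Nsum N' \<omega> - Nsum N \<omega>\<bar>) \<le> expectation ?U"
    by (intro integral_mono iD iU le)
  also have "\<dots> = (\<Sum>a\<in>?K' - ?K. prob {\<omega>\<in>space M. ev a \<omega>}) + (\<Sum>a\<in>?K. prob {\<omega>\<in>space M. hit a (N' - N) \<omega>})"
  proof -
    have "expectation (\<lambda>\<omega>. \<Sum>a\<in>?K' - ?K. of_bool (ev a \<omega>) :: real) = (\<Sum>a\<in>?K' - ?K. prob {\<omega>\<in>space M. ev a \<omega>})"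
      using i1 ep by (subst Bochner_Integration.integral_sum) (auto intro!: sum.cong expectation_of_bool)
    moreover have "expectation (\<lambda>\<omega>. \<Sum>a\<in>?K. of_bool (hit a (N' - N) \<omega>) :: real) = (\<Sum>a\<in>?K. prob {\<omega>\<in>space M. hit a (N' - N) \<omega>})"
      using i2 hp by (subst Bochner_Integration.integral_sum) (auto intro!: sum.cong expectation_of_bool)
    ultimately show ?thesis
      using i1 i2 by (subst Bochner_Integration.integral_add) (auto intro!: Bochner_Integration.integrable_sum)
  qed
  also have "\<dots> \<le> (\<Sum>a\<in>?K' - ?K. theta ^ k) + (\<Sum>a\<in>?K. real (card (N' - N)) * theta ^ (k + 1))"
  proof (intro add_mono sum_mono)
    show "prob {\<omega>\<in>space M. ev a \<omega>} \<le> theta ^ k" if "a \<in> ?K' - ?K" for a using prob_ev_le[of a N'] that by auto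
    show "prob {\<omega>\<in>space M. hit a (N' - N) \<omega>} \<le> real (card (N' - N)) * theta ^ (k + 1)" if "a \<in> ?K" for a
      using prob_hit_le[OF that fJ] ksubsetsD(3)[OF that] by blast
  qed
  also have "\<dots> = real (card (?K' - ?K)) * theta ^ k + real (card N choose (k + 1)) * (real (card (N' - N)) * theta ^ (k + 1))"
    using fN by (simp add: card_ksubsets)
  also have "\<dots> \<le> (real (card (N' - N)) * real (card N') ^ k) * theta ^ k + real (card N') ^ (k + 1) * (real (card (N' - N)) * theta ^ (k + 1))"
  proof (intro add_mono mult_right_mono card_ksubsets_diff_le N)
    have "real (card N choose (k + 1)) \<le> real (card N) ^ (k + 1)" by (rule choose_le_power)
    also have "\<dots> \<le> real (card N') ^ (k + 1)" using N by (intro power_mono of_nat_mono card_mono) auto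
    finally show "real (card N choose (k + 1)) \<le> real (card N') ^ (k + 1)" .
  qed (use theta_nonneg in auto)
  also have "\<dots> = real (card (N' - N)) * real (card N') ^ k * theta ^ k * (1 + real (card N') * theta)"
    by (simp add: algebra_simps)
  finally show ?thesis .
qed

end


section \<open>Measurability of the number of critical points with respect to counts\<close>

text \<open>The events about which \<open>poisson_process\<close> gives information. Measurability
  of \<open>num_crit\<close> for this sigma-algebra is what allows the process to be exchanged for
  another one of equal law.\<close>

definition count_sigma :: "'a::euclidean_space set measure" where
  "count_sigma = sigma UNIV {{P. card (P \<inter> A) = j} | A j. A \<in> sets borel}"

lemma space_count_sigma [simp]: "space count_sigma = UNIV"
  by (simp add: count_sigma_def)

lemma count_sigma_gen: "A \<in> sets borel \<Longrightarrow> {P. card (P \<inter> A) = j} \<in> sets count_sigma"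
  unfolding count_sigma_def by (auto intro!: sigma_sets.Basic simp: sets_measure_of)

lemma count_meas [measurable]: "A \<in> sets borel \<Longrightarrow> (\<lambda>P. card (P \<inter> A)) \<in> count_sigma \<rightarrow>\<^sub>M count_space UNIV"
  using count_sigma_gen[of A] by (intro measurable_count_space_eq2_countable[THEN iffD2]) (auto simp: vimage_def)

lemma measurable_count_sigma:
  fixes P :: "'w \<Rightarrow> 'a::euclidean_space set"
  assumes "\<And>A j. A \<in> sets borel \<Longrightarrow> {\<omega>\<in>space M. card (P \<omega> \<inter> A) = j} \<in> sets M"
  shows "P \<in> M \<rightarrow>\<^sub>M count_sigma"
  unfolding count_sigma_def
proof (rule measurable_measure_of)
  fix Q assume "Q \<in> {{P. card (P \<inter> A) = j} | A j. A \<in> sets (borel :: 'a measure)}"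
  then obtain A j where Q: "A \<in> sets (borel :: 'a measure)" "Q = {P. card (P \<inter> A) = j}" by blast
  have "P -` Q \<inter> space M = {\<omega>\<in>space M. card (P \<omega> \<inter> A) = j}" unfolding Q(2) by auto
  then show "P -` Q \<inter> space M \<in> sets M" using assms[OF Q(1)] by simp
qed auto

text \<open>Recovers a point from counts: whether it lies in \<open>A\<close> is visible in the
  count of \<open>b \<inter> A\<close>. The value 0 is a default for sets \<open>b\<close> that do
  not isolate a point.\<close>

definition point_in :: "'a::euclidean_space set \<Rightarrow> 'a set \<Rightarrow> 'a" where
  "point_in b P = (if card (P \<inter> b) = 1 then the_elem (P \<inter> b) else 0)"

lemma point_in: "card (P \<inter> b) = 1 \<Longrightarrow> P \<inter> b = {point_in b P}"
  unfolding point_in_def by (elim card_1_singletonE) simp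

lemma point_in_meas:
  assumes b: "b \<in> sets borel"
  shows "point_in b \<in> borel_measurable count_sigma"
proof (rule measurableI)
  fix A :: "'a set" assume A: "A \<in> sets borel"
  have "point_in b P \<in> A \<longleftrightarrow> (if card (P \<inter> b) = 1 then card (P \<inter> (b \<inter> A)) = 1 else 0 \<in> A)" for P
  proof (cases "card (P \<inter> b) = 1")
    case True
    have "x \<in> P \<and> x \<in> b \<longleftrightarrow> x = point_in b P" for x using point_in[OF True] by blast
    then have "P \<inter> (b \<inter> A) = {x. x = point_in b P \<and> x \<in> A}" by blast
    then have "P \<inter> (b \<inter> A) = (if point_in b P \<in> A then {point_in b P} else {})" by auto
    then show ?thesis using True by auto
  qed (simp add: point_in_def)
  then have "point_in b -` A \<inter> space count_sigma = {P\<in>space count_sigma. if card (P \<inter> b) = 1 then card (P \<inter> (b \<inter> A)) = 1 else 0 \<in> A}"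
    by auto
  also have "\<dots> \<in> sets count_sigma"
    using count_meas[OF b] count_meas[of "b \<inter> A"] A b by measurable
  finally show "point_in b -` A \<inter> space count_sigma \<in> sets count_sigma" .
qed simp

definition pts :: "'a::euclidean_space set list \<Rightarrow> 'a set \<Rightarrow> nat \<Rightarrow> 'a" where
  "pts bs P i = (if i < length bs then point_in (bs ! i) P else 0)"

lemma pts_meas:
  assumes "\<And>b. b \<in> set bs \<Longrightarrow> b \<in> sets borel"
  shows "pts bs \<in> count_sigma \<rightarrow>\<^sub>M PiM UNIV (\<lambda>_. borel)"
proof (rule measurable_PiM_single')
  fix i :: nat assume "i \<in> UNIV"
  show "(\<lambda>P. pts bs P i) \<in> borel_measurable count_sigma"
    unfolding pts_def using assms by (cases "i < length bs") (auto intro!: point_in_meas)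
qed (auto simp: PiE_def)

text \<open>For a set of infinite cardinality the counts \<open>card (P \<inter> A)\<close> degenerate to \<open>0\<close>; adding a set
  known to contain exactly one point still makes emptiness visible.\<close>

definition no_more :: "'a::euclidean_space set list \<Rightarrow> 'a set \<Rightarrow> 'a set \<Rightarrow> bool" where
  "no_more bs A P \<longleftrightarrow> card (P \<inter> ((A - \<Union>(set bs)) \<union> hd bs)) = 1"

text \<open>The test set always contains the isolated point of \<open>hd bs\<close>, so its count is
  1 precisely if no further point of \<open>P\<close> remains; an infinite remainder gives count
  0.\<close>

lemma no_more_iff:
  assumes bs: "bs \<noteq> []" "\<And>b. b \<in> set bs \<Longrightarrow> card (P \<inter> b) = 1"
  shows "no_more bs A P \<longleftrightarrow> P \<inter> A \<subseteq> pts bs P ` {..<length bs}"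
proof -
  let ?Y = "pts bs P ` {..<length bs}"
  have U: "P \<inter> \<Union>(set bs) = ?Y"
  proof -
    have "P \<inter> \<Union>(set bs) = (\<Union>b\<in>set bs. P \<inter> b)" by auto
    also have "\<dots> = (\<Union>b\<in>set bs. {point_in b P})" using point_in[OF bs(2)] by auto
    also have "\<dots> = ?Y" by (auto simp: pts_def set_conv_nth)
    finally show ?thesis .
  qed
  have h: "P \<inter> hd bs = {point_in (hd bs) P}" using point_in[OF bs(2)] bs(1) by simp
  have "P \<inter> ((A - \<Union>(set bs)) \<union> hd bs) = (P \<inter> A - ?Y) \<union> {point_in (hd bs) P}"
    using U h by auto
  moreover have "point_in (hd bs) P \<in> ?Y"
  proof -
    have "point_in (hd bs) P \<in> P \<inter> hd bs" using h by simp
    moreover have "hd bs \<in> set bs" using bs(1) by simp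
    ultimately show ?thesis unfolding U[symmetric] by blast
  qed
  ultimately show ?thesis
    unfolding no_more_def by (auto simp: card_1_singleton_iff)
qed

lemma no_more_meas [measurable (raw)]:
  assumes "A \<in> sets borel" "\<And>b. b \<in> set bs \<Longrightarrow> b \<in> sets borel" "bs \<noteq> []"
  shows "Measurable.pred count_sigma (no_more bs A)"
proof -
  have "(A - \<Union>(set bs)) \<union> hd bs \<in> sets borel"
    using assms by (intro sets.Un sets.Diff sets.finite_Union) auto
  from count_meas[OF this] show ?thesis unfolding no_more_def by measurable
qed

lemma pred_bex_countable:
  assumes "countable I" "\<And>i. i \<in> I \<Longrightarrow> Measurable.pred M (P i)"
  shows "Measurable.pred M (\<lambda>x. \<exists>i\<in>I. P i x)"
  using assms unfolding pred_def by (intro sets.sets_Collect_countable_Ex') auto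

text \<open>Infinitely many distances means \<open>m\<close> different ones for every
  \<open>m\<close>. Different distances stay separated when the points are enlarged to small balls
  with centers in \<open>D\<close> and rational radii, so the only questions left are whether such
  balls meet \<open>S\<close>.\<close>

lemma infinite_dist_iff:
  fixes c :: "'a::euclidean_space" and D :: "'a set"
  assumes D: "\<And>U. open U \<Longrightarrow> U \<noteq> {} \<Longrightarrow> \<exists>d\<in>D. d \<in> U"
  shows "infinite (dist c ` S) \<longleftrightarrow> (\<forall>m. \<exists>L\<in>lists (D \<times> \<rat>). length L = m \<and>
     (\<forall>i<m. S \<inter> ball (fst (L ! i)) (snd (L ! i)) \<noteq> {}) \<and>
     (\<forall>i<m. \<forall>j<m. i \<noteq> j \<longrightarrow> snd (L ! i) + snd (L ! j) < \<bar>dist c (fst (L ! i)) - dist c (fst (L ! j))\<bar>))"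
    (is "_ \<longleftrightarrow> (\<forall>m. ?R m)")
proof
  assume inf: "infinite (dist c ` S)"
  show "\<forall>m. ?R m"
  proof
    fix m
    obtain T where T: "T \<subseteq> dist c ` S" "card T = m" "finite T"
      using infinite_arbitrarily_large[OF inf] by blast
    obtain t where t: "bij_betw t {..<m} T"
      using ex_bij_betw_nat_finite[OF T(3)] T(2) by (auto simp: lessThan_atLeast0)
    have "\<exists>p\<in>S. dist c p = t i" if "i < m" for i
    proof -
      have "t i \<in> dist c ` S" using t T(1) that by (auto simp: bij_betw_def)
      then obtain p where "p \<in> S" "t i = dist c p" by blast
      then show ?thesis by (metis (no_types))
    qed
    then obtain p where p: "\<And>i. i < m \<Longrightarrow> p i \<in> S" "\<And>i. i < m \<Longrightarrow> dist c (p i) = t i" by metis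
    define gaps where "gaps = insert 1 ((\<lambda>(i, j). \<bar>t i - t j\<bar>) ` {(i, j). i < m \<and> j < m \<and> i \<noteq> j})"
    have fg: "finite gaps" unfolding gaps_def
    proof (intro finite.insertI finite_imageI)
      show "finite {(i, j). i < m \<and> j < m \<and> i \<noteq> j}"
        by (rule finite_subset[of _ "{..<m} \<times> {..<m}"]) auto
    qed
    have "0 < Min gaps" using fg t by (auto simp: gaps_def bij_betw_def inj_on_def)
    \<comment> \<open>A quarter of the smallest gap: passing from points to ball centers moves each
      distance by less than the radius, and the separation must still exceed the sum of two
      radii.\<close>
    then obtain s :: rat where s: "0 < (of_rat s :: real)" "of_rat s < Min gaps / 4"
      using of_rat_dense[of 0 "Min gaps / 4"] by auto
    define s' :: real where "s' = of_rat s"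
    have s': "0 < s'" "s' < Min gaps / 4" "s' \<in> \<rat>" using s by (auto simp: s'_def)
    have gap: "4 * s' < \<bar>t i - t j\<bar>" if "i < m" "j < m" "i \<noteq> j" for i j
    proof -
      have "Min gaps \<le> \<bar>t i - t j\<bar>" using fg that unfolding gaps_def by (intro Min_le) auto
      then show ?thesis using s' by linarith
    qed
    have "\<exists>d\<in>D. d \<in> ball (p i) s'" for i using s'(1) by (intro D) auto
    then obtain d where d: "\<And>i. d i \<in> D" "\<And>i. dist (p i) (d i) < s'" by (metis mem_ball)
    have dd: "\<bar>dist c (d i) - t i\<bar> < s'" if "i < m" for i
      using d(2)[of i] p(2)[OF that] dist_triangle[of c "d i" "p i"] dist_triangle[of c "p i" "d i"]
      by (simp add: dist_commute abs_less_iff)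
    show "?R m"
    proof (intro bexI[of _ "map (\<lambda>i. (d i, s')) [0..<m]"] conjI allI impI)
      show "map (\<lambda>i. (d i, s')) [0..<m] \<in> lists (D \<times> \<rat>)" using d(1) s'(3) by auto
      fix i assume i: "i < m"
      show "S \<inter> ball (fst (map (\<lambda>i. (d i, s')) [0..<m] ! i)) (snd (map (\<lambda>i. (d i, s')) [0..<m] ! i)) \<noteq> {}"
        using i p(1)[OF i] d(2)[of i] by (auto simp: dist_commute)
      fix j assume j: "j < m" "i \<noteq> j"
      show "snd (map (\<lambda>i. (d i, s')) [0..<m] ! i) + snd (map (\<lambda>i. (d i, s')) [0..<m] ! j) <
        \<bar>dist c (fst (map (\<lambda>i. (d i, s')) [0..<m] ! i)) - dist c (fst (map (\<lambda>i. (d i, s')) [0..<m] ! j))\<bar>"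
        using i j dd[OF i] dd[OF j(1)] gap[OF i j] by simp
    qed simp
  qed
next
  assume R: "\<forall>m. ?R m"
  show "infinite (dist c ` S)"
  proof
    assume fin: "finite (dist c ` S)"
    define m where "m = Suc (card (dist c ` S))"
    obtain L where L: "\<forall>i<m. S \<inter> ball (fst (L ! i)) (snd (L ! i)) \<noteq> {}"
       "\<forall>i<m. \<forall>j<m. i \<noteq> j \<longrightarrow> snd (L ! i) + snd (L ! j) < \<bar>dist c (fst (L ! i)) - dist c (fst (L ! j))\<bar>"
      using R by blast
    have "\<exists>p. p \<in> S \<and> dist (fst (L ! i)) p < snd (L ! i)" if "i < m" for i using L(1) that by auto
    then obtain p where p: "\<And>i. i < m \<Longrightarrow> p i \<in> S" "\<And>i. i < m \<Longrightarrow> dist (fst (L ! i)) (p i) < snd (L ! i)" by metis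
    have "inj_on (\<lambda>i. dist c (p i)) {..<m}"
    proof (rule inj_onI, rule ccontr)
      fix i j assume ij: "i \<in> {..<m}" "j \<in> {..<m}" "dist c (p i) = dist c (p j)" "i \<noteq> j"
      have *: "\<bar>dist c (fst (L ! i)) - dist c (p i)\<bar> < snd (L ! i)" if "i < m" for i
        using p(2)[OF that] dist_triangle[of c "fst (L ! i)" "p i"] dist_triangle[of c "p i" "fst (L ! i)"]
        by (simp add: dist_commute abs_less_iff)
      have "snd (L ! i) + snd (L ! j) < \<bar>dist c (fst (L ! i)) - dist c (fst (L ! j))\<bar>" using L(2) ij by auto
      then show False using *[of i] *[of j] ij by auto
    qed
    then have "card ((\<lambda>i. dist c (p i)) ` {..<m}) = m" by (simp add: card_image)
    moreover have "(\<lambda>i. dist c (p i)) ` {..<m} \<subseteq> dist c ` S" using p(1) by auto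
    ultimately have "m \<le> card (dist c ` S)" using card_mono[OF fin] by metis
    then show False by (simp add: m_def)
  qed
qed

text \<open>The last alternative covers infinite \<open>S\<close>, whose \<open>card\<close> is
  0.\<close>

lemma card_eq_iff_subsets:
  "card S = m \<longleftrightarrow> ((\<exists>T\<subseteq>S. finite T \<and> card T = m) \<and> \<not> (\<exists>T\<subseteq>S. finite T \<and> card T = Suc m)) \<or>
     (m = 0 \<and> (\<forall>n. \<exists>T\<subseteq>S. finite T \<and> card T = n))"
proof (cases "finite S")
  case True
  have "(\<exists>T\<subseteq>S. finite T \<and> card T = n) \<longleftrightarrow> n \<le> card S" for n
    using True by (metis card_mono obtain_subset_with_card_n)
  then show ?thesis by (auto simp: not_le) (metis Suc_n_not_le_n)
next
  case False
  then have "\<exists>T\<subseteq>S. finite T \<and> card T = n" for n using infinite_arbitrarily_large by blast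
  then show ?thesis using False by auto
qed

context
  fixes k :: nat and r :: real
begin

text \<open>A list of sets that each contain exactly one point of \<open>P\<close> names the set of
  these points. With lists taken from a countable base there are only countably many names.\<close>

definition coded :: "'a::euclidean_space set list \<Rightarrow> 'a set \<Rightarrow> bool" where
  "coded bs P \<longleftrightarrow> (\<forall>b\<in>set bs. card (P \<inter> b) = 1) \<and> crit_subset k r P (pts bs P ` {..k})"

text \<open>The points of \<open>Y\<close> are isolated in \<open>P\<close>: finitely many distances
  from the center leave a gap beyond the sphere, and by the triangle inequality no point of
  \<open>P\<close> outside \<open>Y\<close> comes closer to a vertex than this gap. Sets of the base
  inside small balls therefore separate them.\<close>

lemma crit_subset_coded:
  fixes P :: "'a::euclidean_space set"
  assumes Y: "crit_subset k r P Y" and B: "topological_basis B"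
  shows "\<exists>bs\<in>lists B. length bs = k + 1 \<and> coded bs P \<and> pts bs P ` {..k} = Y"
proof -
  have cs: "crit_simplex k r Y" and YP: "Y \<subseteq> P" and fin: "finite (dist (circumcenter Y) ` P)"
    and far: "\<And>p. p \<in> P - Y \<Longrightarrow> circumradius Y < dist (circumcenter Y) p"
    using Y by (auto simp: crit_subset_def)
  note D = crit_simplexD[OF cs]
  \<comment> \<open>All gaps to be respected: from the sphere to the other points of
    \<open>P\<close>, and between vertices. The element 1 keeps the set nonempty.\<close>
  define S where "S = insert 1 ((\<lambda>p. dist (circumcenter Y) p - circumradius Y) ` (P - Y) \<union> (\<lambda>(y, z). dist y z) ` {(y, z). y \<in> Y \<and> z \<in> Y \<and> y \<noteq> z})"
  have fS: "finite S"
  proof -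
    have "(\<lambda>p. dist (circumcenter Y) p - circumradius Y) ` (P - Y) \<subseteq> (\<lambda>t. t - circumradius Y) ` dist (circumcenter Y) ` P" by auto
    then have "finite ((\<lambda>p. dist (circumcenter Y) p - circumradius Y) ` (P - Y))"
      by (rule finite_subset) (intro finite_imageI fin)
    moreover have "finite {(y, z). y \<in> Y \<and> z \<in> Y \<and> y \<noteq> z}" 
      by (rule finite_subset[OF _ finite_cartesian_product[OF D(1) D(1)]]) blast
    ultimately show ?thesis unfolding S_def by simp
  qed
  have "0 < Min S" using fS far by (auto simp: S_def)
  have iso: "P \<inter> ball y (Min S) = {y}" if y: "y \<in> Y" for y
  proof -
    have "Min S \<le> dist y p" if p: "p \<in> P" "p \<noteq> y" for p
    proof (cases "p \<in> Y")
      case True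
      then have "dist y p \<in> S" unfolding S_def using y p(2) by force
      then show ?thesis using fS by simp
    next
      case False
      then have "dist (circumcenter Y) p - circumradius Y \<in> S" unfolding S_def using p(1) by auto
      then have "Min S \<le> dist (circumcenter Y) p - circumradius Y" using fS by simp
      also have "\<dots> \<le> dist y p" using D(7)[OF y] dist_triangle[of "circumcenter Y" p y] by simp
      finally show ?thesis .
    qed
    then have "x = y" if "x \<in> P" "dist y x < Min S" for x using that by (meson not_less)
    then show ?thesis using y YP \<open>0 < Min S\<close> by (auto simp del: Min_gr_iff)
  qed
  have "\<exists>b\<in>B. P \<inter> b = {y}" if y: "y \<in> Y" for y
  proof -
    obtain b where b: "b \<in> B" "y \<in> b" "b \<subseteq> ball y (Min S)"
      using topological_basisE[OF B open_ball, of y y "Min S"] \<open>0 < Min S\<close> by auto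
    then show ?thesis using iso[OF y] y YP by (intro bexI[of _ b]) auto
  qed
  then obtain b where b: "\<And>y. y \<in> Y \<Longrightarrow> b y \<in> B" "\<And>y. y \<in> Y \<Longrightarrow> P \<inter> b y = {y}" by metis
  obtain ys where ys: "set ys = Y" "distinct ys" using finite_distinct_list[OF D(1)] by blast
  have len: "length ys = k + 1" using ys D(3) distinct_card by metis
  let ?bs = "map b ys"
  have pt: "pts ?bs P i = ys ! i" if "i < k + 1" for i
  proof -
    have "ys ! i \<in> Y" using ys(1) len that by auto
    then have "card (P \<inter> b (ys ! i)) = 1" "P \<inter> b (ys ! i) = {ys ! i}" using b(2) by auto
    then have "point_in (b (ys ! i)) P = ys ! i" using point_in by fastforce
    then show ?thesis using that len by (simp add: pts_def)
  qed
  have "pts ?bs P ` {..k} = (!) ys ` {..<k + 1}"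
    using pt by (auto simp: lessThan_Suc_atMost intro!: image_cong)
  also have "\<dots> = Y" using ys(1) len by (auto simp: set_conv_nth)
  finally have im: "pts ?bs P ` {..k} = Y" .
  have "coded ?bs P" unfolding coded_def im using Y b(2) ys(1) by auto
  moreover have "?bs \<in> lists B" using b(1) ys(1) by auto
  ultimately show ?thesis using im len by (intro bexI[of _ ?bs]) auto
qed

text \<open>Emptiness of the ball and finiteness of the distances are both expressed by
  \<open>no_more\<close> for balls with centers in a dense set and rational radii, which leaves
  countably many tests once \<open>D\<close> is countable.\<close>

lemma coded_iff:
  fixes P :: "'a::euclidean_space set"
  assumes bs: "length bs = k + 1" "\<And>b. b \<in> set bs \<Longrightarrow> card (P \<inter> b) = 1"
    and D: "\<And>U. open U \<Longrightarrow> U \<noteq> {} \<Longrightarrow> \<exists>d\<in>D. (d::'a) \<in> U"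
  defines "c \<equiv> crit_center k r (pts bs P ` {..k})"
  shows "crit_subset k r P (pts bs P ` {..k}) \<longleftrightarrow> crit_simplex k r (pts bs P ` {..k}) \<and>
     (\<exists>p\<in>D. \<exists>s\<in>\<rat>. dist c p + dist c (pts bs P 0) < s \<and> no_more bs (ball p s) P) \<and>
     \<not> (\<forall>m. \<exists>L\<in>lists (D \<times> \<rat>). length L = m \<and>
       (\<forall>i<m. \<not> no_more bs (ball (fst (L ! i)) (snd (L ! i))) P) \<and>
       (\<forall>i<m. \<forall>j<m. i \<noteq> j \<longrightarrow> snd (L ! i) + snd (L ! j) < \<bar>dist c (fst (L ! i)) - dist c (fst (L ! j))\<bar>))"
proof (cases "crit_simplex k r (pts bs P ` {..k})")
  case True
  define Y where "Y = pts bs P ` {..k}"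
  have Yl: "Y = pts bs P ` {..<length bs}" using bs(1) by (simp add: Y_def lessThan_Suc_atMost)
  have bsn: "bs \<noteq> []" using bs(1) by auto
  have nm: "no_more bs A P \<longleftrightarrow> (P - Y) \<inter> A = {}" for A
    using no_more_iff[OF bsn bs(2), of A] unfolding Yl by auto
  have YP: "Y \<subseteq> P"
  proof -
    have "pts bs P i \<in> P" if "i \<le> k" for i
      using point_in[OF bs(2), of "bs ! i"] that bs(1) by (auto simp: pts_def)
    then show ?thesis by (auto simp: Y_def)
  qed
  note cs = True[folded Y_def]
  note DD = crit_simplexD[OF cs]
  have c: "c = circumcenter Y" using cs by (simp add: c_def crit_center_def Y_def)
  have R: "dist c (pts bs P 0) = circumradius Y" unfolding c by (rule DD(7)) (auto simp: Y_def)
  have split: "dist c ` P = dist c ` (P - Y) \<union> dist c ` Y" using YP by auto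
  have fin_iff: "finite (dist c ` P) \<longleftrightarrow> finite (dist c ` (P - Y))"
    unfolding split using DD(1) by simp
  have inf: "finite (dist c ` (P - Y)) \<longleftrightarrow> \<not> (\<forall>m. \<exists>L\<in>lists (D \<times> \<rat>). length L = m \<and>
       (\<forall>i<m. \<not> no_more bs (ball (fst (L ! i)) (snd (L ! i))) P) \<and>
       (\<forall>i<m. \<forall>j<m. i \<noteq> j \<longrightarrow> snd (L ! i) + snd (L ! j) < \<bar>dist c (fst (L ! i)) - dist c (fst (L ! j))\<bar>))"
    using infinite_dist_iff[OF D, of c "P - Y"] unfolding nm by blast
  \<comment> \<open>If the distances are finitely many, an empty closed ball stays empty when
    slightly enlarged, which leaves room for a center in \<open>D\<close> and a rational radius.
    Conversely such a ball contains the closed circumball.\<close>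
  have far: "(\<forall>p\<in>P - Y. circumradius Y < dist c p) \<longleftrightarrow>
     (\<exists>p\<in>D. \<exists>s\<in>\<rat>. dist c p + dist c (pts bs P 0) < s \<and> no_more bs (ball p s) P)"
    if fin: "finite (dist c ` (P - Y))"
  proof
    assume "\<exists>p\<in>D. \<exists>s\<in>\<rat>. dist c p + dist c (pts bs P 0) < s \<and> no_more bs (ball p s) P"
    then obtain p s where p: "dist c p + circumradius Y < s" "(P - Y) \<inter> ball p s = {}" unfolding nm R by blast
    show "\<forall>p\<in>P - Y. circumradius Y < dist c p"
    proof (rule ballI, rule ccontr)
      fix x assume x: "x \<in> P - Y" "\<not> circumradius Y < dist c x"
      have "dist p x \<le> dist c p + dist c x" by (metis dist_commute dist_triangle)
      then have "x \<in> ball p s" using p(1) x(2) by simp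
      then show False using p(2) x(1) by blast
    qed
  next
    assume far: "\<forall>p\<in>P - Y. circumradius Y < dist c p"
    define S where "S = insert 1 ((\<lambda>t. t - circumradius Y) ` dist c ` (P - Y))"
    have fS: "finite S" using fin by (simp add: S_def)
    have d: "0 < Min S" using fS far by (auto simp: S_def)
    have dle: "circumradius Y + Min S \<le> dist c x" if "x \<in> P - Y" for x
    proof -
      have "dist c x - circumradius Y \<in> S" using that by (auto simp: S_def)
      then have "Min S \<le> dist c x - circumradius Y" using fS by simp
      then show ?thesis by simp
    qed
    have "\<exists>p\<in>D. p \<in> ball c (Min S / 3)" using d by (intro D) auto
    then obtain p where p: "p \<in> D" "dist c p < Min S / 3" by auto
    \<comment> \<open>Thirds of the gap: the radius must exceed the circumradius by more than
      \<open>dist c p\<close>, and the ball around \<open>p\<close> must keep within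
      \<open>circumradius Y + Min S\<close> of \<open>c\<close>.\<close>
    obtain s :: rat where s: "circumradius Y + Min S / 3 < of_rat s" "of_rat s < circumradius Y + 2 * Min S / 3"
      using of_rat_dense[of "circumradius Y + Min S / 3" "circumradius Y + 2 * Min S / 3"] d by auto
    have "(P - Y) \<inter> ball p (of_rat s) = {}"
    proof (rule ccontr)
      assume "(P - Y) \<inter> ball p (of_rat s) \<noteq> {}"
      then obtain x where "x \<in> P - Y" "x \<in> ball p (of_rat s)" by blast
      then have x: "x \<in> P - Y" "dist p x < of_rat s" by simp_all
      have "dist c x \<le> dist c p + dist p x" by (rule dist_triangle)
      then show False using dle[OF x(1)] x(2) p(2) s(2) by simp
    qed
    then show "\<exists>p\<in>D. \<exists>s\<in>\<rat>. dist c p + dist c (pts bs P 0) < s \<and> no_more bs (ball p s) P"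
      unfolding nm R using p s by (intro bexI[of _ p] bexI[of _ "of_rat s"]) auto
  qed
  have "crit_subset k r P Y \<longleftrightarrow> (\<forall>p\<in>P - Y. circumradius Y < dist c p) \<and> finite (dist c ` (P - Y))"
    unfolding crit_subset_def c[symmetric] fin_iff using cs YP by simp
  also have "\<dots> \<longleftrightarrow> (\<exists>p\<in>D. \<exists>s\<in>\<rat>. dist c p + dist c (pts bs P 0) < s \<and> no_more bs (ball p s) P) \<and> finite (dist c ` (P - Y))"
    using far by blast
  finally have fe: "crit_subset k r P Y \<longleftrightarrow>
     (\<exists>p\<in>D. \<exists>s\<in>\<rat>. dist c p + dist c (pts bs P 0) < s \<and> no_more bs (ball p s) P) \<and> finite (dist c ` (P - Y))" .
  show ?thesis unfolding Y_def[symmetric] inf[symmetric] fe by (simp only: cs simp_thms)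
qed (simp add: crit_subset_def)

lemma coded_meas:
  assumes bs: "length bs = k + 1" "\<And>b. b \<in> set bs \<Longrightarrow> b \<in> sets borel"
  shows "Measurable.pred (count_sigma :: 'a::euclidean_space set measure) (coded bs)"
proof -
  obtain D :: "'a set" where D: "countable D" "\<And>U. open U \<Longrightarrow> U \<noteq> {} \<Longrightarrow> \<exists>d\<in>D. d \<in> U"
    using countable_dense_setE by blast
  have cl: "countable (lists (D \<times> (\<rat> :: real set)))" using D(1) countable_rat by (intro countable_lists) auto
  define c where "c P = crit_center k r (pts bs P ` {..k})" for P
  have bsn: "bs \<noteq> []" using bs(1) by auto
  have pm: "pts bs \<in> count_sigma \<rightarrow>\<^sub>M PiM UNIV (\<lambda>_. borel)" by (rule pts_meas) (rule bs(2))
  have p0[measurable]: "(\<lambda>P. pts bs P i) \<in> borel_measurable count_sigma" for i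
    using measurable_compose[OF pm measurable_component_singleton[of i UNIV]] by simp
  have csm[measurable]: "Measurable.pred count_sigma (\<lambda>P. crit_simplex k r (pts bs P ` {..k}))"
    by (rule crit_simplex_pred[OF pm]) auto
  have cm[measurable]: "c \<in> borel_measurable count_sigma" unfolding c_def by (rule crit_center_meas[OF pm]) auto
  have nm[measurable]: "Measurable.pred count_sigma (no_more bs (ball p s))" for p s
    using bs(2) bsn by (intro no_more_meas) auto
  have c1[measurable]: "Measurable.pred count_sigma (\<lambda>P. \<forall>b\<in>set bs. card (P \<inter> b) = 1)"
    using count_meas[OF bs(2)] by measurable
  have m1: "Measurable.pred count_sigma (\<lambda>P. \<exists>p\<in>D. \<exists>s\<in>\<rat>. dist (c P) p + dist (c P) (pts bs P 0) < s \<and> no_more bs (ball p s) P)"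
    by (intro pred_bex_countable D(1) countable_rat) measurable
  have m2: "Measurable.pred count_sigma (\<lambda>P. \<forall>m. \<exists>L\<in>lists (D \<times> \<rat>). length L = m \<and>
       (\<forall>i<m. \<not> no_more bs (ball (fst (L ! i)) (snd (L ! i))) P) \<and>
       (\<forall>i<m. \<forall>j<m. i \<noteq> j \<longrightarrow> snd (L ! i) + snd (L ! j) < \<bar>dist (c P) (fst (L ! i)) - dist (c P) (fst (L ! j))\<bar>))"
    by (intro pred_intros_countable pred_bex_countable cl) measurable
  have eq: "coded bs P \<longleftrightarrow> (\<forall>b\<in>set bs. card (P \<inter> b) = 1) \<and> crit_simplex k r (pts bs P ` {..k}) \<and>
     (\<exists>p\<in>D. \<exists>s\<in>\<rat>. dist (c P) p + dist (c P) (pts bs P 0) < s \<and> no_more bs (ball p s) P) \<and>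
     \<not> (\<forall>m. \<exists>L\<in>lists (D \<times> \<rat>). length L = m \<and>
       (\<forall>i<m. \<not> no_more bs (ball (fst (L ! i)) (snd (L ! i))) P) \<and>
       (\<forall>i<m. \<forall>j<m. i \<noteq> j \<longrightarrow> snd (L ! i) + snd (L ! j) < \<bar>dist (c P) (fst (L ! i)) - dist (c P) (fst (L ! j))\<bar>))" for P
    unfolding coded_def c_def using coded_iff[OF bs(1) _ D(2), of P] by blast
  show ?thesis unfolding eq[abs_def]
    by (intro pred_intros_logic(3) c1 csm m1 pred_intros_logic(2)[OF m2])
qed

text \<open>At least \<open>n\<close> critical subsets exist iff \<open>n\<close> names decode to
  pairwise different sets, an existential over a countable set; these events determine the
  cardinality, also in the infinite case.\<close>

lemma num_crit_meas:
  assumes k: "1 \<le> k" and r: "\<not> 0 < Min (UNIV::real set) \<or> r < Min (UNIV::real set)"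
  shows "(\<lambda>P. num_crit k P r) \<in> (count_sigma :: 'a::euclidean_space set measure) \<rightarrow>\<^sub>M count_space UNIV"
proof -
  obtain B :: "'a set set" where B: "countable B" "topological_basis B" using ex_countable_basis by auto
  define C where "C = {bs\<in>lists B. length bs = k + 1}"
  have cC: "countable C" unfolding C_def using B(1) by (intro countable_subset[OF _ countable_lists[OF B(1)]]) auto
  have Bb: "b \<in> sets borel" if "b \<in> B" for b using topological_basis_open[OF B(2) that] by simp
  have Cb: "b \<in> sets borel" if "bs \<in> C" "b \<in> set bs" for bs b using that Bb by (auto simp: C_def)
  have codm: "Measurable.pred count_sigma (coded bs)" if "bs \<in> C" for bs
    using that Cb[OF that] by (intro coded_meas) (auto simp: C_def)
  have ptm: "(\<lambda>P. pts bs P i) \<in> borel_measurable count_sigma" if "bs \<in> C" for bs i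
    using measurable_compose[OF pts_meas[OF Cb[OF that]] measurable_component_singleton[of i UNIV]] by simp
  let ?S = "\<lambda>P. {Y. crit_subset k r P Y}" and ?Y = "\<lambda>bs P. pts bs P ` {..k}"
  have geq: "(\<exists>T\<subseteq>?S P. finite T \<and> card T = n) \<longleftrightarrow>
     (\<exists>L\<in>lists C. length L = n \<and> (\<forall>bs\<in>set L. coded bs P) \<and> (\<forall>i<n. \<forall>j<n. i \<noteq> j \<longrightarrow> ?Y (L ! i) P \<noteq> ?Y (L ! j) P))" for n P
  proof
    assume "\<exists>T\<subseteq>?S P. finite T \<and> card T = n"
    then obtain T where T: "T \<subseteq> ?S P" "finite T" "card T = n" by blast
    obtain Ys where Ys: "set Ys = T" "distinct Ys" using finite_distinct_list[OF T(2)] by blast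
    have "\<exists>bs\<in>C. coded bs P \<and> ?Y bs P = Y" if "Y \<in> T" for Y
      using crit_subset_coded[OF _ B(2), of P Y] T(1) that by (auto simp: C_def)
    then obtain g where g: "\<And>Y. Y \<in> T \<Longrightarrow> g Y \<in> C \<and> coded (g Y) P \<and> ?Y (g Y) P = Y" by metis
    have len: "length Ys = n" using Ys T(3) distinct_card by metis
    show "\<exists>L\<in>lists C. length L = n \<and> (\<forall>bs\<in>set L. coded bs P) \<and> (\<forall>i<n. \<forall>j<n. i \<noteq> j \<longrightarrow> ?Y (L ! i) P \<noteq> ?Y (L ! j) P)"
    proof (intro bexI[of _ "map g Ys"] conjI allI impI ballI)
      fix i j assume ij: "i < n" "j < n" "i \<noteq> j"
      then have "Ys ! i \<in> T" "Ys ! j \<in> T" "Ys ! i \<noteq> Ys ! j" using Ys len by (auto simp: nth_eq_iff_index_eq)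
      then show "?Y (map g Ys ! i) P \<noteq> ?Y (map g Ys ! j) P" using g ij len by simp
    qed (use g Ys len in auto)
  next
    assume "\<exists>L\<in>lists C. length L = n \<and> (\<forall>bs\<in>set L. coded bs P) \<and> (\<forall>i<n. \<forall>j<n. i \<noteq> j \<longrightarrow> ?Y (L ! i) P \<noteq> ?Y (L ! j) P)"
    then obtain L where L: "length L = n" "\<forall>bs\<in>set L. coded bs P" "\<forall>i<n. \<forall>j<n. i \<noteq> j \<longrightarrow> ?Y (L ! i) P \<noteq> ?Y (L ! j) P" by blast
    let ?T = "(\<lambda>i. ?Y (L ! i) P) ` {..<n}"
    have "inj_on (\<lambda>i. ?Y (L ! i) P) {..<n}" using L(3) by (auto simp: inj_on_def)
    then have "card ?T = n" by (simp add: card_image)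
    moreover have "?T \<subseteq> ?S P" using L(1,2) by (auto simp: coded_def)
    ultimately show "\<exists>T\<subseteq>?S P. finite T \<and> card T = n" by (intro exI[of _ ?T]) auto
  qed
  have gm: "Measurable.pred (count_sigma :: 'a set measure) (\<lambda>P. \<exists>T\<subseteq>?S P. finite T \<and> card T = n)" for n
  proof -
    have neq: "Measurable.pred count_sigma (\<lambda>P. ?Y bs P \<noteq> ?Y bs' P)" if "bs \<in> C" "bs' \<in> C" for bs bs'
    proof -
      have "?Y bs P = ?Y bs' P \<longleftrightarrow> (\<forall>i\<in>{..k}. \<exists>j\<in>{..k}. pts bs P i = pts bs' P j) \<and> (\<forall>j\<in>{..k}. \<exists>i\<in>{..k}. pts bs' P j = pts bs P i)" for P
      proof -
        have "f ` I = g ` I \<longleftrightarrow> (\<forall>i\<in>I. \<exists>j\<in>I. f i = g j) \<and> (\<forall>j\<in>I. \<exists>i\<in>I. g j = f i)" for f g :: "nat \<Rightarrow> 'a" and I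
          unfolding set_eq_subset image_subset_iff by (simp add: image_iff)
        then show ?thesis .
      qed
      moreover have "Measurable.pred count_sigma (\<lambda>P. pts b1 P i = pts b2 P j)" if "b1 \<in> C" "b2 \<in> C" for b1 b2 i j
      proof -
        have "Measurable.pred count_sigma (\<lambda>P. dist (pts b1 P i) (pts b2 P j) = 0)"
          using ptm[OF that(1)] ptm[OF that(2)] by measurable
        then show ?thesis by simp
      qed
      ultimately show ?thesis using that
        by (simp only:) (intro pred_intros_logic pred_intros_finite finite_atMost; blast)
    qed
    have "Measurable.pred count_sigma (\<lambda>P. \<exists>L\<in>lists C. length L = n \<and> (\<forall>bs\<in>set L. coded bs P) \<and>
       (\<forall>i<n. \<forall>j<n. i \<noteq> j \<longrightarrow> ?Y (L ! i) P \<noteq> ?Y (L ! j) P))"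
    proof (rule pred_bex_countable)
      show "countable (lists C)" using cC by simp
      fix L assume L: "L \<in> lists C"
      have cl: "\<And>bs. bs \<in> set L \<Longrightarrow> bs \<in> C" using L by auto
      show "Measurable.pred count_sigma (\<lambda>P. length L = n \<and> (\<forall>bs\<in>set L. coded bs P) \<and>
          (\<forall>i<n. \<forall>j<n. i \<noteq> j \<longrightarrow> ?Y (L ! i) P \<noteq> ?Y (L ! j) P))"
      proof (cases "length L = n")
        case True
        have a: "Measurable.pred count_sigma (\<lambda>P. \<forall>bs\<in>set L. coded bs P)"
          using codm cl by (intro pred_intros_finite) auto
        have "Measurable.pred count_sigma (\<lambda>P. \<forall>i\<in>{..<n}. \<forall>j\<in>{..<n}. i \<noteq> j \<longrightarrow> ?Y (L ! i) P \<noteq> ?Y (L ! j) P)"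
        proof (intro pred_intros_finite pred_intros_imp' neq)
          show "L ! i \<in> C" if "i \<in> {..<n}" for i using that True cl by simp
          show "L ! i \<in> C" if "i \<in> {..<n}" for i using that True cl by simp
        qed simp_all
        then have "Measurable.pred count_sigma (\<lambda>P. (\<forall>bs\<in>set L. coded bs P) \<and>
           (\<forall>i\<in>{..<n}. \<forall>j\<in>{..<n}. i \<noteq> j \<longrightarrow> ?Y (L ! i) P \<noteq> ?Y (L ! j) P))"
          by (intro pred_intros_logic(3) a)
        then show ?thesis using True by (simp only: Ball_def lessThan_iff simp_thms)
      qed simp
    qed
    then show ?thesis by (subst measurable_cong[OF geq])
  qed
  have "Measurable.pred (count_sigma :: 'a set measure) (\<lambda>P. card (?S P) = m)" for m
  proof -
    have m1: "Measurable.pred (count_sigma :: 'a set measure) (\<lambda>P. \<forall>n. \<exists>T\<subseteq>?S P. finite T \<and> card T = n)"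
      by (intro pred_intros_countable gm)
    have "Measurable.pred (count_sigma :: 'a set measure) (\<lambda>P. ((\<exists>T\<subseteq>?S P. finite T \<and> card T = m) \<and>
        \<not> (\<exists>T\<subseteq>?S P. finite T \<and> card T = Suc m)) \<or> (m = 0 \<and> (\<forall>n. \<exists>T\<subseteq>?S P. finite T \<and> card T = n)))"
      by (intro pred_intros_logic(5) pred_intros_logic(3) pred_intros_logic(2)[OF gm] gm m1 measurable_const; simp)
    then show ?thesis by (subst measurable_cong[OF card_eq_iff_subsets])
  qed
  then have "{P\<in>space (count_sigma :: 'a set measure). num_crit k P r = m} \<in> sets count_sigma" for m
  proof -
    assume *: "\<And>m. Measurable.pred (count_sigma :: 'a set measure) (\<lambda>P. card (?S P) = m)"
    have "num_crit k P r = card (?S P)" for P :: "'a set" using num_crit_eq[OF k, of P r] r by blast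
    then show ?thesis using *[of m] by (simp add: pred_def)
  qed
  then show ?thesis
    by (intro measurable_count_space_eq2_countable[THEN iffD2]) (auto simp: vimage_def)
qed

end


section \<open>Joint counts on partitions determine the law\<close>

lemma count_event_meas:
  assumes "\<And>i. A i \<in> sets borel" "finite I"
  shows "{Q. \<forall>i\<in>I. card (Q \<inter> A i) = (j i :: nat)} \<in> sets count_sigma"
proof -
  have "{Q\<in>space count_sigma. \<forall>i\<in>I. card (Q \<inter> A i) = j i} \<in> sets count_sigma"
    using count_sigma_gen[OF assms(1)] assms(2) by (intro sets.sets_Collect_finite_All) auto
  then show ?thesis by simp
qed

text \<open>Events that prescribe several counts at once are closed under intersection, as
  uniqueness of measures requires.\<close>

lemma count_sigma_generator:
  "sets count_sigma = sigma_sets UNIV {{Q. \<forall>i<m. card (Q \<inter> A i) = j i} | (m::nat) A j. \<forall>i. A i \<in> sets (borel :: 'a::euclidean_space measure)}"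
    (is "_ = sigma_sets UNIV ?E")
proof -
  let ?G = "{{P. card (P \<inter> A) = j} | A j. A \<in> sets (borel :: 'a measure)}"
  have s: "sets count_sigma = sigma_sets UNIV ?G" by (simp add: count_sigma_def sets_measure_of)
  show ?thesis
  proof (intro equalityI)
    show "sets count_sigma \<subseteq> sigma_sets UNIV ?E"
      unfolding s
    proof (rule sigma_sets_mono)
      show "?G \<subseteq> sigma_sets UNIV ?E"
      proof
        fix X assume "X \<in> ?G"
        then obtain A j where X: "A \<in> sets (borel :: 'a measure)" "X = {P. card (P \<inter> A) = j}" by blast
        have "X \<in> ?E"
          using X by (intro CollectI exI[of _ "1::nat"] exI[of _ "\<lambda>_. A"] exI[of _ "\<lambda>_. j"]) simp
        then show "X \<in> sigma_sets UNIV ?E" by (rule sigma_sets.Basic)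
      qed
    qed
    have "?E \<subseteq> sets count_sigma"
    proof
      fix X assume "X \<in> ?E"
      then obtain m A j where X: "\<forall>i. A i \<in> sets (borel :: 'a measure)" "X = {Q. \<forall>i<(m::nat). card (Q \<inter> A i) = j i}" by blast
      then show "X \<in> sets count_sigma" using count_event_meas[of A "{..<m}" j] by (simp add: Ball_def)
    qed
    then show "sigma_sets UNIV ?E \<subseteq> sets count_sigma"
      using sets.sigma_sets_subset[of ?E count_sigma] by simp
  qed
qed

text \<open>A cell of the partition generated by the first \<open>m\<close> sets.\<close>

definition atom :: "(nat \<Rightarrow> 'a set) \<Rightarrow> nat \<Rightarrow> nat set \<Rightarrow> 'a set" where
  "atom A m T = {x. \<forall>i<m. x \<in> A i \<longleftrightarrow> i \<in> T}"

lemma atom_meas: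
  assumes [measurable]: "\<And>i. A i \<in> sets (borel :: 'a::euclidean_space measure)"
  shows "atom A m T \<in> sets borel"
proof -
  have "{x\<in>space borel. \<forall>i\<in>{..<m}. x \<in> A i \<longleftrightarrow> i \<in> T} \<in> sets borel" by measurable
  then show ?thesis by (simp add: atom_def Ball_def)
qed

lemma card_atoms:
  assumes Q: "finite Q" and g: "bij_betw g I (Pow {..<m})" and I: "finite I" and i: "i < m"
  shows "card (Q \<inter> A i) = (\<Sum>t\<in>{t\<in>I. i \<in> g t}. card (Q \<inter> atom A m (g t)))"
proof -
  have "Q \<inter> A i = (\<Union>t\<in>{t\<in>I. i \<in> g t}. Q \<inter> atom A m (g t))"
  proof (intro equalityI subsetI)
    fix x assume x: "x \<in> Q \<inter> A i"
    have "{l. l < m \<and> x \<in> A l} \<in> g ` I" using g by (auto simp: bij_betw_def)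
    then obtain t where t: "t \<in> I" "g t = {l. l < m \<and> x \<in> A l}" by auto
    then show "x \<in> (\<Union>t\<in>{t\<in>I. i \<in> g t}. Q \<inter> atom A m (g t))"
      using x i by (intro UN_I[of t]) (auto simp: atom_def)
  qed (use i in \<open>auto simp: atom_def\<close>)
  also have "card \<dots> = (\<Sum>t\<in>{t\<in>I. i \<in> g t}. card (Q \<inter> atom A m (g t)))"
  proof (rule card_UN_disjoint)
    have "Q \<inter> atom A m (g s) \<inter> (Q \<inter> atom A m (g t)) = {}" if "s \<in> I" "t \<in> I" "s \<noteq> t" for s t
    proof -
      have "g s \<noteq> g t" "g s \<subseteq> {..<m}" "g t \<subseteq> {..<m}" using g that by (auto simp: bij_betw_def inj_on_def)
      then have "atom A m (g s) \<inter> atom A m (g t) = {}" unfolding atom_def by blast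
      then show ?thesis by blast
    qed
    then show "\<forall>s\<in>{t\<in>I. i \<in> g t}. \<forall>t\<in>{t\<in>I. i \<in> g t}. s \<noteq> t \<longrightarrow> Q \<inter> atom A m (g s) \<inter> (Q \<inter> atom A m (g t)) = {}"
      by blast
  qed (use I Q in auto)
  finally show ?thesis .
qed

text \<open>Counts in overlapping sets are sums of counts in the cells of the generated partition,
  so the event splits into countably many disjoint ones that prescribe all cell counts. Almost sure
  finiteness enters through the additivity of \<open>card\<close>.\<close>

lemma count_event_by_atoms:
  fixes P :: "'w \<Rightarrow> 'a::euclidean_space set" and g :: "nat \<Rightarrow> nat set"
  assumes M: "prob_space M" and P: "P \<in> M \<rightarrow>\<^sub>M count_sigma" "AE \<omega> in M. finite (P \<omega>)"
    and A: "\<And>i. A i \<in> sets borel" and g: "bij_betw g I (Pow {..<m})" and I: "finite I"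
  shows "emeasure M {\<omega>\<in>space M. \<forall>i<m. card (P \<omega> \<inter> A i) = j i} =
    (\<integral>\<^sup>+n. ennreal (measure M {\<omega>\<in>space M. \<forall>t\<in>I. card (P \<omega> \<inter> atom A m (g t)) = n t})
       \<partial>count_space {n \<in> PiE I (\<lambda>_. UNIV). \<forall>i<m. (\<Sum>t\<in>{t\<in>I. i \<in> g t}. n t) = j i})"
    (is "_ = (\<integral>\<^sup>+n. _ \<partial>count_space ?K)")
proof -
  interpret prob_space M by fact
  have At: "atom A m T \<in> sets borel" for T
    by (rule atom_meas[OF A])
  have ev: "{\<omega>\<in>space M. \<forall>t\<in>I. card (P \<omega> \<inter> atom A m (g t)) = n t} \<in> sets M" for n :: "nat \<Rightarrow> nat"
  proof -
    have e: "{\<omega>\<in>space M. \<forall>t\<in>I. card (P \<omega> \<inter> atom A m (g t)) = n t} = P -` {Q. \<forall>t\<in>I. card (Q \<inter> atom A m (g t)) = n t} \<inter> space M" by auto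
    show ?thesis unfolding e by (rule measurable_sets[OF P(1) count_event_meas[OF At I]])
  qed
  have ev2: "{\<omega>\<in>space M. \<forall>i<m. card (P \<omega> \<inter> A i) = j i} \<in> sets M"
  proof -
    have e: "{\<omega>\<in>space M. \<forall>i<m. card (P \<omega> \<inter> A i) = j i} = P -` {Q. \<forall>i\<in>{..<m}. card (Q \<inter> A i) = j i} \<inter> space M" by auto
    show ?thesis unfolding e by (rule measurable_sets[OF P(1) count_event_meas[OF A finite_lessThan]])
  qed
  have cK: "countable ?K" by (rule countable_subset[OF _ countable_PiE[OF I]]) auto
  let ?F = "\<lambda>n. {\<omega>\<in>space M. \<forall>t\<in>I. card (P \<omega> \<inter> atom A m (g t)) = n t}"
  have "emeasure M {\<omega>\<in>space M. \<forall>i<m. card (P \<omega> \<inter> A i) = j i} = emeasure M (\<Union>n\<in>?K. ?F n)"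
  proof (rule emeasure_eq_AE)
    show "AE \<omega> in M. \<omega> \<in> {\<omega>\<in>space M. \<forall>i<m. card (P \<omega> \<inter> A i) = j i} \<longleftrightarrow> \<omega> \<in> (\<Union>n\<in>?K. ?F n)"
      using P(2)
    proof eventually_elim
      case (elim \<omega>)
      note c = card_atoms[OF elim g I, of _ A]
      show ?case
      proof
        assume w: "\<omega> \<in> {\<omega>\<in>space M. \<forall>i<m. card (P \<omega> \<inter> A i) = j i}"
        let ?n = "\<lambda>t\<in>I. card (P \<omega> \<inter> atom A m (g t))"
        have "(\<Sum>t\<in>{t\<in>I. i \<in> g t}. ?n t) = j i" if i: "i < m" for i
        proof -
          have "(\<Sum>t\<in>{t\<in>I. i \<in> g t}. ?n t) = (\<Sum>t\<in>{t\<in>I. i \<in> g t}. card (P \<omega> \<inter> atom A m (g t)))"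
            by (intro sum.cong) auto
          also have "\<dots> = j i" using c[OF i] w i by simp
          finally show ?thesis .
        qed
        then have "?n \<in> ?K" by simp
        then show "\<omega> \<in> (\<Union>n\<in>?K. ?F n)" using w by (intro UN_I[of ?n]) simp_all
      next
        assume "\<omega> \<in> (\<Union>n\<in>?K. ?F n)"
        then obtain n where n: "\<forall>i<m. (\<Sum>t\<in>{t\<in>I. i \<in> g t}. n t) = j i" "\<omega> \<in> space M"
          "\<forall>t\<in>I. card (P \<omega> \<inter> atom A m (g t)) = n t" by blast
        have "card (P \<omega> \<inter> A i) = j i" if "i < m" for i
          unfolding c[OF that] n(1)[rule_format, OF that, symmetric] using n(3) by (intro sum.cong) auto
        then show "\<omega> \<in> {\<omega>\<in>space M. \<forall>i<m. card (P \<omega> \<inter> A i) = j i}" using n(2) by simp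
      qed
    qed
    show "(\<Union>n\<in>?K. ?F n) \<in> sets M" using cK ev by (intro sets.countable_UN') auto
  qed (rule ev2)
  also have "\<dots> = (\<integral>\<^sup>+n. emeasure M (?F n) \<partial>count_space ?K)"
  proof (rule emeasure_UN_countable)
    show "disjoint_family_on ?F ?K"
      unfolding disjoint_family_on_def
    proof (intro ballI impI, rule ccontr)
      fix n n' assume n: "n \<in> ?K" "n' \<in> ?K" "n \<noteq> n'" "?F n \<inter> ?F n' \<noteq> {}"
      then obtain \<omega> where "\<omega> \<in> ?F n" "\<omega> \<in> ?F n'" by blast
      then have "n t = n' t" if "t \<in> I" for t using that by simp
      then have "n = n'" using n(1,2) by (intro PiE_ext[of n I _ n']) auto
      then show False using n(3) by simp
    qed
  qed (use ev cK in auto)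
  finally show ?thesis by (simp add: emeasure_eq_measure)
qed

text \<open>By the splitting into cells, agreement on partitions of the whole space gives agreement
  on an intersection-stable generator. Reducing to partitions makes the comparison with multinomial
  probabilities possible.\<close>

lemma count_law_unique:
  fixes P :: "'w \<Rightarrow> 'a::euclidean_space set" and P' :: "'v \<Rightarrow> 'a set"
  assumes M: "prob_space M" "P \<in> M \<rightarrow>\<^sub>M count_sigma" "AE \<omega> in M. finite (P \<omega>)"
    and M': "prob_space M'" "P' \<in> M' \<rightarrow>\<^sub>M count_sigma" "AE \<omega> in M'. finite (P' \<omega>)"
    and joint: "\<And>(I::nat set) A j. finite I \<Longrightarrow> (\<And>i. i \<in> I \<Longrightarrow> A i \<in> sets borel) \<Longrightarrow> disjoint_family_on A I \<Longrightarrow>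
       (\<Union>i\<in>I. A i) = UNIV \<Longrightarrow> measure M {\<omega>\<in>space M. \<forall>i\<in>I. card (P \<omega> \<inter> A i) = j i} =
          measure M' {\<omega>\<in>space M'. \<forall>i\<in>I. card (P' \<omega> \<inter> A i) = j i}"
  shows "distr M count_sigma P = distr M' count_sigma P'"
proof -
  let ?E = "{{Q. \<forall>i<m. card (Q \<inter> A i) = j i} | (m::nat) A j. \<forall>i. A i \<in> sets (borel :: 'a measure)}"
  interpret M: prob_space M by fact
  interpret M': prob_space M' by fact
  interpret D: prob_space "distr M count_sigma P" by (rule M.prob_space_distr[OF M(2)])
  show ?thesis
  proof (rule measure_eqI_generator_eq[where \<Omega> = UNIV and E = ?E and A = "\<lambda>_. UNIV"])
    show "Int_stable ?E"
    proof (rule Int_stableI)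
      fix X Y assume "X \<in> ?E" "Y \<in> ?E"
      then obtain m A j m' A' j' where X: "\<forall>i. A i \<in> sets (borel :: 'a measure)" "X = {Q. \<forall>i<(m::nat). card (Q \<inter> A i) = j i}"
        and Y: "\<forall>i. A' i \<in> sets (borel :: 'a measure)" "Y = {Q. \<forall>i<(m'::nat). card (Q \<inter> A' i) = j' i}" by blast
      define A'' j'' where "A'' i = (if i < m then A i else A' (i - m))" and "j'' i = (if i < m then j i else j' (i - m))" for i
      have "X \<inter> Y = {Q. \<forall>i<m + m'. card (Q \<inter> A'' i) = j'' i}"
      proof (intro equalityI subsetI)
        fix Q assume Q: "Q \<in> {Q. \<forall>i<m + m'. card (Q \<inter> A'' i) = j'' i}"
        have "card (Q \<inter> A' i) = j' i" if "i < m'" for i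
          using Q[unfolded mem_Collect_eq, rule_format, of "m + i"] that by (simp add: A''_def j''_def)
        moreover have "card (Q \<inter> A i) = j i" if "i < m" for i
          using Q[unfolded mem_Collect_eq, rule_format, of i] that by (simp add: A''_def j''_def)
        ultimately show "Q \<in> X \<inter> Y" by (simp add: X Y)
      qed (auto simp: X Y A''_def j''_def)
      moreover have "\<forall>i. A'' i \<in> sets borel" using X Y by (simp add: A''_def)
      ultimately show "X \<inter> Y \<in> ?E"
        by (intro CollectI exI[of _ "m + m'"] exI[of _ A''] exI[of _ j'']) (rule conjI)
    qed
    have "(UNIV :: 'a set set) = {Q. \<forall>i<(0::nat). card (Q \<inter> (\<lambda>_. {}) i) = (\<lambda>_. 0) i}" by simp
    then show "range (\<lambda>_::nat. UNIV) \<subseteq> ?E" by (auto intro!: exI[of _ "0::nat"] exI[of _ "\<lambda>_. {}"])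
    show "sets (distr M count_sigma P) = sigma_sets UNIV ?E" "sets (distr M' count_sigma P') = sigma_sets UNIV ?E"
      using count_sigma_generator by simp_all
    show "emeasure (distr M count_sigma P) UNIV \<noteq> \<infinity>" for i :: nat
      using D.emeasure_finite[of UNIV] by simp
    fix X assume "X \<in> ?E"
    then obtain m A j where X: "\<forall>i. A i \<in> sets (borel :: 'a measure)" "X = {Q. \<forall>i<(m::nat). card (Q \<inter> A i) = j i}" by blast
    have A: "A i \<in> sets borel" for i using X(1) by simp
    have Xs: "X \<in> sets count_sigma" unfolding X(2) using count_event_meas[of A "{..<m}" j] A by (simp add: Ball_def)
    obtain g where g: "bij_betw g {0..<card (Pow {..<m})} (Pow {..<m})"
      using ex_bij_betw_nat_finite[of "Pow {..<m}"] by auto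
    let ?I = "{0..<card (Pow {..<m})}"
    have disj: "disjoint_family_on (\<lambda>t. atom A m (g t)) ?I"
      unfolding disjoint_family_on_def
    proof (intro ballI impI)
      fix s t assume st: "s \<in> ?I" "t \<in> ?I" "s \<noteq> t"
      have "g s \<noteq> g t" "g s \<subseteq> {..<m}" "g t \<subseteq> {..<m}"
        using g st by (auto simp: bij_betw_def inj_on_def)
      then show "atom A m (g s) \<inter> atom A m (g t) = {}" unfolding atom_def by blast
    qed
    have cov: "(\<Union>t\<in>?I. atom A m (g t)) = UNIV"
    proof (intro equalityI subsetI UNIV_I)
      fix x :: 'a
      have "{l. l < m \<and> x \<in> A l} \<in> g ` ?I" using g by (auto simp: bij_betw_def)
      then obtain t where t: "t \<in> ?I" "g t = {l. l < m \<and> x \<in> A l}" by auto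
      then show "x \<in> (\<Union>t\<in>?I. atom A m (g t))" by (intro UN_I[of t]) (auto simp: atom_def)
    qed
    have At: "atom A m T \<in> sets borel" for T
      by (rule atom_meas[OF A])
    have fI: "finite ?I" by simp
    have "emeasure (distr M count_sigma P) X = emeasure M {\<omega>\<in>space M. \<forall>i<m. card (P \<omega> \<inter> A i) = j i}"
      using Xs M(2) by (subst emeasure_distr) (auto simp: X(2) intro!: arg_cong[where f = "emeasure M"])
    also have "\<dots> = emeasure M' {\<omega>\<in>space M'. \<forall>i<m. card (P' \<omega> \<inter> A i) = j i}"
      unfolding count_event_by_atoms[OF M A g fI] count_event_by_atoms[OF M' A g fI]
      by (intro nn_integral_cong arg_cong[where f = ennreal] joint fI At disj cov)
    also have "\<dots> = emeasure (distr M' count_sigma P') X"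
      using Xs M'(2) by (subst emeasure_distr) (auto simp: X(2) intro!: arg_cong[where f = "emeasure M'"])
    finally show "emeasure (distr M count_sigma P) X = emeasure (distr M' count_sigma P') X" .
  qed auto
qed

lemma poisson_process_meas:
  fixes P :: "'w \<Rightarrow> 'a::euclidean_space set"
  assumes "poisson_process M P l"
  shows "P \<in> M \<rightarrow>\<^sub>M count_sigma"
proof (rule measurable_count_sigma)
  fix A :: "'a set" and j assume "A \<in> sets borel"
  then have "(\<lambda>\<omega>. card (P \<omega> \<inter> A)) \<in> M \<rightarrow>\<^sub>M count_space UNIV" using assms by (auto simp: poisson_process_def)
  from measurable_sets[OF this, of "{j}"] show "{\<omega>\<in>space M. card (P \<omega> \<inter> A) = j} \<in> sets M"
    by (simp add: vimage_def Int_def conj_commute)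
qed

lemma poisson_process_joint:
  fixes A :: "nat \<Rightarrow> 'a::euclidean_space set"
  assumes P: "poisson_process M P l" and I: "finite I" "I \<noteq> {}" "\<And>i. i \<in> I \<Longrightarrow> A i \<in> sets borel" "disjoint_family_on A I"
  shows "measure M {\<omega>\<in>space M. \<forall>i\<in>I. card (P \<omega> \<inter> A i) = j i} =
    (\<Prod>i\<in>I. (LINT x:A i|lborel. l x) ^ j i / fact (j i) * exp (- (LINT x:A i|lborel. l x)))"
proof -
  interpret prob_space M using P by (simp add: poisson_process_def)
  have "indep_vars (\<lambda>_. count_space UNIV) (\<lambda>i \<omega>. card (P \<omega> \<inter> A i)) I"
    using P I unfolding poisson_process_def by blast
  then have "prob (\<Inter>i\<in>I. (\<lambda>\<omega>. card (P \<omega> \<inter> A i)) -` {j i} \<inter> space M) = (\<Prod>i\<in>I. prob ((\<lambda>\<omega>. card (P \<omega> \<inter> A i)) -` {j i} \<inter> space M))"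
    using I by (intro indep_varsD) auto
  moreover have "(\<Inter>i\<in>I. (\<lambda>\<omega>. card (P \<omega> \<inter> A i)) -` {j i} \<inter> space M) = {\<omega>\<in>space M. \<forall>i\<in>I. card (P \<omega> \<inter> A i) = j i}"
    using I(2) by auto
  moreover have "prob ((\<lambda>\<omega>. card (P \<omega> \<inter> A i)) -` {j i} \<inter> space M) = (LINT x:A i|lborel. l x) ^ j i / fact (j i) * exp (- (LINT x:A i|lborel. l x))" if "i \<in> I" for i
  proof -
    have "(\<lambda>\<omega>. card (P \<omega> \<inter> A i)) -` {j i} \<inter> space M = {\<omega>\<in>space M. card (P \<omega> \<inter> A i) = j i}" by auto
    then show ?thesis using P I(3)[OF that] by (simp add: poisson_process_def)
  qed
  ultimately show ?thesis by simp
qed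

section \<open>Samples of Poisson size have the counts of a Poisson process\<close>

context iid_sample begin

lemma prob_X_eq:
  assumes A: "A \<in> sets borel"
  shows "prob {\<omega>\<in>space M. X i \<omega> \<in> A} = (LINT x:A|lborel. f x)"
proof -
  have fin: "(\<integral>\<^sup>+x. ennreal (indicator A x * f x) \<partial>lborel) = ennreal (prob {\<omega>\<in>space M. X i \<omega> \<in> A})"
  proof -
    have "(\<integral>\<^sup>+x. ennreal (indicator A x * f x) \<partial>lborel) = (\<integral>\<^sup>+x. ennreal (f x) * indicator A x \<partial>lborel)"
      by (intro nn_integral_cong) (simp add: indicator_def)
    then show ?thesis using emeasure_X_in[OF A, of i] by (simp add: emeasure_eq_measure)
  qed
  have "integrable lborel (\<lambda>x. indicator A x * f x)"
    using f_meas A f_nonneg fin by (intro integrableI_nonneg) auto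
  then have "(\<integral>\<^sup>+x. ennreal (indicator A x * f x) \<partial>lborel) = ennreal (\<integral>x. indicator A x * f x \<partial>lborel)"
    using f_nonneg by (intro nn_integral_eq_integral) auto
  then have "ennreal (prob {\<omega>\<in>space M. X i \<omega> \<in> A}) = ennreal (\<integral>x. indicator A x * f x \<partial>lborel)" using fin by simp
  moreover have "0 \<le> (\<integral>x. indicator A x * f x \<partial>lborel)" using f_nonneg by (intro Bochner_Integration.integral_nonneg) simp
  ultimately show ?thesis by (simp add: set_lebesgue_integral_def)
qed

lemma card_index_pred:
  assumes A: "A \<in> sets borel" and F: "finite F" and Y: "\<And>i. i \<in> F \<Longrightarrow> Y i \<in> borel_measurable L"
  shows "Measurable.pred L (\<lambda>w. card {i\<in>F. (Y i w :: 'a) \<in> A} = j)"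
proof -
  have "real (card {i\<in>F. Y i w \<in> A}) = (\<Sum>i\<in>F. indicator A (Y i w))" for w
    using F by (simp add: indicator_def of_bool_def sum.If_cases Int_def)
  then have "card {i\<in>F. Y i w \<in> A} = j \<longleftrightarrow> (\<Sum>i\<in>F. indicator A (Y i w)) = real j" for w
    by (metis (no_types, lifting) of_nat_eq_iff)
  moreover have [measurable]: "(\<lambda>w. \<Sum>i\<in>F. indicator A (Y i w) :: real) \<in> borel_measurable L"
    by (intro borel_measurable_sum measurable_compose[OF Y borel_measurable_indicator[OF A]])
  ultimately show ?thesis by simp
qed

text \<open>The count of a set ignores repetitions, so a further point adds to it only if it differs
  from all earlier ones.\<close>

lemma image_count_meas: "(\<lambda>\<omega>. Xs \<omega> ` {1..m}) \<in> M \<rightarrow>\<^sub>M count_sigma"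
proof (rule measurable_count_sigma)
  fix A :: "'a set" and j assume A: "A \<in> sets borel"
  have "(\<lambda>\<omega>. real (card (Xs \<omega> ` {1..m} \<inter> A))) \<in> borel_measurable M"
  proof (induction m)
    case (Suc m)
    have "Measurable.pred M (\<lambda>\<omega>. X (Suc m) \<omega> \<in> A \<and> (\<forall>l\<in>{1..m}. dist (X l \<omega>) (X (Suc m) \<omega>) \<noteq> 0))"
      using A by measurable
    moreover have "real (card (Xs \<omega> ` {1..Suc m} \<inter> A)) = real (card (Xs \<omega> ` {1..m} \<inter> A)) +
      of_bool (X (Suc m) \<omega> \<in> A \<and> (\<forall>l\<in>{1..m}. dist (X l \<omega>) (X (Suc m) \<omega>) \<noteq> 0))" for \<omega>
    proof -
      define z S where "z = X (Suc m) \<omega>" and "S = Xs \<omega> ` {1..m}"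
      have i: "Xs \<omega> ` {1..Suc m} = insert z S" by (simp add: atLeastAtMostSuc_conv z_def S_def)
      have "finite S" by (simp add: S_def)
      then have c: "real (card (insert z S \<inter> A)) = real (card (S \<inter> A)) + of_bool (z \<in> A \<and> z \<notin> S)"
        by (cases "z \<in> A"; cases "z \<in> S") (simp_all add: insert_absorb)
      have iff: "(\<forall>l\<in>{1..m}. dist (X l \<omega>) z \<noteq> 0) \<longleftrightarrow> z \<notin> S"
        unfolding S_def by (auto simp: image_iff)
      show ?thesis unfolding z_def[symmetric] S_def[symmetric] i iff by (rule c)
    qed
    ultimately show ?case using Suc by simp
  qed simp
  then have "{\<omega>\<in>space M. real (card (Xs \<omega> ` {1..m} \<inter> A)) = real j} \<in> sets M" by measurable
  then show "{\<omega>\<in>space M. card (Xs \<omega> ` {1..m} \<inter> A) = j} \<in> sets M" by simp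
qed

text \<open>Induction on \<open>m\<close> by the cell of the last point, which is independent of the
  earlier points; lowering the count of that cell by one leads back to \<open>m\<close>
  points.\<close>

lemma prob_multinomial:
  fixes A :: "nat \<Rightarrow> 'a set"
  assumes I: "finite I" and A: "\<And>t. t \<in> I \<Longrightarrow> A t \<in> sets borel" "disjoint_family_on A I" "(\<Union>t\<in>I. A t) = UNIV"
  defines "p \<equiv> \<lambda>t. prob {\<omega>\<in>space M. X 0 \<omega> \<in> A t}"
  shows "prob {\<omega>\<in>space M. \<forall>t\<in>I. card {i\<in>{1..m}. X i \<omega> \<in> A t} = j t} =
    (if sum j I = m then fact m * (\<Prod>t\<in>I. p t ^ j t / fact (j t)) else 0)"
proof (induction m arbitrary: j)
  case 0
  have "sum j I = 0 \<longleftrightarrow> (\<forall>t\<in>I. j t = 0)" using I by simp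
  moreover have "{\<omega>\<in>space M. \<forall>t\<in>I. card {i\<in>{1..0::nat}. X i \<omega> \<in> A t} = j t} = (if \<forall>t\<in>I. j t = 0 then space M else {})" by auto
  ultimately show ?case by (auto simp: prob_space)
next
  case (Suc m)
  let ?E = "\<lambda>m j. {\<omega>\<in>space M. \<forall>t\<in>I. card {i\<in>{1..m}. X i \<omega> \<in> A t} = j t}"
  \<comment> \<open>The truncated subtraction is harmless: only cells with
    \<open>j t \<noteq> 0\<close>, collected in \<open>?T\<close>, enter the sum.\<close>
  define j' where "j' t = j(t := j t - 1)" for t
  define h where "h m j x \<longleftrightarrow> (\<forall>t\<in>I. card {i\<in>{1..m}. x i \<in> A t} = j t)" for m j and x :: "nat \<Rightarrow> 'a"
  have hpred: "Measurable.pred L (\<lambda>w. h m j (Y w))" if "\<And>i. (\<lambda>w. Y w i) \<in> borel_measurable L" for L Y m j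
    unfolding h_def using I A(1) that by (intro pred_intros_finite card_index_pred) auto
  let ?H = "\<lambda>t. {\<omega>\<in>space M. h m (j' t) (Xs \<omega>) \<and> X (Suc m) \<omega> \<in> A t}"
  let ?T = "{t\<in>I. j t \<noteq> 0}"
  have Hm: "?H t \<in> events" if "t \<in> I" for t
  proof -
    have "Measurable.pred M (\<lambda>\<omega>. h m (j' t) (Xs \<omega>))" by (rule hpred) (rule X_meas)
    moreover have "Measurable.pred M (\<lambda>\<omega>. X (Suc m) \<omega> \<in> A t)" using A(1)[OF that] by measurable
    ultimately have "Measurable.pred M (\<lambda>\<omega>. h m (j' t) (Xs \<omega>) \<and> X (Suc m) \<omega> \<in> A t)" by (intro pred_intros_logic(3))
    then show ?thesis unfolding pred_def .
  qed
  have cs: "card {i\<in>{1..Suc m}. x i \<in> B} = card {i\<in>{1..m}. x i \<in> B} + (if x (Suc m) \<in> B then 1 else 0)" for x :: "nat \<Rightarrow> 'a" and B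
  proof -
    have "{i\<in>{1..Suc m}. x i \<in> B} = (if x (Suc m) \<in> B then insert (Suc m) {i\<in>{1..m}. x i \<in> B} else {i\<in>{1..m}. x i \<in> B})"
      by (auto simp: le_Suc_eq)
    then show ?thesis by auto
  qed
  have "?E (Suc m) j = (\<Union>t\<in>?T. ?H t)"
  proof (intro equalityI subsetI)
    fix \<omega> assume w: "\<omega> \<in> ?E (Suc m) j"
    obtain t where t: "t \<in> I" "X (Suc m) \<omega> \<in> A t" using A(3) by blast
    have nt: "X (Suc m) \<omega> \<notin> A s" if "s \<in> I" "s \<noteq> t" for s
      using A(2) t that unfolding disjoint_family_on_def by blast
    have jt: "card {i\<in>{1..m}. X i \<omega> \<in> A s} + (if X (Suc m) \<omega> \<in> A s then 1 else 0) = j s" if "s \<in> I" for s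
      using w that cs[of "Xs \<omega>" "A s"] by simp
    have "card {i\<in>{1..m}. X i \<omega> \<in> A s} = j' t s" if "s \<in> I" for s
      using jt[OF that] nt[OF that] t by (cases "s = t") (auto simp: j'_def)
    moreover have "j t \<noteq> 0" using jt[OF t(1)] t(2) by simp
    ultimately show "\<omega> \<in> (\<Union>t\<in>?T. ?H t)" using t w by (intro UN_I[of t]) (auto simp: h_def)
  next
    fix \<omega> assume "\<omega> \<in> (\<Union>t\<in>?T. ?H t)"
    then obtain t where t: "t \<in> I" "j t \<noteq> 0" "\<omega> \<in> space M" "h m (j' t) (Xs \<omega>)" "X (Suc m) \<omega> \<in> A t" by blast
    have nt: "X (Suc m) \<omega> \<notin> A s" if "s \<in> I" "s \<noteq> t" for s
      using A(2) t that unfolding disjoint_family_on_def by blast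
    have "card {i\<in>{1..Suc m}. X i \<omega> \<in> A s} = j s" if "s \<in> I" for s
      unfolding cs[of "Xs \<omega>" "A s"] using t(4)[unfolded h_def, rule_format, OF that] nt[OF that] t(2,5)
      by (cases "s = t") (auto simp: j'_def)
    then show "\<omega> \<in> ?E (Suc m) j" using t(3) by simp
  qed
  then have "prob (?E (Suc m) j) = prob (\<Union>t\<in>?T. ?H t)" by simp
  also have "\<dots> = (\<Sum>t\<in>?T. prob (?H t))"
  proof (rule finite_measure_finite_Union)
    show "disjoint_family_on ?H ?T" using A(2) unfolding disjoint_family_on_def by blast
  qed (use I Hm in auto)
  also have "\<dots> = (\<Sum>t\<in>?T. p t * prob (?E m (j' t)))"
  proof (rule sum.cong[OF refl])
    fix t assume "t \<in> ?T"
    then have t: "t \<in> I" by simp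
    define G where "G x y = (indicator {x. h m (j' t) x} x * indicator (A t) (y (Suc m)) :: ennreal)" for x y :: "nat \<Rightarrow> 'a"
    have hm[measurable]: "Measurable.pred (PiM UNIV (\<lambda>_. borel)) (h m (j' t))"
      by (rule hpred[of "\<lambda>x. x"]) simp
    have Em: "?E m (j' t) \<in> events" 
    proof -
      have "Measurable.pred M (\<lambda>\<omega>. h m (j' t) (Xs \<omega>))" by (rule hpred) (rule X_meas)
      then show ?thesis unfolding h_def pred_def .
    qed
    have Xm: "{\<omega>\<in>space M. X (Suc m) \<omega> \<in> A t} \<in> events" using A(1)[OF t] by measurable
    have "ennreal (prob (?H t)) = (\<integral>\<^sup>+\<omega>. indicator (?H t) \<omega> \<partial>M)" using Hm[OF t] by (simp add: emeasure_eq_measure)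
    also have "\<dots> = (\<integral>\<^sup>+\<omega>. G (Xs \<omega>) (Xs \<omega>) \<partial>M)" by (intro nn_integral_cong) (auto simp: G_def indicator_def)
    also have "\<dots> = (\<integral>\<^sup>+\<omega>. \<integral>\<^sup>+\<omega>'. G (Xs \<omega>) (Xs \<omega>') \<partial>M \<partial>M)"
    proof (rule decouple[of "{1..m}" "{Suc m}"])
      show "(\<lambda>(x, y). G x y) \<in> borel_measurable (PiM UNIV (\<lambda>_. borel) \<Otimes>\<^sub>M PiM UNIV (\<lambda>_. borel))"
        unfolding G_def using A(1)[OF t] by measurable
      have "h m (j' t) x = h m (j' t) (\<lambda>i. if i \<in> {1..m} then x i else 0)" for x
        unfolding h_def by (intro ball_cong refl arg_cong[where f = "\<lambda>S. card S = _"]) auto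
      then show "G x y = G (\<lambda>i. if i \<in> {1..m} then x i else 0) (\<lambda>i. if i \<in> {Suc m} then y i else 0)" for x y
        by (simp add: G_def indicator_def)
    qed auto
    also have "\<dots> = (\<integral>\<^sup>+\<omega>. indicator (?E m (j' t)) \<omega> * ennreal (p t) \<partial>M)"
    proof (rule nn_integral_cong)
      fix \<omega> assume w: "\<omega> \<in> space M"
      have "(\<integral>\<^sup>+\<omega>'. G (Xs \<omega>) (Xs \<omega>') \<partial>M) = (\<integral>\<^sup>+\<omega>'. indicator (?E m (j' t)) \<omega> * indicator {\<omega>\<in>space M. X (Suc m) \<omega> \<in> A t} \<omega>' \<partial>M)"
        using w by (intro nn_integral_cong) (auto simp: G_def h_def indicator_def)
      also have "\<dots> = indicator (?E m (j' t)) \<omega> * ennreal (prob {\<omega>\<in>space M. X (Suc m) \<omega> \<in> A t})"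
        using Xm by (simp add: nn_integral_cmult_indicator emeasure_eq_measure)
      also have "prob {\<omega>\<in>space M. X (Suc m) \<omega> \<in> A t} = p t" unfolding p_def by (rule prob_X_in[OF A(1)[OF t]])
      finally show "(\<integral>\<^sup>+\<omega>'. G (Xs \<omega>) (Xs \<omega>') \<partial>M) = indicator (?E m (j' t)) \<omega> * ennreal (p t)" .
    qed
    also have "\<dots> = (\<integral>\<^sup>+\<omega>. ennreal (p t) * indicator (?E m (j' t)) \<omega> \<partial>M)"
      by (simp only: mult.commute)
    also have "\<dots> = ennreal (p t) * emeasure M (?E m (j' t))" by (rule nn_integral_cmult_indicator[OF Em])
    also have "\<dots> = ennreal (p t * prob (?E m (j' t)))"
      unfolding emeasure_eq_measure by (rule ennreal_mult[symmetric]) (simp_all add: p_def)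
    finally show "prob (?H t) = p t * prob (?E m (j' t))"
      by (subst (asm) ennreal_inj) (auto simp: p_def simp del: Collect_conj_eq)
  qed
  also have "\<dots> = (if sum j I = Suc m then fact (Suc m) * (\<Prod>t\<in>I. p t ^ j t / fact (j t)) else 0)"
  proof -
    have s: "sum j I = sum (j' t) I + 1" if "t \<in> ?T" for t
    proof -
      have t: "t \<in> I" "j t \<noteq> 0" using that by auto
      have "sum (j' t) (I - {t}) = sum j (I - {t})" by (intro sum.cong) (auto simp: j'_def)
      then have "sum (j' t) I = (j t - 1) + sum j (I - {t})"
        by (subst sum.remove[OF I t(1)]) (simp add: j'_def)
      then show ?thesis using t(2) sum.remove[OF I t(1), of j] by simp
    qed
    \<comment> \<open>The probability of cell \<open>t\<close> times the weight of the lowered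
      counts is \<open>j t\<close> times the full weight; as the counts add up to
      \<open>Suc m\<close>, the factorial advances by one.\<close>
    have pr: "p t * (\<Prod>s\<in>I. p s ^ j' t s / fact (j' t s)) = real (j t) * (\<Prod>s\<in>I. p s ^ j s / fact (j s))" if "t \<in> ?T" for t
    proof -
      have "j t \<noteq> 0" using that by simp
      then obtain c where c: "j t = Suc c" using not0_implies_Suc by blast
      define R where "R = (\<Prod>s\<in>I - {t}. p s ^ j s / fact (j s))"
      have t: "t \<in> I" using that by simp
      have "(\<Prod>s\<in>I - {t}. p s ^ j' t s / fact (j' t s)) = R"
        unfolding R_def by (intro prod.cong) (auto simp: j'_def)
      then have 1: "(\<Prod>s\<in>I. p s ^ j' t s / fact (j' t s)) = p t ^ c / fact c * R"
        by (subst prod.remove[OF I t]) (simp add: j'_def c)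
      have 2: "(\<Prod>s\<in>I. p s ^ j s / fact (j s)) = p t ^ Suc c / fact (Suc c) * R"
        unfolding R_def by (subst prod.remove[OF I t]) (simp add: c)
      have "fact (Suc c) = real (Suc c) * fact c" by simp
      then have 3: "p t * (p t ^ c / fact c) = real (Suc c) * (p t ^ Suc c / fact (Suc c))" by simp
      show ?thesis unfolding 1 2 c mult.assoc[symmetric] 3 ..
    qed
    show ?thesis
    proof (cases "sum j I = Suc m")
      case True
      have "(\<Sum>t\<in>?T. p t * prob (?E m (j' t))) = (\<Sum>t\<in>?T. fact m * (real (j t) * (\<Prod>s\<in>I. p s ^ j s / fact (j s))))"
      proof (rule sum.cong[OF refl])
        fix t assume t: "t \<in> ?T"
        have "sum (j' t) I = m" using s[OF t] True by simp
        then have "prob (?E m (j' t)) = fact m * (\<Prod>s\<in>I. p s ^ j' t s / fact (j' t s))"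
          using Suc[of "j' t"] by (simp only: simp_thms if_True)
        then show "p t * prob (?E m (j' t)) = fact m * (real (j t) * (\<Prod>s\<in>I. p s ^ j s / fact (j s)))"
          by (simp only: pr[OF t, symmetric] mult.left_commute)
      qed
      also have "\<dots> = (\<Sum>t\<in>?T. real (j t)) * (fact m * (\<Prod>s\<in>I. p s ^ j s / fact (j s)))"
        unfolding sum_distrib_right by (intro sum.cong refl) (simp only: mult_ac)
      also have "(\<Sum>t\<in>?T. real (j t)) = (\<Sum>t\<in>I. real (j t))" using I by (intro sum.mono_neutral_left) auto
      also have "\<dots> = real (Suc m)" using True by (metis of_nat_sum)
      finally show ?thesis using True by simp
    next
      case False
      have "prob (?E m (j' t)) = 0" if "t \<in> ?T" for t
      proof -
        have "sum (j' t) I \<noteq> m" using s[OF that] False by simp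
        then show ?thesis using Suc[of "j' t"] by (simp only: if_False)
      qed
      then show ?thesis using False by simp
    qed
  qed
  finally show ?case .
qed

end


text \<open>The spaces that carry the Poisson processes need not carry an i.i.d. sample; the
  coordinates of an infinite product supply one.\<close>

lemma iid_canonical:
  fixes f :: "'a::euclidean_space \<Rightarrow> real"
  assumes bd: "bounded_density f" and B: "\<And>x. f x \<le> B"
  shows "iid_sample (PiM UNIV (\<lambda>_. density lborel (\<lambda>x. ennreal (f x)))) (\<lambda>i x. x i) f B"
proof -
  let ?D = "density lborel (\<lambda>x. ennreal (f x)) :: 'a measure"
  let ?Q = "PiM UNIV (\<lambda>_::nat. ?D)"
  interpret D: prob_space ?D
    using density_meas[OF bd] density_nn_integral[OF bd] by (intro prob_spaceI) (simp add: emeasure_density)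
  interpret PP: product_prob_space "\<lambda>_::nat. ?D" UNIV by standard
  have sQ: "sets ?Q = sets (PiM UNIV (\<lambda>_::nat. borel :: 'a measure))" by (intro sets_PiM_cong) auto
  have m[measurable]: "(\<lambda>x. x i) \<in> ?Q \<rightarrow>\<^sub>M borel" for i
    using measurable_component_singleton[of i UNIV "\<lambda>_. ?D"] by simp
  have comp: "distr ?Q borel (\<lambda>x. x i) = ?D" for i
  proof -
    have "distr ?Q borel (\<lambda>x. x i) = distr ?Q ?D (\<lambda>x. x i)" by (rule distr_cong) auto
    then show ?thesis using PP.PiM_component[of i] by simp
  qed
  show ?thesis
  proof (unfold_locales)
    show "prob_space.indep_vars ?Q (\<lambda>_. borel) (\<lambda>i x. x i) UNIV"
      using PP.indep_vars_iff_distr_eq_PiM'[where I = UNIV and M' = "\<lambda>_. borel" and X = "\<lambda>i x. x i"] m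
      by (simp add: comp restrict_UNIV distr_id2[OF sQ[symmetric]])
    have "distr ?Q lborel (\<lambda>x. x i) = distr ?Q borel (\<lambda>x. x i)" for i by (rule distr_cong) auto
    then show "distributed ?Q lborel (\<lambda>x. x i) (\<lambda>x. ennreal (f x))" for i
      unfolding distributed_def using density_meas[OF bd] m[of i] comp[of i] by simp
    show "f \<in> borel_measurable borel" "\<And>x. 0 \<le> f x" "\<And>x. f x \<le> B"
      using density_meas[OF bd] density_nonneg[OF bd] B by auto
  qed
qed

context iid_sample begin

abbreviation "pois n \<equiv> measure_pmf (poisson_pmf (real n)) \<Otimes>\<^sub>M M"

lemma model_meas: "(\<lambda>(m, \<omega>). Xs \<omega> ` {1..m}) \<in> pois n \<rightarrow>\<^sub>M count_sigma"
proof -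
  have "(\<lambda>(m, \<omega>). Xs \<omega> ` {1..m}) \<in> count_space UNIV \<Otimes>\<^sub>M M \<rightarrow>\<^sub>M count_sigma"
    by (rule measurable_pair_measure_countable1) (use image_count_meas in auto)
  moreover have "sets (pois n) = sets (count_space UNIV \<Otimes>\<^sub>M M)" by (intro sets_pair_measure_cong) auto
  ultimately show ?thesis by (simp cong: measurable_cong_sets)
qed

lemma prob_space_pois: "prob_space (pois n)"
proof -
  interpret P: pair_prob_space "measure_pmf (poisson_pmf (real n))" M ..
  show ?thesis by (rule P.prob_space_axioms)
qed

text \<open>Only the sample size \<open>sum j I\<close> contributes. There the multinomial weight
  times the Poisson weight splits into Poisson weights of the cells, because the cell probabilities
  add up to 1.\<close>

lemma model_joint:
  fixes A :: "nat \<Rightarrow> 'a set"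
  assumes n: "0 < n"
    and I: "finite I" and A: "\<And>t. t \<in> I \<Longrightarrow> A t \<in> sets borel" "disjoint_family_on A I" "(\<Union>t\<in>I. A t) = UNIV"
  shows "measure (pois n) {z\<in>space (pois n). \<forall>t\<in>I. card ((\<lambda>(m, \<omega>). Xs \<omega> ` {1..m}) z \<inter> A t) = j t} =
    (\<Prod>t\<in>I. (LINT x:A t|lborel. real n * f x) ^ j t / fact (j t) * exp (- (LINT x:A t|lborel. real n * f x)))"
proof -
  \<comment> \<open>Only the almost sure injectivity is taken from this locale, in order to count
    indices instead of points; the values 1 for \<open>k\<close> and \<open>r\<close> are
    arbitrary.\<close>
  interpret C: crit_sample M X f B 1 1 by standard auto
  let ?P = "\<lambda>(m, \<omega>). Xs \<omega> ` {1..m}"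
  let ?S = "{z\<in>space (pois n). \<forall>t\<in>I. card (?P z \<inter> A t) = j t}"
  define p where "p t = prob {\<omega>\<in>space M. X 0 \<omega> \<in> A t}" for t
  define c where "c = fact (sum j I) * (\<Prod>t\<in>I. p t ^ j t / fact (j t))"
  have p0: "0 \<le> p t" for t by (simp add: p_def)
  have c0: "0 \<le> c" unfolding c_def using p0 by (intro mult_nonneg_nonneg prod_nonneg) auto
  have pl: "(LINT x:A t|lborel. real n * f x) = real n * p t" if "t \<in> I" for t
    unfolding p_def prob_X_eq[OF A(1)[OF that]] set_lebesgue_integral_def by (simp add: mult.left_commute)
  have ps: "(\<Sum>t\<in>I. p t) = 1"
  proof -
    have "(\<Sum>t\<in>I. p t) = prob (\<Union>t\<in>I. {\<omega>\<in>space M. X 0 \<omega> \<in> A t})" unfolding p_def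
    proof (rule finite_measure_finite_Union[symmetric])
      show "disjoint_family_on (\<lambda>t. {\<omega>\<in>space M. X 0 \<omega> \<in> A t}) I" using A(2) unfolding disjoint_family_on_def by blast
      show "(\<lambda>t. {\<omega>\<in>space M. X 0 \<omega> \<in> A t}) ` I \<subseteq> events"
      proof (rule image_subsetI)
        fix t assume "t \<in> I"
        from A(1)[OF this] show "{\<omega>\<in>space M. X 0 \<omega> \<in> A t} \<in> events" by measurable
      qed
    qed (rule I)
    also have "(\<Union>t\<in>I. {\<omega>\<in>space M. X 0 \<omega> \<in> A t}) = space M" using A(3) by blast
    finally show ?thesis by (simp add: prob_space)
  qed
  have Sm: "?S \<in> sets (pois n)"
  proof -
    have "{z\<in>space (pois n). card (?P z \<inter> A t) = j t} \<in> sets (pois n)" if "t \<in> I" for t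
    proof -
      have "{z\<in>space (pois n). card (?P z \<inter> A t) = j t} = ?P -` {Q. card (Q \<inter> A t) = j t} \<inter> space (pois n)" by auto
      then show ?thesis using measurable_sets[OF model_meas count_sigma_gen[OF A(1)[OF that]]] by simp
    qed
    then show ?thesis by (intro sets.sets_Collect_finite_All I) auto
  qed
  have inner: "emeasure M (Pair m -` ?S) = ennreal c * indicator {sum j I} m" for m
  proof -
    have e: "Pair m -` ?S = {\<omega>\<in>space M. \<forall>t\<in>I. card (Xs \<omega> ` {1..m} \<inter> A t) = j t}" by (auto simp: space_pair_measure)
    have cm: "{\<omega>\<in>space M. \<forall>t\<in>I. card {i\<in>{1..m}. X i \<omega> \<in> A t} = j t} \<in> events"
    proof (intro sets.sets_Collect_finite_All I)
      fix t assume "t \<in> I"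
      have "Measurable.pred M (\<lambda>\<omega>. card {i\<in>{1..m}. X i \<omega> \<in> A t} = j t)"
        by (rule card_index_pred[OF A(1)[OF \<open>t \<in> I\<close>]]) auto
      then show "{\<omega>\<in>space M. card {i\<in>{1..m}. X i \<omega> \<in> A t} = j t} \<in> events" by (simp only: pred_def)
    qed
    have "emeasure M (Pair m -` ?S) = emeasure M {\<omega>\<in>space M. \<forall>t\<in>I. card {i\<in>{1..m}. X i \<omega> \<in> A t} = j t}"
    proof (rule emeasure_eq_AE)
      show "AE \<omega> in M. \<omega> \<in> Pair m -` ?S \<longleftrightarrow> \<omega> \<in> {\<omega>\<in>space M. \<forall>t\<in>I. card {i\<in>{1..m}. X i \<omega> \<in> A t} = j t}"
        using C.AE_inj[OF finite_atLeastAtMost[of 1 m]]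
      proof eventually_elim
        case (elim \<omega>)
        have "card (Xs \<omega> ` {1..m} \<inter> A t) = card {i\<in>{1..m}. X i \<omega> \<in> A t}" for t
        proof -
          have i: "Xs \<omega> ` {1..m} \<inter> A t = Xs \<omega> ` {i\<in>{1..m}. X i \<omega> \<in> A t}" by auto
          have "inj_on (Xs \<omega>) {i\<in>{1..m}. X i \<omega> \<in> A t}" by (rule inj_on_subset[OF elim]) auto
          from card_image[OF this] show ?thesis unfolding i .
        qed
        then show ?case unfolding e by simp
      qed
      show "Pair m -` ?S \<in> events" by (rule sets_Pair1[OF Sm])
    qed (rule cm)
    also have "\<dots> = ennreal c * indicator {sum j I} m"
    proof -
      have "prob {\<omega>\<in>space M. \<forall>t\<in>I. card {i\<in>{1..m}. X i \<omega> \<in> A t} = j t} =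
        (if sum j I = m then fact m * (\<Prod>t\<in>I. p t ^ j t / fact (j t)) else 0)"
        unfolding p_def by (rule prob_multinomial[OF I]) (use A in auto)
      then have "prob {\<omega>\<in>space M. \<forall>t\<in>I. card {i\<in>{1..m}. X i \<omega> \<in> A t} = j t} = (if m = sum j I then c else 0)"
        unfolding c_def by (cases "sum j I = m") simp_all
      then show ?thesis unfolding emeasure_eq_measure by (cases "m = sum j I") (simp_all only: indicator_simps insert_iff empty_iff if_True if_False ennreal_0 mult_1_right mult_zero_right simp_thms indicator_def of_bool_def)
    qed
    finally show ?thesis .
  qed
  have "emeasure (pois n) ?S = (\<integral>\<^sup>+m. emeasure M (Pair m -` ?S) \<partial>measure_pmf (poisson_pmf (real n)))"
    by (rule emeasure_pair_measure_alt[OF Sm])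
  also have "\<dots> = ennreal c * emeasure (measure_pmf (poisson_pmf (real n))) {sum j I}"
    unfolding inner by (rule nn_integral_cmult_indicator) simp
  also have "\<dots> = ennreal (c * (real n ^ sum j I / fact (sum j I) * exp (- real n)))"
    using n c0 by (simp add: emeasure_pmf_single ennreal_mult[symmetric])
  finally have "measure (pois n) ?S = c * (real n ^ sum j I / fact (sum j I) * exp (- real n))"
    using c0 by (simp add: measure_def)
  also have "\<dots> = (\<Prod>t\<in>I. p t ^ j t / fact (j t)) * real n ^ sum j I * exp (- real n)"
    by (simp add: c_def)
  also have "\<dots> = (\<Prod>t\<in>I. (real n * p t) ^ j t / fact (j t) * exp (- (real n * p t)))"
  proof -
    have "exp (- real n) = exp (\<Sum>t\<in>I. - (real n * p t))"
      using ps by (simp add: sum_negf sum_distrib_left[symmetric])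
    also have "\<dots> = (\<Prod>t\<in>I. exp (- (real n * p t)))" by (rule exp_sum[OF I])
    finally show ?thesis
      by (simp add: power_sum prod.distrib[symmetric] power_mult_distrib mult_ac)
  qed
  also have "\<dots> = (\<Prod>t\<in>I. (LINT x:A t|lborel. real n * f x) ^ j t / fact (j t) * exp (- (LINT x:A t|lborel. real n * f x)))"
    by (intro prod.cong refl) (simp only: pl)
  finally show ?thesis .
qed

lemma poisson_law:
  assumes P: "poisson_process \<Omega> P (\<lambda>x. real n * f x)" and n: "0 < n"
  shows "distr \<Omega> count_sigma P = distr (pois n) count_sigma (\<lambda>(m, \<omega>). Xs \<omega> ` {1..m})"
proof (rule count_law_unique)
  show "prob_space \<Omega>" "AE \<omega> in \<Omega>. finite (P \<omega>)" using P by (auto simp: poisson_process_def)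
  show "P \<in> \<Omega> \<rightarrow>\<^sub>M count_sigma" by (rule poisson_process_meas[OF P])
  show "prob_space (pois n)" by (rule prob_space_pois)
  show "(\<lambda>(m, \<omega>). Xs \<omega> ` {1..m}) \<in> pois n \<rightarrow>\<^sub>M count_sigma" by (rule model_meas)
  show "AE z in pois n. finite ((\<lambda>(m, \<omega>). Xs \<omega> ` {1..m}) z)" by (rule AE_I2) auto
  fix I :: "nat set" and A :: "nat \<Rightarrow> 'a set" and j
  assume I: "finite I" "\<And>i. i \<in> I \<Longrightarrow> A i \<in> sets borel" "disjoint_family_on A I" "(\<Union>i\<in>I. A i) = UNIV"
  have ne: "I \<noteq> {}" using I(4) by auto
  show "measure \<Omega> {\<omega>\<in>space \<Omega>. \<forall>i\<in>I. card (P \<omega> \<inter> A i) = j i} =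
    measure (pois n) {z\<in>space (pois n). \<forall>i\<in>I. card ((\<lambda>(m, \<omega>). Xs \<omega> ` {1..m}) z \<inter> A i) = j i}"
    by (rule trans[OF poisson_process_joint[OF P I(1) ne I(2,3)] model_joint[OF n I, symmetric]])
qed

end


section \<open>Characteristic functions and the passage to the limit\<close>

lemma char_eq_cis:
  assumes "X \<in> borel_measurable M"
  shows "char (distr M borel X) t = (CLINT \<omega>|M. cis (t * X \<omega>))"
  unfolding char_def using assms
  by (subst integral_distr) (auto simp: cis_conv_exp intro!: borel_measurable_continuous_onI continuous_intros)

lemma char_poisson:
  assumes m: "0 < m"
  shows "char (distr (measure_pmf (poisson_pmf m)) borel real) t = exp (of_real m * (cis t - 1))"
proof -
  let ?a = "\<lambda>n::nat. (m ^ n / fact n * exp (- m)) *\<^sub>R cis (t * real n)"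
  have e: "?a n = of_real (exp (- m)) * ((of_real m * cis t) ^ n /\<^sub>R fact n)" for n
  proof -
    have "cis (t * real n) = cis t ^ n" by (simp add: Complex.DeMoivre mult.commute)
    then show ?thesis by (simp add: power_mult_distrib scaleR_conv_of_real divide_inverse mult_ac)
  qed
  have sm: "?a sums (of_real (exp (- m)) * exp (of_real m * cis t))"
    unfolding e by (intro sums_mult exp_converges)
  have int: "integrable (count_space UNIV) ?a"
  proof (rule integrable_count_space_nat_iff[THEN iffD2])
    have "summable (\<lambda>n. exp (- m) * (m ^ n /\<^sub>R fact n))" by (intro summable_mult summable_exp_generic)
    moreover have "norm (?a n) = exp (- m) * (m ^ n /\<^sub>R fact n)" for n
      using m by (simp add: divide_inverse mult_ac)
    ultimately show "summable (\<lambda>n. norm (?a n))" by simp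
  qed
  have "char (distr (measure_pmf (poisson_pmf m)) borel real) t = (CLINT n|measure_pmf (poisson_pmf m). cis (t * real n))"
    by (rule char_eq_cis) simp
  also have "\<dots> = (CLINT n|count_space UNIV. pmf (poisson_pmf m) n *\<^sub>R cis (t * real n))"
    unfolding measure_pmf_eq_density by (subst integral_density) auto
  also have "\<dots> = (CLINT n|count_space UNIV. ?a n)" using m by simp
  also have "\<dots> = (\<Sum>n. ?a n)" by (rule integral_count_space_nat[OF int])
  also have "\<dots> = of_real (exp (- m)) * exp (of_real m * cis t)" using sm by (rule sums_unique[symmetric])
  also have "\<dots> = exp (of_real m * (cis t - 1))"
    by (simp add: exp_of_real[symmetric] exp_add[symmetric] algebra_simps)
  finally show ?thesis .
qed

lemma normal_char:
  assumes s: "0 < s"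
  shows "char (density lborel (normal_density 0 s)) t = of_real (exp (- (s\<^sup>2 * t\<^sup>2) / 2))"
    and normal_real_distribution: "real_distribution (density lborel (normal_density 0 s))"
proof -
  have s1: "distributed std_normal_distribution lborel (\<lambda>x. x) (normal_density 0 1)"
    unfolding distributed_def by (auto simp: distr_id2)
  have "distributed std_normal_distribution lborel (\<lambda>x. 0 + s * x) (normal_density (0 + s * 0) (\<bar>s\<bar> * 1))"
    using prob_space_normal_density[of 1 0] s1 s by (intro prob_space.normal_density_affine) auto
  then have d: "distr std_normal_distribution borel (\<lambda>x. s * x) = density lborel (normal_density 0 s)"
    using s by (simp add: distributed_def cong: distr_cong)
  have "char (density lborel (normal_density 0 s)) t = (CLINT x|std_normal_distribution. cis (t * (s * x)))"
    unfolding d[symmetric] by (rule char_eq_cis) simp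
  also have "\<dots> = char std_normal_distribution (t * s)"
    unfolding char_def by (simp add: cis_conv_exp mult.assoc)
  also have "\<dots> = of_real (exp (- (s\<^sup>2 * t\<^sup>2) / 2))"
    by (simp add: char_std_normal_distribution power_mult_distrib mult.commute)
  finally show "char (density lborel (normal_density 0 s)) t = of_real (exp (- (s\<^sup>2 * t\<^sup>2) / 2))" .
  interpret prob_space "density lborel (normal_density 0 s)" by (rule prob_space_normal_density[OF s])
  show "real_distribution (density lborel (normal_density 0 s))" by standard auto
qed

lemma weak_conv_m_offset:
  assumes "weak_conv_m (\<lambda>n. F (n + m)) G"
  shows "weak_conv_m F G"
  using assms unfolding weak_conv_m_def weak_conv_def
  by (auto intro: LIMSEQ_offset[where k = m])

text \<open>Levy's continuity theorem, shifted by \<open>n0\<close>: it asks for probability laws at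
  every index, while these are at hand only from \<open>n0\<close> on.\<close>

lemma weak_conv_from_cis:
  fixes X :: "nat \<Rightarrow> 'w \<Rightarrow> real" and G :: "real measure"
  assumes M: "\<And>n. n0 \<le> n \<Longrightarrow> prob_space (M n)" "\<And>n. n0 \<le> n \<Longrightarrow> X n \<in> borel_measurable (M n)"
    and G: "real_distribution G"
    and lim: "\<And>t. (\<lambda>n. CLINT \<omega>|M n. cis (t * X n \<omega>)) \<longlonglongrightarrow> char G t"
  shows "weak_conv_m (\<lambda>n. distr (M n) borel (X n)) G"
proof (rule weak_conv_m_offset[where m = n0], rule levy_continuity[OF _ G])
  show "real_distribution (distr (M (n + n0)) borel (X (n + n0)))" for n
    using M[of "n + n0"] by (intro prob_space.real_distribution_distr) auto
  show "(\<lambda>n. char (distr (M (n + n0)) borel (X (n + n0))) t) \<longlonglongrightarrow> char G t" for t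
    using LIMSEQ_ignore_initial_segment[OF lim[of t], of n0] M by (simp add: char_eq_cis)
qed

lemma cis_second_order: "cmod (cis s - 1 - \<i> * of_real s + of_real (s\<^sup>2 / 2)) \<le> \<bar>s\<bar> ^ 3"
proof -
  have 1: "cmod (cis s - (\<Sum>k\<le>2. (\<i> * of_real s) ^ k / fact k)) \<le> \<bar>s\<bar> ^ 3 / fact 3"
    using iexp_approx1[of s 2] by (simp add: cis_conv_exp numeral_3_eq_3[symmetric])
  have 2: "(\<Sum>k\<le>2. (\<i> * of_real s) ^ k / fact k) = 1 + \<i> * of_real s - of_real (s\<^sup>2 / 2)"
  proof -
    have S: "(\<Sum>k\<le>2. h k) = h 0 + h 1 + h (2::nat)" for h :: "nat \<Rightarrow> complex" by (simp add: numeral_2_eq_2)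
    show ?thesis unfolding S by (simp add: power_mult_distrib)
  qed
  have 3: "\<bar>s\<bar> ^ 3 / fact 3 \<le> \<bar>s\<bar> ^ 3" by (simp add: divide_le_eq fact_numeral)
  have "cis s - 1 - \<i> * of_real s + of_real (s\<^sup>2 / 2) = cis s - (1 + \<i> * of_real s - of_real (s\<^sup>2 / 2))" by simp
  then show ?thesis using order_trans[OF 1 3] unfolding 2 by (simp only:)
qed

text \<open>Second-order expansion with s = t / sqrt T: the quadratic term contributes L / T * t^2 /
  2, and the remainder is at most |L s^2| * |s|, a bounded factor times one that vanishes.\<close>

lemma poisson_to_normal_exponent:
  fixes L T :: "nat \<Rightarrow> real"
  assumes T: "filterlim T at_top sequentially" and L: "(\<lambda>n. L n / T n) \<longlonglongrightarrow> \<mu>"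
  shows "(\<lambda>n. of_real (L n) * (cis (t / sqrt (T n)) - 1 - \<i> * of_real (t / sqrt (T n)))) \<longlonglongrightarrow> of_real (- (\<mu> * t\<^sup>2) / 2)"
proof -
  define s where "s n = t / sqrt (T n)" for n
  have Tpos: "eventually (\<lambda>n. 0 < T n) sequentially" using T by (simp add: filterlim_at_top_dense)
  have s0: "s \<longlonglongrightarrow> 0" unfolding s_def
    by (rule real_tendsto_divide_at_top[OF tendsto_const filterlim_compose[OF sqrt_at_top T]])
  have Ls: "eventually (\<lambda>n. L n * (s n)\<^sup>2 = (L n / T n) * t\<^sup>2) sequentially"
    using Tpos by eventually_elim (simp add: s_def power_divide)
  have lim1: "(\<lambda>n. L n * (s n)\<^sup>2) \<longlonglongrightarrow> \<mu> * t\<^sup>2"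
    by (subst filterlim_cong[OF refl refl Ls]) (intro tendsto_intros L)
  have lim2: "(\<lambda>n. complex_of_real (L n) * (cis (s n) - 1 - \<i> * of_real (s n) + of_real ((s n)\<^sup>2 / 2))) \<longlonglongrightarrow> 0"
  proof (rule Lim_null_comparison)
    show "eventually (\<lambda>n. norm (complex_of_real (L n) * (cis (s n) - 1 - \<i> * of_real (s n) + of_real ((s n)\<^sup>2 / 2))) \<le> \<bar>L n * (s n)\<^sup>2\<bar> * \<bar>s n\<bar>) sequentially"
    proof (rule always_eventually, rule allI)
      fix n
      have "norm (complex_of_real (L n) * (cis (s n) - 1 - \<i> * of_real (s n) + of_real ((s n)\<^sup>2 / 2))) \<le> \<bar>L n\<bar> * \<bar>s n\<bar> ^ 3"
        unfolding norm_mult norm_of_real by (intro mult_left_mono cis_second_order) simp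
      then show "norm (complex_of_real (L n) * (cis (s n) - 1 - \<i> * of_real (s n) + of_real ((s n)\<^sup>2 / 2))) \<le> \<bar>L n * (s n)\<^sup>2\<bar> * \<bar>s n\<bar>"
        by (simp add: abs_mult power2_eq_square power3_eq_cube mult_ac)
    qed
    have "(\<lambda>n. \<bar>L n * (s n)\<^sup>2\<bar> * \<bar>s n\<bar>) \<longlonglongrightarrow> \<bar>\<mu> * t\<^sup>2\<bar> * \<bar>0\<bar>" by (intro tendsto_intros lim1 s0)
    then show "(\<lambda>n. \<bar>L n * (s n)\<^sup>2\<bar> * \<bar>s n\<bar>) \<longlonglongrightarrow> 0" by simp
  qed
  have "(\<lambda>n. complex_of_real (L n) * (cis (s n) - 1 - \<i> * of_real (s n) + of_real ((s n)\<^sup>2 / 2)) - of_real (L n * (s n)\<^sup>2 / 2))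
     \<longlonglongrightarrow> 0 - of_real (\<mu> * t\<^sup>2 / 2)"
    by (intro tendsto_diff lim2 tendsto_of_real tendsto_divide lim1 tendsto_const) simp
  then show ?thesis unfolding s_def[symmetric] by (simp add: algebra_simps)
qed

text \<open>Serves both models. The sequence \<open>L\<close> is the mean of the approximating
  Poisson law, \<open>V\<close> measures dependence, and \<open>e\<close> and \<open>e'\<close> are
  the L^1 errors without and with centering. The plain error has to vanish only where
  \<open>T\<close> converges; the centered one only relative to \<open>sqrt (T n)\<close>, because
  in the third regime the argument of the characteristic function carries this divisor.\<close>

lemma crit_limitsI:
  fixes \<Omega> :: "nat \<Rightarrow> 'w measure" and Z :: "nat \<Rightarrow> 'w \<Rightarrow> nat" and r :: "nat \<Rightarrow> real" and d k :: nat
  defines "T \<equiv> \<lambda>n. real n ^ (k + 1) * r n ^ (d * k)"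
  assumes mu: "0 < \<mu>"
    and M: "\<And>n. n0 \<le> n \<Longrightarrow> prob_space (\<Omega> n)" "\<And>n. n0 \<le> n \<Longrightarrow> Z n \<in> \<Omega> n \<rightarrow>\<^sub>M count_space UNIV"
    and sq: "\<And>n. n0 \<le> n \<Longrightarrow> (\<integral>\<^sup>+\<omega>. ennreal ((real (Z n \<omega>))\<^sup>2) \<partial>\<Omega> n) \<le> ennreal (a n)"
    and ch: "\<And>n t. n0 \<le> n \<Longrightarrow> cmod ((CLINT \<omega>|\<Omega> n. cis (t * real (Z n \<omega>))) - exp (of_real (L n) * (cis t - 1))) \<le>
        t\<^sup>2 * V n * exp (L n * t\<^sup>2 / 2) + \<bar>t\<bar> * e n"
    and ch': "\<And>n t. n0 \<le> n \<Longrightarrow> cmod ((CLINT \<omega>|\<Omega> n. cis (t * (real (Z n \<omega>) - (\<integral>\<omega>'. real (Z n \<omega>') \<partial>\<Omega> n)))) -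
          cis (- (t * L n)) * exp (of_real (L n) * (cis t - 1))) \<le>
        t\<^sup>2 * V n * exp (L n * t\<^sup>2 / 2) + \<bar>t\<bar> * e' n"
    and a: "T \<longlonglongrightarrow> 0 \<Longrightarrow> a \<longlonglongrightarrow> 0"
    and L: "(\<lambda>n. L n / T n) \<longlonglongrightarrow> \<mu>" and V: "(\<lambda>n. V n / T n) \<longlonglongrightarrow> 0"
    and e: "\<And>\<alpha>. T \<longlonglongrightarrow> \<alpha> \<Longrightarrow> e \<longlonglongrightarrow> 0"
    and e': "filterlim T at_top sequentially \<Longrightarrow> (\<lambda>n. e' n / sqrt (T n)) \<longlonglongrightarrow> 0"
  shows "crit_limits \<Omega> Z k r d \<mu>"
  unfolding crit_limits_def T_def[symmetric]
proof (intro conjI allI impI)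
  have Tf: "T = (\<lambda>n. real n ^ (k + 1) * r n ^ (d * k))" by (simp add: T_def)
  have TT: "(\<lambda>n. real n ^ (k + 1) * r n ^ (d * k)) = T" by (simp add: T_def)
  have Zm: "(\<lambda>\<omega>. real (Z n \<omega>)) \<in> borel_measurable (\<Omega> n)" if "n0 \<le> n" for n
    using measurable_compose[OF M(2)[OF that], of real borel] by simp
  {
    assume "T \<longlonglongrightarrow> 0"
    then have up: "(\<lambda>n. ennreal (a n)) \<longlonglongrightarrow> 0" using tendsto_ennrealI[OF a] by simp
    have "eventually (\<lambda>n. (\<integral>\<^sup>+\<omega>. ennreal ((real (Z n \<omega>))\<^sup>2) \<partial>\<Omega> n) \<le> ennreal (a n)) sequentially"
      using sq by (auto simp: eventually_sequentially)
    from tendsto_sandwich[OF always_eventually this tendsto_const up]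
    show "(\<lambda>n. \<integral>\<^sup>+\<omega>. ennreal ((real (Z n \<omega>))\<^sup>2) \<partial>\<Omega> n) \<longlonglongrightarrow> 0" by simp
  next
    fix \<alpha> :: real assume al: "0 < \<alpha>" and Tl: "T \<longlonglongrightarrow> \<alpha>"
    have Tn: "eventually (\<lambda>n. T n \<noteq> 0) sequentially" using Tl al by (intro tendsto_imp_eventually_ne) auto
    have Ll: "L \<longlonglongrightarrow> \<mu> * \<alpha>"
      by (rule Lim_transform_eventually[OF tendsto_mult[OF L Tl]]) (use Tn in \<open>eventually_elim, simp\<close>)
    have Vl: "V \<longlonglongrightarrow> 0"
    proof -
      have "eventually (\<lambda>n. V n / T n * T n = V n) sequentially" using Tn by eventually_elim simp
      from Lim_transform_eventually[OF tendsto_mult[OF V Tl] this] show ?thesis by simp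
    qed
    show "weak_conv_m (\<lambda>n. distr (\<Omega> n) borel (\<lambda>\<omega>. real (Z n \<omega>))) (distr (measure_pmf (poisson_pmf (\<alpha> * \<mu>))) borel real)"
    proof (rule weak_conv_from_cis[OF M(1) Zm])
      show "real_distribution (distr (measure_pmf (poisson_pmf (\<alpha> * \<mu>))) borel real)"
        by (rule prob_space.real_distribution_distr) (auto simp: measure_pmf.prob_space_axioms)
      fix t
      have "(\<lambda>n. (CLINT \<omega>|\<Omega> n. cis (t * real (Z n \<omega>))) - exp (of_real (L n) * (cis t - 1))) \<longlonglongrightarrow> 0"
      proof (rule Lim_null_comparison)
        show "eventually (\<lambda>n. norm ((CLINT \<omega>|\<Omega> n. cis (t * real (Z n \<omega>))) - exp (of_real (L n) * (cis t - 1))) \<le>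
           t\<^sup>2 * V n * exp (L n * t\<^sup>2 / 2) + \<bar>t\<bar> * e n) sequentially"
          using ch by (auto simp: eventually_sequentially)
        have "(\<lambda>n. t\<^sup>2 * V n * exp (L n * t\<^sup>2 / 2) + \<bar>t\<bar> * e n) \<longlonglongrightarrow> t\<^sup>2 * 0 * exp (\<mu> * \<alpha> * t\<^sup>2 / 2) + \<bar>t\<bar> * 0"
          by (intro tendsto_intros Ll Vl e[OF Tl]) simp
        then show "(\<lambda>n. t\<^sup>2 * V n * exp (L n * t\<^sup>2 / 2) + \<bar>t\<bar> * e n) \<longlonglongrightarrow> 0" by simp
      qed
      moreover have "(\<lambda>n. exp (of_real (L n) * (cis t - 1))) \<longlonglongrightarrow> exp (of_real (\<mu> * \<alpha>) * (cis t - 1))"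
        by (intro tendsto_intros Ll)
      ultimately have "(\<lambda>n. ((CLINT \<omega>|\<Omega> n. cis (t * real (Z n \<omega>))) - exp (of_real (L n) * (cis t - 1))) + exp (of_real (L n) * (cis t - 1)))
         \<longlonglongrightarrow> 0 + exp (of_real (\<mu> * \<alpha>) * (cis t - 1))" by (rule tendsto_add)
      then show "(\<lambda>n. CLINT \<omega>|\<Omega> n. cis (t * real (Z n \<omega>))) \<longlonglongrightarrow> char (distr (measure_pmf (poisson_pmf (\<alpha> * \<mu>))) borel real) t"
        using char_poisson[of "\<alpha> * \<mu>" t] al mu by (simp add: mult.commute)
    qed
  next
    assume Tl: "filterlim T at_top sequentially"
    have Tpos: "eventually (\<lambda>n. 0 < T n) sequentially" using Tl by (simp add: filterlim_at_top_dense)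
    have "weak_conv_m (\<lambda>n. distr (\<Omega> n) borel (\<lambda>\<omega>. (real (Z n \<omega>) - (\<integral>\<omega>'. real (Z n \<omega>') \<partial>\<Omega> n)) / sqrt (T n)))
       (density lborel (normal_density 0 (sqrt \<mu>)))"
    proof (rule weak_conv_from_cis[OF M(1)])
      show "(\<lambda>\<omega>. (real (Z n \<omega>) - (\<integral>\<omega>'. real (Z n \<omega>') \<partial>\<Omega> n)) / sqrt (T n)) \<in> borel_measurable (\<Omega> n)" if "n0 \<le> n" for n
        using Zm[OF that] by measurable
      show "real_distribution (density lborel (normal_density 0 (sqrt \<mu>)))" using mu by (intro normal_real_distribution) simp
      fix t
      define s where "s n = t / sqrt (T n)" for n
      \<comment> \<open>The characteristic function at \<open>s n\<close> of a centered Poisson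
        variable with mean \<open>L n\<close> before centering.\<close>
      let ?E = "\<lambda>n. cis (- (s n * L n)) * exp (of_real (L n) * (cis (s n) - 1))"
      have "(\<lambda>n. (CLINT \<omega>|\<Omega> n. cis (s n * (real (Z n \<omega>) - (\<integral>\<omega>'. real (Z n \<omega>') \<partial>\<Omega> n)))) - ?E n) \<longlonglongrightarrow> 0"
      proof (rule Lim_null_comparison)
        have "eventually (\<lambda>n. norm ((CLINT \<omega>|\<Omega> n. cis (s n * (real (Z n \<omega>) - (\<integral>\<omega>'. real (Z n \<omega>') \<partial>\<Omega> n)))) - ?E n) \<le>
           (s n)\<^sup>2 * V n * exp (L n * (s n)\<^sup>2 / 2) + \<bar>s n\<bar> * e' n) sequentially"
          using ch' by (auto simp: eventually_sequentially)
        then show "eventually (\<lambda>n. norm ((CLINT \<omega>|\<Omega> n. cis (s n * (real (Z n \<omega>) - (\<integral>\<omega>'. real (Z n \<omega>') \<partial>\<Omega> n)))) - ?E n) \<le>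
           t\<^sup>2 * (V n / T n) * exp ((L n / T n) * t\<^sup>2 / 2) + \<bar>t\<bar> * (e' n / sqrt (T n))) sequentially"
          using Tpos by eventually_elim (simp add: s_def power_divide abs_div)
        have "(\<lambda>n. t\<^sup>2 * (V n / T n) * exp ((L n / T n) * t\<^sup>2 / 2) + \<bar>t\<bar> * (e' n / sqrt (T n))) \<longlonglongrightarrow>
           t\<^sup>2 * 0 * exp (\<mu> * t\<^sup>2 / 2) + \<bar>t\<bar> * 0"
          by (intro tendsto_intros L V e'[OF Tl]) simp
        then show "(\<lambda>n. t\<^sup>2 * (V n / T n) * exp ((L n / T n) * t\<^sup>2 / 2) + \<bar>t\<bar> * (e' n / sqrt (T n))) \<longlonglongrightarrow> 0" by simp
      qed
      moreover have "?E \<longlonglongrightarrow> of_real (exp (- (\<mu> * t\<^sup>2) / 2))"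
      proof -
        have E: "?E n = exp (of_real (L n) * (cis (s n) - 1 - \<i> * of_real (s n)))" for n
          by (simp add: cis_conv_exp exp_add[symmetric] algebra_simps)
        show ?thesis
          unfolding E unfolding s_def using tendsto_exp[OF poisson_to_normal_exponent[OF Tl L, of t]] unfolding exp_of_real .
      qed
      ultimately have "(\<lambda>n. ((CLINT \<omega>|\<Omega> n. cis (s n * (real (Z n \<omega>) - (\<integral>\<omega>'. real (Z n \<omega>') \<partial>\<Omega> n)))) - ?E n) + ?E n)
         \<longlonglongrightarrow> 0 + of_real (exp (- (\<mu> * t\<^sup>2) / 2))" by (rule tendsto_add)
      then show "(\<lambda>n. CLINT \<omega>|\<Omega> n. cis (t * ((real (Z n \<omega>) - (\<integral>\<omega>'. real (Z n \<omega>') \<partial>\<Omega> n)) / sqrt (T n))))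
         \<longlonglongrightarrow> char (density lborel (normal_density 0 (sqrt \<mu>))) t"
        using normal_char[of "sqrt \<mu>"] mu by (simp add: s_def)
    qed
    then show "weak_conv_m (\<lambda>n. distr (\<Omega> n) borel (\<lambda>\<omega>. (real (Z n \<omega>) - (\<integral>\<omega>'. real (Z n \<omega>') \<partial>\<Omega> n)) / sqrt (real n ^ (k + 1) * r n ^ (d * k))))
       (density lborel (normal_density 0 (sqrt \<mu>)))" unfolding T_def .
  }
qed


section \<open>Error estimates for samples of fixed and of Poisson size\<close>

text \<open>A weighted arithmetic-geometric inequality separates the deviation from the polynomial
  factor: the variance of the size contributes n, the moments contribute n^(2l).\<close>

lemma poisson_dev_moment:
  "\<exists>K\<ge>0. \<forall>n\<ge>1. (\<integral>\<^sup>+m. ennreal (\<bar>real m - real n\<bar> * (real m + real n) ^ l) \<partial>measure_pmf (poisson_pmf (real n)))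
     \<le> ennreal (K * (sqrt (real n) * real n ^ l))"
proof -
  obtain C where C: "0 \<le> C" "\<And>rate. 1 \<le> rate \<Longrightarrow>
    (\<integral>\<^sup>+m. ennreal (real m ^ (2 * l)) \<partial>measure_pmf (poisson_pmf rate)) \<le> ennreal (C * rate ^ (2 * l))"
    using poisson_moment_bound[of "2 * l"] by blast
  define K where "K = (1 + 2 ^ (2 * l) * (C + 1)) / 2"
  show ?thesis
  proof (intro exI[of _ K] conjI allI impI)
    show "0 \<le> K" using C(1) by (simp add: K_def)
    fix n :: nat assume n: "1 \<le> n"
    let ?P = "measure_pmf (poisson_pmf (real n))"
    \<comment> \<open>The weight that balances the two contributions: both \<open>c * real n\<close>
      and \<open>real n ^ (2 * l) / c\<close> equal
      \<open>sqrt (real n) * real n ^ l\<close>.\<close>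
    define c where "c = real n ^ l / sqrt (real n)"
    have c: "0 < c" using n by (simp add: c_def)
    have cn: "c * real n = sqrt (real n) * real n ^ l"
    proof -
      have "real n / sqrt (real n) = sqrt (real n)" by (rule real_div_sqrt) simp
      moreover have "c * real n = real n / sqrt (real n) * real n ^ l" by (simp add: c_def)
      ultimately show ?thesis by (simp only:)
    qed
    have c2: "real n ^ (2 * l) / c = sqrt (real n) * real n ^ l"
      using n by (simp add: c_def power_mult[symmetric] mult_2 power_add)
    have "(\<integral>\<^sup>+m. ennreal (\<bar>real m - real n\<bar> * (real m + real n) ^ l) \<partial>?P) \<le>
      (\<integral>\<^sup>+m. ennreal (c / 2) * ennreal ((real m - real n)\<^sup>2) + ennreal (2 ^ (2 * l) / (2 * c)) * (ennreal (real m ^ (2 * l)) + ennreal (real n ^ (2 * l))) \<partial>?P)"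
    proof (rule nn_integral_mono)
      fix m :: nat
      let ?a = "\<bar>real m - real n\<bar>" and ?b = "(real m + real n) ^ l"
      have "0 \<le> (c * ?a - ?b)\<^sup>2" by simp
      then have "2 * c * (?a * ?b) \<le> c\<^sup>2 * ?a\<^sup>2 + ?b\<^sup>2" by (simp add: power2_diff power_mult_distrib mult_ac)
      then have "?a * ?b \<le> (c\<^sup>2 * ?a\<^sup>2 + ?b\<^sup>2) / (2 * c)" using c by (simp add: pos_le_divide_eq mult_ac)
      also have "\<dots> = c / 2 * (real m - real n)\<^sup>2 + ?b\<^sup>2 / (2 * c)" using c by (simp add: field_simps power2_eq_square)
      also have "?b\<^sup>2 \<le> 2 ^ (2 * l) * (real m ^ (2 * l) + real n ^ (2 * l))"
        using add_power_le[of "real m" "real n" "2 * l"] by (simp add: power_mult[symmetric] mult.commute)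
      finally have "?a * ?b \<le> c / 2 * (real m - real n)\<^sup>2 + 2 ^ (2 * l) / (2 * c) * (real m ^ (2 * l) + real n ^ (2 * l))"
        using c by (simp add: divide_right_mono)
      then have "ennreal (?a * ?b) \<le> ennreal (c / 2 * (real m - real n)\<^sup>2 + 2 ^ (2 * l) / (2 * c) * (real m ^ (2 * l) + real n ^ (2 * l)))"
        by (rule ennreal_leI)
      also have "\<dots> = ennreal (c / 2) * ennreal ((real m - real n)\<^sup>2) + ennreal (2 ^ (2 * l) / (2 * c)) * (ennreal (real m ^ (2 * l)) + ennreal (real n ^ (2 * l)))"
        using c by (simp add: ennreal_mult[symmetric] ennreal_plus[symmetric] del: ennreal_plus)
      finally show "ennreal (?a * ?b) \<le> \<dots>" .
    qed
    also have "\<dots> = ennreal (c / 2) * (\<integral>\<^sup>+m. ennreal ((real m - real n)\<^sup>2) \<partial>?P) +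
       ennreal (2 ^ (2 * l) / (2 * c)) * ((\<integral>\<^sup>+m. ennreal (real m ^ (2 * l)) \<partial>?P) + ennreal (real n ^ (2 * l)))"
      by (simp add: nn_integral_add nn_integral_cmult measure_pmf.emeasure_space_1[simplified])
    also have "\<dots> \<le> ennreal (c / 2) * ennreal (real n) +
       ennreal (2 ^ (2 * l) / (2 * c)) * (ennreal (C * real n ^ (2 * l)) + ennreal (real n ^ (2 * l)))"
      using n C(2)[of "real n"] poisson_variance[of "real n"] by (intro add_mono mult_left_mono) auto
    also have "\<dots> = ennreal (c / 2 * real n + 2 ^ (2 * l) / (2 * c) * ((C + 1) * real n ^ (2 * l)))"
    proof -
      have "ennreal (C * real n ^ (2 * l)) + ennreal (real n ^ (2 * l)) = ennreal ((C + 1) * real n ^ (2 * l))"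
        using C(1) by (subst ennreal_plus[symmetric]) (auto simp: distrib_right)
      moreover have "0 \<le> (C + 1) * real n ^ (2 * l)" using C(1) by simp
      ultimately show ?thesis using c C(1) by (simp add: ennreal_mult[symmetric] ennreal_plus[symmetric] del: ennreal_plus)
    qed
    also have "c / 2 * real n + 2 ^ (2 * l) / (2 * c) * ((C + 1) * real n ^ (2 * l)) = (c * real n) / 2 + 2 ^ (2 * l) * (C + 1) / 2 * (real n ^ (2 * l) / c)"
      by simp
    also have "\<dots> = K * (sqrt (real n) * real n ^ l)"
      unfolding cn c2 by (simp add: K_def algebra_simps add_divide_distrib)
    finally show "(\<integral>\<^sup>+m. ennreal (\<bar>real m - real n\<bar> * (real m + real n) ^ l) \<partial>?P) \<le> ennreal (K * (sqrt (real n) * real n ^ l))" .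
  qed
qed

lemma cis_borel [measurable]: "cis \<in> borel_measurable borel"
  by (intro borel_measurable_continuous_onI continuous_intros)

text \<open>Centering adds the difference of the two means, again at most \<open>b\<close>, whence
  the factor 2.\<close>

lemma (in prob_space) centered_cis_close:
  assumes [measurable]: "Y \<in> borel_measurable M" "Z \<in> borel_measurable M" and i: "integrable M Y" "integrable M Z"
    and b: "expectation (\<lambda>\<omega>. \<bar>Y \<omega> - Z \<omega>\<bar>) \<le> b"
  shows "cmod ((CLINT \<omega>|M. cis (t * Y \<omega>)) - (CLINT \<omega>|M. cis (t * Z \<omega>))) \<le> \<bar>t\<bar> * b"
    and "cmod ((CLINT \<omega>|M. cis (t * (Y \<omega> - expectation Y))) - (CLINT \<omega>|M. cis (t * (Z \<omega> - expectation Z)))) \<le> \<bar>t\<bar> * (2 * b)"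
proof -
  have iD: "integrable M (\<lambda>\<omega>. \<bar>Y \<omega> - Z \<omega>\<bar>)" using i by auto
  have "cmod ((CLINT \<omega>|M. cis (t * Y \<omega>)) - (CLINT \<omega>|M. cis (t * Z \<omega>))) \<le> expectation (\<lambda>\<omega>. \<bar>t * Y \<omega> - t * Z \<omega>\<bar>)"
    using i by (intro expectation_cis_close) auto
  also have "\<dots> = expectation (\<lambda>\<omega>. \<bar>t\<bar> * \<bar>Y \<omega> - Z \<omega>\<bar>)" by (simp add: right_diff_distrib[symmetric] abs_mult)
  also have "\<dots> \<le> \<bar>t\<bar> * b" using b by (simp add: mult_left_mono)
  finally show "cmod ((CLINT \<omega>|M. cis (t * Y \<omega>)) - (CLINT \<omega>|M. cis (t * Z \<omega>))) \<le> \<bar>t\<bar> * b" .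
  have eb: "\<bar>expectation Y - expectation Z\<bar> \<le> b"
    using integral_abs_bound[of M "\<lambda>\<omega>. Y \<omega> - Z \<omega>"] b i by simp
  have "cmod ((CLINT \<omega>|M. cis (t * (Y \<omega> - expectation Y))) - (CLINT \<omega>|M. cis (t * (Z \<omega> - expectation Z)))) \<le>
    expectation (\<lambda>\<omega>. \<bar>t * (Y \<omega> - expectation Y) - t * (Z \<omega> - expectation Z)\<bar>)"
    using i by (intro expectation_cis_close) auto
  also have "\<dots> \<le> expectation (\<lambda>\<omega>. \<bar>t\<bar> * (\<bar>Y \<omega> - Z \<omega>\<bar> + b))"
  proof (intro integral_mono)
    fix \<omega>
    have "\<bar>(Y \<omega> - expectation Y) - (Z \<omega> - expectation Z)\<bar> \<le> \<bar>Y \<omega> - Z \<omega>\<bar> + b" using eb by linarith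
    then show "\<bar>t * (Y \<omega> - expectation Y) - t * (Z \<omega> - expectation Z)\<bar> \<le> \<bar>t\<bar> * (\<bar>Y \<omega> - Z \<omega>\<bar> + b)"
      by (simp add: right_diff_distrib[symmetric] abs_mult mult_left_mono)
  qed (use i iD in auto)
  also have "\<dots> = \<bar>t\<bar> * (expectation (\<lambda>\<omega>. \<bar>Y \<omega> - Z \<omega>\<bar>) + b)" using iD by (simp add: prob_space)
  also have "\<dots> \<le> \<bar>t\<bar> * (2 * b)" using b by (intro mult_left_mono) auto
  finally show "cmod ((CLINT \<omega>|M. cis (t * (Y \<omega> - expectation Y))) - (CLINT \<omega>|M. cis (t * (Z \<omega> - expectation Z)))) \<le> \<bar>t\<bar> * (2 * b)" .
qed

context crit_sample begin

definition Z :: "nat \<Rightarrow> 'a \<Rightarrow> real" where "Z n \<omega> = real (num_crit k (Xs \<omega> ` {1..n}) r)"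

lemma Z_AE: "AE \<omega> in M. Z n \<omega> = Nsum {1..n} \<omega>"
  using AE_inj[OF finite_atLeastAtMost[of 1 n]] by eventually_elim (simp add: Z_def num_crit_eq_Nsum)

context
  assumes small: "\<not> 0 < Min (UNIV::real set) \<or> r < Min (UNIV::real set)"
begin

lemma Z_num_meas: "(\<lambda>\<omega>. num_crit k (Xs \<omega> ` {1..n}) r) \<in> M \<rightarrow>\<^sub>M count_space UNIV"
  using measurable_compose[OF image_count_meas num_crit_meas[OF k_pos small]] .

lemma Z_meas [measurable]: "Z n \<in> borel_measurable M"
  unfolding Z_def using measurable_compose[OF Z_num_meas, of real borel] by simp

lemma Z_square: "(\<integral>\<^sup>+\<omega>. ennreal ((Z n \<omega>)\<^sup>2) \<partial>M) \<le> ennreal (lam {1..n} + W n + (lam {1..n})\<^sup>2)"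
proof -
  let ?C = "real (card (ksubsets k {1..n}))"
  have "integrable M (\<lambda>\<omega>. (Ssum {1..n} \<omega>)\<^sup>2)"
    by (rule integrable_bounded[where C = "?C\<^sup>2"]) (auto intro!: power_mono Ssum_bounds)
  have "(\<integral>\<^sup>+\<omega>. ennreal ((Z n \<omega>)\<^sup>2) \<partial>M) \<le> (\<integral>\<^sup>+\<omega>. ennreal ((Ssum {1..n} \<omega>)\<^sup>2) \<partial>M)"
    using Z_AE[of n] by (intro nn_integral_mono_AE) (auto intro!: ennreal_leI power_mono Nsum_bounds elim!: eventually_mono)
  also have "\<dots> = ennreal (expectation (\<lambda>\<omega>. (Ssum {1..n} \<omega>)\<^sup>2))" by (rule nn_integral_eq_integral) (fact, simp)
  also have "\<dots> \<le> ennreal (lam {1..n} + W n + (lam {1..n})\<^sup>2)"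
    using second_moment_Ssum[of "{1..n}"] by (intro ennreal_leI) simp
  finally show ?thesis .
qed

lemma Z_integrable: "integrable M (Z n)"
proof -
  have "integrable M (Nsum {1..n})"
    using Nsum_bounds[of "{1..n}"] Ssum_bounds(2)[of "{1..n}"] order_trans
    by (intro integrable_bounded[where C = "real (card (ksubsets k {1..n}))"]) (auto intro: order_trans)
  then show ?thesis using Z_AE[of n] by (subst integrable_cong_AE) auto
qed

text \<open>Almost surely the count is \<open>Ssum\<close> minus \<open>Dsum\<close>. Without
  centering the error is the mean of \<open>Dsum\<close>, at most \<open>W n\<close>. With centering
  only the deviation of \<open>Dsum\<close> remains; its bound \<open>sqrt (2 * W n)\<close> can be
  small relative to sqrt T even when \<open>W n\<close> is not.\<close>

lemma Z_char:
  shows "cmod ((CLINT \<omega>|M. cis (t * Z n \<omega>)) - exp (of_real (lam {1..n}) * (cis t - 1))) \<le>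
     t\<^sup>2 * (W' n + W n) * exp (lam {1..n} * t\<^sup>2 / 2) + \<bar>t\<bar> * W n" (is "?A \<le> ?V + _")
    and "cmod ((CLINT \<omega>|M. cis (t * (Z n \<omega> - expectation (Z n)))) - cis (- (t * lam {1..n})) * exp (of_real (lam {1..n}) * (cis t - 1))) \<le>
     t\<^sup>2 * (W' n + W n) * exp (lam {1..n} * t\<^sup>2 / 2) + \<bar>t\<bar> * sqrt (2 * W n)" (is "?B \<le> _")
proof -
  let ?N = "{1..n}"
  have Dm[measurable]: "Dsum ?N \<in> borel_measurable M" by (rule Dsum_meas) simp
  then have [measurable]: "Dsum {Suc 0..n} \<in> borel_measurable M" by simp
  have iS: "integrable M (Ssum ?N)"
    by (rule integrable_bounded[where C = "real (card (ksubsets k ?N))"]) (use Ssum_bounds in auto)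
  have bD: "\<bar>Dsum ?N \<omega>\<bar> \<le> real (card (ksubsets k ?N))" for \<omega>
    using Dsum_bounds[of ?N \<omega>] Ssum_bounds(2)[of ?N \<omega>] by auto
  have iD: "integrable M (Dsum ?N)"
    by (rule integrable_bounded[where C = "real (card (ksubsets k ?N))"]) (use bD Dm in \<open>auto simp del: One_nat_def\<close>)
  have ZN: "AE \<omega> in M. Z n \<omega> = Ssum ?N \<omega> - Dsum ?N \<omega>" using Z_AE[of n] by (simp add: Nsum_eq)
  have EZ: "expectation (Z n) = lam ?N - expectation (Dsum ?N)"
  proof -
    have "expectation (Z n) = expectation (\<lambda>\<omega>. Ssum ?N \<omega> - Dsum ?N \<omega>)" by (rule integral_cong_AE[OF Z_meas borel_measurable_diff[OF Ssum_meas Dm] ZN])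
    then show ?thesis using iS iD expectation_Ssum by simp
  qed
  have S: "cmod ((CLINT \<omega>|M. cis (t * Ssum ?N \<omega>)) - exp (of_real (lam ?N) * (cis t - 1))) \<le> ?V"
    using Ssum_char[of ?N t] by simp
  have "expectation (\<lambda>\<omega>. \<bar>Z n \<omega> - Ssum ?N \<omega>\<bar>) = expectation (Dsum ?N)"
    using ZN Dsum_bounds(1)[of ?N] by (intro integral_cong_AE) (auto elim!: eventually_mono)
  then have "expectation (\<lambda>\<omega>. \<bar>Z n \<omega> - Ssum ?N \<omega>\<bar>) \<le> W n"
    using expectation_Dsum[of ?N] sum_prob_hit_le[of ?N] by simp
  from centered_cis_close(1)[OF Z_meas Ssum_meas Z_integrable iS this, of t]
  show "?A \<le> ?V + \<bar>t\<bar> * W n"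
    using norm_diff_triangle_le[OF _ S] by (simp only: add.commute)
  have "cmod ((CLINT \<omega>|M. cis (t * (Z n \<omega> - expectation (Z n)))) - (CLINT \<omega>|M. cis (t * (Ssum ?N \<omega> - lam ?N)))) \<le>
    expectation (\<lambda>\<omega>. \<bar>t * (Z n \<omega> - expectation (Z n)) - t * (Ssum ?N \<omega> - lam ?N)\<bar>)"
    using Z_integrable iS by (intro expectation_cis_close) auto
  also have "\<dots> = expectation (\<lambda>\<omega>. \<bar>t\<bar> * \<bar>Dsum ?N \<omega> - expectation (Dsum ?N)\<bar>)"
  proof (rule integral_cong_AE)
    show "AE \<omega> in M. \<bar>t * (Z n \<omega> - expectation (Z n)) - t * (Ssum ?N \<omega> - lam ?N)\<bar> = \<bar>t\<bar> * \<bar>Dsum ?N \<omega> - expectation (Dsum ?N)\<bar>"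
      using ZN
    proof eventually_elim
      case (elim \<omega>)
      have "t * (Z n \<omega> - expectation (Z n)) - t * (Ssum ?N \<omega> - lam ?N) = - (t * (Dsum ?N \<omega> - expectation (Dsum ?N)))"
        unfolding elim EZ by (simp add: algebra_simps)
      then show ?case by (simp add: abs_mult)
    qed
  qed auto
  also have "\<dots> \<le> \<bar>t\<bar> * sqrt (2 * W n)"
    using Dsum_deviation[of ?N] by (simp add: mult_left_mono)
  finally have 1: "cmod ((CLINT \<omega>|M. cis (t * (Z n \<omega> - expectation (Z n)))) - (CLINT \<omega>|M. cis (t * (Ssum ?N \<omega> - lam ?N)))) \<le> \<bar>t\<bar> * sqrt (2 * W n)" .
  \<comment> \<open>Subtracting the mean multiplies the characteristic function by a constant of
    modulus 1, so the estimate for \<open>Ssum\<close> carries over.\<close>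
  have "(CLINT \<omega>|M. cis (t * (Ssum ?N \<omega> - lam ?N))) = (CLINT \<omega>|M. cis (- (t * lam ?N)) * cis (t * Ssum ?N \<omega>))"
    by (simp add: cis_mult algebra_simps)
  also have "\<dots> = cis (- (t * lam ?N)) * (CLINT \<omega>|M. cis (t * Ssum ?N \<omega>))" by simp
  finally have "cmod ((CLINT \<omega>|M. cis (t * (Ssum ?N \<omega> - lam ?N))) - cis (- (t * lam ?N)) * exp (of_real (lam ?N) * (cis t - 1))) \<le> ?V"
    using S by (simp add: right_diff_distrib[symmetric] norm_mult)
  from norm_diff_triangle_le[OF 1 this] show "?B \<le> ?V + \<bar>t\<bar> * sqrt (2 * W n)"
    by (simp only: add.commute)
qed

text \<open>The two samples are nested initial segments, so \<open>Nsum_coupling\<close> applies.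
  The sum of the sizes stands in for their maximum to keep the bound symmetric and
  polynomial.\<close>

lemma Z_coupling: "(\<integral>\<^sup>+\<omega>. ennreal \<bar>Z m \<omega> - Z n \<omega>\<bar> \<partial>M) \<le>
   ennreal (theta ^ k * (\<bar>real m - real n\<bar> * (real m + real n) ^ k) + theta ^ (k + 1) * (\<bar>real m - real n\<bar> * (real m + real n) ^ (k + 1)))"
proof -
  have *: "(\<integral>\<^sup>+\<omega>. ennreal \<bar>Z a \<omega> - Z b \<omega>\<bar> \<partial>M) \<le>
     ennreal (theta ^ k * (\<bar>real a - real b\<bar> * (real a + real b) ^ k) + theta ^ (k + 1) * (\<bar>real a - real b\<bar> * (real a + real b) ^ (k + 1)))"
    if "b \<le> a" for a b
  proof -
    have "(\<integral>\<^sup>+\<omega>. ennreal \<bar>Z a \<omega> - Z b \<omega>\<bar> \<partial>M) = ennreal (expectation (\<lambda>\<omega>. \<bar>Z a \<omega> - Z b \<omega>\<bar>))"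
      using Z_integrable by (intro nn_integral_eq_integral) auto
    also have "expectation (\<lambda>\<omega>. \<bar>Z a \<omega> - Z b \<omega>\<bar>) = expectation (\<lambda>\<omega>. \<bar>Nsum {1..a} \<omega> - Nsum {1..b} \<omega>\<bar>)"
      using Z_AE[of a] Z_AE[of b] by (intro integral_cong_AE) auto
    also have "\<dots> \<le> real (card ({1..a} - {1..b})) * real (card {1..a}) ^ k * theta ^ k * (1 + real (card {1..a}) * theta)"
      using that by (intro Nsum_coupling) auto
    also have "{1..a} - {1..b} = {b<..a}" by auto
    also have "real (card {b<..a}) * real (card {1..a}) ^ k * theta ^ k * (1 + real (card {1..a}) * theta) =
       theta ^ k * (\<bar>real a - real b\<bar> * real a ^ k) + theta ^ (k + 1) * (\<bar>real a - real b\<bar> * real a ^ (k + 1))"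
      using that by (simp add: of_nat_diff algebra_simps)
    also have "\<dots> \<le> theta ^ k * (\<bar>real a - real b\<bar> * (real a + real b) ^ k) + theta ^ (k + 1) * (\<bar>real a - real b\<bar> * (real a + real b) ^ (k + 1))"
      using theta_nonneg by (intro add_mono mult_left_mono power_mono) auto
    finally show ?thesis by (simp add: ennreal_leI)
  qed
  show ?thesis
  proof (cases "n \<le> m")
    case False
    then show ?thesis using *[of m n] by (simp add: abs_minus_commute add.commute)
  qed (rule *)
qed

text \<open>Replacing the sample size by an independent Poisson variable changes the count
  only by \<open>c\<close> in \<open>L\<^sup>1\<close>, which transfers both characteristic function estimates.\<close>

lemma pois_transfer:
  fixes Y :: "nat \<times> 'a \<Rightarrow> nat"
  defines "Y \<equiv> \<lambda>(m, \<omega>). num_crit k (Xs \<omega> ` {1..m}) r"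
  assumes c: "(\<integral>\<^sup>+m. ennreal (theta ^ k * (\<bar>real m - real n\<bar> * (real m + real n) ^ k) +
       theta ^ (k + 1) * (\<bar>real m - real n\<bar> * (real m + real n) ^ (k + 1))) \<partial>measure_pmf (poisson_pmf (real n))) \<le> ennreal c" "0 \<le> c"
  shows "cmod ((CLINT z|pois n. cis (t * real (Y z))) - (CLINT \<omega>|M. cis (t * Z n \<omega>))) \<le> \<bar>t\<bar> * c"
    and "cmod ((CLINT z|pois n. cis (t * (real (Y z) - (\<integral>z. real (Y z) \<partial>pois n)))) -
         (CLINT \<omega>|M. cis (t * (Z n \<omega> - expectation (Z n))))) \<le> \<bar>t\<bar> * (2 * c)"
proof -
  let ?p = "measure_pmf (poisson_pmf (real n))"
  interpret PP: pair_prob_space ?p M ..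
  have Ym: "(\<lambda>z. real (Y z)) \<in> borel_measurable (pois n)"
  proof -
    have "(\<lambda>z. num_crit k ((\<lambda>(m, \<omega>). Xs \<omega> ` {1..m}) z) r) \<in> pois n \<rightarrow>\<^sub>M count_space UNIV"
      by (rule measurable_compose[OF model_meas num_crit_meas[OF k_pos small]])
    then have "Y \<in> pois n \<rightarrow>\<^sub>M count_space UNIV" by (simp add: Y_def case_prod_beta')
    from measurable_compose[OF this, of real borel] show ?thesis by simp
  qed
  \<comment> \<open>The count for the fixed size \<open>n\<close>, viewed on the product space,
    where it has the law of \<open>Z n\<close>.\<close>
  define V where "V = (\<lambda>z::nat \<times> 'a. Z n (snd z))"
  have Vm: "V \<in> borel_measurable (pois n)" unfolding V_def by measurable
  note [measurable] = Ym Vm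
  have YZ: "real (Y (m, \<omega>)) = Z m \<omega>" for m \<omega> by (simp add: Y_def Z_def)
  have YVi: "(\<integral>\<^sup>+z. ennreal \<bar>real (Y z) - V z\<bar> \<partial>pois n) \<le> ennreal c"
  proof -
    have "(\<integral>\<^sup>+z. ennreal \<bar>real (Y z) - V z\<bar> \<partial>pois n) = (\<integral>\<^sup>+m. \<integral>\<^sup>+\<omega>. ennreal \<bar>real (Y (m, \<omega>)) - V (m, \<omega>)\<bar> \<partial>M \<partial>?p)"
      by (rule nn_integral_fst[symmetric]) measurable
    also have "\<dots> \<le> (\<integral>\<^sup>+m. ennreal (theta ^ k * (\<bar>real m - real n\<bar> * (real m + real n) ^ k) +
       theta ^ (k + 1) * (\<bar>real m - real n\<bar> * (real m + real n) ^ (k + 1))) \<partial>?p)"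
      unfolding YZ V_def snd_conv by (intro nn_integral_mono Z_coupling)
    finally show ?thesis using c(1) by (rule order_trans)
  qed
  have snd_int: "(\<integral>z. h (snd z) \<partial>pois n) = (\<integral>\<omega>. h \<omega> \<partial>M)" and snd_i: "integrable (pois n) (\<lambda>z. h (snd z))"
    if h: "integrable M h" for h :: "'a \<Rightarrow> 'z::{banach, second_countable_topology}"
  proof -
    have hm[measurable]: "h \<in> borel_measurable M" using h by simp
    have d: "distr (pois n) M snd = M"
    proof (rule measure_eqI)
      fix A assume "A \<in> sets (distr (pois n) M snd)"
      then have A: "A \<in> sets M" by simp
      have "snd -` A \<inter> space (pois n) = space ?p \<times> A" using sets.sets_into_space[OF A] by (auto simp: space_pair_measure)
      then show "emeasure (distr (pois n) M snd) A = emeasure M A"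
        using A by (simp add: emeasure_distr emeasure_pair_measure_Times measure_pmf.emeasure_space_1[simplified])
    qed simp
    show "(\<integral>z. h (snd z) \<partial>pois n) = (\<integral>\<omega>. h \<omega> \<partial>M)"
      using integral_distr[of snd "pois n" M h] by (simp add: d)
    have "integrable (distr (pois n) M snd) h" using h by (simp add: d)
    then show "integrable (pois n) (\<lambda>z. h (snd z))" by (rule integrable_distr[rotated]) simp
  qed
  have Vi: "integrable (pois n) V" unfolding V_def by (rule snd_i[OF Z_integrable])
  \<comment> \<open>Integrability of the count at Poisson size comes from the coupling: it differs
    from an integrable variable by an integrable one.\<close>
  have Di: "integrable (pois n) (\<lambda>z. real (Y z) - V z)"
    using YVi by (intro integrableI_bounded) (auto intro: le_less_trans)
  have Yi: "integrable (pois n) (\<lambda>z. real (Y z))"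
    using Bochner_Integration.integrable_add[OF Di Vi] by simp
  have b: "(\<integral>z. \<bar>real (Y z) - V z\<bar> \<partial>pois n) \<le> c"
  proof -
    have "ennreal (\<integral>z. \<bar>real (Y z) - V z\<bar> \<partial>pois n) = (\<integral>\<^sup>+z. ennreal \<bar>real (Y z) - V z\<bar> \<partial>pois n)"
      using Di by (intro nn_integral_eq_integral[symmetric]) auto
    then have "ennreal (\<integral>z. \<bar>real (Y z) - V z\<bar> \<partial>pois n) \<le> ennreal c" using YVi by (simp only:)
    then show ?thesis by (simp only: ennreal_le_iff[OF c(2)])
  qed
  have ci: "integrable M (\<lambda>\<omega>. cis (t * (Z n \<omega> - a)))" for t a by (rule integrable_bounded[where C = 1]) auto
  have EV: "(\<integral>z. V z \<partial>pois n) = expectation (Z n)" unfolding V_def by (rule snd_int[OF Z_integrable])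
  have c1: "(CLINT z|pois n. cis (t * (V z - a))) = (CLINT \<omega>|M. cis (t * (Z n \<omega> - a)))" for a
    unfolding V_def by (rule snd_int[OF ci])
  show "cmod ((CLINT z|pois n. cis (t * real (Y z))) - (CLINT \<omega>|M. cis (t * Z n \<omega>))) \<le> \<bar>t\<bar> * c"
    using PP.centered_cis_close(1)[OF Ym Vm Yi Vi b, of t] c1[of 0] by simp
  show "cmod ((CLINT z|pois n. cis (t * (real (Y z) - (\<integral>z. real (Y z) \<partial>pois n)))) -
         (CLINT \<omega>|M. cis (t * (Z n \<omega> - expectation (Z n))))) \<le> \<bar>t\<bar> * (2 * c)"
    using PP.centered_cis_close(2)[OF Ym Vm Yi Vi b, of t] unfolding EV c1 .
qed

end

end


section \<open>Orders of magnitude of the error terms\<close>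

text \<open>This and \<open>dependence_bound\<close> are \<open>W\<close> and \<open>W'\<close> with
  \<open>theta\<close> as an explicit argument, so that they can be followed along the whole
  sequence of radii.\<close>

definition overlap_bound :: "nat \<Rightarrow> real \<Rightarrow> nat \<Rightarrow> real" where
  "overlap_bound k \<theta> n = (\<Sum>l\<in>{k+2..2*k+2}. 4 ^ l * real n ^ l * \<theta> ^ (l - 1))"

definition dependence_bound :: "nat \<Rightarrow> real \<Rightarrow> nat \<Rightarrow> real" where
  "dependence_bound k \<theta> n = (\<Sum>l\<in>{k+1..2*k+1}. 4 ^ l * real n ^ l * \<theta> ^ (2 * k))"

lemma choose_over_power: "(\<lambda>n. real (n choose j) / real n ^ j) \<longlonglongrightarrow> 1 / fact j"
proof -
  have "(\<lambda>n. (\<Prod>i<j. 1 - real i / real n) / fact j) \<longlonglongrightarrow> (\<Prod>i<j. 1 - 0) / fact j"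
    by (intro tendsto_intros lim_const_over_n) simp
  moreover have "eventually (\<lambda>n. (\<Prod>i<j. 1 - real i / real n) / fact j = real (n choose j) / real n ^ j) sequentially"
    using eventually_gt_at_top[of 0]
  proof eventually_elim
    case (elim n)
    have "(\<Prod>i<j. 1 - real i / real n) = (\<Prod>i<j. (real n - real i) / real n)"
      using elim by (intro prod.cong) (auto simp: diff_divide_distrib)
    also have "\<dots> = (\<Prod>i<j. real n - real i) / real n ^ j" by (simp add: prod_dividef)
    also have "(\<Prod>i<j. real n - real i) = fact j * real (n choose j)"
      by (simp add: binomial_gbinomial gbinomial_prod_rev atLeast0LessThan)
    finally show ?case by simp
  qed
  ultimately show ?thesis using Lim_transform_eventually by fastforce
qed

locale scaling =
  fixes r :: "nat \<Rightarrow> real" and k d :: nat and c :: real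
  assumes r_pos: "\<And>n. 0 < r n" and nr: "(\<lambda>n. real n * r n ^ d) \<longlonglongrightarrow> 0" and k: "1 \<le> k" and c: "0 \<le> c"
begin

abbreviation "T \<equiv> (\<lambda>n. real n ^ (k + 1) * r n ^ (d * k))"
abbreviation "\<theta> \<equiv> (\<lambda>n. c * r n ^ d)"

lemma T_pos: "0 < n \<Longrightarrow> 0 < T n" using r_pos by simp

lemma T_eq: "T n = real n * (real n * r n ^ d) ^ k"
  by (simp add: power_mult power_mult_distrib)

text \<open>Every point beyond the \<open>k + 1\<close> of a single simplex costs one factor n r^d,
  which tends to 0. All error terms are compared with \<open>T\<close> in this way.\<close>

lemma excess: "real n ^ (k + 1 + j) * \<theta> n ^ (k + j) = T n * (c ^ (k + j) * (real n * r n ^ d) ^ j)"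
  unfolding T_eq by (simp add: power_add power_mult_distrib)

lemma sum_ratio: "(\<lambda>n. (\<Sum>l\<in>{k+2..2*k+2}. K l * (real n ^ l * \<theta> n ^ (l - 1))) / T n) \<longlonglongrightarrow> 0"
proof -
  have "(\<lambda>n. \<Sum>l\<in>{k+2..2*k+2}. K l * (c ^ (l - 1) * (real n * r n ^ d) ^ (l - k - 1))) \<longlonglongrightarrow>
     (\<Sum>l\<in>{k+2..2*k+2}. K l * (c ^ (l - 1) * 0 ^ (l - k - 1)))" by (intro tendsto_intros nr)
  \<comment> \<open>Every \<open>l\<close> is at least \<open>k + 2\<close>, so 0 occurs with a
    positive exponent.\<close>
  also have "(\<Sum>l\<in>{k+2..2*k+2}. K l * (c ^ (l - 1) * 0 ^ (l - k - 1))) = 0" by (intro sum.neutral) auto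
  finally have *: "(\<lambda>n. \<Sum>l\<in>{k+2..2*k+2}. K l * (c ^ (l - 1) * (real n * r n ^ d) ^ (l - k - 1))) \<longlonglongrightarrow> 0" .
  show ?thesis
  proof (rule Lim_transform_eventually[OF *])
    show "eventually (\<lambda>n. (\<Sum>l\<in>{k+2..2*k+2}. K l * (c ^ (l - 1) * (real n * r n ^ d) ^ (l - k - 1))) =
       (\<Sum>l\<in>{k+2..2*k+2}. K l * (real n ^ l * \<theta> n ^ (l - 1))) / T n) sequentially"
      using eventually_gt_at_top[of 0]
    proof eventually_elim
      case (elim n)
      have "(\<Sum>l\<in>{k+2..2*k+2}. K l * (real n ^ l * \<theta> n ^ (l - 1))) =
         (\<Sum>l\<in>{k+2..2*k+2}. T n * (K l * (c ^ (l - 1) * (real n * r n ^ d) ^ (l - k - 1))))"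
      proof (rule sum.cong[OF refl])
        fix l assume "l \<in> {k+2..2*k+2}"
        then have l: "k + 1 + (l - k - 1) = l" "k + (l - k - 1) = l - 1" by auto
        show "K l * (real n ^ l * \<theta> n ^ (l - 1)) = T n * (K l * (c ^ (l - 1) * (real n * r n ^ d) ^ (l - k - 1)))"
          unfolding excess[of n "l - k - 1", unfolded l] by (rule mult.left_commute)
      qed
      also have "\<dots> = T n * (\<Sum>l\<in>{k+2..2*k+2}. K l * (c ^ (l - 1) * (real n * r n ^ d) ^ (l - k - 1)))"
        by (rule sum_distrib_left[symmetric])
      finally show ?case by (simp only: nonzero_mult_div_cancel_left[OF less_imp_neq[OF T_pos[OF elim], symmetric]])
    qed
  qed
qed

lemma overlap_ratio: "(\<lambda>n. overlap_bound k (\<theta> n) n / T n) \<longlonglongrightarrow> 0"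
  using sum_ratio[of "\<lambda>l. 4 ^ l"] unfolding overlap_bound_def by (simp only: mult.assoc)

lemma bounds_nonneg: "0 \<le> overlap_bound k (\<theta> n) n" "0 \<le> dependence_bound k (\<theta> n) n"
proof -
  show "0 \<le> overlap_bound k (\<theta> n) n" unfolding overlap_bound_def
    by (intro sum_nonneg mult_nonneg_nonneg zero_le_power) (use c r_pos[of n] in auto)
  show "0 \<le> dependence_bound k (\<theta> n) n" unfolding dependence_bound_def
    by (intro sum_nonneg mult_nonneg_nonneg zero_le_power) (use c r_pos[of n] in auto)
qed

text \<open>For positive \<open>n\<close> the largest size \<open>2 * k + 1\<close> dominates; it
  exceeds \<open>k + 1\<close> by \<open>k\<close> points, and \<open>k\<close> is positive.\<close>

lemma dependence_ratio: "(\<lambda>n. dependence_bound k (\<theta> n) n / T n) \<longlonglongrightarrow> 0"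
proof (rule tendsto_sandwich[OF _ _ tendsto_const])
  let ?u = "\<lambda>n. (\<Sum>l\<in>{k+1..2*k+1}. 4 ^ l) * (c ^ (k + k) * (real n * r n ^ d) ^ k)"
  show "eventually (\<lambda>n. 0 \<le> dependence_bound k (\<theta> n) n / T n) sequentially"
    using bounds_nonneg(2) r_pos by (intro always_eventually allI divide_nonneg_nonneg mult_nonneg_nonneg zero_le_power) (auto intro: less_imp_le)
  have "?u \<longlonglongrightarrow> (\<Sum>l\<in>{k+1..2*k+1}. 4 ^ l) * (c ^ (k + k) * 0 ^ k)" by (intro tendsto_intros nr)
  moreover have "(0::real) ^ k = 0" using k by simp
  ultimately show "?u \<longlonglongrightarrow> 0" by (simp only: mult_zero_right)
  show "eventually (\<lambda>n. dependence_bound k (\<theta> n) n / T n \<le> ?u n) sequentially"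
    using eventually_gt_at_top[of 0]
  proof eventually_elim
    case (elim n)
    have "dependence_bound k (\<theta> n) n \<le> (\<Sum>l\<in>{k+1..2*k+1}. 4 ^ l * (T n * (c ^ (k + k) * (real n * r n ^ d) ^ k)))"
      unfolding dependence_bound_def
    proof (rule sum_mono)
      fix l assume l: "l \<in> {k+1..2*k+1}"
      have "real n ^ l * \<theta> n ^ (2 * k) \<le> real n ^ (k + 1 + k) * \<theta> n ^ (k + k)"
        using l elim c r_pos[of n] unfolding mult_2 by (intro mult_right_mono power_increasing) auto
      also note excess[of n k]
      finally show "4 ^ l * real n ^ l * \<theta> n ^ (2 * k) \<le> 4 ^ l * (T n * (c ^ (k + k) * (real n * r n ^ d) ^ k))"
        unfolding mult.assoc[of "4 ^ l"] by (rule mult_left_mono) simp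
    qed
    also have "\<dots> = ?u n * T n" unfolding sum_distrib_right[symmetric] by (simp only: mult_ac)
    finally show ?case using T_pos[OF elim] by (subst pos_divide_le_eq)
  qed
qed

lemma of_ratio:
  assumes "(\<lambda>n. g n / T n) \<longlonglongrightarrow> x" "T \<longlonglongrightarrow> \<alpha>"
  shows "g \<longlonglongrightarrow> x * \<alpha>"
proof (rule Lim_transform_eventually[OF tendsto_mult[OF assms]])
  show "eventually (\<lambda>n. g n / T n * T n = g n) sequentially"
    using eventually_gt_at_top[of 0]
  proof eventually_elim
    case (elim n)
    show ?case by (rule nonzero_divide_eq_eq[OF less_imp_neq[OF T_pos[OF elim], symmetric], THEN iffD1, OF refl, symmetric])
  qed
qed

text \<open>In terms of \<open>\<rho> = n r\<^sup>d\<close> one has \<open>T = n \<rho>\<^sup>k\<close>, so the coupling error divided by \<open>sqrt T\<close> is of order \<open>\<rho>\<^sup>k\<^sup>/\<^sup>2\<close>.\<close>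

lemma coupling_ratio:
  "(\<lambda>n. (\<theta> n ^ k * (D1 * (sqrt (real n) * real n ^ k)) + \<theta> n ^ (k + 1) * (D2 * (sqrt (real n) * real n ^ (k + 1)))) / sqrt (T n)) \<longlonglongrightarrow> 0"
  (is "(\<lambda>n. ?c n / _) \<longlonglongrightarrow> 0")
proof -
  let ?\<rho> = "\<lambda>n. real n * r n ^ d"
  have "(\<lambda>n. sqrt (?\<rho> n ^ k) * (c ^ k * D1 + c ^ (k + 1) * D2 * ?\<rho> n)) \<longlonglongrightarrow> sqrt (0 ^ k) * (c ^ k * D1 + c ^ (k + 1) * D2 * 0)"
    by (intro tendsto_intros nr)
  then have *: "(\<lambda>n. sqrt (?\<rho> n ^ k) * (c ^ k * D1 + c ^ (k + 1) * D2 * ?\<rho> n)) \<longlonglongrightarrow> 0"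
    using zero_power[of k, where 'a = real] k by (simp only: real_sqrt_zero mult_zero_left)
  show ?thesis
  proof (rule Lim_transform_eventually[OF *])
    show "eventually (\<lambda>n. sqrt (?\<rho> n ^ k) * (c ^ k * D1 + c ^ (k + 1) * D2 * ?\<rho> n) = ?c n / sqrt (T n)) sequentially"
      using eventually_gt_at_top[of 0]
    proof eventually_elim
      case (elim n)
      define s where "s = sqrt (?\<rho> n ^ k)"
      have \<rho>: "0 < ?\<rho> n" using elim r_pos by simp
      then have s: "0 < s" and s2: "?\<rho> n ^ k = s * s" by (simp_all add: s_def)
      have "?c n = sqrt (real n) * ?\<rho> n ^ k * (c ^ k * D1 + c ^ (k + 1) * D2 * ?\<rho> n)"
        by (simp add: power_mult_distrib algebra_simps)
      moreover have "sqrt (T n) = sqrt (real n) * s" unfolding T_eq s_def by (rule real_sqrt_mult)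
      ultimately show ?case using elim s unfolding s2 s_def[symmetric] by (simp add: s_def[symmetric])
    qed
  qed
qed

end

lemma poisson_poly_moment:
  assumes K: "\<And>l. 0 \<le> K l" "\<And>l rate. 1 \<le> rate \<Longrightarrow>
      (\<integral>\<^sup>+m. ennreal (real m ^ l) \<partial>measure_pmf (poisson_pmf rate)) \<le> ennreal (K l * rate ^ l)"
    and S: "finite S" "\<And>l. l \<in> S \<Longrightarrow> 0 \<le> a l" and n: "1 \<le> rate"
  shows "(\<integral>\<^sup>+m. ennreal (\<Sum>l\<in>S. a l * real m ^ l) \<partial>measure_pmf (poisson_pmf rate)) \<le> ennreal (\<Sum>l\<in>S. a l * (K l * rate ^ l))"
proof -
  have "(\<integral>\<^sup>+m. ennreal (\<Sum>l\<in>S. a l * real m ^ l) \<partial>measure_pmf (poisson_pmf rate)) =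
    (\<integral>\<^sup>+m. (\<Sum>l\<in>S. ennreal (a l) * ennreal (real m ^ l)) \<partial>measure_pmf (poisson_pmf rate))"
    using S by (intro nn_integral_cong) (simp add: sum_ennreal[symmetric] ennreal_mult)
  also have "\<dots> = (\<Sum>l\<in>S. ennreal (a l) * (\<integral>\<^sup>+m. ennreal (real m ^ l) \<partial>measure_pmf (poisson_pmf rate)))"
    by (simp add: nn_integral_sum nn_integral_cmult)
  also have "\<dots> \<le> (\<Sum>l\<in>S. ennreal (a l) * ennreal (K l * rate ^ l))"
    using K(2)[OF n] by (intro sum_mono mult_left_mono) auto
  also have "\<dots> = ennreal (\<Sum>l\<in>S. a l * (K l * rate ^ l))"
    using S K(1) n by (simp add: sum_ennreal[symmetric] ennreal_mult)
  finally show ?thesis .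
qed

context crit_sample begin

lemma theta_eq: "theta = B * unit_ball_vol (real DIM('b)) * 8 ^ DIM('b) * r ^ DIM('b)"
  by (simp add: theta_def q_def power_mult_distrib)

lemma lam_eq:
  assumes "bounded_density f"
  shows "lam {1..n} = real (n choose (k + 1)) * simplex_prob f k r"
proof -
  have "lam {1..n} = (\<Sum>a\<in>ksubsets k {1..n}. simplex_prob f k r)"
    unfolding lam_def by (intro sum.cong refl prob_ev_eq[OF assms])
  then show ?thesis using card_ksubsets[of "{1..n}"] by simp
qed

context
  fixes \<theta> L :: real and n :: nat
  assumes small: "\<not> 0 < Min (UNIV::real set) \<or> r < Min (UNIV::real set)"
    and bd: "bounded_density f"
    and \<theta>: "\<theta> = B * unit_ball_vol (real DIM('b)) * 8 ^ DIM('b) * r ^ DIM('b)"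
    and L: "L = real (n choose (k + 1)) * simplex_prob f k r"
begin

lemma L_eq: "lam {1..n} = L" using lam_eq[OF bd] L by simp
lemma \<theta>_eq: "theta = \<theta>" using theta_eq \<theta> by simp
lemma W_eq: "W n = overlap_bound k \<theta> n" "W' n = dependence_bound k \<theta> n"
  unfolding W_def W'_def overlap_bound_def dependence_bound_def \<theta>_eq by simp_all

text \<open>The estimates with \<open>\<theta>\<close> and \<open>L\<close> given by formulas
  outside of the locale, so that they can be used for varying radii and for both the given and the
  canonical sample.\<close>

lemma iid_bounds:
  shows iid_measurable: "(\<lambda>\<omega>. num_crit k (Xs \<omega> ` {1..n}) r) \<in> M \<rightarrow>\<^sub>M count_space UNIV"
    and iid_square: "(\<integral>\<^sup>+\<omega>. ennreal ((real (num_crit k (Xs \<omega> ` {1..n}) r))\<^sup>2) \<partial>M) \<le> ennreal (L + overlap_bound k \<theta> n + L\<^sup>2)"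
    and iid_char: "cmod ((CLINT \<omega>|M. cis (t * real (num_crit k (Xs \<omega> ` {1..n}) r))) - exp (of_real L * (cis t - 1))) \<le>
     t\<^sup>2 * (dependence_bound k \<theta> n + overlap_bound k \<theta> n) * exp (L * t\<^sup>2 / 2) + \<bar>t\<bar> * overlap_bound k \<theta> n"
    and iid_char_centered: "cmod ((CLINT \<omega>|M. cis (t * (real (num_crit k (Xs \<omega> ` {1..n}) r) -
        (\<integral>\<omega>'. real (num_crit k (Xs \<omega>' ` {1..n}) r) \<partial>M)))) - cis (- (t * L)) * exp (of_real L * (cis t - 1))) \<le>
     t\<^sup>2 * (dependence_bound k \<theta> n + overlap_bound k \<theta> n) * exp (L * t\<^sup>2 / 2) + \<bar>t\<bar> * sqrt (2 * overlap_bound k \<theta> n)"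
  using Z_num_meas[OF small, of n] Z_square[OF small, of n] Z_char[OF small, of t n] unfolding Z_def L_eq W_eq .

end

end


section \<open>Transfer to the Poisson process\<close>

text \<open>Integrals of functions of the count depend only on the law of the process on
  \<open>count_sigma\<close>, which by \<open>poisson_law\<close> is that of a sample of Poisson
  size.\<close>

lemma (in crit_sample) poisson_transfer:
  assumes small: "\<not> 0 < Min (UNIV::real set) \<or> r < Min (UNIV::real set)"
    and P: "poisson_process \<Omega> P (\<lambda>x. real n * f x)" and n: "0 < n"
  defines "Y \<equiv> \<lambda>(m, \<omega>). num_crit k (Xs \<omega> ` {1..m}) r"
  shows poisson_num_meas: "(\<lambda>\<omega>. num_crit k (P \<omega>) r) \<in> \<Omega> \<rightarrow>\<^sub>M count_space UNIV"
    and pois_num_meas: "Y \<in> pois n \<rightarrow>\<^sub>M count_space UNIV"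
    and "(\<integral>\<omega>. (h::nat \<Rightarrow> 'z::{banach, second_countable_topology}) (num_crit k (P \<omega>) r) \<partial>\<Omega>) = (\<integral>z. h (Y z) \<partial>pois n)"
    and "(\<integral>\<^sup>+\<omega>. g (num_crit k (P \<omega>) r) \<partial>\<Omega>) = (\<integral>\<^sup>+z. g (Y z) \<partial>pois n)"
proof -
  let ?S = "\<lambda>(m, \<omega>). Xs \<omega> ` {1..m}"
  have Pm: "P \<in> \<Omega> \<rightarrow>\<^sub>M count_sigma" by (rule poisson_process_meas[OF P])
  have G: "(\<lambda>Q. num_crit k Q r) \<in> (count_sigma :: 'b set measure) \<rightarrow>\<^sub>M count_space UNIV" by (rule num_crit_meas[OF k_pos small])
  have Y: "Y = (\<lambda>z. num_crit k (?S z) r)" by (auto simp: Y_def)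
  show "(\<lambda>\<omega>. num_crit k (P \<omega>) r) \<in> \<Omega> \<rightarrow>\<^sub>M count_space UNIV" by (rule measurable_compose[OF Pm G])
  show "Y \<in> pois n \<rightarrow>\<^sub>M count_space UNIV" unfolding Y by (rule measurable_compose[OF model_meas G])
  have hm: "(\<lambda>Q. h (num_crit k Q r)) \<in> borel_measurable (count_sigma :: 'b set measure)"
    by (rule measurable_compose[OF G]) simp
  have gm: "(\<lambda>Q. g (num_crit k Q r)) \<in> borel_measurable (count_sigma :: 'b set measure)"
    by (rule measurable_compose[OF G]) simp
  have "(\<integral>\<omega>. h (num_crit k (P \<omega>) r) \<partial>\<Omega>) = (\<integral>Q. h (num_crit k Q r) \<partial>distr \<Omega> count_sigma P)"
    by (rule integral_distr[OF Pm hm, symmetric])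
  also have "\<dots> = (\<integral>z. h (num_crit k (?S z) r) \<partial>pois n)"
    unfolding poisson_law[OF P n] by (rule integral_distr[OF model_meas hm])
  finally show "(\<integral>\<omega>. h (num_crit k (P \<omega>) r) \<partial>\<Omega>) = (\<integral>z. h (Y z) \<partial>pois n)" unfolding Y .
  have "(\<integral>\<^sup>+\<omega>. g (num_crit k (P \<omega>) r) \<partial>\<Omega>) = (\<integral>\<^sup>+Q. g (num_crit k Q r) \<partial>distr \<Omega> count_sigma P)"
    by (rule nn_integral_distr[OF Pm, symmetric]) (simp add: gm)
  also have "\<dots> = (\<integral>\<^sup>+z. g (num_crit k (?S z) r) \<partial>pois n)"
    unfolding poisson_law[OF P n] by (rule nn_integral_distr[OF model_meas]) (simp add: gm)
  finally show "(\<integral>\<^sup>+\<omega>. g (num_crit k (P \<omega>) r) \<partial>\<Omega>) = (\<integral>\<^sup>+z. g (Y z) \<partial>pois n)" unfolding Y .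
qed

lemma (in crit_sample) poisson_bounds:
  fixes \<theta> L :: real and n :: nat
  assumes small: "\<not> 0 < Min (UNIV::real set) \<or> r < Min (UNIV::real set)"
    and bd: "bounded_density f"
    and \<theta>: "\<theta> = B * unit_ball_vol (real DIM('b)) * 8 ^ DIM('b) * r ^ DIM('b)"
    and L: "L = real (n choose (k + 1)) * simplex_prob f k r"
    and P: "poisson_process \<Omega> P (\<lambda>x. real n * f x)" and n: "1 \<le> n"
    and K: "\<And>l. 0 \<le> K l" "\<And>l rate. 1 \<le> rate \<Longrightarrow>
      (\<integral>\<^sup>+m. ennreal (real m ^ l) \<partial>measure_pmf (poisson_pmf rate)) \<le> ennreal (K l * rate ^ l)"
    and D: "\<And>l. 0 \<le> D l" "\<And>l n. 1 \<le> n \<Longrightarrow>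
      (\<integral>\<^sup>+m. ennreal (\<bar>real m - real n\<bar> * (real m + real n) ^ l) \<partial>measure_pmf (poisson_pmf (real n))) \<le> ennreal (D l * (sqrt (real n) * real n ^ l))"
    and c: "c = \<theta> ^ k * (D k * (sqrt (real n) * real n ^ k)) + \<theta> ^ (k + 1) * (D (k + 1) * (sqrt (real n) * real n ^ (k + 1)))"
  shows poisson_square: "(\<integral>\<^sup>+\<omega>. ennreal ((real (num_crit k (P \<omega>) r))\<^sup>2) \<partial>\<Omega>) \<le>
      ennreal (K (k + 1) * (real n ^ (k + 1) * \<theta> ^ k) + (\<Sum>l\<in>{k+2..2*k+2}. 4 ^ l * K l * (real n ^ l * \<theta> ^ (l - 1))) +
        K (2 * k + 2) * (real n ^ (2 * k + 2) * \<theta> ^ (2 * k)))"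
    and poisson_char: "cmod ((CLINT \<omega>|\<Omega>. cis (t * real (num_crit k (P \<omega>) r))) - exp (of_real L * (cis t - 1))) \<le>
     t\<^sup>2 * (dependence_bound k \<theta> n + overlap_bound k \<theta> n) * exp (L * t\<^sup>2 / 2) + \<bar>t\<bar> * (overlap_bound k \<theta> n + c)"
    and poisson_char_centered: "cmod ((CLINT \<omega>|\<Omega>. cis (t * (real (num_crit k (P \<omega>) r) -
        (\<integral>\<omega>'. real (num_crit k (P \<omega>') r) \<partial>\<Omega>)))) - cis (- (t * L)) * exp (of_real L * (cis t - 1))) \<le>
     t\<^sup>2 * (dependence_bound k \<theta> n + overlap_bound k \<theta> n) * exp (L * t\<^sup>2 / 2) + \<bar>t\<bar> * (sqrt (2 * overlap_bound k \<theta> n) + 2 * c)"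
proof -
  let ?p = "measure_pmf (poisson_pmf (real n))"
  let ?Y = "\<lambda>(m, \<omega>). num_crit k (Xs \<omega> ` {1..m}) r"
  have n0: "0 < n" and n1: "1 \<le> real n" using n by auto
  have \<theta>t: "theta = \<theta>" using theta_eq \<theta> by simp
  have \<theta>0: "0 \<le> \<theta>" using theta_nonneg \<theta>t by simp
  note tr = poisson_transfer[OF small P n0]
  have c0: "0 \<le> c" unfolding c using \<theta>0 D(1) by simp
  \<comment> \<open>The coupling error is averaged over the Poisson size and bounded by the
    deviation moments \<open>D\<close>.\<close>
  have "(\<integral>\<^sup>+m. ennreal (\<theta> ^ k * (\<bar>real m - real n\<bar> * (real m + real n) ^ k) +
       \<theta> ^ (k + 1) * (\<bar>real m - real n\<bar> * (real m + real n) ^ (k + 1))) \<partial>?p) =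
     (\<integral>\<^sup>+m. ennreal (\<theta> ^ k) * ennreal (\<bar>real m - real n\<bar> * (real m + real n) ^ k) +
       ennreal (\<theta> ^ (k + 1)) * ennreal (\<bar>real m - real n\<bar> * (real m + real n) ^ (k + 1)) \<partial>?p)"
    using \<theta>0 by (intro nn_integral_cong) (simp add: ennreal_mult[symmetric] ennreal_plus[symmetric] del: ennreal_plus power_Suc)
  also have "\<dots> = ennreal (\<theta> ^ k) * (\<integral>\<^sup>+m. ennreal (\<bar>real m - real n\<bar> * (real m + real n) ^ k) \<partial>?p) +
       ennreal (\<theta> ^ (k + 1)) * (\<integral>\<^sup>+m. ennreal (\<bar>real m - real n\<bar> * (real m + real n) ^ (k + 1)) \<partial>?p)"
    by (simp add: nn_integral_add nn_integral_cmult del: power_Suc)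
  also have "\<dots> \<le> ennreal (\<theta> ^ k) * ennreal (D k * (sqrt (real n) * real n ^ k)) +
       ennreal (\<theta> ^ (k + 1)) * ennreal (D (k + 1) * (sqrt (real n) * real n ^ (k + 1)))"
    by (intro add_mono mult_left_mono D(2)[OF n]) simp_all
  also have "\<dots> = ennreal c"
    unfolding c using \<theta>0 D(1)[of k] D(1)[of "k + 1"]
    by (simp add: ennreal_mult[symmetric] ennreal_plus[symmetric] del: ennreal_plus power_Suc)
  finally have cc: "(\<integral>\<^sup>+m. ennreal (theta ^ k * (\<bar>real m - real n\<bar> * (real m + real n) ^ k) +
       theta ^ (k + 1) * (\<bar>real m - real n\<bar> * (real m + real n) ^ (k + 1))) \<partial>?p) \<le> ennreal c" unfolding \<theta>t .
  note ib = iid_bounds[OF small bd \<theta> L]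
  show "cmod ((CLINT \<omega>|\<Omega>. cis (t * real (num_crit k (P \<omega>) r))) - exp (of_real L * (cis t - 1))) \<le>
     t\<^sup>2 * (dependence_bound k \<theta> n + overlap_bound k \<theta> n) * exp (L * t\<^sup>2 / 2) + \<bar>t\<bar> * (overlap_bound k \<theta> n + c)"
    unfolding tr(3)[of "\<lambda>m. cis (t * real m)"]
    using norm_diff_triangle_le[OF pois_transfer(1)[OF small cc c0, of t, unfolded Z_def] ib(3)[of t]]
    by (simp only: distrib_left add_ac)
  show "cmod ((CLINT \<omega>|\<Omega>. cis (t * (real (num_crit k (P \<omega>) r) -
        (\<integral>\<omega>'. real (num_crit k (P \<omega>') r) \<partial>\<Omega>)))) - cis (- (t * L)) * exp (of_real L * (cis t - 1))) \<le>
     t\<^sup>2 * (dependence_bound k \<theta> n + overlap_bound k \<theta> n) * exp (L * t\<^sup>2 / 2) + \<bar>t\<bar> * (sqrt (2 * overlap_bound k \<theta> n) + 2 * c)"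
    unfolding tr(3)[of real] unfolding tr(3)[of "\<lambda>m. cis (t * (real m - a))" for a]
    using norm_diff_triangle_le[OF pois_transfer(2)[OF small cc c0, of t, unfolded Z_def] ib(4)[of t]]
    by (simp only: distrib_left add_ac)
  have lam_m: "lam {1..m} \<le> real m ^ (k + 1) * \<theta> ^ k" for m using lam_le[of "{1..m}"] by (simp add: \<theta>t)
  \<comment> \<open>Polynomials in the sample size that bound the mean, the overlap term and the
    squared mean. The one-element sums bring all three into the shape of
    \<open>poisson_poly_moment\<close>.\<close>
  let ?a = "\<lambda>m. \<Sum>l\<in>{k + 1}. \<theta> ^ k * real m ^ l" and ?b = "\<lambda>m. \<Sum>l\<in>{k+2..2*k+2}. 4 ^ l * \<theta> ^ (l - 1) * real m ^ l"
    and ?c = "\<lambda>m. \<Sum>l\<in>{2 * k + 2}. \<theta> ^ (2 * k) * real m ^ l"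
  have abc0: "0 \<le> ?a m" "0 \<le> ?b m" "0 \<le> ?c m" for m using \<theta>0 by (intro sum_nonneg mult_nonneg_nonneg zero_le_power; simp)+
  have Ym: "(\<lambda>z. ennreal ((real (?Y z))\<^sup>2)) \<in> borel_measurable (pois n)"
    by (rule measurable_compose[OF tr(2)]) simp
  have "(\<integral>\<^sup>+\<omega>. ennreal ((real (num_crit k (P \<omega>) r))\<^sup>2) \<partial>\<Omega>) = (\<integral>\<^sup>+z. ennreal ((real (?Y z))\<^sup>2) \<partial>pois n)"
    by (rule tr(4)[of "\<lambda>m. ennreal ((real m)\<^sup>2)"])
  also have "\<dots> = (\<integral>\<^sup>+m. \<integral>\<^sup>+\<omega>. ennreal ((real (?Y (m, \<omega>)))\<^sup>2) \<partial>M \<partial>?p)"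
    by (rule nn_integral_fst[symmetric, OF Ym])
  also have "\<dots> \<le> (\<integral>\<^sup>+m. ennreal (?a m) + ennreal (?b m) + ennreal (?c m) \<partial>?p)"
  proof (rule nn_integral_mono)
    fix m
    have "(\<integral>\<^sup>+\<omega>. ennreal ((real (?Y (m, \<omega>)))\<^sup>2) \<partial>M) \<le> ennreal (lam {1..m} + W m + (lam {1..m})\<^sup>2)"
      using Z_square[OF small, of m] by (simp only: Z_def case_prod_conv)
    also have "\<dots> \<le> ennreal (?a m + ?b m + ?c m)"
    proof (intro ennreal_leI add_mono)
      show "lam {1..m} \<le> ?a m" using lam_m[of m] by (simp add: mult.commute)
      show "W m \<le> ?b m" unfolding W_def \<theta>t by (intro sum_mono) (simp add: mult_ac)
      have "(lam {1..m})\<^sup>2 \<le> (real m ^ (k + 1) * \<theta> ^ k)\<^sup>2" by (intro power_mono lam_m lam_nonneg)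
      also have "\<dots> = \<theta> ^ (2 * k) * real m ^ (2 * (k + 1))"
        unfolding power_even_eq power_mult_distrib by (rule mult.commute)
      also have "\<dots> = ?c m" by simp
      finally show "(lam {1..m})\<^sup>2 \<le> ?c m" .
    qed
    also have "\<dots> = ennreal (?a m) + ennreal (?b m) + ennreal (?c m)"
      using abc0[of m] by (simp only: ennreal_plus add_nonneg_nonneg)
    finally show "(\<integral>\<^sup>+\<omega>. ennreal ((real (?Y (m, \<omega>)))\<^sup>2) \<partial>M) \<le> ennreal (?a m) + ennreal (?b m) + ennreal (?c m)" .
  qed
  also have "\<dots> = (\<integral>\<^sup>+m. ennreal (?a m) \<partial>?p) + (\<integral>\<^sup>+m. ennreal (?b m) \<partial>?p) + (\<integral>\<^sup>+m. ennreal (?c m) \<partial>?p)"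
    by (subst nn_integral_add, simp, simp)+ simp
  also have "\<dots> \<le> ennreal (\<Sum>l\<in>{k + 1}. \<theta> ^ k * (K l * real n ^ l)) + ennreal (\<Sum>l\<in>{k+2..2*k+2}. 4 ^ l * \<theta> ^ (l - 1) * (K l * real n ^ l)) +
     ennreal (\<Sum>l\<in>{2 * k + 2}. \<theta> ^ (2 * k) * (K l * real n ^ l))"
    using \<theta>0 by (intro add_mono poisson_poly_moment[OF K(1) K(2)] n1) auto
  also have "\<dots> = ennreal ((\<Sum>l\<in>{k + 1}. \<theta> ^ k * (K l * real n ^ l)) + (\<Sum>l\<in>{k+2..2*k+2}. 4 ^ l * \<theta> ^ (l - 1) * (K l * real n ^ l)) +
     (\<Sum>l\<in>{2 * k + 2}. \<theta> ^ (2 * k) * (K l * real n ^ l)))"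
  proof -
    have nn: "0 \<le> (\<Sum>l\<in>S. u l * (K l * real n ^ l))" if "\<And>l. 0 \<le> u l" for S u
      using that K(1) by (intro sum_nonneg) auto
    have "0 \<le> \<theta> ^ i" "0 \<le> 4 ^ l * \<theta> ^ i" for i l using \<theta>0 by simp_all
    with nn show ?thesis by (simp only: ennreal_plus add_nonneg_nonneg)
  qed
  also have "(\<Sum>l\<in>{k + 1}. \<theta> ^ k * (K l * real n ^ l)) = K (k + 1) * (real n ^ (k + 1) * \<theta> ^ k)" by (simp add: mult_ac)
  also have "(\<Sum>l\<in>{2 * k + 2}. \<theta> ^ (2 * k) * (K l * real n ^ l)) = K (2 * k + 2) * (real n ^ (2 * k + 2) * \<theta> ^ (2 * k))" by (simp add: mult_ac)
  also have "(\<Sum>l\<in>{k+2..2*k+2}. 4 ^ l * \<theta> ^ (l - 1) * (K l * real n ^ l)) = (\<Sum>l\<in>{k+2..2*k+2}. 4 ^ l * K l * (real n ^ l * \<theta> ^ (l - 1)))"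
    by (intro sum.cong) (simp_all add: mult_ac)
  finally show "(\<integral>\<^sup>+\<omega>. ennreal ((real (num_crit k (P \<omega>) r))\<^sup>2) \<partial>\<Omega>) \<le>
      ennreal (K (k + 1) * (real n ^ (k + 1) * \<theta> ^ k) + (\<Sum>l\<in>{k+2..2*k+2}. 4 ^ l * K l * (real n ^ l * \<theta> ^ (l - 1))) +
        K (2 * k + 2) * (real n ^ (2 * k + 2) * \<theta> ^ (2 * k)))" .
qed


theorem theorem3p3:
  fixes f :: "'a::euclidean_space \<Rightarrow> real" and r :: "nat \<Rightarrow> real" and k :: nat
  assumes f: "bounded_density f"
    and r_pos: "\<And>n. 0 < r n" and r_lim: "r \<longlonglongrightarrow> 0"
    and nr: "(\<lambda>n. real n * r n ^ DIM('a)) \<longlonglongrightarrow> 0"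
    and k: "1 \<le> k" "k \<le> DIM('a)"
  shows
    "(\<forall>(\<Omega>::'w measure) X. iid_density \<Omega> X f \<longrightarrow>
        crit_limits (\<lambda>_. \<Omega>) (\<lambda>n \<omega>. num_crit k ((\<lambda>i. X i \<omega>) ` {1..n}) (r n))
                    k r DIM('a) (mu k f))
     \<and> (\<forall>(\<Omega>::nat \<Rightarrow> 'w measure) P. (\<forall>n. poisson_process (\<Omega> n) (P n) (\<lambda>x. real n * f x)) \<longrightarrow>
        crit_limits \<Omega> (\<lambda>n \<omega>. num_crit k (P n \<omega>) (r n)) k r DIM('a) (mu k f))"
proof -
  let ?d = "DIM('a)"
  note mu = mu_pos[OF f k]
  obtain B where B: "\<And>x. f x \<le> B" "0 \<le> B" using density_bound[OF f] by blast
  \<comment> \<open>Chosen so that \<open>c * r n ^ DIM('a)\<close> is the \<open>theta\<close> of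
    the sample at radius \<open>r n\<close>.\<close>
  define c where "c = B * unit_ball_vol (real ?d) * 8 ^ ?d"
  have c0: "0 \<le> c" using B(2) by (simp add: c_def)
  interpret scaling r k ?d c by (unfold_locales) (fact r_pos nr k(1) c0)+
  have \<theta>_eq: "\<theta> n = B * unit_ball_vol (real ?d) * 8 ^ ?d * r n ^ ?d" for n by (simp only: c_def)
  define L where "L n = real (n choose (k + 1)) * simplex_prob f k (r n)" for n
  define W where "W n = overlap_bound k (\<theta> n) n" for n
  define V where "V n = dependence_bound k (\<theta> n) n + W n" for n
  have L_lim: "(\<lambda>n. L n / T n) \<longlonglongrightarrow> mu k f"
  proof -
    \<comment> \<open>The number of index sets supplies the factor 1 / (k + 1)!, and the simplex
      probability supplies (k + 1)! times \<open>mu\<close>.\<close>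
    have "(\<lambda>n. real (n choose (k + 1)) / real n ^ (k + 1) * (simplex_prob f k (r n) / r n ^ (?d * k))) \<longlonglongrightarrow>
       1 / fact (k + 1) * (fact (k + 1) * mu k f)"
      by (intro tendsto_mult choose_over_power simplex_prob_limit[OF f r_pos r_lim])
    moreover have "1 / fact (k + 1) * (fact (k + 1) * mu k f) = mu k f"
      using fact_nonzero[of "k + 1", where 'a = real] by (simp del: fact_Suc)
    ultimately show ?thesis by (simp only: L_def times_divide_times_eq)
  qed
  have W0: "(\<lambda>n. W n / T n) \<longlonglongrightarrow> 0" unfolding W_def by (rule overlap_ratio)
  have V_lim: "(\<lambda>n. V n / T n) \<longlonglongrightarrow> 0"
    using tendsto_add[OF dependence_ratio W0] by (simp only: V_def add_divide_distrib add_0)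
  have W_lim: "W \<longlonglongrightarrow> 0" if "T \<longlonglongrightarrow> \<alpha>" for \<alpha>
    using of_ratio[OF W0 that] by (simp only: mult_zero_left)
  have sqrt_W_lim: "(\<lambda>n. sqrt (2 * W n) / sqrt (T n)) \<longlonglongrightarrow> 0"
  proof -
    have "(\<lambda>n. sqrt (2 * (W n / T n))) \<longlonglongrightarrow> sqrt (2 * 0)" by (intro tendsto_intros W0)
    then show ?thesis by (simp only: real_sqrt_divide times_divide_eq_right mult_zero_right real_sqrt_zero)
  qed
  \<comment> \<open>The threshold concerns infinite sets, on which \<open>Min\<close> returns a
    fixed number. If that number is positive, the radii are eventually below it.\<close>
  have "eventually (\<lambda>n. \<not> 0 < Min (UNIV::real set) \<or> r n < Min (UNIV::real set)) sequentially"
  proof (cases "0 < Min (UNIV::real set)")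
    case True
    from order_tendstoD(2)[OF r_lim this] show ?thesis by eventually_elim simp
  qed simp
  then obtain n1 where n1: "\<And>n. n1 \<le> n \<Longrightarrow> \<not> 0 < Min (UNIV::real set) \<or> r n < Min (UNIV::real set)"
    unfolding eventually_sequentially by blast
  \<comment> \<open>Sizes start at 1, since the comparison with a sample of Poisson size asks for a
    positive mean.\<close>
  define n0 where "n0 = max 1 n1"
  have n0: "1 \<le> n" and small: "\<not> 0 < Min (UNIV::real set) \<or> r n < Min (UNIV::real set)" if "n0 \<le> n" for n
    using that n1[of n] by (auto simp: n0_def)
  have cs: "crit_sample M X f B k (r n)" if "iid_sample M X f B" for M :: "'v measure" and X n
    using that r_pos k(1) by (simp add: crit_sample_def crit_sample_axioms_def)

  have "crit_limits (\<lambda>_. \<Omega>) (\<lambda>n \<omega>. num_crit k ((\<lambda>i. X i \<omega>) ` {1..n}) (r n)) k r ?d (mu k f)"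
    if iid: "iid_density \<Omega> X f" for \<Omega> :: "'w measure" and X
  proof -
    have "iid_sample \<Omega> X f B"
      using iid density_meas[OF f] density_nonneg[OF f] B(1)
      by (simp add: iid_density_def iid_sample_def iid_sample_axioms_def)
    note S = cs[OF this]
    note bounds = crit_sample.iid_bounds[OF S small f \<theta>_eq L_def, folded W_def, folded V_def]
    show ?thesis
    proof (rule crit_limitsI[where ?n0.0 = n0 and L = L and V = V and e = W and
          e' = "\<lambda>n. sqrt (2 * W n)" and a = "\<lambda>n. L n + W n + (L n)\<^sup>2"])
      show "prob_space \<Omega>" using iid by (simp add: iid_density_def)
      assume T0: "T \<longlonglongrightarrow> 0"
      have "L \<longlonglongrightarrow> 0" using of_ratio[OF L_lim T0] by (simp only: mult_zero_right)
      then have "(\<lambda>n. L n + W n + (L n)\<^sup>2) \<longlonglongrightarrow> 0 + 0 + 0\<^sup>2" by (intro tendsto_intros W_lim[OF T0])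
      then show "(\<lambda>n. L n + W n + (L n)\<^sup>2) \<longlonglongrightarrow> 0" by simp
    qed (rule mu | rule L_lim | rule V_lim | rule sqrt_W_lim | erule W_lim | (rule bounds; assumption))+
  qed
  moreover have "crit_limits \<Omega> (\<lambda>n \<omega>. num_crit k (P n \<omega>) (r n)) k r ?d (mu k f)"
    if P: "\<And>n. poisson_process (\<Omega> n) (P n) (\<lambda>x. real n * f x)" for \<Omega> :: "nat \<Rightarrow> 'w measure" and P
  proof -
    \<comment> \<open>One i.i.d. sample on a product space serves as comparison for all
      \<open>n\<close>, whatever the spaces \<open>\<Omega> n\<close> are.\<close>
    note S = cs[OF iid_canonical[OF f B(1)]]
    have "\<exists>K. \<forall>l. 0 \<le> K l \<and> (\<forall>rate\<ge>1. (\<integral>\<^sup>+m. ennreal (real m ^ l) \<partial>measure_pmf (poisson_pmf rate)) \<le> ennreal (K l * rate ^ l))"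
    proof (rule choice, rule allI)
      show "\<exists>C. 0 \<le> C \<and> (\<forall>rate\<ge>1. (\<integral>\<^sup>+m. ennreal (real m ^ l) \<partial>measure_pmf (poisson_pmf rate)) \<le> ennreal (C * rate ^ l))" for l
        using poisson_moment_bound[of l] by blast
    qed
    then obtain K where K: "\<And>l. 0 \<le> K l" "\<And>l rate. 1 \<le> rate \<Longrightarrow>
      (\<integral>\<^sup>+m. ennreal (real m ^ l) \<partial>measure_pmf (poisson_pmf rate)) \<le> ennreal (K l * rate ^ l)" by blast
    have "\<exists>D. \<forall>l. 0 \<le> D l \<and> (\<forall>n\<ge>1. (\<integral>\<^sup>+m. ennreal (\<bar>real m - real n\<bar> * (real m + real n) ^ l) \<partial>measure_pmf (poisson_pmf (real n)))
       \<le> ennreal (D l * (sqrt (real n) * real n ^ l)))"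
    proof (rule choice, rule allI)
      show "\<exists>D. 0 \<le> D \<and> (\<forall>n\<ge>1. (\<integral>\<^sup>+m. ennreal (\<bar>real m - real n\<bar> * (real m + real n) ^ l) \<partial>measure_pmf (poisson_pmf (real n)))
       \<le> ennreal (D * (sqrt (real n) * real n ^ l)))" for l
        using poisson_dev_moment[of l] by blast
    qed
    then obtain D where D: "\<And>l. 0 \<le> D l" "\<And>l n. 1 \<le> n \<Longrightarrow>
      (\<integral>\<^sup>+m. ennreal (\<bar>real m - real n\<bar> * (real m + real n) ^ l) \<partial>measure_pmf (poisson_pmf (real n))) \<le> ennreal (D l * (sqrt (real n) * real n ^ l))"
      by blast
    define C where "C n = \<theta> n ^ k * (D k * (sqrt (real n) * real n ^ k)) + \<theta> n ^ (k + 1) * (D (k + 1) * (sqrt (real n) * real n ^ (k + 1)))" for n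
    define a where "a n = K (k + 1) * (real n ^ (k + 1) * \<theta> n ^ k) + (\<Sum>l\<in>{k+2..2*k+2}. 4 ^ l * K l * (real n ^ l * \<theta> n ^ (l - 1))) +
        K (2 * k + 2) * (real n ^ (2 * k + 2) * \<theta> n ^ (2 * k))" for n
    have C_ratio: "(\<lambda>n. C n / sqrt (T n)) \<longlonglongrightarrow> 0" unfolding C_def by (rule coupling_ratio)
    note bounds = crit_sample.poisson_bounds[where K = K and D = D, OF S small f \<theta>_eq L_def P n0 K D C_def,
        folded W_def, folded V_def, folded a_def]
    show ?thesis
    proof (rule crit_limitsI[where ?n0.0 = n0 and L = L and V = V and e = "\<lambda>n. W n + C n" and
          e' = "\<lambda>n. sqrt (2 * W n) + 2 * C n" and a = a])
      show "prob_space (\<Omega> n)" for n using P[of n] by (simp add: poisson_process_def)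
      show "(\<lambda>\<omega>. num_crit k (P n \<omega>) (r n)) \<in> \<Omega> n \<rightarrow>\<^sub>M count_space UNIV" if "n0 \<le> n" for n
        by (rule crit_sample.poisson_transfer(1)[OF S small[OF that] P]) (use n0[OF that] in simp)
      show "T \<longlonglongrightarrow> 0 \<Longrightarrow> a \<longlonglongrightarrow> 0"
      proof -
        assume T0: "T \<longlonglongrightarrow> 0"
        let ?F = "\<lambda>n. real n ^ (k + 1) * \<theta> n ^ k"
        have "?F n = T n * c ^ k" for n using excess[of n 0] by (simp only: add_0_right power_0 mult_1_right)
        moreover have "(\<lambda>n. T n * c ^ k) \<longlonglongrightarrow> 0" using tendsto_mult_right[OF T0, of "c ^ k"] by (simp only: mult_zero_left)
        ultimately have F: "?F \<longlonglongrightarrow> 0" by (simp only:)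
        have sq: "real n ^ (2 * k + 2) * \<theta> n ^ (2 * k) = (?F n)\<^sup>2" for n
        proof -
          have "2 * k + 2 = 2 * (k + 1)" by simp
          then show ?thesis by (simp only: power_even_eq power_mult_distrib)
        qed
        have a_eq: "a = (\<lambda>n. K (k + 1) * ?F n + (\<Sum>l\<in>{k+2..2*k+2}. 4 ^ l * K l * (real n ^ l * \<theta> n ^ (l - 1))) + K (2 * k + 2) * (?F n)\<^sup>2)"
          by (rule ext) (simp only: a_def sq)
        have "a \<longlonglongrightarrow> K (k + 1) * 0 + 0 * 0 + K (2 * k + 2) * 0\<^sup>2" unfolding a_eq
          by (rule tendsto_add[OF tendsto_add[OF tendsto_mult_left[OF F] of_ratio[OF sum_ratio[of "\<lambda>l. 4 ^ l * K l"] T0]]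
                tendsto_mult_left[OF tendsto_power[OF F]]])
        then show "a \<longlonglongrightarrow> 0" by simp
      qed
      show "(\<lambda>n. W n + C n) \<longlonglongrightarrow> 0" if Tl: "T \<longlonglongrightarrow> \<alpha>" for \<alpha>
      proof -
        \<comment> \<open>Where \<open>T\<close> converges, smallness relative to sqrt T is
          smallness outright, so the coupling estimate made for the third regime also covers the
          second.\<close>
        have "(\<lambda>n. C n / sqrt (T n) * sqrt (T n)) \<longlonglongrightarrow> 0 * sqrt \<alpha>" by (intro tendsto_mult C_ratio tendsto_real_sqrt Tl)
        moreover have "eventually (\<lambda>n. C n / sqrt (T n) * sqrt (T n) = C n) sequentially"
          using eventually_gt_at_top[of 0]
        proof eventually_elim
          case (elim n)
          have "0 < sqrt (T n)" by (rule real_sqrt_gt_zero[OF T_pos[OF elim]])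
          from less_imp_neq[OF this, symmetric] show ?case
            by (rule nonzero_divide_eq_eq[THEN iffD1, OF _ refl, symmetric])
        qed
        ultimately have "C \<longlonglongrightarrow> 0 * sqrt \<alpha>" by (rule Lim_transform_eventually)
        from tendsto_add[OF W_lim[OF Tl] this] show ?thesis by simp
      qed
      show "(\<lambda>n. (sqrt (2 * W n) + 2 * C n) / sqrt (T n)) \<longlonglongrightarrow> 0"
        using tendsto_add[OF sqrt_W_lim tendsto_mult_left[OF C_ratio, of 2]] by (simp only: add_divide_distrib times_divide_eq_right mult_zero_right add_0)
    qed (rule mu | rule L_lim | rule V_lim | (rule bounds; assumption))+
  qed
  ultimately show ?thesis by blast
qed

end
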